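(* Let $G$ be a primitive soluble permutation group of degree $n$. Then $I(G) \le \log n + 1$, and there exist infinitely many primitive soluble permutation groups $G$ (with $n$ the degree of $G$) for which $I(G) \ge 0.63 \log n + 1$. Furthermore, if $G$ is basic then $I(G) \le 6.49 \log\log n + 2$, and there exist infinitely many basic primitive soluble permutation groups $G$ (with $n$ the degree of $G$) for which $I(G) \ge \log\log n + 2$.
   Context: All logarithms are to base 2. For a subgroup $G$ of $\mathrm{Sym}(\Delta)$ with $\Delta$ finite, of degree $|\Delta|$, a sequence $(\delta_1,\dots,\delta_k) \in \Delta^k$ is irredundant for $G$ if $G > G_{\delta_1} > G_{(\delta_1,\delta_2)} > \dots > G_{(\delta_1,\dots,\delta_k)}$ (all inclusions strict, where $G_{(\delta_1,\dots,\delta_i)}$ is the pointwise stabiliser); it is a base if $G_{(\delta_1,\dots,\delta_k)} = 1$. $I(G)$ is the maximum $k$ such that there is an irredundant base for $G$ of length $k$. A primitive permutation group is a transitive one preserving no non-trivial partition of $\Delta$. A primitive soluble permutation group $G$ is a subgroup of $\mathrm{AGL}_d(p)$ for some prime $p$ and $d\ge 1$, containing all translations, where $\Delta$ is identified with $\mathbb{F}_p^d$ (so $n = p^d$), and the point stabiliser $H = G_0$ is an irreducible subgroup of $\mathrm{GL}_d(p)$. The irreducible group $H$ is imprimitive as a linear group if it preserves a direct sum decomposition $\mathbb{F}_p^d = V_1 \oplus \dots \oplus V_k$ into non-zero subspaces for some $k \ge 2$, and otherwise it is primitive as a linear group. $G$ is called basic if $H$ is primitive as a linear group, and non-basic if $H$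 is imprimitive (equivalently, $G$ is non-basic if it preserves a product action structure on $\Delta$). *)

theory Defs
  imports Complex_Main "HOL-Algebra.Algebra" "HOL-Number_Theory.Residues"
    "HOL-Library.Disjoint_Sets"
begin

section \<open>Permutation groups, irredundant bases\<close>

text \<open>Elements of \<^term>\<open>BijGroup \<Delta>\<close>, i.e. of Sym(\<Delta>), are extensional functions:
  they are \<^const>\<open>undefined\<close> outside \<Delta>.\<close>

definition perm_group :: "'a set \<Rightarrow> ('a \<Rightarrow> 'a) set \<Rightarrow> bool" where
  "perm_group \<Delta> G \<longleftrightarrow> finite \<Delta> \<and> \<Delta> \<noteq> {} \<and> subgroup G (BijGroup \<Delta>)"

definition pointwise_stab :: "('a \<Rightarrow> 'a) set \<Rightarrow> 'a list \<Rightarrow> ('a \<Rightarrow> 'a) set" where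
  "pointwise_stab G \<delta> = {g \<in> G. \<forall>x\<in>set \<delta>. g x = x}"

definition irredundant :: "'a set \<Rightarrow> ('a \<Rightarrow> 'a) set \<Rightarrow> 'a list \<Rightarrow> bool" where
  "irredundant \<Delta> G \<delta> \<longleftrightarrow> set \<delta> \<subseteq> \<Delta> \<and>
     (\<forall>i<length \<delta>. pointwise_stab G (take (Suc i) \<delta>) \<subset> pointwise_stab G (take i \<delta>))"

definition is_base :: "'a set \<Rightarrow> ('a \<Rightarrow> 'a) set \<Rightarrow> 'a list \<Rightarrow> bool" where
  "is_base \<Delta> G \<delta> \<longleftrightarrow> set \<delta> \<subseteq> \<Delta> \<and> pointwise_stab G \<delta> = {\<one>\<^bsub>BijGroup \<Delta>\<^esub>}"

text \<open>The empty sequence is allowed, so the trivial group has the value 0.\<close>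

definition max_irredundant_base :: "'a set \<Rightarrow> ('a \<Rightarrow> 'a) set \<Rightarrow> nat" where
  "max_irredundant_base \<Delta> G = Max {length \<delta> | \<delta>. irredundant \<Delta> G \<delta> \<and> is_base \<Delta> G \<delta>}"

text \<open>The maximum is over a finite nonempty set.\<close>

lemma irredundant_length_le:
  assumes "finite \<Delta>" "irredundant \<Delta> G \<delta>"
  shows "length \<delta> \<le> card \<Delta>"
proof -
  have "distinct \<delta>"
  proof (rule ccontr)
    assume "\<not> distinct \<delta>"
    then obtain i j where ij: "i < j" "j < length \<delta>" "\<delta> ! i = \<delta> ! j"
      unfolding distinct_conv_nth by (metis linorder_neqE_nat)
    have "\<delta> ! j \<in> set (take j \<delta>)"
      using ij by (metis in_set_conv_nth length_take min.absorb4 nth_take)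
    then have "set (take (Suc j) \<delta>) = set (take j \<delta>)"
      using ij by (simp add: take_Suc_conv_app_nth insert_absorb)
    then show False
      using assms(2) ij unfolding irredundant_def pointwise_stab_def by auto
  qed
  then show ?thesis
    using assms by (metis card_mono distinct_card irredundant_def)
qed

lemma irredundant_bases_finite:
  "finite \<Delta> \<Longrightarrow> finite {length \<delta> | \<delta>. irredundant \<Delta> G \<delta> \<and> is_base \<Delta> G \<delta>}"
  by (rule finite_subset[of _ "{..card \<Delta>}"]) (auto intro: irredundant_length_le)

lemma irredundant_base_exists:
  assumes "perm_group \<Delta> G"
  shows "\<exists>\<delta>. irredundant \<Delta> G \<delta> \<and> is_base \<Delta> G \<delta>"
proof -
  have fin: "finite \<Delta>" and sub: "subgroup G (BijGroup \<Delta>)"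
    using assms by (auto simp: perm_group_def)
  have nil: "irredundant \<Delta> G []" by (simp add: irredundant_def)
  obtain \<delta> where \<delta>: "irredundant \<Delta> G \<delta>"
    and mx: "\<And>\<delta>'. irredundant \<Delta> G \<delta>' \<Longrightarrow> length \<delta>' \<le> length \<delta>"
    using ex_has_greatest_nat[of "irredundant \<Delta> G" "[]" length "Suc (card \<Delta>)"]
      irredundant_length_le[OF fin] nil by (metis le_imp_less_Suc)
  have sD: "set \<delta> \<subseteq> \<Delta>" using \<delta> by (simp add: irredundant_def)
  have one: "\<one>\<^bsub>BijGroup \<Delta>\<^esub> \<in> pointwise_stab G \<delta>"
    using subgroup.one_closed[OF sub] sD by (auto simp: pointwise_stab_def BijGroup_def)
  have "g = \<one>\<^bsub>BijGroup \<Delta>\<^esub>" if g: "g \<in> pointwise_stab G \<delta>" for g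
  proof (rule ccontr)
    assume ne: "g \<noteq> \<one>\<^bsub>BijGroup \<Delta>\<^esub>"
    have "g \<in> extensional \<Delta>"
      using g subgroup.subset[OF sub] by (auto simp: pointwise_stab_def BijGroup_def Bij_def)
    then obtain x where x: "x \<in> \<Delta>" "g x \<noteq> x"
      using ne by (auto simp: BijGroup_def extensional_def fun_eq_iff restrict_def split: if_splits)
    have "pointwise_stab G (\<delta> @ [x]) \<subset> pointwise_stab G \<delta>"
      using g x by (auto simp: pointwise_stab_def)
    then have "irredundant \<Delta> G (\<delta> @ [x])"
      using \<delta> x by (auto simp: irredundant_def less_Suc_eq)
    then show False using mx by fastforce
  qed
  then have "is_base \<Delta> G \<delta>" using one sD unfolding is_base_def by blast
  then show ?thesis using \<delta> by blast
qed

section \<open>Primitive soluble groups\<close>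

definition primitive_perm_group :: "'a set \<Rightarrow> ('a \<Rightarrow> 'a) set \<Rightarrow> bool" where
  "primitive_perm_group \<Delta> G \<longleftrightarrow> perm_group \<Delta> G \<and>
     transitive_action ((BijGroup \<Delta>)\<lparr>carrier := G\<rparr>) \<Delta> (\<lambda>g. g) \<and>
     (\<forall>P. partition_on \<Delta> P \<and> (\<forall>g\<in>G. \<forall>B\<in>P. g ` B \<in> P) \<longrightarrow>
        P = {\<Delta>} \<or> P = (\<lambda>x. {x}) ` \<Delta>)"

definition primitive_soluble :: "'a set \<Rightarrow> ('a \<Rightarrow> 'a) set \<Rightarrow> bool" where
  "primitive_soluble \<Delta> G \<longleftrightarrow>
     primitive_perm_group \<Delta> G \<and> solvable ((BijGroup \<Delta>)\<lparr>carrier := G\<rparr>)"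

section \<open>Linear and affine groups over the prime field\<close>

text \<open>Coordinate vectors are extensional functions on \<open>{..<d}\<close>. The multiplicative fields of the
  module record play no role.\<close>

definition vec_space :: "nat \<Rightarrow> nat \<Rightarrow> (int, nat \<Rightarrow> int) module" where
  "vec_space p d =
    \<lparr>carrier = {..<d} \<rightarrow>\<^sub>E carrier (residue_ring (int p)),
     monoid.mult = undefined,
     monoid.one = undefined,
     ring.zero = (\<lambda>i\<in>{..<d}. \<zero>\<^bsub>residue_ring (int p)\<^esub>),
     ring.add = (\<lambda>x y. \<lambda>i\<in>{..<d}. x i \<oplus>\<^bsub>residue_ring (int p)\<^esub> y i),
     module.smult = (\<lambda>a x. \<lambda>i\<in>{..<d}. a \<otimes>\<^bsub>residue_ring (int p)\<^esub> x i)\<rparr>"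

lemma vec_space_module:
  assumes "Factorial_Ring.prime p"
  shows "Module.module (residue_ring (int p)) (vec_space p d)"
proof -
  interpret R: residues "int p" "residue_ring (int p)"
    by unfold_locales (use assms prime_gt_1_nat in auto)
  let ?R = "residue_ring (int p)" and ?V = "vec_space p d"
  have car: "x \<in> carrier ?V \<longleftrightarrow> (\<forall>i<d. x i \<in> carrier ?R) \<and> (\<forall>i. \<not> i < d \<longrightarrow> x i = undefined)" for x
    by (auto simp: vec_space_def PiE_iff extensional_def)
  have add: "(x \<oplus>\<^bsub>?V\<^esub> y) i = (if i < d then x i \<oplus>\<^bsub>?R\<^esub> y i else undefined)" for x y i
    by (simp add: vec_space_def)
  have zero: "\<zero>\<^bsub>?V\<^esub> i = (if i < d then \<zero>\<^bsub>?R\<^esub> else undefined)" for i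
    by (simp add: vec_space_def)
  have smult: "(a \<odot>\<^bsub>?V\<^esub> x) i = (if i < d then a \<otimes>\<^bsub>?R\<^esub> x i else undefined)" for a x i
    by (simp add: vec_space_def)
  show ?thesis
  proof (rule moduleI)
    show "cring ?R" by (rule R.cring)
    show "abelian_group ?V"
    proof (rule abelian_groupI)
      fix x assume x: "x \<in> carrier ?V"
      define y where "y = (\<lambda>i. if i < d then \<ominus>\<^bsub>?R\<^esub> x i else undefined)"
      have "y \<in> carrier ?V" using x by (simp add: car y_def)
      moreover have "y \<oplus>\<^bsub>?V\<^esub> x = \<zero>\<^bsub>?V\<^esub>"
        using x by (simp add: fun_eq_iff add zero car y_def R.l_neg)
      ultimately show "\<exists>y\<in>carrier ?V. y \<oplus>\<^bsub>?V\<^esub> x = \<zero>\<^bsub>?V\<^esub>" by blast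
    qed (simp_all add: car add zero fun_eq_iff R.a_ac)
  qed (simp_all add: car add smult fun_eq_iff R.l_distr R.r_distr R.m_assoc)
qed

abbreviation subspace_of :: "nat \<Rightarrow> nat \<Rightarrow> (nat \<Rightarrow> int) set \<Rightarrow> bool" where
  "subspace_of p d W \<equiv> submodule W (residue_ring (int p)) (vec_space p d)"

definition GL :: "nat \<Rightarrow> nat \<Rightarrow> ((nat \<Rightarrow> int) \<Rightarrow> (nat \<Rightarrow> int)) set" where
  "GL p d = {f \<in> Bij (carrier (vec_space p d)).
     (\<forall>x\<in>carrier (vec_space p d). \<forall>y\<in>carrier (vec_space p d).
        f (x \<oplus>\<^bsub>vec_space p d\<^esub> y) = f x \<oplus>\<^bsub>vec_space p d\<^esub> f y) \<and>
     (\<forall>a\<in>carrier (residue_ring (int p)). \<forall>x\<in>carrier (vec_space p d).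
        f (a \<odot>\<^bsub>vec_space p d\<^esub> x) = a \<odot>\<^bsub>vec_space p d\<^esub> f x)}"

definition translation_maps :: "nat \<Rightarrow> nat \<Rightarrow> ((nat \<Rightarrow> int) \<Rightarrow> (nat \<Rightarrow> int)) set" where
  "translation_maps p d =
     {\<lambda>x\<in>carrier (vec_space p d). x \<oplus>\<^bsub>vec_space p d\<^esub> v | v. v \<in> carrier (vec_space p d)}"

definition AGL :: "nat \<Rightarrow> nat \<Rightarrow> ((nat \<Rightarrow> int) \<Rightarrow> (nat \<Rightarrow> int)) set" where
  "AGL p d = {\<lambda>x\<in>carrier (vec_space p d). h x \<oplus>\<^bsub>vec_space p d\<^esub> v | h v.
     h \<in> GL p d \<and> v \<in> carrier (vec_space p d)}"

text \<open>The zero space (\<^prop>\<open>d = 0\<close>) is not excluded here; \<open>basic\<close> below requires \<^prop>\<open>d \<ge> 1\<close>.\<close>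

definition irreducible_linear ::
    "nat \<Rightarrow> nat \<Rightarrow> ((nat \<Rightarrow> int) \<Rightarrow> (nat \<Rightarrow> int)) set \<Rightarrow> bool" where
  "irreducible_linear p d H \<longleftrightarrow>
     subgroup H (BijGroup (carrier (vec_space p d))) \<and> H \<subseteq> GL p d \<and>
     (\<forall>W. subspace_of p d W \<and> (\<forall>h\<in>H. h ` W \<subseteq> W) \<longrightarrow>
        W = {\<zero>\<^bsub>vec_space p d\<^esub>} \<or> W = carrier (vec_space p d))"

definition direct_sum_decomposition :: "nat \<Rightarrow> nat \<Rightarrow> nat \<Rightarrow> (nat \<Rightarrow> (nat \<Rightarrow> int) set) \<Rightarrow> bool" where
  "direct_sum_decomposition p d k W \<longleftrightarrow>
     (\<forall>i<k. subspace_of p d (W i) \<and> W i \<noteq> {\<zero>\<^bsub>vec_space p d\<^esub>}) \<and>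
     bij_betw (\<lambda>w. \<Oplus>\<^bsub>vec_space p d\<^esub>i\<in>{..<k}. w i) (\<Pi>\<^sub>E i\<in>{..<k}. W i) (carrier (vec_space p d))"

text \<open>Preserving a decomposition means permuting its summands.\<close>

definition imprimitive_linear ::
    "nat \<Rightarrow> nat \<Rightarrow> ((nat \<Rightarrow> int) \<Rightarrow> (nat \<Rightarrow> int)) set \<Rightarrow> bool" where
  "imprimitive_linear p d H \<longleftrightarrow> irreducible_linear p d H \<and>
     (\<exists>k\<ge>2. \<exists>W. direct_sum_decomposition p d k W \<and> (\<forall>h\<in>H. \<forall>i<k. \<exists>j<k. h ` W i = W j))"

definition primitive_linear ::
    "nat \<Rightarrow> nat \<Rightarrow> ((nat \<Rightarrow> int) \<Rightarrow> (nat \<Rightarrow> int)) set \<Rightarrow> bool" where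
  "primitive_linear p d H \<longleftrightarrow> irreducible_linear p d H \<and> \<not> imprimitive_linear p d H"

section \<open>Basic groups\<close>

text \<open>The permutation group on \<open>\<phi> ` \<Delta>\<close> obtained from \<open>G\<close> by renaming points along \<open>\<phi>\<close>.\<close>

definition transport :: "('a \<Rightarrow> 'b) \<Rightarrow> 'a set \<Rightarrow> ('a \<Rightarrow> 'a) set \<Rightarrow> ('b \<Rightarrow> 'b) set" where
  "transport \<phi> \<Delta> G = (\<lambda>g. \<lambda>y\<in>\<phi> ` \<Delta>. \<phi> (g (inv_into \<Delta> \<phi> y))) ` G"

definition affine_identification ::
    "'a set \<Rightarrow> ('a \<Rightarrow> 'a) set \<Rightarrow> nat \<Rightarrow> nat \<Rightarrow> ('a \<Rightarrow> (nat \<Rightarrow> int)) \<Rightarrow> bool" where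
  "affine_identification \<Delta> G p d \<phi> \<longleftrightarrow>
     Factorial_Ring.prime p \<and> d \<ge> 1 \<and> bij_betw \<phi> \<Delta> (carrier (vec_space p d)) \<and>
     transport \<phi> \<Delta> G \<subseteq> AGL p d \<and> translation_maps p d \<subseteq> transport \<phi> \<Delta> G \<and>
     irreducible_linear p d (pointwise_stab (transport \<phi> \<Delta> G) [\<zero>\<^bsub>vec_space p d\<^esub>])"

text \<open>For a primitive soluble group the choice of identification is immaterial: the translations
  form the unique minimal normal subgroup, so two identifications differ by an affine map.\<close>

definition basic :: "'a set \<Rightarrow> ('a \<Rightarrow> 'a) set \<Rightarrow> bool" where
  "basic \<Delta> G \<longleftrightarrow> (\<exists>p d \<phi>. affine_identification \<Delta> G p d \<phi> \<and>
     primitive_linear p d (pointwise_stab (transport \<phi> \<Delta> G) [\<zero>\<^bsub>vec_space p d\<^esub>]))"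

end

theory Submission
  imports Defs "HOL-Library.Numeral_Type" "HOL-Library.Z2" "HOL-Algebra.Algebraic_Closure_Type"
begin

text \<open>In a primitive soluble group \<open>G\<close> a non-trivial abelian normal subgroup \<open>N\<close> is regular,
  and the fixed points of the successive stabilisers of an irredundant sequence correspond to a
  strictly ascending chain of subgroups of \<open>N\<close>; each step at least doubles the order,
  which gives \<open>2\<^sup>I\<^sup>-\<^sup>1 \<le> n\<close>.

  For basic \<open>G\<close> one bounds the stabiliser \<open>H\<^sub>v\<close> of a non-zero vector, since \<open>I(G) \<le> 2 + log |H\<^sub>v|\<close>.
  A maximal abelian normal subgroup \<open>A\<close> of the primitive linear group \<open>H\<close> spans a field \<open>R\<close>, over
  which \<open>V\<close> has some dimension \<open>m\<close>. By Dedekind's independence of characters \<open>|H : C\<^sub>H(A)|\<close> is at most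
  \<open>log |R|\<close>. A normal subgroup \<open>B\<close> of class at most 2 with \<open>A \<le> B \<le> C\<^sub>H(A)\<close> and \<open>|B/A| \<le> m\<^sup>2\<close> is its own
  centraliser in \<open>C\<^sub>H(A)\<close> modulo \<open>A\<close>, so \<open>C\<^sub>H(A)/B\<close> acts faithfully on the abelian group \<open>B/A\<close>. The
  chief factors inside \<open>B/A\<close> are irreducible modules much smaller than \<open>V\<close>, and the bound
  \<open>64 |H|\<^sup>3 \<le> |V|\<^sup>8\<close> for soluble irreducible \<open>H\<close>, proved by induction on \<open>|V|\<close> (the imprimitive case
  uses \<open>4\<^sup>k\<^sup>-\<^sup>1\<close> as a bound for soluble permutation groups of degree \<open>k\<close>), makes \<open>|H\<^sub>v|\<close> polynomial in
  \<open>log |V|\<close>.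

  The lower bounds are attained by \<open>F\<^sub>3\<^sup>d : ({\<plusminus>1} wr C\<^sub>d)\<close>, with \<open>0\<close> followed by the standard basis, and by the
  one-dimensional semiaffine group over the field with \<open>2\<close> to the power \<open>2\<^sup>k\<close> elements, with \<open>0, 1\<close>
  followed by generators of the successive quadratic subfields.\<close>

section \<open>Group actions and primitive soluble groups\<close>

text \<open>The constants follow from one computation. Write \<open>Q\<close>, \<open>a\<close>,
  \<open>b\<close> for the orders of \<open>R\<close>, \<open>A\<close>, \<open>B\<close>, so
  \<open>|V| = Q^m\<close>, \<open>a < Q\<close> and \<open>b \<le> m^2 a\<close>. The bound with
  exponent 8/3, multiplied up over the chief factors in \<open>B/A\<close>, gives
  \<open>64 |C|^3 a^8 \<le> b^11\<close> for the centraliser \<open>C\<close> of \<open>A\<close>,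
  hence \<open>64 |C|^3 \<le> m^22 a^3\<close>. With index at most \<open>k\<close>, where
  \<open>2^k \<le> Q\<close>, this is again below \<open>|V|^8\<close> and closes the induction. For
  a vector stabiliser \<open>b^11\<close> becomes \<open>b^8 m^3\<close>, since a subgroup of
  \<open>B\<close> fixing a non-zero vector has order at most \<open>m\<close>. What remains is
  \<open>k^3 m^19\<close>, and \<open>k m \<le> log |V|\<close> turns it into
  \<open>(log |V|)^(19/3)\<close> after a cube root; 19/3 lies below 6.49. The factor 64 = 4^3 pays
  for permuting the summands of an imprimitive module. Cubes keep the inequalities among natural
  numbers. The bounds on indices use no dimension theory: each comes from an injection between
  finite sets of functions whose sizes are powers of \<open>|V|\<close> or \<open>Q\<close>, and a
  comparison of exponents.\<close>

definition commutator :: "('a, 'b) monoid_scheme \<Rightarrow> 'a \<Rightarrow> 'a \<Rightarrow> 'a" where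
  "commutator G x y = x \<otimes>\<^bsub>G\<^esub> y \<otimes>\<^bsub>G\<^esub> inv\<^bsub>G\<^esub> x \<otimes>\<^bsub>G\<^esub> inv\<^bsub>G\<^esub> y"

context group
begin

lemma commutator_closed [simp, intro]:
  "x \<in> carrier G \<Longrightarrow> y \<in> carrier G \<Longrightarrow> commutator G x y \<in> carrier G"
  by (simp add: commutator_def)

lemma commutator_mult:
  "x \<in> carrier G \<Longrightarrow> y \<in> carrier G \<Longrightarrow> commutator G x y \<otimes> y \<otimes> x = x \<otimes> y"
  by (simp add: commutator_def m_assoc)

lemma commutator_eq_one_iff:
  "x \<in> carrier G \<Longrightarrow> y \<in> carrier G \<Longrightarrow> commutator G x y = \<one> \<longleftrightarrow> x \<otimes> y = y \<otimes> x"
  using commutator_mult[of x y] r_cancel_one[of "y \<otimes> x" "commutator G x y"]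
  by (metis commutator_closed m_assoc m_closed)

text \<open>Sending \<open>h\<close> to its value \<open>f h\<close> together with its quotient by a
  chosen element of the same fibre is injective into \<open>Z \<times> L\<close>. No homomorphism is
  involved, so the lemma serves orbit maps as well as actions on sections.\<close>

lemma card_le_fibres:
  assumes "H \<subseteq> carrier G" "f ` H \<subseteq> Z" "finite Z" "finite L"
    and "\<And>h h'. h \<in> H \<Longrightarrow> h' \<in> H \<Longrightarrow> f h = f h' \<Longrightarrow> inv h \<otimes> h' \<in> L"
  shows "card H \<le> card Z * card L"
proof -
  define r where "r y = (SOME h. h \<in> H \<and> f h = y)" for y
  have r: "r (f h) \<in> H \<and> f (r (f h)) = f h" if "h \<in> H" for h
    unfolding r_def by (rule someI[where x = h]) (use that in auto)
  define \<Phi> where "\<Phi> h = (f h, inv (r (f h)) \<otimes> h)" for h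
  have "inj_on \<Phi> H"
  proof (rule inj_onI)
    fix h h' assume h: "h \<in> H" "h' \<in> H" and eq: "\<Phi> h = \<Phi> h'"
    then have "inv (r (f h)) \<otimes> h = inv (r (f h)) \<otimes> h'" unfolding \<Phi>_def by (metis prod.inject)
    moreover have "r (f h) \<in> carrier G" "h \<in> carrier G" "h' \<in> carrier G" using r h assms(1) by auto
    ultimately show "h = h'" by simp
  qed
  moreover have "\<Phi> ` H \<subseteq> Z \<times> L"
  proof
    fix z assume "z \<in> \<Phi> ` H"
    then obtain h where h: "h \<in> H" "z = \<Phi> h" by auto
    then show "z \<in> Z \<times> L" using assms(2) assms(5)[of "r (f h)" h] r[of h] by (auto simp: \<Phi>_def)
  qed
  ultimately have "card H \<le> card (Z \<times> L)"
    by (metis assms(3,4) card_image card_mono finite_cartesian_product)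
  then show ?thesis by (simp add: card_cartesian_product)
qed

text \<open>A coset of \<open>H\<close> inside \<open>K\<close> is disjoint from \<open>H\<close>.
  The powers of 2 attached to chains of subgroups and to generating sets come from here.\<close>

lemma card_subgroup_double:
  assumes "subgroup H G" "subgroup K G" "H \<subset> K" "finite K"
  shows "2 * card H \<le> card K"
proof -
  obtain k where k: "k \<in> K" "k \<notin> H" using assms(3) by auto
  have kc: "k \<in> carrier G" using k assms(2) subgroup.mem_carrier by fastforce
  have Hc: "H \<subseteq> carrier G" using assms(1) by (rule subgroup.subset)
  have inj: "inj_on (\<lambda>h. h \<otimes> k) H" using Hc kc by (meson inj_onI right_cancel subsetD)
  have disj: "H \<inter> (\<lambda>h. h \<otimes> k) ` H = {}"
  proof (rule ccontr)
    assume "H \<inter> (\<lambda>h. h \<otimes> k) ` H \<noteq> {}"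
    then obtain h where h: "h \<in> H" "h \<otimes> k \<in> H" by auto
    then have "inv h \<otimes> (h \<otimes> k) \<in> H" using assms(1) by (simp add: subgroup.m_closed subgroup.m_inv_closed)
    moreover have "inv h \<otimes> (h \<otimes> k) = k" using h Hc kc by (simp add: m_assoc[symmetric] subset_iff)
    ultimately show False using k by simp
  qed
  have sub: "H \<union> (\<lambda>h. h \<otimes> k) ` H \<subseteq> K"
    using assms k by (auto intro: subgroup.m_closed)
  have "finite H" using assms by (meson finite_subset psubset_imp_subset)
  then have "card (H \<union> (\<lambda>h. h \<otimes> k) ` H) = 2 * card H"
    using disj inj by (subst card_Un_disjoint) (auto simp: card_image)
  then show ?thesis using card_mono[OF assms(4) sub] by simp
qed

lemma normal_set_mult_normal:
  assumes "A \<lhd> G" "B \<lhd> G"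
  shows "A <#> B \<lhd> G"
proof (rule normal_invI)
  show "subgroup (A <#> B) G"
    using mult_norm_subgroup[OF assms(1)] assms(2) by (simp add: normal_imp_subgroup)
  have car: "A \<subseteq> carrier G" "B \<subseteq> carrier G"
    using assms normal_imp_subgroup subgroup.subset by blast+
  fix x h assume x: "x \<in> carrier G" and "h \<in> A <#> B"
  then obtain a b where ab: "a \<in> A" "b \<in> B" "h = a \<otimes> b" by (auto simp: set_mult_def)
  have "x \<otimes> h \<otimes> inv x = (x \<otimes> a \<otimes> inv x) \<otimes> (x \<otimes> b \<otimes> inv x)"
    using ab car x by (simp add: m_assoc subset_iff)
       (simp add: m_assoc[symmetric])
  then show "x \<otimes> h \<otimes> inv x \<in> A <#> B"
    using normal.inv_op_closed2[OF assms(1) x ab(1)] normal.inv_op_closed2[OF assms(2) x ab(2)]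
    unfolding set_mult_def by auto
qed

lemma exp_of_derived_is_normal: "H \<lhd> G \<Longrightarrow> (derived G ^^ n) H \<lhd> G"
  by (induct n) (auto intro: derived_is_normal)

text \<open>\<open>M\<close> is \<open>A\<close> times the last term of the derived series of
  \<open>Y\<close> that is not inside \<open>A\<close>. That term is characteristic in
  \<open>Y\<close>, hence normal in \<open>G\<close>, and its derived subgroup lies in
  \<open>A\<close>, so \<open>M/A\<close> is a non-trivial abelian normal subgroup of
  \<open>G/A\<close>.\<close>

lemma solvable_normal_step:
  assumes "solvable G" "A \<lhd> G" "Y \<lhd> G" "A \<subset> Y"
  obtains M where "M \<lhd> G" "A \<subset> M" "M \<subseteq> Y"
    "\<And>x y. x \<in> M \<Longrightarrow> y \<in> M \<Longrightarrow> commutator G x y \<in> A"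
proof -
  interpret A: normal A G by fact
  interpret Y: normal Y G by fact
  define D where "D i = (derived G ^^ i) Y" for i
  have Dn: "D i \<lhd> G" for i unfolding D_def by (rule exp_of_derived_is_normal) fact
  have Dc: "D i \<subseteq> carrier G" for i using Dn normal_imp_subgroup subgroup.subset by blast
  have Dsuc: "D (Suc i) \<subseteq> D i" for i
    using derived_incl[of "D i" "D i"] Dn normal_imp_subgroup by (auto simp: D_def)
  have DY: "D i \<subseteq> Y" for i by (induct i) (use Dsuc in \<open>auto simp: D_def[of 0]\<close>)
  obtain n where "(derived G ^^ n) (carrier G) = {\<one>}"
    using assms(1) solvable_iff_trivial_derived_seq by auto
  then have "D n \<subseteq> A"
    using mono_exp_of_derived[OF Y.subset, of n] A.one_closed by (auto simp: D_def)
  moreover have "\<not> D 0 \<subseteq> A" using assms(4) by (auto simp: D_def)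
  ultimately obtain i where i: "\<not> D i \<subseteq> A" "D (Suc i) \<subseteq> A"
    using ex_least_nat_less[of "\<lambda>i. D i \<subseteq> A" n] by blast
  define M where "M = A <#> D i"
  have "M \<lhd> G" unfolding M_def using assms(2) Dn by (rule normal_set_mult_normal)
  moreover have "A \<subset> M"
  proof
    show "A \<subseteq> M"
    proof
      fix a assume "a \<in> A"
      then have "a \<otimes> \<one> \<in> M"
        using subgroup.one_closed[OF normal_imp_subgroup[OF Dn[of i]]]
        unfolding M_def set_mult_def by blast
      then show "a \<in> M" using \<open>a \<in> A\<close> A.subset by (auto simp: subset_iff)
    qed
    show "A \<noteq> M"
    proof
      assume eq: "A = M"
      have "D i \<subseteq> M"
      proof
        fix d assume "d \<in> D i"
        then have "\<one> \<otimes> d \<in> M" using A.one_closed unfolding M_def set_mult_def by blast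
        then show "d \<in> M" using \<open>d \<in> D i\<close> Dc by (auto simp: subset_iff)
      qed
      then show False using i eq by simp
    qed
  qed
  moreover have "M \<subseteq> Y" using assms(4) DY[of i] by (auto simp: M_def set_mult_def)
  moreover have "commutator G x y \<in> A" if xyM: "x \<in> M" "y \<in> M" for x y
  proof -
    obtain a d a' d' where ad: "a \<in> A" "d \<in> D i" "x = a \<otimes> d" "a' \<in> A" "d' \<in> D i" "y = a' \<otimes> d'"
      using xyM unfolding M_def set_mult_def by blast
    then have car: "a \<in> carrier G" "d \<in> carrier G" "a' \<in> carrier G" "d' \<in> carrier G"
      using Dc A.subset by auto
    \<comment> \<open>Modulo \<open>A\<close> the elements \<open>x\<close>, \<open>y\<close>
      coincide with their parts \<open>d\<close>, \<open>d'\<close> in \<open>D i\<close>, whose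
      commutator is already trivial there.\<close>
    interpret h: group_hom G "G Mod A" "\<lambda>g. A #> g"
      using A.r_coset_hom_Mod A.factorgroup_is_group
      by (simp add: group_hom_def group_hom_axioms_def is_group)
    have hA: "A #> a = \<one>\<^bsub>G Mod A\<^esub>" if "a \<in> A" for a
      using that A.rcos_const by (simp add: FactGroup_def)
    have car2: "x \<in> carrier G" "y \<in> carrier G" using car ad by auto
    have xy: "A #> x = A #> d" "A #> y = A #> d'"
      using ad car hA by (simp_all del: one_FactGroup mult_FactGroup)
    have "commutator G d d' \<in> derived_set G (D i)" using ad unfolding commutator_def by blast
    also have "derived_set G (D i) \<subseteq> derived G (D i)"
      unfolding derived_def by (rule subsetI) (rule generate.incl)
    also have "\<dots> \<subseteq> A" using i(2) by (simp add: D_def)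
    finally have "A #> commutator G d d' = \<one>\<^bsub>G Mod A\<^esub>" by (rule hA)
    then have "A #> commutator G x y = \<one>\<^bsub>G Mod A\<^esub>"
      unfolding commutator_def using car car2 xy by (simp del: one_FactGroup mult_FactGroup)
    then have "A #> commutator G x y = A" by (simp add: FactGroup_def)
    then show ?thesis using car2 coset_join1[of A] A.is_subgroup by simp
  qed
  ultimately show ?thesis by (rule that)
qed

end

text \<open>Actions are functions with laws required only on \<open>E\<close>, so one
  \<open>act\<close> can be reused for subgroups and for invariant subsets. They may have a kernel,
  which is \<open>fixer E\<close>: sections of a group act without being faithful, and the bounds
  below carry this kernel as a factor.\<close>

locale set_act = group G for G (structure) +
  fixes E :: "'e set" and act :: "'a \<Rightarrow> 'e \<Rightarrow> 'e"
  assumes act_closed [simp]: "g \<in> carrier G \<Longrightarrow> x \<in> E \<Longrightarrow> act g x \<in> E"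
    and act_mult [simp]: "g \<in> carrier G \<Longrightarrow> h \<in> carrier G \<Longrightarrow> x \<in> E \<Longrightarrow> act (g \<otimes> h) x = act g (act h x)"
    and act_one [simp]: "x \<in> E \<Longrightarrow> act \<one> x = x"
    and finite_carrier [simp]: "finite (carrier G)"
    and finite_set [simp]: "finite E"
begin

definition fixer :: "'e set \<Rightarrow> 'a set" where
  "fixer F = {g \<in> carrier G. \<forall>x\<in>F. act g x = x}"

lemma fixer_empty [simp]: "fixer {} = carrier G"
  by (simp add: fixer_def)

lemma act_inv [simp]: "g \<in> carrier G \<Longrightarrow> x \<in> E \<Longrightarrow> act (inv g) (act g x) = x"
  by (metis act_mult act_one inv_closed l_inv)

lemma act_inv' [simp]: "g \<in> carrier G \<Longrightarrow> x \<in> E \<Longrightarrow> act g (act (inv g) x) = x"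
  by (metis act_mult act_one inv_closed r_inv)

lemma act_inj: "g \<in> carrier G \<Longrightarrow> x \<in> E \<Longrightarrow> y \<in> E \<Longrightarrow> act g x = act g y \<Longrightarrow> x = y"
  by (metis act_inv)

lemma subgroup_fixer: "F \<subseteq> E \<Longrightarrow> subgroup (fixer F) G"
  by (rule subgroupI) (auto simp: fixer_def subset_iff intro!: exI[of _ \<one>] dest: act_inv)

lemma subgroup_act: "subgroup H G \<Longrightarrow> set_act (G\<lparr>carrier := H\<rparr>) E act"
  unfolding set_act_def set_act_axioms_def
  by (auto simp: subgroup.subgroup_is_group subgroup.mem_carrier
      intro: finite_subset[OF subgroup.subset])

lemma normal_fixer: 
  assumes "F \<subseteq> E" "\<And>g x. g \<in> carrier G \<Longrightarrow> x \<in> F \<Longrightarrow> act g x \<in> F"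
  shows "fixer F \<lhd> G"
proof (rule normal_invI)
  show "subgroup (fixer F) G" using assms by (simp add: subgroup_fixer)
  fix g h assume g: "g \<in> carrier G" and h: "h \<in> fixer F"
  then show "g \<otimes> h \<otimes> inv g \<in> fixer F"
    using assms by (auto simp: fixer_def subset_iff)
qed

text \<open>Only the upper half of the orbit-stabiliser theorem: \<open>Z\<close> is any finite set
  that contains the orbit.\<close>

lemma card_le_orbit_stabilizer:
  assumes "H \<subseteq> carrier G" "x \<in> E" "\<And>h. h \<in> H \<Longrightarrow> act h x \<in> Z" "finite Z"
    and "\<And>h h'. h \<in> H \<Longrightarrow> h' \<in> H \<Longrightarrow> inv h \<otimes> h' \<in> H"
  shows "card H \<le> card Z * card (H \<inter> fixer {x})"
proof (rule card_le_fibres[where f = "\<lambda>h. act h x"])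
  fix h h' assume h: "h \<in> H" "h' \<in> H" "act h x = act h' x"
  then have "act (inv h \<otimes> h') x = x"
    using assms(1,2) by (metis act_inv act_mult inv_closed subsetD)
  then show "inv h \<otimes> h' \<in> H \<inter> fixer {x}" using h assms by (auto simp: fixer_def subset_iff)
qed (use assms in \<open>auto intro: finite_subset[OF _ finite_carrier]\<close>)

text \<open>Normality lets \<open>g\<close> pass across \<open>N\<close>, so \<open>g\<close>
  carries the \<open>N\<close>-orbit of \<open>x\<close> onto the \<open>N\<close>-orbit of
  \<open>g x\<close>. For a primitive action a normal subgroup is therefore transitive or acts
  trivially.\<close>

lemma orbit_partition:
  assumes "N \<lhd> G"
  defines "P \<equiv> (\<lambda>x. (\<lambda>n. act n x) ` N) ` E"
  shows "partition_on E P" "\<And>g B. g \<in> carrier G \<Longrightarrow> B \<in> P \<Longrightarrow> act g ` B \<in> P"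
    "\<And>x. x \<in> E \<Longrightarrow> x \<in> (\<lambda>n. act n x) ` N"
proof -
  interpret N: normal N G by fact
  show self: "x \<in> (\<lambda>n. act n x) ` N" if "x \<in> E" for x
    using that N.one_closed image_eqI[of x "\<lambda>n. act n x" \<one> N] by simp
  have sub: "(\<lambda>n. act n (act m x)) ` N \<subseteq> (\<lambda>n. act n x) ` N" if "x \<in> E" "m \<in> N" for x m
  proof clarify
    fix n assume "n \<in> N"
    then show "act n (act m x) \<in> (\<lambda>n. act n x) ` N"
      using that by (intro image_eqI[of _ _ "n \<otimes> m"]) auto
  qed
  have eq: "(\<lambda>n. act n (act m x)) ` N = (\<lambda>n. act n x) ` N" if "x \<in> E" "m \<in> N" for x m
  proof
    show "(\<lambda>n. act n (act m x)) ` N \<subseteq> (\<lambda>n. act n x) ` N" using that by (rule sub)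
    show "(\<lambda>n. act n x) ` N \<subseteq> (\<lambda>n. act n (act m x)) ` N"
      using sub[of "act m x" "inv m"] that by simp
  qed
  show "partition_on E P"
  proof (rule partition_onI)
    show "\<Union> P = E" using self by (auto simp: P_def)
    show "{} \<notin> P" using self by (auto simp: P_def)
    fix B B' assume "B \<in> P" "B' \<in> P" "B \<noteq> B'"
    then obtain x y where xy: "x \<in> E" "y \<in> E" "B = (\<lambda>n. act n x) ` N" "B' = (\<lambda>n. act n y) ` N"
      by (auto simp: P_def)
    show "disjnt B B'" unfolding disjnt_def
    proof (rule ccontr)
      assume "B \<inter> B' \<noteq> {}"
      then obtain n m where "n \<in> N" "m \<in> N" "act n x = act m y" using xy by auto
      then have "B = B'" using eq[OF xy(1), of n] eq[OF xy(2), of m] xy(3,4) by simp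
      then show False using \<open>B \<noteq> B'\<close> by simp
    qed
  qed
  fix g B assume g: "g \<in> carrier G" and "B \<in> P"
  then obtain x where x: "x \<in> E" "B = (\<lambda>n. act n x) ` N" by (auto simp: P_def)
  have "act g ` B = (\<lambda>n. act n (act g x)) ` N"
  proof (intro equalityI subsetI)
    fix y assume "y \<in> act g ` B"
    then obtain n where n: "n \<in> N" "y = act g (act n x)" using x by auto
    have "y = act (g \<otimes> n \<otimes> inv g) (act g x)" using n x g by simp
    then show "y \<in> (\<lambda>n. act n (act g x)) ` N" using N.inv_op_closed2[OF g n(1)] by blast
  next
    fix y assume "y \<in> (\<lambda>n. act n (act g x)) ` N"
    then obtain n where n: "n \<in> N" "y = act n (act g x)" using x by auto
    have "y = act g (act (inv g \<otimes> n \<otimes> g) x)" using n x g by simp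
    then show "y \<in> act g ` B" using N.inv_op_closed1[OF g n(1)] x(2) by blast
  qed
  then show "act g ` B \<in> P" using x g by (auto simp: P_def)
qed

definition primitive :: bool where
  "primitive \<longleftrightarrow> (\<forall>x\<in>E. \<forall>y\<in>E. \<exists>g\<in>carrier G. act g x = y) \<and>
    (\<forall>P. partition_on E P \<and> (\<forall>g\<in>carrier G. \<forall>B\<in>P. act g ` B \<in> P) \<longrightarrow>
        P = {E} \<or> P = (\<lambda>x. {x}) ` E)"

definition irred_seq :: "'e list \<Rightarrow> bool" where
  "irred_seq xs \<longleftrightarrow> set xs \<subseteq> E \<and>
     (\<forall>i<length xs. fixer (set (take (Suc i) xs)) \<subset> fixer (set (take i xs)))"

end

lemma (in group) solvable_subgroup_group:
  assumes "solvable G" "subgroup H G"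
  shows "solvable (G\<lparr>carrier := H\<rparr>)"
proof -
  interpret H: group "G\<lparr>carrier := H\<rparr>" by (rule subgroup_imp_group) fact
  interpret i: group_hom "G\<lparr>carrier := H\<rparr>" G id
    using assms(2) by unfold_locales (auto simp: hom_def subgroup.mem_carrier)
  show ?thesis by (rule i.inj_hom_imp_solvable) (use assms in auto)
qed

section \<open>Irredundant sequences in primitive soluble actions\<close>

context set_act
begin

text \<open>With \<open>K\<close> the kernel and \<open>M/K\<close> a non-trivial abelian normal
  subgroup, \<open>M/K\<close> is regular on \<open>E\<close>. An irredundant sequence gives a
  strictly ascending chain of subgroups \<open>F 1 < F 2 < ...\<close> between \<open>K\<close> and
  \<open>M\<close>. The first point only serves to identify \<open>E\<close> with
  \<open>M/K\<close>, which is the 1 subtracted from the length.\<close>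

lemma primitive_irred_seq_length:
  assumes prim: "primitive" and sol: "solvable G" and irr: "irred_seq xs" and ne: "xs \<noteq> []"
  shows "2 ^ (length xs - 1) \<le> card E"
proof -
  define K where "K = fixer E"
  define S where "S i = fixer (set (take i xs))" for i
  have xsE: "set xs \<subseteq> E" and S: "\<And>i. i < length xs \<Longrightarrow> S (Suc i) \<subset> S i"
    using irr by (auto simp: irred_seq_def S_def)
  have "K \<subseteq> S 1" "S 1 \<subset> carrier G"
    using S[of 0] ne xsE by (auto simp: K_def S_def fixer_def dest: in_set_takeD)
  then have KG: "K \<subset> carrier G" by blast
  have Kn: "K \<lhd> G" unfolding K_def by (rule normal_fixer) auto
  obtain M where M: "M \<lhd> G" "K \<subset> M" "\<And>x y. x \<in> M \<Longrightarrow> y \<in> M \<Longrightarrow> commutator G x y \<in> K"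
    using solvable_normal_step[OF sol Kn normal_self KG] by metis
  interpret M: normal M G by fact
  have Mc: "m \<in> carrier G" if "m \<in> M" for m using that M.subset by auto
  have trans: "(\<lambda>m. act m x) ` M = E" if x: "x \<in> E" for x
  proof -
    let ?P = "(\<lambda>x. (\<lambda>m. act m x) ` M) ` E"
    have "?P = {E} \<or> ?P = (\<lambda>x. {x}) ` E"
      using prim orbit_partition(1)[OF M(1)] orbit_partition(2)[OF M(1)]
      unfolding primitive_def by (elim conjE allE[of _ ?P] impE) simp_all
    then show ?thesis
    proof
      assume "?P = {E}"
      moreover have "(\<lambda>m. act m x) ` M \<in> ?P" using x by (rule imageI)
      ultimately show ?thesis by simp
    next
      assume eq: "?P = (\<lambda>x. {x}) ` E"
      have "M \<subseteq> K"
      proof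
        fix m assume m: "m \<in> M"
        have "act m y = y" if y: "y \<in> E" for y
        proof -
          have "(\<lambda>m. act m y) ` M \<in> ?P" using y by (rule imageI)
          then obtain z where z: "(\<lambda>m. act m y) ` M = {z}" unfolding eq by auto
          then have "y = z" using orbit_partition(3)[OF M(1) y] by auto
          then show ?thesis using z m by blast
        qed
        then show "m \<in> K" using m Mc by (auto simp: K_def fixer_def)
      qed
      then show ?thesis using M(2) by auto
    qed
  qed
  have Kact: "act c z = z" if "c \<in> K" "z \<in> E" for c z using that by (simp add: K_def fixer_def)
  have commK: "act m (act g z) = act g (act m z)"
    if "m \<in> carrier G" "g \<in> carrier G" "commutator G m g \<in> K" "z \<in> E" for m g z
  proof -
    have "act (m \<otimes> g) z = act (commutator G m g \<otimes> g \<otimes> m) z"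
      using that commutator_mult by simp
    also have "\<dots> = act (commutator G m g) (act g (act m z))"
      using that by (simp add: m_assoc)
    finally show ?thesis using that Kact by simp
  qed
  \<comment> \<open>A transitive abelian group is semiregular: an element fixing \<open>x\<close>
    fixes each \<open>n x\<close>, because it commutes with \<open>n\<close> up to
    \<open>K\<close>.\<close>
  have reg: "M \<inter> fixer {x} \<subseteq> K" if x: "x \<in> E" for x
  proof
    fix m assume m: "m \<in> M \<inter> fixer {x}"
    have "act m z = z" if "z \<in> E" for z
    proof -
      obtain n where n: "n \<in> M" "z = act n x" using trans[OF x] \<open>z \<in> E\<close> by blast
      then have "act m (act n x) = act n (act m x)" using m M(3) Mc x by (intro commK) auto
      then show ?thesis using m n by (simp add: fixer_def)
    qed
    then show "m \<in> K" using m Mc by (auto simp: K_def fixer_def)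
  qed
  have finM: "finite M" "finite K" using M.subset KG by (auto intro: finite_subset[OF _ finite_carrier])
  obtain x1 where x1: "x1 = xs ! 0" "x1 \<in> E" using ne xsE by (auto simp: subset_iff)
  have cardM: "card M \<le> card E * card K"
  proof -
    have "card M \<le> card E * card (M \<inter> fixer {x1})"
      using x1 M.subset by (intro card_le_orbit_stabilizer) auto
    also have "card (M \<inter> fixer {x1}) \<le> card K" using reg[OF x1(2)] finM by (simp add: card_mono)
    finally show ?thesis by simp
  qed
  \<comment> \<open>Elements of \<open>M\<close> that commute with \<open>S i\<close> as
    permutations. Identifying \<open>m\<close> with the point \<open>m x1\<close>, they correspond
    to the fixed points of \<open>S i\<close> as soon as \<open>S i\<close> fixes
    \<open>x1\<close>.\<close>
  define F where "F i = {n \<in> M. \<forall>g\<in>S i. \<forall>z\<in>E. act n (act g z) = act g (act n z)}" for i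
  have Sc: "g \<in> carrier G" if "g \<in> S i" for g i using that by (simp add: S_def fixer_def)
  have Fsub: "subgroup (F i) G" for i
  proof (rule subgroupI)
    show "F i \<subseteq> carrier G" using M.subset by (auto simp: F_def)
    have "\<one> \<in> F i" using Sc by (simp add: F_def)
    then show "F i \<noteq> {}" by blast
    fix a assume a: "a \<in> F i"
    then have ac: "a \<in> carrier G" using Mc by (simp add: F_def)
    have "act (inv a) (act g z) = act g (act (inv a) z)" if g: "g \<in> S i" and z: "z \<in> E" for g z
    proof -
      have "act a (act g (act (inv a) z)) = act g (act a (act (inv a) z))"
        using a g z ac Sc by (simp add: F_def del: act_inv act_inv')
      then have "act (inv a) (act a (act g (act (inv a) z))) = act (inv a) (act g z)"
        using z ac by simp
      then show ?thesis using z ac Sc[OF g] by simp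
    qed
    then show "inv a \<in> F i" using a by (simp add: F_def)
    fix b assume b: "b \<in> F i"
    then have bc: "b \<in> carrier G" using Mc by (simp add: F_def)
    show "a \<otimes> b \<in> F i" using a b ac bc Sc by (simp add: F_def)
  qed
  \<comment> \<open>The new element is the \<open>n\<close> in \<open>M\<close> with
    \<open>n x1 = d\<close>, where \<open>d\<close> is the next point of the sequence. It commutes
    with everything fixing both \<open>x1\<close> and \<open>d\<close>, but not with an element of
    \<open>S i\<close> that moves \<open>d\<close>.\<close>
  have Fstrict: "F i \<subset> F (Suc i)" if i: "1 \<le> i" "i < length xs" for i
  proof
    have "S (Suc i) \<subseteq> S i" using S i by auto
    then show "F i \<subseteq> F (Suc i)" by (auto simp: F_def)
    define d where "d = xs ! i"
    have dE: "d \<in> E" using i xsE by (auto simp: d_def)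
    have Suc_eq: "S (Suc i) = S i \<inter> fixer {d}"
      using i by (auto simp: S_def d_def take_Suc_conv_app_nth fixer_def)
    have x1S: "act g x1 = x1" if "g \<in> S i" for g
    proof -
      have "x1 \<in> set (take i xs)" using i x1 by (auto simp: set_conv_nth intro!: exI[of _ 0])
      then show ?thesis using that by (simp add: S_def fixer_def)
    qed
    obtain n where n: "n \<in> M" "d = act n x1" using trans[OF x1(2)] dE by blast
    have nc: "n \<in> carrier G" using n Mc by simp
    have "act n (act g z) = act g (act n z)" if g: "g \<in> S (Suc i)" and z: "z \<in> E" for g z
    proof (rule commK)
      have gc: "g \<in> carrier G" using g Sc by blast
      have gx: "act g x1 = x1" "act g d = d"
        using g Suc_eq x1S by (auto simp: fixer_def)
      have ix: "act (inv g) d = d" "act (inv n) d = x1" using gx act_inv[OF gc dE] act_inv[OF nc x1(2)] n by simp_all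
      \<comment> \<open>The commutator lies in \<open>M\<close> by normality and fixes
        \<open>d\<close>, along \<open>d\<close>, \<open>d\<close>, \<open>x1\<close>,
        \<open>x1\<close>, \<open>d\<close>; by semiregularity it acts trivially.\<close>
      have "g \<otimes> inv n \<otimes> inv g \<in> M" using M.inv_op_closed2[OF gc] n by simp
      then have "commutator G n g \<in> M"
        using n M.m_closed[of n "g \<otimes> inv n \<otimes> inv g"] nc gc by (simp add: commutator_def m_assoc)
      moreover have "act (commutator G n g) d = d"
        using dE nc gc ix gx n x1 by (simp add: commutator_def del: act_inv act_inv')
      ultimately show "commutator G n g \<in> K" using reg[OF dE] nc gc by (auto simp: fixer_def)
    qed (use nc Sc g z in auto)
    then have "n \<in> F (Suc i)" using n by (simp add: F_def)
    moreover have "n \<notin> F i"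
    proof
      assume nF: "n \<in> F i"
      obtain g where g: "g \<in> S i" "g \<notin> S (Suc i)" using S[OF i(2)] by auto
      have "act g d \<noteq> d" using g Suc_eq Sc by (auto simp: fixer_def)
      moreover have "act n (act g x1) = act g (act n x1)" using nF g x1 by (simp add: F_def)
      ultimately show False using n x1S[OF g(1)] by simp
    qed
    ultimately show "F i \<noteq> F (Suc i)" by blast
  qed
  have Ffin: "finite (F i)" for i using finM by (simp add: F_def)
  have pow: "2 ^ i * card K \<le> card (F (Suc i))" if "i < length xs" for i
    using that
  proof (induct i)
    case 0
    have "K \<subseteq> F 1" using M(2) Kact Sc by (auto simp: F_def)
    then show ?case using Ffin by (simp add: card_mono)
  next
    case (Suc i)
    then have "2 * card (F (Suc i)) \<le> card (F (Suc (Suc i)))"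
      using Fsub Fstrict Ffin by (intro card_subgroup_double) auto
    then show ?case using Suc by simp
  qed
  have "2 ^ (length xs - 1) * card K \<le> card (F (length xs))" using pow[of "length xs - 1"] ne by simp
  also have "\<dots> \<le> card M" using finM by (intro card_mono) (auto simp: F_def)
  also have "\<dots> \<le> card E * card K" by (rule cardM)
  finally show ?thesis using subgroup.one_closed[OF normal_imp_subgroup[OF Kn]] finM(2) by (auto simp: card_gt_0_iff)
qed

lemma irred_seq_append:
  assumes "irred_seq xs" "x \<in> E" "fixer (insert x (set xs)) \<noteq> fixer (set xs)"
  shows "irred_seq (xs @ [x])"
  using assms by (auto simp: irred_seq_def less_Suc_eq fixer_def insert_commute)

end

text \<open>The left side bounds the order of a group of degree \<open>k\<close> with an irredundant
  base of length \<open>j + 1\<close>: the first point has at most \<open>k\<close> images and each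
  later one at most \<open>k - 1\<close>. The form \<open>4 ^ (k - 1)\<close> on the right is chosen
  because its exponents add up over a partition into blocks.\<close>

lemma pow_log_le_pow4:
  fixes k j :: nat
  assumes k: "2 \<le> k" and j: "2 ^ j \<le> k"
  shows "k * (k - 1) ^ j \<le> 4 ^ (k - 1)"
proof (cases "k < 16")
  case True
  have "j < 4"
  proof (rule ccontr)
    assume "\<not> j < 4"
    then have "(2::nat) ^ 4 \<le> 2 ^ j" by (intro power_increasing) auto
    then show False using j True by simp
  qed
  then have "j \<in> {0,1,2,3}" by auto
  moreover have "k \<in> {2,3,4,5,6,7,8,9,10,11,12,13,14,15}" using k True by simp presburger
  ultimately show ?thesis using j by auto
next
  case False
  obtain s where s: "2 ^ s \<le> k" "k < 2 ^ Suc s"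
    using ex_power_ivl1[of 2 k] k by auto
  have "(2::nat) ^ 4 < 2 ^ Suc s" using False s by simp
  then have s4: "4 \<le> s" by (subst (asm) power_strict_increasing_iff) auto
  have "(2::nat) ^ j < 2 ^ Suc s" using j s by linarith
  then have js: "j \<le> s" by (subst (asm) power_strict_increasing_iff) auto
  \<comment> \<open>At \<open>s = 4\<close> this reads 25 \<le> 30, while it fails at
    \<open>s = 3\<close>; this is why the degrees below 16 are checked one by one.\<close>
  have sq: "(s + 1) * (s + 1) \<le> 2 * (2 ^ s - 1)"
    using s4
  proof (induct s rule: dec_induct)
    case (step n)
    have "n * 2 + 3 \<le> 2 * 2 ^ n"
      using step(1) by (induct n rule: dec_induct) auto
    then show ?case using step by (simp add: algebra_simps)
  qed simp
  have "k * (k - 1) ^ j \<le> 2 ^ Suc s * (2 ^ Suc s) ^ s"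
  proof (rule mult_mono)
    have "(k - 1) ^ j \<le> (2 ^ Suc s) ^ j" using s by (intro power_mono) auto
    also have "\<dots> \<le> (2 ^ Suc s) ^ s" using js by (intro power_increasing) auto
    finally show "(k - 1) ^ j \<le> (2 ^ Suc s) ^ s" .
  qed (use s in auto)
  also have "\<dots> = 2 ^ ((s + 1) * (s + 1))"
    by (simp add: power_mult[symmetric] power_add[symmetric] algebra_simps)
  also have "\<dots> \<le> 2 ^ (2 * (k - 1))"
  proof (rule power_increasing)
    have "(2::nat) ^ s - 1 \<le> k - 1" using s by linarith
    then show "(s + 1) * (s + 1) \<le> 2 * (k - 1)" using sq by linarith
  qed auto
  also have "\<dots> = 4 ^ (k - 1)" by (simp add: power_mult)
  finally show ?thesis .
qed

section \<open>Orders of soluble permutation groups\<close>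

context set_act
begin

text \<open>A longest irredundant sequence has the kernel as its pointwise stabiliser, and its
  length is logarithmic in the degree by \<open>primitive_irred_seq_length\<close>. The order is
  bounded by the product of the orbit lengths down the chain of stabilisers.\<close>

lemma primitive_card_le:
  assumes prim: "primitive" and sol: "solvable G" and E: "2 \<le> card E"
  shows "card (carrier G) \<le> 4 ^ (card E - 1) * card (fixer E)"
proof -
  have nil: "irred_seq []" by (simp add: irred_seq_def)
  have bound: "length xs < card E + 2" if "irred_seq xs" for xs
  proof (cases "xs = []")
    case False
    have "length xs - 1 < card E"
      using primitive_irred_seq_length[OF prim sol that False] less_exp order.strict_trans2 by blast
    then show ?thesis by simp
  qed simp
  obtain xs where xs: "irred_seq xs" and mx: "\<And>ys. irred_seq ys \<Longrightarrow> length ys \<le> length xs"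
    using ex_has_greatest_nat[of irred_seq "[]" length "card E + 2"] bound nil by blast
  have xsE: "set xs \<subseteq> E" using xs by (simp add: irred_seq_def)
  define S where "S i = fixer (set (take i xs))" for i
  have base: "S (length xs) \<subseteq> fixer E"
  proof
    fix g assume g: "g \<in> S (length xs)"
    have "act g x = x" if x: "x \<in> E" for x
    proof (rule ccontr)
      assume "act g x \<noteq> x"
      then have "fixer (insert x (set xs)) \<noteq> fixer (set xs)"
        using g by (auto simp: S_def fixer_def)
      then have "irred_seq (xs @ [x])" using xs x by (rule irred_seq_append[rotated 2])
      then show False using mx by fastforce
    qed
    then show "g \<in> fixer E" using g by (auto simp: S_def fixer_def)
  qed
  have Ssub: "subgroup (S i) G" for i
    unfolding S_def using xsE by (intro subgroup_fixer) (auto dest: in_set_takeD)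
  have step: "card (S i) \<le> card Z * card (S (Suc i))"
    if i: "i < length xs" and Z: "\<And>h. h \<in> S i \<Longrightarrow> act h (xs ! i) \<in> Z" "finite Z" for i Z
  proof -
    have "S (Suc i) = S i \<inter> fixer {xs ! i}"
      using i by (auto simp: S_def take_Suc_conv_app_nth fixer_def)
    moreover have "card (S i) \<le> card Z * card (S i \<inter> fixer {xs ! i})"
      using i xsE Z Ssub[of i] by (intro card_le_orbit_stabilizer)
        (auto simp: subgroup.m_closed subgroup.m_inv_closed subgroup.mem_carrier)
    ultimately show ?thesis by simp
  qed
  \<comment> \<open>Stabilisers after the first step fix \<open>xs ! 0\<close>, so orbits of later
    points avoid it. This saves one point in every factor except the first.\<close>
  have chain: "card (S 1) \<le> (card E - 1) ^ i * card (S (Suc i))" if "i < length xs" for i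
    using that
  proof (induct i)
    case (Suc i)
    have x0: "xs ! 0 \<in> set (take (Suc i) xs)" "xs ! 0 \<in> E"
      using Suc xsE by (auto simp: set_conv_nth intro!: exI[of _ 0])
    have ne: "xs ! 0 \<noteq> xs ! Suc i"
    proof
      assume "xs ! 0 = xs ! Suc i"
      then have "set (take (Suc (Suc i)) xs) = set (take (Suc i) xs)"
        using Suc x0 by (auto simp: take_Suc_conv_app_nth)
      then show False using xs Suc(2) unfolding irred_seq_def by auto
    qed
    have "card (S (Suc i)) \<le> card (E - {xs ! 0}) * card (S (Suc (Suc i)))"
    proof (rule step)
      fix h assume h: "h \<in> S (Suc i)"
      then have hc: "h \<in> carrier G" "act h (xs ! 0) = xs ! 0" using x0 by (auto simp: S_def fixer_def)
      have "xs ! Suc i \<in> E" using Suc(2) xsE by auto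
      then show "act h (xs ! Suc i) \<in> E - {xs ! 0}"
        using hc x0 ne act_inj[of h "xs ! 0" "xs ! Suc i"] by auto
    qed (use Suc in auto)
    then have "card (S (Suc i)) \<le> (card E - 1) * card (S (Suc (Suc i)))"
      using x0 by simp
    then have "(card E - 1) ^ i * card (S (Suc i)) \<le> (card E - 1) ^ Suc i * card (S (Suc (Suc i)))"
      by (simp add: mult.assoc)
    moreover have "card (S 1) \<le> (card E - 1) ^ i * card (S (Suc i))" using Suc by simp
    ultimately show ?case by linarith
  qed simp
  have finF: "finite (fixer E)" by (simp add: fixer_def)
  show ?thesis
  proof (cases "xs = []")
    case True
    then have "carrier G \<subseteq> fixer E" using base by (simp add: S_def)
    then have "card (carrier G) \<le> card (fixer E)" using finF by (simp add: card_mono)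
    also have "\<dots> \<le> 4 ^ (card E - 1) * card (fixer E)" by simp
    finally show ?thesis .
  next
    case False
    define j where "j = length xs - 1"
    have j: "2 ^ j \<le> card E" "j < length xs" "Suc j = length xs"
      using primitive_irred_seq_length[OF prim sol xs False] False by (auto simp: j_def)
    have "card (carrier G) \<le> card E * card (S 1)"
      using step[of 0 E] False xsE by (simp add: S_def subset_iff)
    also have "\<dots> \<le> card E * ((card E - 1) ^ j * card (fixer E))"
    proof (rule mult_left_mono)
      have "card (S (Suc j)) \<le> card (fixer E)" using base finF j by (simp add: card_mono)
      then show "card (S 1) \<le> (card E - 1) ^ j * card (fixer E)"
        using chain[OF j(2)] by (meson mult_le_mono2 order_trans)
    qed simp
    also have "\<dots> \<le> 4 ^ (card E - 1) * card (fixer E)"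
      using pow_log_le_pow4[OF E j(1)] by (simp add: mult.assoc[symmetric])
    finally show ?thesis .
  qed
qed

end

text \<open>Induction on the degree. For an invariant partition \<open>P\<close> the group acts on
  the blocks, and the kernel of that action acts on each block in turn. The exponents
  \<open>card P - 1\<close> and \<open>card B - 1\<close> sum to \<open>card E - 1\<close>, so the
  bound reproduces itself exactly.\<close>

lemma soluble_perm_card_le:
  fixes G :: "('g, 'm) monoid_scheme" and E :: "'b set"
  assumes "set_act G E act" "solvable G" "E \<noteq> {}"
  shows "card (carrier G) \<le> 4 ^ (card E - 1) * card {g \<in> carrier G. \<forall>x\<in>E. act g x = x}"
  using assms
proof (induction "card E" arbitrary: G E act rule: less_induct)
  case less
  interpret set_act G E act by fact
  note sol = less.prems(2)
  have goal: "card (carrier G) \<le> 4 ^ (card E - 1) * card (fixer E)"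
  proof (cases "\<exists>P. partition_on E P \<and> (\<forall>g\<in>carrier G. \<forall>B\<in>P. act g ` B \<in> P) \<and>
      P \<noteq> {E} \<and> P \<noteq> (\<lambda>x. {x}) ` E")
    case False
    have noP: "P = {E} \<or> P = (\<lambda>x. {x}) ` E"
      if "partition_on E P" "\<forall>g\<in>carrier G. \<forall>B\<in>P. act g ` B \<in> P" for P
      by (rule ccontr) (rule notE[OF False], rule exI[of _ P], use that in simp)
    let ?P = "(\<lambda>x. (\<lambda>m. act m x) ` carrier G) ` E"
    have finF: "finite (fixer E)" by (simp add: fixer_def)
    have triv: ?thesis if "carrier G \<subseteq> fixer E"
    proof -
      have "card (carrier G) \<le> card (fixer E)" using that finF by (simp add: card_mono)
      also have "\<dots> \<le> 4 ^ (card E - 1) * card (fixer E)" by simp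
      finally show ?thesis .
    qed
    \<comment> \<open>In the absence of a non-trivial invariant partition the orbits form a trivial
      one, so the action is trivial or transitive, and in the latter case primitive. Intransitive
      groups thus fall under the partition case.\<close>
    have "?P = {E} \<or> ?P = (\<lambda>x. {x}) ` E"
      by (rule noP) (use orbit_partition[OF normal_self] in auto)
    then show ?thesis
    proof
      assume eq: "?P = (\<lambda>x. {x}) ` E"
      have "act m y = y" if m: "m \<in> carrier G" and y: "y \<in> E" for m y
      proof -
        have "(\<lambda>m. act m y) ` carrier G \<in> ?P" using y by (rule imageI)
        then obtain z where z: "(\<lambda>m. act m y) ` carrier G = {z}" unfolding eq by auto
        then have "y = z" using orbit_partition(3)[OF normal_self y] by auto
        then show ?thesis using z imageI[OF m, of "\<lambda>m. act m y"] by simp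
      qed
      then show ?thesis by (intro triv) (auto simp: fixer_def)
    next
      assume eq: "?P = {E}"
      have "(\<lambda>m. act m x) ` carrier G = E" if "x \<in> E" for x
      proof -
        have "(\<lambda>m. act m x) ` carrier G \<in> ?P" using that by (rule imageI)
        then show ?thesis using eq by simp
      qed
      then have "\<exists>g\<in>carrier G. act g x = y" if "x \<in> E" "y \<in> E" for x y using that by blast
      then have prim: primitive unfolding primitive_def using noP by simp
      show ?thesis
      proof (cases "2 \<le> card E")
        case True then show ?thesis using primitive_card_le[OF prim sol] by simp
      next
        case False
        moreover have "card E \<noteq> 0" using less.prems(3) by simp
        ultimately have "card E = 1" by linarith
        then obtain e where "E = {e}" by (meson card_1_singletonE)
        then show ?thesis using act_closed by (intro triv) (auto simp: fixer_def)
      qed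
    qed
  next
    case True
    then obtain P where P: "partition_on E P" and inv': "\<forall>g\<in>carrier G. \<forall>B\<in>P. act g ` B \<in> P"
      and nE: "P \<noteq> {E}" and nS: "P \<noteq> (\<lambda>x. {x}) ` E" by (elim exE conjE)
    have inv: "act g ` B \<in> P" if "g \<in> carrier G" "B \<in> P" for g B using inv' that by simp
    have UP: "\<Union>P = E" and neP: "{} \<notin> P" using P by (auto simp: partition_on_def)
    have disj: "B = B'" if "B \<in> P" "B' \<in> P" "x \<in> B" "x \<in> B'" for B B' x
      using P that by (auto simp: partition_on_def disjoint_def)
    have finP: "finite P" using UP finite_set by (metis finite_UnionD)
    have finB: "finite B" if "B \<in> P" for B using that UP finite_set by (metis Union_upper finite_subset)
    define e where "e B = (SOME x. x \<in> B)" for B :: "'b set"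
    have e: "e B \<in> B" if "B \<in> P" for B
      using that neP unfolding e_def by (metis some_in_eq)
    define bl where "bl x = (THE B. B \<in> P \<and> x \<in> B)" for x
    have bl: "bl x = B" if "B \<in> P" "x \<in> B" for x B
      unfolding bl_def by (rule the_equality) (use that disj in auto)
    have blP: "bl x \<in> P" "x \<in> bl x" if xE: "x \<in> E" for x
    proof -
      obtain B where "B \<in> P" "x \<in> B" using UP xE by blast
      then show "bl x \<in> P" "x \<in> bl x" using bl by auto
    qed
    \<comment> \<open>The action on blocks is modelled on block representatives, which are points of
      \<open>E\<close>. The induction hypothesis then applies at the same type of points.\<close>
    define \<rho> where "\<rho> x = e (bl x)" for x
    define R where "R = e ` P"
    have RE: "R \<subseteq> E" using e UP by (auto simp: R_def)
    have eE: "e B \<in> E" if "B \<in> P" for B using e[OF that] that UP by blast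
    have bl_e: "bl (e B) = B" if "B \<in> P" for B using bl[OF that e[OF that]] .
    have inj_e: "inj_on e P" by (metis bl_e inj_onI)
    have cardR: "card R = card P" by (simp add: R_def card_image inj_e)
    have bl_act: "bl (act g x) = act g ` bl x" if "g \<in> carrier G" "x \<in> E" for g x
      using that by (intro bl inv blP imageI)
    have sumP: "(\<Sum>B\<in>P. card B) = card E"
      using card_Union_disjoint[of P] P finB UP by (auto simp: partition_on_def disjoint_def pairwise_def disjnt_def)
    have card1: "1 \<le> card B" if "B \<in> P" for B
      using that neP finB by (metis One_nat_def Suc_leI card_gt_0_iff)
    have sumP1: "(\<Sum>B\<in>P. card B - 1) + card P = card E"
    proof -
      have "(\<Sum>B\<in>P. card B - 1) + card P = (\<Sum>B\<in>P. (card B - 1) + 1)"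
        by (simp only: sum.distrib) simp
      also have "\<dots> = (\<Sum>B\<in>P. card B)" by (intro sum.cong refl) (use card1 in \<open>metis le_add_diff_inverse2\<close>)
      finally show ?thesis using sumP by simp
    qed
    have small: "card P < card E"
    proof (rule ccontr)
      assume "\<not> card P < card E"
      then have "(\<Sum>B\<in>P. card B - 1) = 0" using sumP1 by linarith
      then have one: "card B = 1" if "B \<in> P" for B using that finP card1[OF that] by force
      have "P = (\<lambda>x. {x}) ` E"
      proof (intro equalityI subsetI)
        fix B assume B: "B \<in> P"
        then obtain x where "B = {x}" using one by (meson card_1_singletonE)
        then show "B \<in> (\<lambda>x. {x}) ` E" using B UP by auto
      next
        fix B assume "B \<in> (\<lambda>x. {x}) ` E"
        then obtain x where x: "x \<in> E" "B = {x}" by auto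
        then have "card (bl x) = 1" "x \<in> bl x" using one blP by auto
        then have "bl x = {x}" by (metis card_1_singletonE singletonD)
        then show "B \<in> P" using blP x by metis
      qed
      then show False using nS by simp
    qed
    have Bsmall: "card B < card E" if B: "B \<in> P" for B
    proof -
      have "B \<noteq> E"
      proof
        assume "B = E"
        have "P = {E}"
        proof (intro equalityI subsetI)
          fix C assume C: "C \<in> P"
          then have "e C \<in> B" using eE \<open>B = E\<close> by simp
          then have "C = B" using disj[OF C B e[OF C]] by simp
          then show "C \<in> {E}" using \<open>B = E\<close> by simp
        qed (use B \<open>B = E\<close> in auto)
        then show False using nE by simp
      qed
      then show ?thesis using B UP finite_set by (metis Union_upper psubsetI psubset_card_mono)
    qed
    interpret R: set_act G R "\<lambda>g x. \<rho> (act g x)"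
    proof unfold_locales
      fix g h x assume g: "g \<in> carrier G" and x: "x \<in> R"
      have xE: "x \<in> E" using x RE by auto
      show "\<rho> (act g x) \<in> R" using g xE blP by (auto simp: \<rho>_def R_def)
      assume h: "h \<in> carrier G"
      have y: "act h x \<in> E" using h xE by simp
      have "bl (act g (\<rho> (act h x))) = act g ` bl (\<rho> (act h x))"
        using g eE[OF blP(1)[OF y]] by (simp only: \<rho>_def bl_act)
      also have "\<dots> = bl (act g (act h x))"
        using g y bl_e[OF blP(1)[OF y]] by (simp only: \<rho>_def bl_act)
      finally have "bl (act g (\<rho> (act h x))) = bl (act g (act h x))" .
      then show "\<rho> (act (g \<otimes>\<^bsub>G\<^esub> h) x) = \<rho> (act g (\<rho> (act h x)))"
        using g h xE by (simp add: \<rho>_def)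
    next
      fix x assume "x \<in> R"
      then show "\<rho> (act \<one>\<^bsub>G\<^esub> x) = x" using RE bl_e by (auto simp: \<rho>_def R_def eE)
    qed (use finite_subset[OF RE] in auto)
    have "P \<noteq> {}" using UP less.prems(3) by auto
    then have "R \<noteq> {}" by (simp add: R_def)
    define L where "L = R.fixer R"
    have Lsub: "subgroup L G" unfolding L_def by (rule R.subgroup_fixer) simp
    have GL: "card (carrier G) \<le> 4 ^ (card P - 1) * card L"
      using less.hyps[OF _ R.set_act_axioms sol \<open>R \<noteq> {}\<close>] small cardR
      by (simp add: L_def R.fixer_def)
    have LB: "act g ` B = B" if g: "g \<in> L" and B: "B \<in> P" for g B
    proof -
      have gc: "g \<in> carrier G" using g by (simp add: L_def R.fixer_def)
      have "e B \<in> R" using B by (simp add: R_def)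
      then have "\<rho> (act g (e B)) = e B" using g by (simp add: L_def R.fixer_def)
      then have "e (bl (act g (e B))) = e B" by (simp add: \<rho>_def)
      then have "e (act g ` B) = e B" using bl_act[OF gc eE[OF B]] bl_e[OF B] by simp
      then show ?thesis using inj_onD[OF inj_e] inv[OF gc B] B by blast
    qed
    \<comment> \<open>The blocks are treated one at a time: the part of \<open>L\<close> that fixes
      the earlier blocks pointwise acts on the block \<open>B\<close>, and the kernel of that action
      is passed on.\<close>
    have chain: "card L \<le> 4 ^ (\<Sum>B\<in>F. card B - 1) * card (L \<inter> fixer (\<Union>F))"
      if "finite F" "F \<subseteq> P" for F
      using that
    proof (induct F rule: finite_induct)
      case empty
      have "L \<inter> carrier G = L" using subgroup.subset[OF Lsub] by blast
      then show ?case by simp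
    next
      case (insert B F)
      define H where "H = L \<inter> fixer (\<Union>F)"
      have "\<Union>F \<subseteq> E" using insert UP by auto
      then have Hsub: "subgroup H G" unfolding H_def
        using subgroups_Inter_pair Lsub subgroup_fixer by blast
      have B: "B \<in> P" "B \<subseteq> E" using insert UP by auto
      have sH: "set_act (G\<lparr>carrier := H\<rparr>) E act" using Hsub by (rule subgroup_act)
      have "act g x \<in> B" if "g \<in> H" "x \<in> B" for g x
        using LB[of g B] B that by (auto simp: H_def)
      then interpret H: set_act "G\<lparr>carrier := H\<rparr>" B act
        using sH B finB unfolding set_act_def set_act_axioms_def
        by (auto simp: H_def subset_iff)
      have "card H \<le> 4 ^ (card B - 1) * card {g \<in> H. \<forall>x\<in>B. act g x = x}"
        using less.hyps[OF Bsmall[OF B(1)] H.set_act_axioms solvable_subgroup_group[OF sol Hsub]] neP B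
        by auto
      also have "{g \<in> H. \<forall>x\<in>B. act g x = x} = L \<inter> fixer (\<Union>(insert B F))"
        using subgroup.subset[OF Lsub] by (auto simp: H_def fixer_def)
      finally have "card H \<le> 4 ^ (card B - 1) * card (L \<inter> fixer (\<Union>(insert B F)))" .
      moreover have "card L \<le> 4 ^ (\<Sum>B\<in>F. card B - 1) * card H" using insert by (simp add: H_def)
      ultimately have "card L \<le> 4 ^ (\<Sum>B\<in>F. card B - 1) * (4 ^ (card B - 1) * card (L \<inter> fixer (\<Union>(insert B F))))"
        by (meson mult_le_mono2 order_trans)
      then show ?case using insert by (simp add: power_add mult_ac)
    qed
    have "card L \<le> 4 ^ (\<Sum>B\<in>P. card B - 1) * card (L \<inter> fixer E)"
      using chain[of P] finP UP by simp
    also have "\<dots> \<le> 4 ^ (\<Sum>B\<in>P. card B - 1) * card (fixer E)"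
      by (intro mult_left_mono card_mono) (auto simp: fixer_def)
    finally have "card (carrier G) \<le> 4 ^ (card P - 1) * (4 ^ (\<Sum>B\<in>P. card B - 1) * card (fixer E))"
      using GL by (meson mult_le_mono2 order_trans)
    also have "\<dots> = 4 ^ (card P - 1 + (\<Sum>B\<in>P. card B - 1)) * card (fixer E)"
      by (simp add: power_add)
    also have "card P - 1 + (\<Sum>B\<in>P. card B - 1) = card E - 1"
      using sumP1 \<open>P \<noteq> {}\<close> finP by (metis One_nat_def Suc_leI add.commute add_diff_assoc card_gt_0_iff)
    finally show ?thesis .
  qed
  then show ?case by (simp add: fixer_def)
qed

section \<open>Independence of characters\<close>

context abelian_group
begin

definition endo :: "('a \<Rightarrow> 'a) \<Rightarrow> bool" where
  "endo f \<longleftrightarrow> (\<forall>u\<in>carrier G. f u \<in> carrier G) \<and>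
     (\<forall>u\<in>carrier G. \<forall>v\<in>carrier G. f (u \<oplus> v) = f u \<oplus> f v)"

lemma endo_closed [simp]: "endo f \<Longrightarrow> u \<in> carrier G \<Longrightarrow> f u \<in> carrier G"
  by (simp add: endo_def)

lemma endo_add: "endo f \<Longrightarrow> u \<in> carrier G \<Longrightarrow> v \<in> carrier G \<Longrightarrow> f (u \<oplus> v) = f u \<oplus> f v"
  by (simp add: endo_def)

lemma endo_zero [simp]:
  assumes "endo f" shows "f \<zero> = \<zero>"
proof -
  have "f \<zero> \<oplus> f \<zero> = f \<zero> \<oplus> \<zero>" using endo_add[OF assms, of \<zero> \<zero>] assms by simp
  then show ?thesis using assms by (metis add.l_cancel endo_closed zero_closed)
qed

lemma endo_neg:
  assumes "endo f" "u \<in> carrier G" shows "f (\<ominus> u) = \<ominus> f u"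
proof -
  have "f (\<ominus> u) \<oplus> f u = \<zero>"
    using assms endo_add[OF assms(1), of "\<ominus> u" u] by (simp add: l_neg)
  then show ?thesis using assms by (simp add: minus_equality)
qed

lemma endo_diff:
  "endo f \<Longrightarrow> u \<in> carrier G \<Longrightarrow> v \<in> carrier G \<Longrightarrow> f (u \<ominus> v) = f u \<ominus> f v"
  by (simp add: a_minus_def endo_add endo_neg)

lemma endo_finsum:
  assumes "endo f" "u \<in> I \<rightarrow> carrier G"
  shows "f (\<Oplus>i\<in>I. u i) = (\<Oplus>i\<in>I. f (u i))"
  using assms(2)
proof (induct I rule: infinite_finite_induct)
  case (insert i I)
  then show ?case using assms(1)
    by (auto simp: finsum_insert endo_add Pi_iff)
qed (use assms in auto)

lemma diff_eq_zero_iff: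
  "u \<in> carrier G \<Longrightarrow> v \<in> carrier G \<Longrightarrow> u \<ominus> v = \<zero> \<longleftrightarrow> u = v"
  by (metis a_minus_def add.inv_closed minus_equality minus_minus r_neg)

lemma diff_add_diff:
  assumes "a \<in> carrier G" "b \<in> carrier G" "c \<in> carrier G" "d \<in> carrier G"
  shows "(a \<oplus> b) \<ominus> (c \<oplus> d) = (a \<ominus> c) \<oplus> (b \<ominus> d)"
  using assms by (simp add: a_minus_def minus_add a_ac)

lemma endo_diff_fun: "endo f \<Longrightarrow> endo g \<Longrightarrow> endo (\<lambda>v. f v \<ominus> g v)"
  by (simp add: endo_def diff_add_diff)

lemma endo_cong: "(\<And>v. v \<in> carrier G \<Longrightarrow> f v = g v) \<Longrightarrow> endo f = endo g"
  by (simp add: endo_def)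

lemma finsum_diff:
  assumes "f \<in> I \<rightarrow> carrier G" "g \<in> I \<rightarrow> carrier G"
  shows "(\<Oplus>i\<in>I. f i \<ominus> g i) = (\<Oplus>i\<in>I. f i) \<ominus> (\<Oplus>i\<in>I. g i)"
proof -
  have "\<zero> = \<zero> \<ominus> \<zero>" using diff_eq_zero_iff[of \<zero> \<zero>] by simp
  then show ?thesis
    using assms
  proof (induct I rule: infinite_finite_induct)
    case (insert i I)
    then show ?case
      by (simp add: finsum_insert Pi_iff diff_add_diff)
  qed simp_all
qed

text \<open>Dedekind's independence of characters, with coefficients in a module on which the values
  of the characters act.\<close>

lemma dedekind_independence:
  assumes "finite I"
    and endo: "\<And>i t. i \<in> I \<Longrightarrow> t \<in> T \<Longrightarrow> endo (\<chi> i t)"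
    and closed: "\<And>s t. s \<in> T \<Longrightarrow> t \<in> T \<Longrightarrow> mul s t \<in> T"
    and hom: "\<And>i s t v. i \<in> I \<Longrightarrow> s \<in> T \<Longrightarrow> t \<in> T \<Longrightarrow> v \<in> carrier G \<Longrightarrow>
        \<chi> i (mul s t) v = \<chi> i s (\<chi> i t v)"
    and one: "e \<in> T" "\<And>i v. i \<in> I \<Longrightarrow> v \<in> carrier G \<Longrightarrow> \<chi> i e v = v"
    and comm: "\<And>i j s t v. i \<in> I \<Longrightarrow> j \<in> I \<Longrightarrow> s \<in> T \<Longrightarrow> t \<in> T \<Longrightarrow> v \<in> carrier G \<Longrightarrow>
        \<chi> i s (\<chi> j t v) = \<chi> j t (\<chi> i s v)"
    and sep: "\<And>i j. i \<in> I \<Longrightarrow> j \<in> I \<Longrightarrow> i \<noteq> j \<Longrightarrow>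
        \<exists>t\<in>T. \<forall>v\<in>carrier G. \<chi> i t v = \<chi> j t v \<longrightarrow> v = \<zero>"
    and u: "u \<in> I \<rightarrow> carrier G"
    and sum: "\<And>t. t \<in> T \<Longrightarrow> (\<Oplus>i\<in>I. \<chi> i t (u i)) = \<zero>"
  shows "\<forall>i\<in>I. u i = \<zero>"
proof -
  have "\<forall>u. u \<in> J \<rightarrow> carrier G \<longrightarrow> (\<forall>t\<in>T. (\<Oplus>i\<in>J. \<chi> i t (u i)) = \<zero>) \<longrightarrow> (\<forall>i\<in>J. u i = \<zero>)"
    if "J \<subseteq> I" for J
    using finite_subset[OF that \<open>finite I\<close>] that
  proof (induct J rule: finite_induct)
    case (insert j J)
    show ?case
    proof (intro allI impI)
      fix u assume u: "u \<in> insert j J \<rightarrow> carrier G"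
        and sum: "\<forall>t\<in>T. (\<Oplus>i\<in>insert j J. \<chi> i t (u i)) = \<zero>"
      have jI: "j \<in> I" and JI: "\<And>i. i \<in> J \<Longrightarrow> i \<in> I" using insert by auto
      have uj: "u j \<in> carrier G" and uJ: "\<And>i. i \<in> J \<Longrightarrow> u i \<in> carrier G" using u by auto
      have endo': "\<chi> i t v \<in> carrier G" if "i \<in> I" "t \<in> T" "v \<in> carrier G" for i t v
        using endo[OF that(1,2)] that(3) by simp
      have split: "(\<Oplus>i\<in>J. \<chi> i t (u i)) = \<ominus> \<chi> j t (u j)" if t: "t \<in> T" for t
      proof -
        have "\<chi> j t (u j) \<oplus> (\<Oplus>i\<in>J. \<chi> i t (u i)) = \<zero>"
          using sum t insert(1,2) uj uJ JI jI endo'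
            finsum_insert[of J j "\<lambda>i. \<chi> i t (u i)"] by (simp add: Pi_iff)
        moreover have "(\<Oplus>i\<in>J. \<chi> i t (u i)) \<in> carrier G"
          using uJ JI endo' t by (intro finsum_closed) auto
        ultimately show ?thesis using endo'[OF jI t uj] by (metis a_comm minus_equality)
      qed
      \<comment> \<open>Subtracting \<open>\<chi> j s\<close> applied to the relation at
        \<open>t\<close> from the relation at \<open>mul t s\<close> cancels the \<open>j\<close>
        term. The shorter relation has the coefficients
        \<open>\<chi> i s (u i) \<ominus> \<chi> j s (u i)\<close>, which vanish by
        induction.\<close>
      have eqs: "\<chi> i s (u i) = \<chi> j s (u i)" if s: "s \<in> T" and i: "i \<in> J" for s i
      proof -
        have w: "(\<lambda>i. \<chi> i s (u i) \<ominus> \<chi> j s (u i)) \<in> J \<rightarrow> carrier G"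
          using uJ JI jI endo' s by auto
        have "(\<Oplus>i\<in>J. \<chi> i t (\<chi> i s (u i) \<ominus> \<chi> j s (u i))) = \<zero>" if t: "t \<in> T" for t
        proof -
          have "(\<Oplus>i\<in>J. \<chi> i t (\<chi> i s (u i) \<ominus> \<chi> j s (u i)))
              = (\<Oplus>i\<in>J. \<chi> i (mul t s) (u i) \<ominus> \<chi> j s (\<chi> i t (u i)))"
          proof (rule finsum_cong'[OF refl])
            fix i assume i: "i \<in> J"
            have "\<chi> i t (\<chi> i s (u i) \<ominus> \<chi> j s (u i)) = \<chi> i t (\<chi> i s (u i)) \<ominus> \<chi> i t (\<chi> j s (u i))"
              using i uJ JI jI endo' s t endo by (intro endo_diff) auto
            then show "\<chi> i t (\<chi> i s (u i) \<ominus> \<chi> j s (u i)) = \<chi> i (mul t s) (u i) \<ominus> \<chi> j s (\<chi> i t (u i))"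
              using i uJ JI jI s t hom comm by metis
          qed (use uJ JI jI endo' s t closed in auto)
          also have "\<dots> = (\<Oplus>i\<in>J. \<chi> i (mul t s) (u i)) \<ominus> (\<Oplus>i\<in>J. \<chi> j s (\<chi> i t (u i)))"
            using uJ JI jI endo' s t closed by (intro finsum_diff) auto
          also have "(\<Oplus>i\<in>J. \<chi> j s (\<chi> i t (u i))) = \<chi> j s (\<Oplus>i\<in>J. \<chi> i t (u i))"
            using uJ JI jI endo endo' s t by (intro endo_finsum[symmetric]) auto
          also have "\<dots> = \<ominus> \<chi> j s (\<chi> j t (u j))"
            using split[OF t] endo_neg[OF endo[OF jI s]] endo'[OF jI t uj] by simp
          also have "\<dots> = \<ominus> \<chi> j (mul t s) (u j)"
            using hom[OF jI t s uj] comm[OF jI jI t s uj] by simp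
          finally show ?thesis
            using split[OF closed[OF t s]] endo'[OF jI closed[OF t s] uj] by (simp add: diff_eq_zero_iff)
        qed
        then have "\<chi> i s (u i) \<ominus> \<chi> j s (u i) = \<zero>"
          using insert(3,4) w i by auto
        then show ?thesis using i uJ JI jI endo' s by (simp add: diff_eq_zero_iff)
      qed
      \<comment> \<open>Coefficients lie in a module, so characters being merely different would not
        suffice: \<open>sep\<close> supplies a \<open>t\<close> at which two of them agree on the
        zero vector only.\<close>
      have J0: "u i = \<zero>" if i: "i \<in> J" for i
      proof -
        have "i \<noteq> j" using i insert(2) by auto
        then obtain t where "t \<in> T" "\<forall>v\<in>carrier G. \<chi> i t v = \<chi> j t v \<longrightarrow> v = \<zero>"
          using sep[OF JI[OF i] jI] by auto
        then show ?thesis using eqs i uJ by blast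
      qed
      have "\<ominus> \<chi> j e (u j) = (\<Oplus>i\<in>J. \<zero>)"
        unfolding split[OF one(1), symmetric] using J0 JI one endo
        by (intro finsum_cong') auto
      then have "\<ominus> u j = \<zero>" using one jI uj by (simp add: finsum_zero)
      then have "u j = \<zero>" using uj add.inv_eq_1_iff by simp
      then show "\<forall>i\<in>insert j J. u i = \<zero>" using J0 by auto
    qed
  qed auto
  then show ?thesis using u sum by blast
qed

text \<open>The form used for counting. The map from tuples in \<open>V^I\<close> to functions on
  \<open>T\<close> is injective, so if such a function is known from its values on \<open>r\<close>
  elements of \<open>T\<close>, then \<open>|V|^|I| \<le> |V|^r\<close> and
  \<open>|I| \<le> r\<close>.\<close>

lemma dedekind_inj:
  assumes "finite I"
    and endo: "\<And>i t. i \<in> I \<Longrightarrow> t \<in> T \<Longrightarrow> endo (\<chi> i t)"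
    and closed: "\<And>s t. s \<in> T \<Longrightarrow> t \<in> T \<Longrightarrow> mul s t \<in> T"
    and hom: "\<And>i s t v. i \<in> I \<Longrightarrow> s \<in> T \<Longrightarrow> t \<in> T \<Longrightarrow> v \<in> carrier G \<Longrightarrow>
        \<chi> i (mul s t) v = \<chi> i s (\<chi> i t v)"
    and one: "e \<in> T" "\<And>i v. i \<in> I \<Longrightarrow> v \<in> carrier G \<Longrightarrow> \<chi> i e v = v"
    and comm: "\<And>i j s t v. i \<in> I \<Longrightarrow> j \<in> I \<Longrightarrow> s \<in> T \<Longrightarrow> t \<in> T \<Longrightarrow> v \<in> carrier G \<Longrightarrow>
        \<chi> i s (\<chi> j t v) = \<chi> j t (\<chi> i s v)"
    and sep: "\<And>i j. i \<in> I \<Longrightarrow> j \<in> I \<Longrightarrow> i \<noteq> j \<Longrightarrow>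
        \<exists>t\<in>T. \<forall>v\<in>carrier G. \<chi> i t v = \<chi> j t v \<longrightarrow> v = \<zero>"
    and uw: "u \<in> I \<rightarrow>\<^sub>E carrier G" "w \<in> I \<rightarrow>\<^sub>E carrier G"
    and eq: "\<And>t. t \<in> T \<Longrightarrow> (\<Oplus>i\<in>I. \<chi> i t (u i)) = (\<Oplus>i\<in>I. \<chi> i t (w i))"
  shows "u = w"
proof -
  have uw': "u i \<in> carrier G" "w i \<in> carrier G" if "i \<in> I" for i using uw that by auto
  have cl: "\<chi> i t v \<in> carrier G" if "i \<in> I" "t \<in> T" "v \<in> carrier G" for i t v
    using endo[OF that(1,2)] that(3) by simp
  have "\<forall>i\<in>I. u i \<ominus> w i = \<zero>"
  proof (rule dedekind_independence[where T = T and \<chi> = \<chi> and mul = mul and e = e])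
    fix t assume t: "t \<in> T"
    have "(\<Oplus>i\<in>I. \<chi> i t (u i \<ominus> w i)) = (\<Oplus>i\<in>I. \<chi> i t (u i) \<ominus> \<chi> i t (w i))"
      using uw' endo t cl by (intro finsum_cong') (auto simp: endo_diff)
    also have "\<dots> = (\<Oplus>i\<in>I. \<chi> i t (u i)) \<ominus> (\<Oplus>i\<in>I. \<chi> i t (w i))"
      using uw' cl t by (intro finsum_diff) auto
    also have "\<dots> = \<zero>"
      using eq[OF t] uw' cl t by (subst diff_eq_zero_iff) (auto intro!: finsum_closed)
    finally show "(\<Oplus>i\<in>I. \<chi> i t (u i \<ominus> w i)) = \<zero>" .
  qed (use assms uw' in auto)
  then have "u i = w i" if "i \<in> I" for i using uw' that by (simp add: diff_eq_zero_iff)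
  then show ?thesis using uw by (intro PiE_ext) auto
qed

end

text \<open>Besides the count, the separation property is what later makes the elements of
  \<open>T\<close> give distinct characters.\<close>

lemma (in group) transversal:
  assumes Z: "subgroup Z G" and B: "subgroup B G" and ZB: "Z \<subseteq> B" and fin: "finite B"
  obtains T where "T \<subseteq> B" "\<And>b. b \<in> B \<Longrightarrow> \<exists>t\<in>T. \<exists>z\<in>Z. b = t \<otimes> z"
    "\<And>t t'. t \<in> T \<Longrightarrow> t' \<in> T \<Longrightarrow> inv t \<otimes> t' \<in> Z \<Longrightarrow> t = t'" "card T * card Z = card B"
proof -
  define r where "r b = (SOME t. t \<in> B \<and> inv b \<otimes> t \<in> Z)" for b
  have Bc: "b \<in> carrier G" if "b \<in> B" for b using B that by (rule subgroup.mem_carrier)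
  have Zc: "b \<in> carrier G" if "b \<in> Z" for b using Z that by (rule subgroup.mem_carrier)
  have r: "r b \<in> B \<and> inv b \<otimes> r b \<in> Z" if "b \<in> B" for b
    unfolding r_def
    by (rule someI[where x = b]) (use that Bc subgroup.one_closed[OF Z] in auto)
  \<comment> \<open>Elements of one coset satisfy the same defining predicate, so the choice
    operator picks the same representative for them.\<close>
  have req: "r b = r b'" if b: "b \<in> B" "b' \<in> B" and z: "inv b \<otimes> b' \<in> Z" for b b'
  proof -
    have "inv b \<otimes> t \<in> Z \<longleftrightarrow> inv b' \<otimes> t \<in> Z" if t: "t \<in> B" for t
    proof
      have c: "b \<in> carrier G" "b' \<in> carrier G" "t \<in> carrier G" using b t Bc by auto
      assume "inv b \<otimes> t \<in> Z"
      then have "inv (inv b \<otimes> b') \<otimes> (inv b \<otimes> t) \<in> Z"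
        using z Z by (simp add: subgroup.m_closed subgroup.m_inv_closed)
      then show "inv b' \<otimes> t \<in> Z" using c by (simp add: inv_mult_group m_assoc inv_solve_left')
          (metis c inv_closed inv_solve_left m_assoc m_closed)
    next
      have c: "b \<in> carrier G" "b' \<in> carrier G" "t \<in> carrier G" using b t Bc by auto
      assume "inv b' \<otimes> t \<in> Z"
      then have "(inv b \<otimes> b') \<otimes> (inv b' \<otimes> t) \<in> Z"
        using z Z by (simp add: subgroup.m_closed)
      moreover have "(inv b \<otimes> b') \<otimes> (inv b' \<otimes> t) = inv b \<otimes> t"
        using c by (metis inv_closed m_assoc m_closed r_inv l_one)
      ultimately show "inv b \<otimes> t \<in> Z" by simp
    qed
    then show ?thesis unfolding r_def by (metis (mono_tags, lifting))
  qed
  define T where "T = r ` B"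
  have TB: "T \<subseteq> B" using r by (auto simp: T_def)
  have dec: "\<exists>t\<in>T. \<exists>z\<in>Z. b = t \<otimes> z" if b: "b \<in> B" for b
  proof (intro bexI)
    have c: "b \<in> carrier G" "r b \<in> carrier G" using b r Bc by auto
    show "inv (inv b \<otimes> r b) \<in> Z" using r[OF b] Z by (simp add: subgroup.m_inv_closed)
    show "b = r b \<otimes> inv (inv b \<otimes> r b)" using c by (simp add: inv_mult_group m_assoc[symmetric])
  qed (use b in \<open>auto simp: T_def\<close>)
  have sep: "t = t'" if t: "t \<in> T" "t' \<in> T" "inv t \<otimes> t' \<in> Z" for t t'
  proof -
    have rr: "r t = t" if tT: "t \<in> T" for t
    proof -
      obtain b where b: "b \<in> B" "t = r b" using tT by (auto simp: T_def)
      then show ?thesis using req[of b "r b"] r[OF b(1)] by simp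
    qed
    then show ?thesis using req[of t t'] t TB by auto
  qed
  have "bij_betw (\<lambda>(t, z). t \<otimes> z) (T \<times> Z) B"
  proof (rule bij_betw_imageI)
    show "inj_on (\<lambda>(t, z). t \<otimes> z) (T \<times> Z)"
    proof (rule inj_onI, clarify)
      fix t z t' z' assume t: "t \<in> T" "t' \<in> T" and z: "z \<in> Z" "z' \<in> Z" and eq: "t \<otimes> z = t' \<otimes> z'"
      have c: "t \<in> carrier G" "t' \<in> carrier G" "z \<in> carrier G" "z' \<in> carrier G" using t z TB Bc Zc by auto
      have "t' = t \<otimes> (z \<otimes> inv z')" using eq c by (simp add: m_assoc[symmetric] inv_solve_right)
      then have "inv t \<otimes> t' = z \<otimes> inv z'" using c by (simp add: m_assoc[symmetric])
      then have "t = t'" using sep t z Z by (simp add: subgroup.m_closed subgroup.m_inv_closed)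
      then show "t = t' \<and> z = z'" using eq c by simp
    qed
    show "(\<lambda>(t, z). t \<otimes> z) ` (T \<times> Z) = B"
    proof (intro equalityI subsetI)
      fix b assume "b \<in> (\<lambda>(t, z). t \<otimes> z) ` (T \<times> Z)"
      then show "b \<in> B" using TB ZB B by (auto intro!: subgroup.m_closed)
    next
      fix b assume "b \<in> B"
      then obtain t z where "t \<in> T" "z \<in> Z" "b = t \<otimes> z" using dec by blast
      then show "b \<in> (\<lambda>(t, z). t \<otimes> z) ` (T \<times> Z)" by (intro image_eqI[of _ _ "(t, z)"]) auto
    qed
  qed
  then have "card (T \<times> Z) = card B" by (rule bij_betw_same_card)
  then have "card T * card Z = card B" by (simp add: card_cartesian_product)
  then show ?thesis using that TB dec sep by blast
qed

text \<open>Each generator outside the subgroup generated so far at least doubles it. Among the sets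
  \<open>Y\<close> with \<open>2 ^ card Y \<le> card (generate G Y)\<close>, one generating a
  largest subgroup must generate the whole group.\<close>

lemma (in group) small_generating_set:
  assumes "finite (carrier G)"
  obtains Y where "Y \<subseteq> carrier G" "2 ^ card Y \<le> card (carrier G)" "generate G Y = carrier G"
proof -
  define good where "good Y \<longleftrightarrow> Y \<subseteq> carrier G \<and> 2 ^ card Y \<le> card (generate G Y)" for Y
  have sub: "generate G Y \<subseteq> carrier G" if "good Y" for Y
    using that generate_incl by (auto simp: good_def)
  have "good {}" by (simp add: good_def generate_empty)
  then obtain Y where Y: "good Y" and mx: "\<And>Y'. good Y' \<Longrightarrow> card (generate G Y') \<le> card (generate G Y)"
    using ex_has_greatest_nat[of good "{}" "\<lambda>Y. card (generate G Y)" "Suc (card (carrier G))"]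
      sub assms by (meson card_mono le_imp_less_Suc)
  have "generate G Y = carrier G"
  proof (rule ccontr)
    assume "generate G Y \<noteq> carrier G"
    then obtain x where x: "x \<in> carrier G" "x \<notin> generate G Y" using sub[OF Y] by auto
    have Yc: "Y \<subseteq> carrier G" "insert x Y \<subseteq> carrier G" using Y x by (auto simp: good_def)
    have "generate G Y \<subseteq> generate G (insert x Y)" by (rule mono_generate) auto
    moreover have "x \<in> generate G (insert x Y)" by (rule generate.incl) simp
    ultimately have ss: "generate G Y \<subset> generate G (insert x Y)" using x by auto
    have "finite (generate G (insert x Y))" using generate_incl[OF Yc(2)] assms finite_subset by blast
    then have dbl: "2 * card (generate G Y) \<le> card (generate G (insert x Y))"
      using ss Yc by (intro card_subgroup_double generate_is_subgroup) auto
    have "x \<notin> Y" using x generate.incl by metis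
    moreover have "finite Y" using Yc assms finite_subset by blast
    ultimately have "good (insert x Y)" using dbl Y Yc by (simp add: good_def)
    then have "card (generate G (insert x Y)) \<le> card (generate G Y)" by (rule mx)
    moreover have "card (generate G Y) > 0" using Y unfolding good_def
      by (metis less_le_trans zero_less_numeral zero_less_power)
    ultimately show False using dbl by linarith
  qed
  then show ?thesis using that Y by (auto simp: good_def)
qed

section \<open>Linear actions with an abelian normal subgroup\<close>

lemma (in abelian_group) diff_eq_diffI:
  assumes "u \<oplus> a = u' \<oplus> b" "u \<in> carrier G" "u' \<in> carrier G" "a \<in> carrier G" "b \<in> carrier G"
  shows "a \<ominus> b = u' \<ominus> u"
proof -
  have "(u \<ominus> u) \<oplus> (a \<ominus> b) = (u' \<ominus> u) \<oplus> (b \<ominus> b)"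
    using assms diff_add_diff[of u a u b] diff_add_diff[of u' b u b] by simp
  then show ?thesis
    using assms diff_eq_zero_iff[of u u] diff_eq_zero_iff[of b b] by simp
qed

lemma (in group) inv_cancel_left:
  "x \<in> carrier G \<Longrightarrow> y \<in> carrier G \<Longrightarrow> inv x \<otimes> (x \<otimes> y) = y"
  by (simp add: m_assoc[symmetric])

lemma (in group) inv_mult_one_imp_eq:
  assumes "x \<in> carrier G" "y \<in> carrier G" "inv x \<otimes> y = \<one>" shows "x = y"
proof -
  have "x \<otimes> (inv x \<otimes> y) = y" using assms(1,2) by (simp add: m_assoc[symmetric])
  then show ?thesis using assms by simp
qed

lemma hom_eq_on_generate:
  assumes "group_hom G H f" "group_hom G H g" "Y \<subseteq> carrier G" "\<And>y. y \<in> Y \<Longrightarrow> f y = g y"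
    and "x \<in> generate G Y"
  shows "f x = g x"
proof -
  interpret f: group_hom G H f by fact
  interpret g: group_hom G H g by fact
  show ?thesis using assms(5)
  proof (induct rule: generate.induct)
    case (eng h1 h2)
    then have "h1 \<in> carrier G" "h2 \<in> carrier G" using f.G.generate_in_carrier[OF assms(3)] by auto
    then show ?case using eng by simp
  qed (use assms(3,4) in \<open>auto simp: subset_iff\<close>)
qed

text \<open>Modules over a prime field are treated as finite abelian groups with an action by
  additive maps: additive subgroups and subspaces coincide there, so irreducibility and direct sums
  keep their meaning.\<close>

locale lin_act = set_act G "carrier V" act + V: abelian_group V
  for G (structure) and V :: "('v, 'w) ring_scheme" and act +
  assumes act_add: "g \<in> carrier G \<Longrightarrow> u \<in> carrier V \<Longrightarrow> v \<in> carrier V \<Longrightarrow>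
    act g (u \<oplus>\<^bsub>V\<^esub> v) = act g u \<oplus>\<^bsub>V\<^esub> act g v"
begin

lemma act_endo [simp]: "g \<in> carrier G \<Longrightarrow> V.endo (act g)"
  by (simp add: V.endo_def act_add)

end

locale lin_abel = lin_act G V act
  for G (structure) and V :: "('v, 'w) ring_scheme" and act +
  fixes A
  assumes faithful: "\<And>g. g \<in> carrier G \<Longrightarrow> (\<And>v. v \<in> carrier V \<Longrightarrow> act g v = v) \<Longrightarrow> g = \<one>"
    and V_nontrivial: "carrier V \<noteq> {\<zero>\<^bsub>V\<^esub>}"
    and A_normal: "A \<lhd> G"
    and A_comm: "\<And>a b. a \<in> A \<Longrightarrow> b \<in> A \<Longrightarrow> a \<otimes> b = b \<otimes> a"
begin

sublocale A: normal A G by (rule A_normal)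

lemma A_carrier [simp]: "a \<in> A \<Longrightarrow> a \<in> carrier G"
  using A.subset by auto

definition C where "C = {g \<in> carrier G. \<forall>a\<in>A. g \<otimes> a = a \<otimes> g}"

lemma C_carrier [simp]: "g \<in> C \<Longrightarrow> g \<in> carrier G"
  by (simp add: C_def)

lemma A_le_C: "A \<subseteq> C"
  unfolding C_def using A_comm A_carrier by blast

lemma C_commute: "g \<in> C \<Longrightarrow> a \<in> A \<Longrightarrow> g \<otimes> a = a \<otimes> g"
  unfolding C_def by blast

lemma C_I: "g \<in> carrier G \<Longrightarrow> (\<And>a. a \<in> A \<Longrightarrow> g \<otimes> a = a \<otimes> g) \<Longrightarrow> g \<in> C"
  unfolding C_def by blast

text \<open>The subring of the endomorphisms of \<open>V\<close> generated by \<open>A\<close>.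
  Closure under differences is enough, since products of generators are again generators
  (\<open>span_comp\<close>). Restricting the maps to the carrier makes equality pointwise on
  \<open>V\<close> and the ring finite.\<close>

inductive_set span :: "('v \<Rightarrow> 'v) set" where
  base: "a \<in> A \<Longrightarrow> (\<lambda>v\<in>carrier V. act a v) \<in> span"
| diff: "r \<in> span \<Longrightarrow> s \<in> span \<Longrightarrow> (\<lambda>v\<in>carrier V. r v \<ominus>\<^bsub>V\<^esub> s v) \<in> span"

lemma span_endo [simp]: "r \<in> span \<Longrightarrow> V.endo r"
proof (induct rule: span.induct)
  case (base a)
  then have "V.endo (act a)" by simp
  then show ?case by (simp cong: V.endo_cong)
next
  case (diff r s)
  then show ?case using V.endo_diff_fun[of r s] by (simp cong: V.endo_cong)
qed

lemma span_extensional: "r \<in> span \<Longrightarrow> r \<in> extensional (carrier V)"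
  by (induct rule: span.induct) (rule restrict_extensional)+

lemma span_closed [simp]: "r \<in> span \<Longrightarrow> v \<in> carrier V \<Longrightarrow> r v \<in> carrier V"
  by simp

lemma span_eqI:
  "r \<in> span \<Longrightarrow> s \<in> span \<Longrightarrow> (\<And>v. v \<in> carrier V \<Longrightarrow> r v = s v) \<Longrightarrow> r = s"
  using span_extensional extensionalityI by blast

lemma span_cong:
  assumes "r \<in> span" "\<And>v. v \<in> carrier V \<Longrightarrow> r v = g v"
  shows "restrict g (carrier V) \<in> span"
proof -
  have "restrict g (carrier V) = r"
    using span_extensional[OF assms(1)] assms(2) by (intro extensionalityI[where A = "carrier V"]) auto
  then show ?thesis using assms(1) by simp
qed

lemma finite_span: "finite span"
proof (rule finite_subset)
  show "span \<subseteq> carrier V \<rightarrow>\<^sub>E carrier V"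
    using span_extensional span_closed by (auto simp: PiE_def)
qed (simp add: finite_PiE)

lemma span_id: "(\<lambda>v\<in>carrier V. v) \<in> span"
  by (rule span_cong[OF base[of \<one>]]) auto

lemma span_zero: "(\<lambda>v\<in>carrier V. \<zero>\<^bsub>V\<^esub>) \<in> span"
  by (rule span_cong[OF diff[OF span_id span_id]]) (simp add: V.diff_eq_zero_iff)

lemma span_add:
  assumes "r \<in> span" "s \<in> span"
  shows "(\<lambda>v\<in>carrier V. r v \<oplus>\<^bsub>V\<^esub> s v) \<in> span"
  by (rule span_cong[OF diff[OF assms(1) diff[OF span_zero assms(2)]]])
    (use assms in \<open>simp add: a_minus_def V.minus_minus\<close>)

lemma span_comp: "r \<in> span \<Longrightarrow> s \<in> span \<Longrightarrow> (\<lambda>v\<in>carrier V. r (s v)) \<in> span"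
proof (induct rule: span.induct)
  case (base a)
  have "(\<lambda>v\<in>carrier V. act a (s v)) \<in> span" using base(2)
  proof (induct rule: span.induct)
    case (base b)
    show ?case
      by (rule span_cong[OF span.base[of "a \<otimes> b"]]) (use \<open>a \<in> A\<close> base in auto)
  next
    case (diff r s)
    show ?case
      by (rule span_cong[OF span.diff[OF diff(2,4)]])
        (use \<open>a \<in> A\<close> diff in \<open>simp add: V.endo_diff[of "act a"]\<close>)
  qed
  then show ?case by (rule span_cong[of _ "\<lambda>v. (\<lambda>v\<in>carrier V. act a v) (s v)"]) (use base in simp)
next
  case (diff q r)
  show ?case
    by (rule span_cong[OF span.diff[OF diff(2)[OF diff(5)] diff(4)[OF diff(5)]]]) (use diff(1,3,5) in simp)
qed

lemma span_commute_C:
  assumes "g \<in> C" "r \<in> span" "v \<in> carrier V"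
  shows "act g (r v) = r (act g v)"
  using assms(2,3)
proof (induct arbitrary: v rule: span.induct)
  case (base a)
  have "act (g \<otimes> a) v = act (a \<otimes> g) v"
    by (rule arg_cong[OF C_commute[OF assms(1) base(1)]])
  then show ?case using base assms(1) by simp
next
  case (diff r s)
  then show ?case using assms(1) by (simp add: V.endo_diff[of "act g"])
qed

lemma span_commute:
  assumes "s \<in> span" "r \<in> span" "v \<in> carrier V"
  shows "s (r v) = r (s v)"
  using assms(1,3)
proof (induct arbitrary: v rule: span.induct)
  case (base a)
  then show ?case using span_commute_C[of a r v] A_le_C assms(2) by auto
next
  case (diff q s)
  then show ?case using assms(2) by (simp add: V.endo_diff[of r])
qed

text \<open>\<open>A\<close> is normal, so conjugation by \<open>G\<close> permutes the generators
  of the ring. This is the action of \<open>G\<close> by ring automorphisms whose image is counted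
  in \<open>card_index_C\<close>.\<close>

lemma span_conj:
  assumes g: "g \<in> carrier G" and r: "r \<in> span"
  shows "(\<lambda>v\<in>carrier V. act g (r (act (inv g) v))) \<in> span"
  using r
proof (induct rule: span.induct)
  case (base a)
  show ?case
    by (rule span_cong[OF span.base[OF A.inv_op_closed2[OF g base]]]) (use g base in simp)
next
  case (diff r s)
  show ?case
    by (rule span_cong[OF span.diff[OF diff(2,4)]])
      (use diff(1,3) g in \<open>simp add: V.endo_diff[of "act g"]\<close>)
qed

text \<open>The commutative ring \<open>span\<close> is a field acting on \<open>V\<close> by scalar multiplications.\<close>

definition span_field :: bool where
  "span_field \<longleftrightarrow> (\<forall>r\<in>span. (\<exists>v\<in>carrier V. v \<noteq> \<zero>\<^bsub>V\<^esub> \<and> r v = \<zero>\<^bsub>V\<^esub>) \<longrightarrow>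
     (\<forall>v\<in>carrier V. r v = \<zero>\<^bsub>V\<^esub>))"

end

locale lin_field = lin_abel G V act A
  for G (structure) and V :: "('v, 'w) ring_scheme" and act and A +
  assumes fld: span_field
begin

lemma span_zero_divisor:
  "r \<in> span \<Longrightarrow> v \<in> carrier V \<Longrightarrow> r v = \<zero>\<^bsub>V\<^esub> \<Longrightarrow> u \<in> carrier V \<Longrightarrow> v = \<zero>\<^bsub>V\<^esub> \<or> r u = \<zero>\<^bsub>V\<^esub>"
  using fld unfolding span_field_def by blast

lemma span_separates:
  assumes "r \<in> span" "s \<in> span" "r \<noteq> s" "v \<in> carrier V" "r v = s v"
  shows "v = \<zero>\<^bsub>V\<^esub>"
proof (rule ccontr)
  assume v: "v \<noteq> \<zero>\<^bsub>V\<^esub>"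
  have "r u = s u" if u: "u \<in> carrier V" for u
    using span_zero_divisor[OF diff[OF assms(1,2)], of v u] assms v u
    by (simp add: V.diff_eq_zero_iff)
  then show False using span_eqI assms by blast
qed

text \<open>Finiteness is used twice: \<open>r\<close> is injective and hence onto on
  \<open>V\<close>, and then \<open>s \<mapsto> s r\<close> is injective and hence onto on
  \<open>span\<close>, so it reaches the identity.\<close>

lemma span_inverse:
  assumes r: "r \<in> span" and v0: "v0 \<in> carrier V" "r v0 \<noteq> \<zero>\<^bsub>V\<^esub>"
  obtains s where "s \<in> span" "\<And>v. v \<in> carrier V \<Longrightarrow> s (r v) = v"
proof -
  have rinj: "inj_on r (carrier V)"
  proof (rule inj_onI)
    fix u v assume uv: "u \<in> carrier V" "v \<in> carrier V" "r u = r v"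
    then have "r (u \<ominus>\<^bsub>V\<^esub> v) = \<zero>\<^bsub>V\<^esub>" using r by (simp add: V.endo_diff V.diff_eq_zero_iff)
    then have "u \<ominus>\<^bsub>V\<^esub> v = \<zero>\<^bsub>V\<^esub>" using span_zero_divisor[OF r _ _ v0(1)] v0(2) uv by auto
    then show "u = v" using uv by (simp add: V.diff_eq_zero_iff)
  qed
  have rsurj: "r ` carrier V = carrier V"
    by (rule endo_inj_surj[OF finite_set image_subsetI rinj]) (use r in simp)
  define \<Phi> where "\<Phi> s = (\<lambda>v\<in>carrier V. s (r v))" for s :: "'v \<Rightarrow> 'v"
  have "inj_on \<Phi> span"
  proof (rule inj_onI)
    fix s s' assume s: "s \<in> span" "s' \<in> span" and eq: "\<Phi> s = \<Phi> s'"
    have "s u = s' u" if uV: "u \<in> carrier V" for u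
    proof -
      have "u \<in> r ` carrier V" using uV rsurj by simp
      then obtain v where v: "v \<in> carrier V" "u = r v" by (elim imageE)
      show ?thesis using fun_cong[OF eq, of v] v by (simp add: \<Phi>_def)
    qed
    then show "s = s'" by (rule span_eqI[OF s])
  qed
  moreover have "\<Phi> ` span \<subseteq> span" unfolding \<Phi>_def using span_comp r by blast
  ultimately have "\<Phi> ` span = span" using finite_span by (intro endo_inj_surj)
  then have "(\<lambda>v\<in>carrier V. v) \<in> \<Phi> ` span" using span_id by simp
  then obtain s where s: "s \<in> span" "(\<lambda>v\<in>carrier V. v) = \<Phi> s" by blast
  have "s (r v) = v" if "v \<in> carrier V" for v
    using fun_cong[OF s(2), of v] that by (simp add: \<Phi>_def)
  then show ?thesis using that s(1) by blast
qed

lemma nonzero_vector: obtains v where "v \<in> carrier V" "v \<noteq> \<zero>\<^bsub>V\<^esub>"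
  using V_nontrivial V.zero_closed by blast

text \<open>Both \<open>a\<close> and the identity lie in the field, and two distinct scalars agree
  on the zero vector only.\<close>

lemma A_semiregular:
  assumes "a \<in> A" "v \<in> carrier V" "v \<noteq> \<zero>\<^bsub>V\<^esub>" "act a v = v"
  shows "a = \<one>"
proof (rule faithful)
  have "(\<lambda>v\<in>carrier V. act a v) = (\<lambda>v\<in>carrier V. v)"
    using span_separates[OF base[OF assms(1)] span_id _ assms(2)] assms by auto
  then show "act a v = v" if "v \<in> carrier V" for v using that by (metis restrict_apply')
qed (use assms in auto)

text \<open>\<open>A\<close> embeds into the non-zero elements of the field. The strict inequality
  is what the numerical estimates need for fields with 2 or 3 elements.\<close>

lemma card_A_less_span: "card A < card span"
proof -
  let ?f = "\<lambda>a. (\<lambda>v\<in>carrier V. act a v)"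
  obtain v where v: "v \<in> carrier V" "v \<noteq> \<zero>\<^bsub>V\<^esub>" by (rule nonzero_vector)
  have "inj_on ?f A"
  proof (rule inj_onI)
    fix a b assume ab: "a \<in> A" "b \<in> A" and eq: "?f a = ?f b"
    have "inv a \<otimes> b = \<one>"
    proof (rule A_semiregular)
      have "act a v = act b v" using fun_cong[OF eq, of v] v by simp
      then have "act (inv a) (act b v) = act (inv a) (act a v)" by simp
      then have "act (inv a) (act b v) = v" using ab v by simp
      then show "act (inv a \<otimes> b) v = v" using ab v by simp
    qed (use v ab in auto)
    then show "a = b" by (rule inv_mult_one_imp_eq[rotated 2]) (use ab in simp_all)
  qed
  moreover have "?f ` A \<subseteq> span - {\<lambda>v\<in>carrier V. \<zero>\<^bsub>V\<^esub>}"
  proof clarify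
    fix a assume a: "a \<in> A"
    have "?f a \<noteq> (\<lambda>v\<in>carrier V. \<zero>\<^bsub>V\<^esub>)"
    proof
      assume "?f a = (\<lambda>v\<in>carrier V. \<zero>\<^bsub>V\<^esub>)"
      from fun_cong[OF this, of v] have "act a v = \<zero>\<^bsub>V\<^esub>" using v by simp
      then have "act (inv a) \<zero>\<^bsub>V\<^esub> = act (inv a) (act a v)" by simp
      then have "act (inv a) \<zero>\<^bsub>V\<^esub> = v" using a v by simp
      then show False using a v V.endo_zero[OF act_endo[of "inv a"]] by simp
    qed
    then show "?f a \<in> span - {\<lambda>v\<in>carrier V. \<zero>\<^bsub>V\<^esub>}" using base[OF a] by simp
  qed
  ultimately have "card A \<le> card (span - {\<lambda>v\<in>carrier V. \<zero>\<^bsub>V\<^esub>})"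
    using finite_span by (metis card_image card_mono finite_Diff)
  also have "\<dots> < card span" using span_zero finite_span by (intro psubset_card_mono) auto
  finally show ?thesis .
qed

definition submod :: "'v set \<Rightarrow> bool" where
  "submod U \<longleftrightarrow> U \<subseteq> carrier V \<and> \<zero>\<^bsub>V\<^esub> \<in> U \<and>
     (\<forall>u\<in>U. \<forall>v\<in>U. u \<oplus>\<^bsub>V\<^esub> v \<in> U \<and> u \<ominus>\<^bsub>V\<^esub> v \<in> U) \<and> (\<forall>r\<in>span. \<forall>u\<in>U. r u \<in> U)"

definition span_hom :: "('v \<Rightarrow> 'v) \<Rightarrow> bool" where
  "span_hom f \<longleftrightarrow> V.endo f \<and> (\<forall>r\<in>span. \<forall>v\<in>carrier V. f (r v) = r (f v))"

text \<open>The property of a basis that the counting arguments use: a linear map over the field is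
  known from its values on \<open>Y\<close>.\<close>

definition determining :: "'v set \<Rightarrow> bool" where
  "determining Y \<longleftrightarrow> (\<forall>f g. span_hom f \<longrightarrow> span_hom g \<longrightarrow> (\<forall>y\<in>Y. f y = g y) \<longrightarrow>
     (\<forall>v\<in>carrier V. f v = g v))"

lemma determiningD:
  "determining Y \<Longrightarrow> span_hom f \<Longrightarrow> span_hom g \<Longrightarrow> (\<And>y. y \<in> Y \<Longrightarrow> f y = g y) \<Longrightarrow> v \<in> carrier V \<Longrightarrow> f v = g v"
  unfolding determining_def by blast

text \<open>A largest submodule \<open>U\<close> with \<open>card U = card span ^ n\<close> and a
  determining set of \<open>n\<close> vectors is all of \<open>V\<close>: a vector \<open>x\<close>
  outside \<open>U\<close> would enlarge it to the direct sum of \<open>U\<close> and the line of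
  \<open>x\<close>.\<close>

lemma span_basis:
  obtains Y where "Y \<subseteq> carrier V" "card (carrier V) = card span ^ card Y"
    "determining Y"
proof -
  define good where "good n \<longleftrightarrow> (\<exists>U Y. submod U \<and> card U = card span ^ n \<and> Y \<subseteq> U \<and> card Y = n \<and>
     (\<forall>f g. span_hom f \<longrightarrow> span_hom g \<longrightarrow> (\<forall>y\<in>Y. f y = g y) \<longrightarrow> (\<forall>v\<in>U. f v = g v)))" for n
  have span2: "2 \<le> card span"
  proof -
    have "card A \<ge> 1" using A.one_closed A.subset finite_subset[OF A.subset finite_carrier]
      by (metis One_nat_def Suc_leI card_gt_0_iff empty_iff)
    then show ?thesis using card_A_less_span by linarith
  qed
  have bound: "n < card (carrier V) + 1" if gn: "good n" for n
  proof -
    obtain U where U: "U \<subseteq> carrier V" "card U = card span ^ n"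
      using gn unfolding good_def submod_def by blast
    have "n < 2 ^ n" by (rule less_exp)
    also have "(2::nat) ^ n \<le> card span ^ n" using span2 by (rule power_mono) simp
    also have "\<dots> \<le> card (carrier V)" using U by (metis card_mono finite_set)
    finally show ?thesis by simp
  qed
  have "good 0" unfolding good_def
  proof (intro exI conjI)
    show "submod {\<zero>\<^bsub>V\<^esub>}" unfolding submod_def by (auto simp: V.diff_eq_zero_iff)
  qed (auto simp: span_hom_def)
  then obtain n where n: "good n" and mx: "\<And>k. good k \<Longrightarrow> k \<le> n"
    using ex_has_greatest_nat[of good 0 "\<lambda>n. n" "card (carrier V) + 1"] bound by blast
  obtain U Y where U: "submod U" "card U = card span ^ n" and Y: "Y \<subseteq> U" "card Y = n"
    and det: "\<And>f g v. span_hom f \<Longrightarrow> span_hom g \<Longrightarrow> \<forall>y\<in>Y. f y = g y \<Longrightarrow> v \<in> U \<Longrightarrow> f v = g v"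
    using n unfolding good_def by blast
  have UV: "u \<in> carrier V" if "u \<in> U" for u using U that by (auto simp: submod_def)
  have Uadd: "u \<oplus>\<^bsub>V\<^esub> v \<in> U" "u \<ominus>\<^bsub>V\<^esub> v \<in> U" if "u \<in> U" "v \<in> U" for u v
    using U that by (auto simp: submod_def)
  have Uspan: "r u \<in> U" if "r \<in> span" "u \<in> U" for r u
    using U that by (auto simp: submod_def)
  have "U = carrier V"
  proof (rule ccontr)
    assume "U \<noteq> carrier V"
    then obtain x where x: "x \<in> carrier V" "x \<notin> U" using U by (auto simp: submod_def)
    define h where "h = (\<lambda>(u, r). u \<oplus>\<^bsub>V\<^esub> r x)"
    define U' where "U' = h ` (U \<times> span)"
    have xs: "r x \<in> carrier V" if "r \<in> span" for r using that x by simp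
    have inj: "inj_on h (U \<times> span)"
    proof (rule inj_onI, clarify)
      fix u r u' r' assume u: "u \<in> U" "u' \<in> U" and r: "r \<in> span" "r' \<in> span"
        and eq: "h (u, r) = h (u', r')"
      have dd: "r x \<ominus>\<^bsub>V\<^esub> r' x = u' \<ominus>\<^bsub>V\<^esub> u"
        using eq u r UV xs by (intro V.diff_eq_diffI) (simp_all add: h_def)
      \<comment> \<open>Otherwise \<open>(r - r') x\<close> would lie in \<open>U\<close>, and
        dividing by the non-zero scalar \<open>r - r'\<close> would put \<open>x\<close> itself into
        \<open>U\<close>.\<close>
      have "r = r'"
      proof (rule ccontr)
        assume "r \<noteq> r'"
        define d where "d = (\<lambda>v\<in>carrier V. r v \<ominus>\<^bsub>V\<^esub> r' v)"
        have d: "d \<in> span" "d x = u' \<ominus>\<^bsub>V\<^esub> u" using r x dd by (simp_all add: d_def diff)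
        have "d x \<noteq> \<zero>\<^bsub>V\<^esub>"
        proof
          assume "d x = \<zero>\<^bsub>V\<^esub>"
          then have "r x = r' x" using x xs r by (simp add: d_def V.diff_eq_zero_iff)
          then have "x = \<zero>\<^bsub>V\<^esub>" using span_separates[OF r \<open>r \<noteq> r'\<close> x(1)] by simp
          then show False using x U by (simp add: submod_def)
        qed
        then obtain s where s: "s \<in> span" "\<And>v. v \<in> carrier V \<Longrightarrow> s (d v) = v"
          using span_inverse[OF d(1) x(1)] by metis
        have "s (d x) \<in> U" unfolding d(2) by (rule Uspan[OF s(1) Uadd(2)[OF u(2,1)]])
        then show False using s(2)[OF x(1)] x by simp
      qed
      then show "u = u' \<and> r = r'" using dd u r UV xs V.diff_eq_zero_iff[of u' u]
        by (simp add: V.diff_eq_zero_iff[of "r' x" "r' x", simplified])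
    qed
    have hU: "h (u, r) \<in> U'" if "u \<in> U" "r \<in> span" for u r
      using that by (auto simp: U'_def)
    have sub': "submod U'"
      unfolding submod_def
    proof (intro conjI ballI)
      show "U' \<subseteq> carrier V" using UV xs by (auto simp: U'_def h_def)
      have "h (\<zero>\<^bsub>V\<^esub>, \<lambda>v\<in>carrier V. \<zero>\<^bsub>V\<^esub>) \<in> U'" by (rule hU[OF _ span_zero]) (use U in \<open>simp add: submod_def\<close>)
      then show "\<zero>\<^bsub>V\<^esub> \<in> U'" using x by (simp add: h_def)
      fix w w' assume "w \<in> U'" "w' \<in> U'"
      then obtain u r u' r' where u: "u \<in> U" "u' \<in> U" and r: "r \<in> span" "r' \<in> span"
        and w: "w = u \<oplus>\<^bsub>V\<^esub> r x" "w' = u' \<oplus>\<^bsub>V\<^esub> r' x" by (auto simp: U'_def h_def)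
      have "h (u \<oplus>\<^bsub>V\<^esub> u', \<lambda>v\<in>carrier V. r v \<oplus>\<^bsub>V\<^esub> r' v) \<in> U'" by (rule hU[OF Uadd(1)[OF u] span_add[OF r]])
      then show "w \<oplus>\<^bsub>V\<^esub> w' \<in> U'" using u r UV xs x by (simp add: h_def w V.a_ac)
      have "h (u \<ominus>\<^bsub>V\<^esub> u', \<lambda>v\<in>carrier V. r v \<ominus>\<^bsub>V\<^esub> r' v) \<in> U'" by (rule hU[OF Uadd(2)[OF u] diff[OF r]])
      then show "w \<ominus>\<^bsub>V\<^esub> w' \<in> U'" using u r UV xs x by (simp add: h_def w V.diff_add_diff)
    next
      fix s w assume s: "s \<in> span" and "w \<in> U'"
      then obtain u r where u: "u \<in> U" and r: "r \<in> span" and w: "w = u \<oplus>\<^bsub>V\<^esub> r x"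
        by (auto simp: U'_def h_def)
      have "h (s u, \<lambda>v\<in>carrier V. s (r v)) \<in> U'" by (rule hU[OF Uspan[OF s u] span_comp[OF s r]])
      then show "s w \<in> U'" using u r s UV xs x by (simp add: h_def w V.endo_add)
    qed
    have "card U' = card U * card span"
      using inj by (simp add: U'_def card_image card_cartesian_product)
    then have card': "card U' = card span ^ Suc n" using U by simp
    have YU': "insert x Y \<subseteq> U'"
    proof
      fix y assume "y \<in> insert x Y"
      then show "y \<in> U'"
      proof
        assume "y = x"
        have "h (\<zero>\<^bsub>V\<^esub>, \<lambda>v\<in>carrier V. v) \<in> U'" by (rule hU[OF _ span_id]) (use U in \<open>simp add: submod_def\<close>)
        then show ?thesis using x \<open>y = x\<close> by (simp add: h_def)
      next
        assume "y \<in> Y"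
        then have "y \<in> U" using Y by auto
        have "h (y, \<lambda>v\<in>carrier V. \<zero>\<^bsub>V\<^esub>) \<in> U'" by (rule hU[OF \<open>y \<in> U\<close> span_zero])
        then show ?thesis using x UV[OF \<open>y \<in> U\<close>] by (simp add: h_def)
      qed
    qed
    have "finite Y" using Y UV finite_set by (meson finite_subset subsetI subset_trans)
    then have cY: "card (insert x Y) = Suc n" using Y x by (subst card_insert_disjoint) auto
    have "good (Suc n)" unfolding good_def
    proof (intro exI conjI allI impI ballI)
      fix f g v assume f: "span_hom f" and g: "span_hom g" and eq: "\<forall>y\<in>insert x Y. f y = g y"
        and "v \<in> U'"
      then obtain u r where u: "u \<in> U" and r: "r \<in> span" and v: "v = u \<oplus>\<^bsub>V\<^esub> r x"
        by (auto simp: U'_def h_def)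
      have "f u = g u" using det[OF f g _ u] eq by simp
      moreover have "f (r x) = g (r x)" using f g eq r x by (simp add: span_hom_def)
      ultimately show "f v = g v" using f g u UV xs r by (simp add: v span_hom_def V.endo_add)
    qed (use sub' card' YU' cY in auto)
    then show False using mx by fastforce
  qed
  then show ?thesis using that[of Y] U Y det unfolding determining_def by blast
qed

end

section \<open>The index of the centraliser of \<open>A\<close>\<close>

context lin_field begin

text \<open>\<open>k\<close> is the number of automorphisms of the field induced by
  \<open>G\<close>. Tuples \<open>u\<close> in \<open>V^I\<close> give additive maps
  \<open>t \<mapsto> \<Sum> i(t) (u i)\<close> on the field, injectively by Dedekind. Such a map is
  determined on an additive generating set of at most \<open>log |span|\<close> elements, so
  \<open>k \<le> log |span|\<close>. The bound is stated for every subgroup because vector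
  stabilisers need it too.\<close>

lemma card_index_C:
  obtains k where "\<forall>H. subgroup H G \<longrightarrow> card H \<le> k * card (H \<inter> C)" "2 ^ k \<le> card span"
proof -
  define \<sigma> where "\<sigma> g = (\<lambda>r\<in>span. \<lambda>v\<in>carrier V. act g (r (act (inv g) v)))" for g
  define I where "I = \<sigma> ` carrier G"
  have \<sigma>: "\<sigma> g r v = act g (r (act (inv g) v))" if "r \<in> span" "v \<in> carrier V" for g r v
    using that by (simp add: \<sigma>_def)
  have \<sigma>span: "i r \<in> span" if "i \<in> I" "r \<in> span" for i r
    using that span_conj by (auto simp: I_def \<sigma>_def)
  have finI: "finite I" by (simp add: I_def)
  \<comment> \<open>Two elements inducing the same automorphism conjugate each \<open>a\<close> in
    \<open>A\<close> to the same element, as the action on \<open>V\<close> is faithful; their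
    quotient therefore centralises \<open>A\<close>.\<close>
  have "card H \<le> card I * card (H \<inter> C)"
    if Hsub: "subgroup H G" for H
  proof (rule card_le_fibres[where f = \<sigma>])
    show H: "H \<subseteq> carrier G" by (rule subgroup.subset[OF Hsub])
    show "finite (H \<inter> C)" by (rule finite_subset[OF subsetI finite_carrier]) (use C_carrier in blast)
    fix g h assume gH: "g \<in> H" and hH: "h \<in> H" and eq: "\<sigma> g = \<sigma> h"
    have g: "g \<in> carrier G" and h: "h \<in> carrier G" using gH hH H by auto
    have "inv g \<otimes> h \<otimes> a = a \<otimes> (inv g \<otimes> h)" if a: "a \<in> A" for a
    proof -
      have ca: "a \<in> carrier G" using a by simp
      have "inv (h \<otimes> a \<otimes> inv h) \<otimes> (g \<otimes> a \<otimes> inv g) = \<one>"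
      proof (rule faithful)
        fix v assume v: "v \<in> carrier V"
        have "\<sigma> g (\<lambda>v\<in>carrier V. act a v) v = \<sigma> h (\<lambda>v\<in>carrier V. act a v) v" using eq by simp
        then have "act (g \<otimes> a \<otimes> inv g) v = act (h \<otimes> a \<otimes> inv h) v"
          using v g h ca base[OF a] by (simp add: \<sigma>)
        then have "act (inv (h \<otimes> a \<otimes> inv h)) (act (g \<otimes> a \<otimes> inv g) v) = v"
          using act_inv[of "h \<otimes> a \<otimes> inv h" v] v g h ca by (simp del: act_inv act_mult)
        then show "act (inv (h \<otimes> a \<otimes> inv h) \<otimes> (g \<otimes> a \<otimes> inv g)) v = v"
          using v g h ca by (subst act_mult) auto
      qed (use g h ca in auto)
      then have e: "g \<otimes> a \<otimes> inv g = h \<otimes> a \<otimes> inv h"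
        by (rule inv_mult_one_imp_eq[symmetric, rotated 2]) (use g h ca in simp_all)
      have "inv g \<otimes> h \<otimes> a = inv g \<otimes> (h \<otimes> a \<otimes> inv h) \<otimes> h" using g h ca by (simp add: m_assoc)
      also have "\<dots> = inv g \<otimes> (g \<otimes> a \<otimes> inv g) \<otimes> h" by (simp only: e)
      also have "\<dots> = a \<otimes> (inv g \<otimes> h)" using g h ca by (simp add: m_assoc inv_cancel_left)
      finally show ?thesis .
    qed
    then have "inv g \<otimes> h \<in> C" by (rule C_I[rotated]) (use g h in auto)
    then show "inv g \<otimes> h \<in> H \<inter> C" using gH hH Hsub by (simp add: subgroup.m_closed subgroup.m_inv_closed)
  next
    show "\<sigma> ` H \<subseteq> I" using subgroup.subset[OF Hsub] by (auto simp: I_def)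
  qed (rule finI)
  moreover have "2 ^ card I \<le> card span"
  proof -
    \<comment> \<open>The additive group of the field, written multiplicatively so that
      \<open>small_generating_set\<close> applies to it.\<close>
    define R where "R = \<lparr>carrier = span, monoid.mult = (\<lambda>r s. \<lambda>v\<in>carrier V. r v \<oplus>\<^bsub>V\<^esub> s v),
      monoid.one = (\<lambda>v\<in>carrier V. \<zero>\<^bsub>V\<^esub>)\<rparr>"
    have R: "group R"
    proof (rule groupI)
      fix r assume r: "r \<in> carrier R"
      have "(\<lambda>v\<in>carrier V. \<zero>\<^bsub>V\<^esub> \<ominus>\<^bsub>V\<^esub> r v) \<in> span"
        by (rule span_cong[OF diff[OF span_zero]]) (use r in \<open>auto simp: R_def\<close>)
      then show "\<exists>s\<in>carrier R. s \<otimes>\<^bsub>R\<^esub> r = \<one>\<^bsub>R\<^esub>"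
        using r by (intro bexI) (auto simp: R_def a_minus_def V.l_neg cong: restrict_cong)
    next
      fix r assume r: "r \<in> carrier R"
      then have "r \<in> span" by (simp add: R_def)
      from span_eqI[OF span_add[OF span_zero this] this]
      have "(\<lambda>v\<in>carrier V. (\<lambda>v\<in>carrier V. \<zero>\<^bsub>V\<^esub>) v \<oplus>\<^bsub>V\<^esub> r v) = r"
        using \<open>r \<in> span\<close> by simp
      then show "\<one>\<^bsub>R\<^esub> \<otimes>\<^bsub>R\<^esub> r = r" by (simp only: R_def monoid.simps partial_object.simps)
    qed (auto simp: R_def span_add span_zero V.a_assoc intro!: restrict_ext)
    obtain Y where Y: "Y \<subseteq> span" "2 ^ card Y \<le> card span" "generate R Y = span"
      using group.small_generating_set[OF R] finite_span by (auto simp: R_def)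
    have finY: "finite Y" using Y finite_span finite_subset by auto
    define \<Phi> where "\<Phi> u t = (\<Oplus>\<^bsub>V\<^esub>i\<in>I. i t (u i))" for u t
    have \<Phi>hom: "group_hom R (add_monoid V) (\<Phi> u)" if u: "u \<in> I \<rightarrow>\<^sub>E carrier V" for u
    proof -
      have uI: "u i \<in> carrier V" if "i \<in> I" for i using u that by auto
      have "\<Phi> u t \<in> carrier V" if "t \<in> span" for t
        unfolding \<Phi>_def using uI \<sigma>span that by (intro V.finsum_closed) auto
      moreover have "\<Phi> u (\<lambda>v\<in>carrier V. r v \<oplus>\<^bsub>V\<^esub> s v) = \<Phi> u r \<oplus>\<^bsub>V\<^esub> \<Phi> u s" if r: "r \<in> span" "s \<in> span" for r s
      proof -
        have "\<Phi> u (\<lambda>v\<in>carrier V. r v \<oplus>\<^bsub>V\<^esub> s v) = (\<Oplus>\<^bsub>V\<^esub>i\<in>I. i r (u i) \<oplus>\<^bsub>V\<^esub> i s (u i))"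
          unfolding \<Phi>_def
        proof (rule V.finsum_cong'[OF refl])
          fix i assume i: "i \<in> I"
          then obtain g where g: "g \<in> carrier G" "i = \<sigma> g" by (auto simp: I_def)
          show "i (\<lambda>v\<in>carrier V. r v \<oplus>\<^bsub>V\<^esub> s v) (u i) = i r (u i) \<oplus>\<^bsub>V\<^esub> i s (u i)"
            using g r uI[OF i] by (simp add: \<sigma> span_add act_add)
        qed (use uI \<sigma>span r in auto)
        also have "\<dots> = \<Phi> u r \<oplus>\<^bsub>V\<^esub> \<Phi> u s"
          unfolding \<Phi>_def using uI \<sigma>span r by (intro V.finsum_addf) auto
        finally show ?thesis .
      qed
      ultimately show ?thesis
        using R V.a_group by (simp add: group_hom_def group_hom_axioms_def hom_def R_def)
    qed
    have "inj_on (\<lambda>u. \<lambda>t\<in>Y. \<Phi> u t) (I \<rightarrow>\<^sub>E carrier V)"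
    proof (rule inj_onI)
      fix u w assume u: "u \<in> I \<rightarrow>\<^sub>E carrier V" and w: "w \<in> I \<rightarrow>\<^sub>E carrier V"
        and eq: "(\<lambda>t\<in>Y. \<Phi> u t) = (\<lambda>t\<in>Y. \<Phi> w t)"
      have agree: "\<Phi> u t = \<Phi> w t" if t: "t \<in> span" for t
      proof (rule hom_eq_on_generate[OF \<Phi>hom[OF u] \<Phi>hom[OF w]])
        show "Y \<subseteq> carrier R" using Y by (simp add: R_def)
        show "t \<in> generate R Y" using t Y by simp
        show "\<Phi> u y = \<Phi> w y" if "y \<in> Y" for y using fun_cong[OF eq, of y] that by simp
      qed
      show "u = w"
      proof (rule V.dedekind_inj[where I = I and T = span and \<chi> = "\<lambda>i t. i t"
            and mul = "\<lambda>s t. \<lambda>v\<in>carrier V. s (t v)" and e = "\<lambda>v\<in>carrier V. v"])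
        fix i s t v assume i: "i \<in> I" and s: "s \<in> span" and t: "t \<in> span" and v: "v \<in> carrier V"
        then obtain g where g: "g \<in> carrier G" "i = \<sigma> g" by (auto simp: I_def)
        show "i (\<lambda>v\<in>carrier V. s (t v)) v = i s (i t v)"
          using g s t v by (simp add: \<sigma> span_comp)
      next
        fix i v assume i: "i \<in> I" and v: "v \<in> carrier V"
        then obtain g where g: "g \<in> carrier G" "i = \<sigma> g" by (auto simp: I_def)
        show "i (\<lambda>v\<in>carrier V. v) v = v" using g v by (simp add: \<sigma> span_id)
      next
        fix i j assume i: "i \<in> I" and j: "j \<in> I" and ij: "i \<noteq> j"
        have "i \<in> extensional span" "j \<in> extensional span" using i j by (auto simp: I_def \<sigma>_def)
        then obtain t where t: "t \<in> span" "i t \<noteq> j t" using ij extensionalityI by blast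
        then show "\<exists>t\<in>span. \<forall>v\<in>carrier V. i t v = j t v \<longrightarrow> v = \<zero>\<^bsub>V\<^esub>"
          using span_separates[OF \<sigma>span[OF i] \<sigma>span[OF j]] by blast
      qed (use finI \<sigma>span span_comp span_id span_commute u w agree in \<open>auto simp: \<Phi>_def\<close>)
    qed
    moreover have "(\<lambda>u. \<lambda>t\<in>Y. \<Phi> u t) ` (I \<rightarrow>\<^sub>E carrier V) \<subseteq> Y \<rightarrow>\<^sub>E carrier V"
    proof (intro image_subsetI restrict_PiE_iff[THEN iffD2] ballI)
      fix u t assume u: "u \<in> I \<rightarrow>\<^sub>E carrier V" and t: "t \<in> Y"
      interpret h: group_hom R "add_monoid V" "\<Phi> u" by (rule \<Phi>hom[OF u])
      show "\<Phi> u t \<in> carrier V" using h.hom_closed[of t] t Y by (auto simp: R_def)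
    qed
    ultimately have "card (I \<rightarrow>\<^sub>E carrier V) \<le> card (Y \<rightarrow>\<^sub>E carrier V)"
      using finY by (intro card_inj_on_le) (auto simp: finite_PiE)
    then have "card (carrier V) ^ card I \<le> card (carrier V) ^ card Y"
      using finI finY by (simp add: card_PiE)
    moreover have "1 < card (carrier V)"
    proof -
      obtain v where "v \<in> carrier V" "v \<noteq> \<zero>\<^bsub>V\<^esub>" by (rule nonzero_vector)
      then have "card {v, \<zero>\<^bsub>V\<^esub>} \<le> card (carrier V)" by (intro card_mono) auto
      then show ?thesis using \<open>v \<noteq> \<zero>\<^bsub>V\<^esub>\<close> by simp
    qed
    ultimately have "card I \<le> card Y" by (simp add: power_increasing_iff)
    then have "(2::nat) ^ card I \<le> 2 ^ card Y" by (intro power_increasing) auto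
    then show ?thesis using Y by linarith
  qed
  ultimately show ?thesis using that by blast
qed

end

section \<open>Groups of class two\<close>

context group
begin

lemma inv_cancel_left': "x \<in> carrier G \<Longrightarrow> y \<in> carrier G \<Longrightarrow> x \<otimes> (inv x \<otimes> y) = y"
  by (simp add: m_assoc[symmetric])

lemma commutator_mult_left:
  "x \<in> carrier G \<Longrightarrow> y \<in> carrier G \<Longrightarrow> z \<in> carrier G \<Longrightarrow>
    commutator G (x \<otimes> y) z = x \<otimes> commutator G y z \<otimes> inv x \<otimes> commutator G x z"
  by (simp add: commutator_def m_assoc inv_mult_group inv_cancel_left inv_cancel_left')

lemma commutator_mult_right:
  "x \<in> carrier G \<Longrightarrow> y \<in> carrier G \<Longrightarrow> z \<in> carrier G \<Longrightarrow>
    commutator G x (y \<otimes> z) = commutator G x y \<otimes> (y \<otimes> commutator G x z \<otimes> inv y)"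
  by (simp add: commutator_def m_assoc inv_mult_group inv_cancel_left inv_cancel_left')

lemma commutator_inv_right:
  "x \<in> carrier G \<Longrightarrow> y \<in> carrier G \<Longrightarrow>
    commutator G x (inv y) = inv y \<otimes> inv (commutator G x y) \<otimes> y"
  by (simp add: commutator_def m_assoc inv_mult_group inv_cancel_left inv_cancel_left')

lemma inv_commutator:
  "x \<in> carrier G \<Longrightarrow> y \<in> carrier G \<Longrightarrow> inv (commutator G x y) = commutator G y x"
  by (simp add: commutator_def m_assoc inv_mult_group)

lemma commutator_eq_imp_commute:
  assumes "b \<in> carrier G" "x \<in> carrier G" "y \<in> carrier G" "commutator G b x = commutator G b y"
  shows "b \<otimes> (inv x \<otimes> y) = (inv x \<otimes> y) \<otimes> b"
proof -
  have "commutator G b (inv x \<otimes> y) =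
      inv x \<otimes> inv (commutator G b x) \<otimes> x \<otimes> (inv x \<otimes> commutator G b y \<otimes> x)"
    using assms(1-3) by (simp add: commutator_mult_right commutator_inv_right)
  also have "\<dots> = \<one>"
    unfolding assms(4) using assms(1-3) commutator_closed[of b y]
    by (simp del: commutator_closed add: m_assoc inv_cancel_left inv_cancel_left')
  finally show ?thesis using assms(1-3) by (simp add: commutator_eq_one_iff)
qed

text \<open>In \<open>G/A\<close> this is the centraliser of the image of \<open>N\<close>. For
  normal \<open>N\<close> with \<open>N/A\<close> abelian it is the kernel of the conjugation action
  on the section.\<close>

lemma subgroup_centralizer_mod:
  assumes "A \<lhd> G" "N \<subseteq> carrier G"
  shows "subgroup {g \<in> carrier G. \<forall>n\<in>N. commutator G n g \<in> A} G"
proof -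
  interpret A: normal A G by fact
  show ?thesis
  proof (rule subgroupI)
    have "commutator G n \<one> = \<one>" if "n \<in> carrier G" for n
      using that by (simp add: commutator_eq_one_iff)
    then have "\<one> \<in> {g \<in> carrier G. \<forall>n\<in>N. commutator G n g \<in> A}" using assms(2) by auto
    then show "{g \<in> carrier G. \<forall>n\<in>N. commutator G n g \<in> A} \<noteq> {}" by blast
  next
    fix g assume g: "g \<in> {g \<in> carrier G. \<forall>n\<in>N. commutator G n g \<in> A}"
    have "commutator G n (inv g) \<in> A" if n: "n \<in> N" for n
    proof -
      have c: "n \<in> carrier G" "g \<in> carrier G" "commutator G n g \<in> A" using g n assms(2) by auto
      then have "inv g \<otimes> inv (commutator G n g) \<otimes> g \<in> A"
        by (intro A.inv_op_closed1) simp_all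
      then show ?thesis using c by (simp add: commutator_inv_right)
    qed
    then show "inv g \<in> {g \<in> carrier G. \<forall>n\<in>N. commutator G n g \<in> A}" using g by simp
    fix h assume h: "h \<in> {g \<in> carrier G. \<forall>n\<in>N. commutator G n g \<in> A}"
    have "commutator G n (g \<otimes> h) \<in> A" if n: "n \<in> N" for n
    proof -
      have c: "n \<in> carrier G" "g \<in> carrier G" "h \<in> carrier G"
        "commutator G n g \<in> A" "commutator G n h \<in> A" using g h n assms(2) by auto
      have "g \<otimes> commutator G n h \<otimes> inv g \<in> A" using c by (intro A.inv_op_closed2)
      then show ?thesis using c by (simp add: commutator_mult_right)
    qed
    then show "g \<otimes> h \<in> {g \<in> carrier G. \<forall>n\<in>N. commutator G n g \<in> A}" using g h by simp
  qed auto
qed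

lemma subgroup_centralizer:
  assumes "subgroup B G" "Y \<subseteq> carrier G"
  shows "subgroup {b \<in> B. \<forall>y\<in>Y. b \<otimes> y = y \<otimes> b} G"
proof (rule subgroupI)
  have Bc: "\<And>b. b \<in> B \<Longrightarrow> b \<in> carrier G" using assms(1) subgroup.mem_carrier by fastforce
  show "{b \<in> B. \<forall>y\<in>Y. b \<otimes> y = y \<otimes> b} \<subseteq> carrier G" using Bc by blast
  have "\<one> \<in> {b \<in> B. \<forall>y\<in>Y. b \<otimes> y = y \<otimes> b}" using assms by (auto simp: subgroup.one_closed)
  then show "{b \<in> B. \<forall>y\<in>Y. b \<otimes> y = y \<otimes> b} \<noteq> {}" by blast
  fix a assume a: "a \<in> {b \<in> B. \<forall>y\<in>Y. b \<otimes> y = y \<otimes> b}"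
  then have ac: "a \<in> carrier G" "a \<in> B" using Bc by auto
  have "inv a \<otimes> y = y \<otimes> inv a" if y: "y \<in> Y" for y
  proof -
    have yc: "y \<in> carrier G" using y assms(2) by auto
    have ay: "a \<otimes> y = y \<otimes> a" using a y by blast
    have "inv a \<otimes> (y \<otimes> a) \<otimes> inv a = inv a \<otimes> (a \<otimes> y) \<otimes> inv a" by (simp only: ay)
    moreover have "inv a \<otimes> (y \<otimes> a) \<otimes> inv a = inv a \<otimes> y" using ac yc by (simp add: m_assoc)
    moreover have "inv a \<otimes> (a \<otimes> y) \<otimes> inv a = y \<otimes> inv a" using ac yc by (simp add: inv_cancel_left)
    ultimately show ?thesis by simp
  qed
  then show "inv a \<in> {b \<in> B. \<forall>y\<in>Y. b \<otimes> y = y \<otimes> b}"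
    using ac subgroup.m_inv_closed[OF assms(1)] by blast
  fix b assume b: "b \<in> {b \<in> B. \<forall>y\<in>Y. b \<otimes> y = y \<otimes> b}"
  then have bc: "b \<in> carrier G" "b \<in> B" using Bc by auto
  have "a \<otimes> b \<otimes> y = y \<otimes> (a \<otimes> b)" if y: "y \<in> Y" for y
  proof -
    have yc: "y \<in> carrier G" using y assms(2) by auto
    have ay: "a \<otimes> y = y \<otimes> a" and b_y: "b \<otimes> y = y \<otimes> b" using a b y by blast+
    have "a \<otimes> b \<otimes> y = a \<otimes> (y \<otimes> b)" using ac bc yc b_y m_assoc by metis
    also have "\<dots> = y \<otimes> a \<otimes> b" using ac bc yc ay m_assoc by metis
    finally show ?thesis using ac bc yc by (simp add: m_assoc)
  qed
  then show "a \<otimes> b \<in> {b \<in> B. \<forall>y\<in>Y. b \<otimes> y = y \<otimes> b}"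
    using ac bc subgroup.m_closed[OF assms(1)] by blast
qed

end

section \<open>Commutators as characters with values in \<open>A\<close>\<close>

context lin_field
begin

lemma V_gt_1: "1 < card (carrier V)"
proof -
  obtain v where "v \<in> carrier V" "v \<noteq> \<zero>\<^bsub>V\<^esub>" by (rule nonzero_vector)
  then have "card {v, \<zero>\<^bsub>V\<^esub>} \<le> card (carrier V)" by (intro card_mono) auto
  then show ?thesis using \<open>v \<noteq> \<zero>\<^bsub>V\<^esub>\<close> by simp
qed

text \<open>The commutator of \<open>t\<close> and \<open>i\<close> lies in \<open>A\<close> and so
  commutes with \<open>s\<close>. Thus \<open>b \<mapsto> [b, i]\<close> is multiplicative; the
  reversed order of the factors is harmless because \<open>A\<close> is abelian.\<close>

lemma commutator_mult_left_C:
  assumes "s \<in> C" "t \<in> carrier G" "i \<in> carrier G" "commutator G t i \<in> A"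
  shows "commutator G (s \<otimes> t) i = commutator G t i \<otimes> commutator G s i"
proof -
  have c: "s \<in> carrier G" using assms by simp
  have "s \<otimes> commutator G t i = commutator G t i \<otimes> s" using C_commute assms by blast
  then have "s \<otimes> commutator G t i \<otimes> inv s = commutator G t i"
    using assms c by (simp add: m_assoc)
  then show ?thesis using assms c by (simp add: commutator_mult_left)
qed

text \<open>For each \<open>i\<close> the map \<open>b \<mapsto> [b, i]\<close> is a character of
  \<open>B\<close> with values in \<open>A\<close>, hence in the field acting on \<open>V\<close>.
  Distinct values agree on no non-zero vector by semiregularity of \<open>A\<close>, which is the
  separation demanded by \<open>dedekind_inj\<close>.\<close>

lemma commutator_characters:
  assumes B: "subgroup B G" "B \<subseteq> C" and I: "finite I" "I \<subseteq> carrier G"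
    and comm: "\<And>b i. b \<in> B \<Longrightarrow> i \<in> I \<Longrightarrow> commutator G b i \<in> A"
    and sep: "\<And>i j. i \<in> I \<Longrightarrow> j \<in> I \<Longrightarrow> i \<noteq> j \<Longrightarrow> \<exists>b\<in>B. commutator G b i \<noteq> commutator G b j"
    and uw: "u \<in> I \<rightarrow>\<^sub>E carrier V" "w \<in> I \<rightarrow>\<^sub>E carrier V"
    and eq: "\<And>b. b \<in> B \<Longrightarrow> (\<Oplus>\<^bsub>V\<^esub>i\<in>I. act (commutator G b i) (u i)) = (\<Oplus>\<^bsub>V\<^esub>i\<in>I. act (commutator G b i) (w i))"
  shows "u = w"
proof (rule V.dedekind_inj[where I = I and T = B and \<chi> = "\<lambda>i b. act (commutator G b i)" and mul = "(\<otimes>)" and e = \<one>])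
  have Bc: "\<And>b. b \<in> B \<Longrightarrow> b \<in> carrier G" using B(1) subgroup.mem_carrier by fastforce
  fix i assume i: "i \<in> I"
  have ic: "i \<in> carrier G" using i I by auto
  show "V.endo (act (commutator G b i))" if "b \<in> B" for b using that Bc ic by simp
  show "act (commutator G \<one> i) v = v" if "v \<in> carrier V" for v
    using that ic by (simp add: commutator_def)
  show "act (commutator G (s \<otimes> t) i) v = act (commutator G s i) (act (commutator G t i) v)"
    if s: "s \<in> B" and t: "t \<in> B" and v: "v \<in> carrier V" for s t v
  proof -
    have "commutator G (s \<otimes> t) i = commutator G t i \<otimes> commutator G s i"
      using s t B Bc ic comm[OF t i] by (intro commutator_mult_left_C) auto
    also have "\<dots> = commutator G s i \<otimes> commutator G t i"
      by (rule A_comm[OF comm[OF t i] comm[OF s i]])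
    finally show ?thesis using s t v Bc ic by simp
  qed
  fix j assume j: "j \<in> I"
  have jc: "j \<in> carrier G" using j I by auto
  show "act (commutator G s i) (act (commutator G t j) v) = act (commutator G t j) (act (commutator G s i) v)"
    if s: "s \<in> B" and t: "t \<in> B" and v: "v \<in> carrier V" for s t v
  proof -
    have "act (commutator G s i \<otimes> commutator G t j) v = act (commutator G t j \<otimes> commutator G s i) v"
      by (rule arg_cong[OF A_comm[OF comm[OF s i] comm[OF t j]]])
    then show ?thesis using s t v Bc ic jc by simp
  qed
  show "\<exists>b\<in>B. \<forall>v\<in>carrier V. act (commutator G b i) v = act (commutator G b j) v \<longrightarrow> v = \<zero>\<^bsub>V\<^esub>" if ij: "i \<noteq> j"
  proof -
    obtain b where b: "b \<in> B" "commutator G b i \<noteq> commutator G b j" using sep[OF i j ij] by blast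
    have c: "commutator G b i \<in> carrier G" "commutator G b j \<in> carrier G" using b Bc ic jc by auto
    have "v = \<zero>\<^bsub>V\<^esub>" if v: "v \<in> carrier V" and eqv: "act (commutator G b i) v = act (commutator G b j) v" for v
    proof (rule ccontr)
      assume v0: "v \<noteq> \<zero>\<^bsub>V\<^esub>"
      have "inv (commutator G b i) \<otimes> commutator G b j = \<one>"
      proof (rule A_semiregular[OF _ v v0])
        have "act (inv (commutator G b i)) (act (commutator G b j) v) = v"
          unfolding eqv[symmetric] using c v by simp
        then show "act (inv (commutator G b i) \<otimes> commutator G b j) v = v" using c v by simp
      qed (use comm[OF b(1) i] comm[OF b(1) j] in simp)
      then have "commutator G b i = commutator G b j" by (rule inv_mult_one_imp_eq[OF c])
      then show False using b by simp
    qed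
    then show ?thesis using b by blast
  qed
qed (use assms in \<open>auto simp: subgroup.m_closed subgroup.one_closed\<close>)

text \<open>Distinct characters of \<open>B\<close> that are trivial on \<open>Z\<close> number at
  most \<open>|B : Z|\<close>. The sums over such characters are constant on cosets of
  \<open>Z\<close>, so they are known on a transversal, and
  \<open>|V|^|I| \<le> |V|^|T|\<close>.\<close>

lemma commutator_character_count:
  assumes B: "subgroup B G" "B \<subseteq> C" and I: "I \<subseteq> carrier G"
    and comm: "\<And>b i. b \<in> B \<Longrightarrow> i \<in> I \<Longrightarrow> commutator G b i \<in> A"
    and sep: "\<And>i j. i \<in> I \<Longrightarrow> j \<in> I \<Longrightarrow> i \<noteq> j \<Longrightarrow> \<exists>b\<in>B. commutator G b i \<noteq> commutator G b j"
    and Z: "subgroup Z G" "Z \<subseteq> B" "\<And>z i. z \<in> Z \<Longrightarrow> i \<in> I \<Longrightarrow> commutator G z i = \<one>"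
  shows "card I * card Z \<le> card B"
proof -
  have Bc: "\<And>b. b \<in> B \<Longrightarrow> b \<in> carrier G" using B(1) subgroup.mem_carrier by fastforce
  have finB: "finite B" and finI: "finite I"
    using subgroup.subset[OF B(1)] I finite_carrier finite_subset by blast+
  obtain T where T: "T \<subseteq> B" "\<And>b. b \<in> B \<Longrightarrow> \<exists>t\<in>T. \<exists>z\<in>Z. b = t \<otimes> z" "card T * card Z = card B"
    using transversal[OF Z(1) B(1) Z(2) finB] by metis
  have finT: "finite T" using T finB finite_subset by blast
  define \<Phi> where "\<Phi> u b = (\<Oplus>\<^bsub>V\<^esub>i\<in>I. act (commutator G b i) (u i))" for u b
  have "inj_on (\<lambda>u. \<lambda>t\<in>T. \<Phi> u t) (I \<rightarrow>\<^sub>E carrier V)"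
  proof (rule inj_onI)
    fix u w assume u: "u \<in> I \<rightarrow>\<^sub>E carrier V" and w: "w \<in> I \<rightarrow>\<^sub>E carrier V"
      and eq: "(\<lambda>t\<in>T. \<Phi> u t) = (\<lambda>t\<in>T. \<Phi> w t)"
    have red: "\<Phi> u (t \<otimes> z) = \<Phi> u t" if u: "u \<in> I \<rightarrow>\<^sub>E carrier V" and t: "t \<in> T" and z: "z \<in> Z" for u t z
      unfolding \<Phi>_def
    proof (rule V.finsum_cong'[OF refl])
      have c: "t \<in> C" "t \<in> carrier G" "z \<in> carrier G" using t z T B Z Bc by auto
      show "(\<lambda>i. act (commutator G t i) (u i)) \<in> I \<rightarrow> carrier V"
        using PiE_mem[OF u] I c by (auto intro!: act_closed)
      fix i assume i: "i \<in> I"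
      have "commutator G (t \<otimes> z) i = commutator G z i \<otimes> commutator G t i"
        using c i I z Z comm by (intro commutator_mult_left_C) auto
      also have "\<dots> = commutator G t i" using Z(3)[OF z i] c i I by auto
      finally show "act (commutator G (t \<otimes> z) i) (u i) = act (commutator G t i) (u i)" by simp
    qed
    show "u = w"
    proof (rule commutator_characters[OF B finI I comm sep u w])
      fix b assume "b \<in> B"
      then obtain t z where tz: "t \<in> T" "z \<in> Z" "b = t \<otimes> z" using T(2) by blast
      have "\<Phi> u b = \<Phi> w b" using red[OF u tz(1,2)] red[OF w tz(1,2)] fun_cong[OF eq, of t] tz by simp
      then show "(\<Oplus>\<^bsub>V\<^esub>i\<in>I. act (commutator G b i) (u i)) = (\<Oplus>\<^bsub>V\<^esub>i\<in>I. act (commutator G b i) (w i))"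
        by (simp add: \<Phi>_def)
    qed auto
  qed
  moreover have "(\<lambda>u. \<lambda>t\<in>T. \<Phi> u t) ` (I \<rightarrow>\<^sub>E carrier V) \<subseteq> T \<rightarrow>\<^sub>E carrier V"
  proof (intro image_subsetI restrict_PiE_iff[THEN iffD2] ballI)
    fix u t assume u: "u \<in> I \<rightarrow>\<^sub>E carrier V" and t: "t \<in> T"
    have "act (commutator G t i) (u i) \<in> carrier V" if "i \<in> I" for i
      using PiE_mem[OF u that] t T(1) Bc I that by (intro act_closed commutator_closed) auto
    then show "\<Phi> u t \<in> carrier V" unfolding \<Phi>_def by (intro V.finsum_closed) auto
  qed
  ultimately have "card (I \<rightarrow>\<^sub>E carrier V) \<le> card (T \<rightarrow>\<^sub>E carrier V)"
    using finT by (intro card_inj_on_le) (auto simp: finite_PiE)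
  then have "card (carrier V) ^ card I \<le> card (carrier V) ^ card T"
    using finI finT by (simp add: card_PiE)
  then have "card I \<le> card T" using V_gt_1 by (simp add: power_increasing_iff)
  then show ?thesis using T(3) by (metis mult_le_mono1)
qed

text \<open>\<open>B/A\<close> is abelian and the centre of \<open>B\<close> is exactly
  \<open>A\<close>: the last condition gives one inclusion and \<open>B \<subseteq> C\<close> the
  other. The commutator thus induces a non-degenerate pairing on \<open>B/A\<close> with values in
  \<open>A\<close>.\<close>

definition class2 :: "'a set \<Rightarrow> bool" where
  "class2 B \<longleftrightarrow> B \<lhd> G \<and> A \<subseteq> B \<and> B \<subseteq> C \<and> (\<forall>x\<in>B. \<forall>y\<in>B. commutator G x y \<in> A) \<and>
     (\<forall>x\<in>B. (\<forall>y\<in>B. x \<otimes> y = y \<otimes> x) \<longrightarrow> x \<in> A)"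

lemma class2D:
  assumes "class2 B"
  shows "subgroup B G" "A \<subseteq> B" "B \<subseteq> C" "\<And>x. x \<in> B \<Longrightarrow> x \<in> carrier G"
    "\<And>x y. x \<in> B \<Longrightarrow> y \<in> B \<Longrightarrow> commutator G x y \<in> A"
    "\<And>x. x \<in> B \<Longrightarrow> (\<And>y. y \<in> B \<Longrightarrow> x \<otimes> y = y \<otimes> x) \<Longrightarrow> x \<in> A" "finite B"
proof -
  show "subgroup B G" using assms normal_imp_subgroup[of B G] by (simp add: class2_def)
  then show "\<And>x. x \<in> B \<Longrightarrow> x \<in> carrier G" using subgroup.mem_carrier by fastforce
  show "finite B" using \<open>subgroup B G\<close> finite_carrier finite_subset subgroup.subset by blast
  show "A \<subseteq> B" "B \<subseteq> C" using assms by (simp_all add: class2_def)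
  show "\<And>x y. x \<in> B \<Longrightarrow> y \<in> B \<Longrightarrow> commutator G x y \<in> A" using assms by (simp add: class2_def)
  show "\<And>x. x \<in> B \<Longrightarrow> (\<And>y. y \<in> B \<Longrightarrow> x \<otimes> y = y \<otimes> x) \<Longrightarrow> x \<in> A"
    using assms unfolding class2_def by blast
qed

text \<open>Non-degeneracy of the commutator pairing: equal characters would make
  \<open>inv i \<otimes> j\<close> central in \<open>B\<close>.\<close>

lemma class2_separates:
  assumes B: "class2 B" and i: "i \<in> B" and j: "j \<in> B" and ij: "inv i \<otimes> j \<notin> A"
  shows "\<exists>b\<in>B. commutator G b i \<noteq> commutator G b j"
proof (rule ccontr)
  note D = class2D[OF B]
  assume "\<not> ?thesis"
  then have eq: "commutator G b i = commutator G b j" if "b \<in> B" for b using that by blast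
  have "inv i \<otimes> j \<in> A"
  proof (rule D(6))
    show "inv i \<otimes> j \<in> B" using i j D(1) by (simp add: subgroup.m_closed subgroup.m_inv_closed)
    fix b assume b: "b \<in> B"
    show "inv i \<otimes> j \<otimes> b = b \<otimes> (inv i \<otimes> j)"
      using commutator_eq_imp_commute[OF D(4)[OF b] D(4)[OF i] D(4)[OF j] eq[OF b]] by (rule sym)
  qed
  then show False using ij by simp
qed

text \<open>A transversal \<open>T\<close> of \<open>A\<close> in \<open>B\<close> is linearly
  independent over the field inside the \<open>m^2\<close>-dimensional algebra of linear maps of
  \<open>V\<close>. Combinations \<open>\<Sum> k(x) x\<close> are field-linear, hence known from
  their values on the \<open>m\<close> vectors of \<open>Y\<close>, so
  \<open>|span|^|T| \<le> |V|^m = |span|^(m^2)\<close>.\<close>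

lemma class2_card_le:
  assumes B: "class2 B" and Y: "Y \<subseteq> carrier V" and cardV: "card (carrier V) = card span ^ card Y"
    and det: "determining Y"
  shows "card B \<le> (card Y)\<^sup>2 * card A"
proof -
  note D = class2D[OF B]
  obtain T where T: "T \<subseteq> B" "\<And>t t'. t \<in> T \<Longrightarrow> t' \<in> T \<Longrightarrow> inv t \<otimes> t' \<in> A \<Longrightarrow> t = t'" "card T * card A = card B"
    using transversal[OF A.is_subgroup D(1,2,7)] by metis
  have finT: "finite T" using T D(7) finite_subset by blast
  have finY: "finite Y" using Y finite_subset finite_set by blast
  have Tc: "\<And>t. t \<in> T \<Longrightarrow> t \<in> carrier G" "\<And>t. t \<in> T \<Longrightarrow> t \<in> C" using T D by auto
  define f where "f k v = (\<Oplus>\<^bsub>V\<^esub>x\<in>T. k x (act x v))" for k v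
  have kc: "k x (act y v) \<in> carrier V" if "k \<in> T \<rightarrow>\<^sub>E span" "x \<in> T" "y \<in> carrier G" "v \<in> carrier V" for k x y v
  proof -
    have "k x \<in> span" using that by auto
    then show ?thesis using that by simp
  qed
  have f_hom: "span_hom (f k)" if k: "k \<in> T \<rightarrow>\<^sub>E span" for k
  proof -
    have ks: "k x \<in> span" if "x \<in> T" for x using k that by auto
    have "f k v \<in> carrier V" if "v \<in> carrier V" for v
      unfolding f_def using kc[OF k] Tc that by (intro V.finsum_closed) auto
    moreover have "f k (u \<oplus>\<^bsub>V\<^esub> v) = f k u \<oplus>\<^bsub>V\<^esub> f k v" if "u \<in> carrier V" "v \<in> carrier V" for u v
    proof -
      have "f k (u \<oplus>\<^bsub>V\<^esub> v) = (\<Oplus>\<^bsub>V\<^esub>x\<in>T. k x (act x u) \<oplus>\<^bsub>V\<^esub> k x (act x v))"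
        unfolding f_def using that kc[OF k] Tc ks
        by (intro V.finsum_cong') (auto simp: act_add V.endo_add)
      also have "\<dots> = f k u \<oplus>\<^bsub>V\<^esub> f k v"
        unfolding f_def using that kc[OF k] Tc by (intro V.finsum_addf) auto
      finally show ?thesis .
    qed
    moreover have "f k (r v) = r (f k v)" if r: "r \<in> span" and v: "v \<in> carrier V" for r v
    proof -
      have "r (f k v) = (\<Oplus>\<^bsub>V\<^esub>x\<in>T. r (k x (act x v)))"
        unfolding f_def using r v kc[OF k] Tc by (intro V.endo_finsum) auto
      also have "\<dots> = f k (r v)"
        unfolding f_def
      proof (rule V.finsum_cong'[OF refl])
        fix x assume x: "x \<in> T"
        show "r (k x (act x v)) = k x (act x (r v))"
          using span_commute[OF r ks[OF x], of "act x v"] span_commute_C[OF Tc(2)[OF x] r v] Tc(1)[OF x] v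
          by simp
      qed (use kc[OF k] Tc r v in auto)
      finally show ?thesis by simp
    qed
    ultimately show ?thesis by (simp add: span_hom_def V.endo_def)
  qed
  have "inj_on (\<lambda>k. \<lambda>y\<in>Y. f k y) (T \<rightarrow>\<^sub>E span)"
  proof (rule inj_onI)
    fix k l assume k: "k \<in> T \<rightarrow>\<^sub>E span" and l: "l \<in> T \<rightarrow>\<^sub>E span" and eq: "(\<lambda>y\<in>Y. f k y) = (\<lambda>y\<in>Y. f l y)"
    have kl: "k x \<in> span" "l x \<in> span" if "x \<in> T" for x using k l that by auto
    have agree: "f k v = f l v" if "v \<in> carrier V" for v
    proof (rule determiningD[OF det f_hom[OF k] f_hom[OF l] _ that])
      fix y assume "y \<in> Y" then show "f k y = f l y" using fun_cong[OF eq, of y] by simp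
    qed
    \<comment> \<open>Conjugating the combination by \<open>b\<close> multiplies its term at
      \<open>x\<close> by the commutator of \<open>b\<close> and \<open>x\<close>. Independence of
      the coefficients is thereby reduced to that of the commutator characters.\<close>
    have tr: "act b (f k (act (inv b) v)) = (\<Oplus>\<^bsub>V\<^esub>x\<in>T. act (commutator G b x) ((\<lambda>x\<in>T. k x (act x v)) x))"
      if k: "k \<in> T \<rightarrow>\<^sub>E span" and b: "b \<in> B" and v: "v \<in> carrier V" for k b v
    proof -
      have ks: "k x \<in> span" if "x \<in> T" for x using k that by auto
      have bc: "b \<in> carrier G" "b \<in> C" using b D by auto
      have "act b (f k (act (inv b) v)) = (\<Oplus>\<^bsub>V\<^esub>x\<in>T. act b (k x (act x (act (inv b) v))))"
        unfolding f_def using kc[OF k] Tc bc v by (intro V.endo_finsum) auto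
      also have "\<dots> = (\<Oplus>\<^bsub>V\<^esub>x\<in>T. act (commutator G b x) ((\<lambda>x\<in>T. k x (act x v)) x))"
      proof (rule V.finsum_cong'[OF refl])
        fix x assume x: "x \<in> T"
        note xc = Tc(1)[OF x]
        have cA: "commutator G b x \<in> A" using D(5) b x T by blast
        have "b \<otimes> x \<otimes> inv b = commutator G b x \<otimes> x"
          using bc xc by (simp add: commutator_def m_assoc)
        then have e: "act b (act x (act (inv b) v)) = act (commutator G b x) (act x v)"
          using bc xc v by (metis act_closed act_mult commutator_closed inv_closed m_closed)
        have "act b (k x (act x (act (inv b) v))) = k x (act b (act x (act (inv b) v)))"
          using bc xc v ks[OF x] by (intro span_commute_C) auto
        also have "\<dots> = act (commutator G b x) (k x (act x v))"
          unfolding e using cA A_le_C xc v ks[OF x] by (intro span_commute_C[symmetric]) auto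
        finally show "act b (k x (act x (act (inv b) v))) = act (commutator G b x) ((\<lambda>x\<in>T. k x (act x v)) x)"
          using x by simp
      qed (use kc[OF k] Tc bc v in auto)
      finally show ?thesis .
    qed
    have eqf: "(\<lambda>x\<in>T. k x (act x v)) = (\<lambda>x\<in>T. l x (act x v))" if v: "v \<in> carrier V" for v
    proof (rule commutator_characters[OF D(1,3) finT])
      show "T \<subseteq> carrier G" using Tc by auto
      show "commutator G b i \<in> A" if "b \<in> B" "i \<in> T" for b i using that T D(5) by blast
      show "\<exists>b\<in>B. commutator G b i \<noteq> commutator G b j" if "i \<in> T" "j \<in> T" "i \<noteq> j" for i j
        using that T by (intro class2_separates[OF B]) auto
      show "(\<lambda>x\<in>T. k x (act x v)) \<in> T \<rightarrow>\<^sub>E carrier V" "(\<lambda>x\<in>T. l x (act x v)) \<in> T \<rightarrow>\<^sub>E carrier V"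
        using kc[OF k] kc[OF l] Tc v by auto
      fix b assume b: "b \<in> B"
      have "f k (act (inv b) v) = f l (act (inv b) v)" using D(4)[OF b] v by (intro agree) auto
      then show "(\<Oplus>\<^bsub>V\<^esub>x\<in>T. act (commutator G b x) ((\<lambda>x\<in>T. k x (act x v)) x))
          = (\<Oplus>\<^bsub>V\<^esub>x\<in>T. act (commutator G b x) ((\<lambda>x\<in>T. l x (act x v)) x))"
        using tr[OF k b v] tr[OF l b v] by simp
    qed
    have eq': "k x (act x v) = l x (act x v)" if "x \<in> T" "v \<in> carrier V" for x v
      using fun_cong[OF eqf[OF that(2)], of x] that(1) by simp
    show "k = l"
    proof (rule PiE_ext[OF k l])
      fix x assume x: "x \<in> T"
      show "k x = l x"
      proof (rule span_eqI[OF kl[OF x]])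
        fix v assume v: "v \<in> carrier V"
        then show "k x v = l x v" using eq'[OF x, of "act (inv x) v"] Tc(1)[OF x] by simp
      qed
    qed
  qed
  moreover have "(\<lambda>k. \<lambda>y\<in>Y. f k y) ` (T \<rightarrow>\<^sub>E span) \<subseteq> Y \<rightarrow>\<^sub>E carrier V"
    using f_hom Y by (auto simp: span_hom_def)
  ultimately have "card (T \<rightarrow>\<^sub>E span) \<le> card (Y \<rightarrow>\<^sub>E carrier V)"
    using finY by (intro card_inj_on_le) (auto simp: finite_PiE)
  then have "card span ^ card T \<le> card span ^ (card Y * card Y)"
    using finT finY by (simp add: card_PiE cardV power_mult)
  moreover have "1 < card span"
  proof -
    have "A \<noteq> {}" using A.one_closed by blast
    then have "card A \<noteq> 0" using finite_subset[OF A.subset finite_carrier] by simp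
    then show ?thesis using card_A_less_span by linarith
  qed
  ultimately have "card T \<le> card Y * card Y" by (simp add: power_increasing_iff)
  then show ?thesis using T(3) by (metis mult_le_mono1 power2_eq_square)
qed

text \<open>Modulo \<open>A\<close>, the elements of \<open>C\<close> acting trivially on
  \<open>B/A\<close> give distinct commutator characters of \<open>B\<close> that are trivial on
  \<open>A\<close>, so there are at most \<open>|B/A|\<close> of them. This is the quantitative form
  of the faithful action of \<open>C/B\<close>.\<close>

lemma class2_centralizer_card:
  assumes B: "class2 B" and self: "\<And>g. g \<in> C \<Longrightarrow> (\<And>b. b \<in> B \<Longrightarrow> g \<otimes> b = b \<otimes> g) \<Longrightarrow> g \<in> A"
  shows "card {g \<in> C. \<forall>b\<in>B. commutator G b g \<in> A} \<le> card B"
proof -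
  note D = class2D[OF B]
  define E where "E = {g \<in> C. \<forall>b\<in>B. commutator G b g \<in> A}"
  have CS: "subgroup C G"
    using subgroup_centralizer[OF subgroup_self A.subset] by (simp only: C_def)
  have "E = C \<inter> {g \<in> carrier G. \<forall>b\<in>B. commutator G b g \<in> A}" by (auto simp: E_def)
  moreover have "B \<subseteq> carrier G" using D(4) by blast
  ultimately have Esub: "subgroup E G"
    using subgroups_Inter_pair[OF CS subgroup_centralizer_mod[OF A_normal]] by simp
  have finE: "finite E" using subgroup.subset[OF Esub] finite_carrier finite_subset by blast
  have AE: "A \<subseteq> E" using D A_le_C by (auto simp: E_def)
  obtain T where T: "T \<subseteq> E" "\<And>t t'. t \<in> T \<Longrightarrow> t' \<in> T \<Longrightarrow> inv t \<otimes> t' \<in> A \<Longrightarrow> t = t'" "card T * card A = card E"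
    using transversal[OF A.is_subgroup Esub AE finE] by metis
  have Tc: "t \<in> carrier G" "t \<in> C" if "t \<in> T" for t using that T by (auto simp: E_def)
  have "card T * card A \<le> card B"
  proof (rule commutator_character_count[OF D(1,3)])
    show "T \<subseteq> carrier G" using Tc by blast
    show "commutator G b i \<in> A" if "b \<in> B" "i \<in> T" for b i using that T by (auto simp: E_def)
    show "commutator G z i = \<one>" if "z \<in> A" "i \<in> T" for z i
      using C_commute[OF Tc(2)[OF that(2)] that(1)] Tc that by (simp add: commutator_eq_one_iff)
    fix i j assume i: "i \<in> T" and j: "j \<in> T" and ij: "i \<noteq> j"
    show "\<exists>b\<in>B. commutator G b i \<noteq> commutator G b j"
    proof (rule ccontr)
      assume "\<not> ?thesis"
      then have eq: "commutator G b i = commutator G b j" if "b \<in> B" for b using that by blast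
      have "inv i \<otimes> j \<in> A"
      proof (rule self)
        show "inv i \<otimes> j \<in> C" using Tc i j CS by (simp add: subgroup.m_closed subgroup.m_inv_closed)
        fix b assume b: "b \<in> B"
        show "inv i \<otimes> j \<otimes> b = b \<otimes> (inv i \<otimes> j)"
          using commutator_eq_imp_commute[OF D(4)[OF b] Tc(1)[OF i] Tc(1)[OF j] eq[OF b]] by (rule sym)
      qed
      then show False using T(2) i j ij by blast
    qed
  qed (use A.is_subgroup D(2) in auto)
  then show ?thesis using T(3) by (simp add: E_def)
qed

text \<open>\<open>Y = B \<inter> fixer {v}\<close> meets \<open>A\<close> trivially by
  semiregularity, so it is abelian: its commutators lie in \<open>A\<close> and in \<open>Y\<close>.
  In the commutator pairing it is totally isotropic. Its centraliser \<open>Z\<close> in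
  \<open>B\<close> contains \<open>A Y\<close>, while the characters given by \<open>Y\<close> are
  distinct and trivial on \<open>Z\<close>, so \<open>|Y| |Z| \<le> |B|\<close>.\<close>

lemma class2_stabilizer_card:
  assumes B: "class2 B" and v: "v \<in> carrier V" "v \<noteq> \<zero>\<^bsub>V\<^esub>"
  shows "(card (B \<inter> fixer {v}))\<^sup>2 * card A \<le> card B"
proof -
  note D = class2D[OF B]
  define Y where "Y = B \<inter> fixer {v}"
  have Ysub: "subgroup Y G" unfolding Y_def
    using subgroups_Inter_pair[OF D(1) subgroup_fixer[of "{v}"]] v by simp
  have Yc: "y \<in> carrier G" if "y \<in> Y" for y using that D(4) by (simp add: Y_def)
  have YA: "y = \<one>" if "y \<in> Y" "y \<in> A" for y
    using that v by (intro A_semiregular[of y v]) (auto simp: Y_def fixer_def)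
  have Ycomm: "y \<otimes> y' = y' \<otimes> y" if "y \<in> Y" "y' \<in> Y" for y y'
  proof -
    have "commutator G y y' \<in> Y" unfolding commutator_def
      using that Ysub by (simp add: subgroup.m_closed subgroup.m_inv_closed)
    moreover have "commutator G y y' \<in> A" using that D(5) by (simp add: Y_def)
    ultimately have "commutator G y y' = \<one>" by (rule YA)
    then show ?thesis using that Yc by (simp add: commutator_eq_one_iff)
  qed
  define Z where "Z = {b \<in> B. \<forall>y\<in>Y. b \<otimes> y = y \<otimes> b}"
  have Zsub: "subgroup Z G" unfolding Z_def using Yc by (intro subgroup_centralizer[OF D(1)]) blast
  have ZB: "Z \<subseteq> B" by (auto simp: Z_def)
  have YZ: "Y \<subseteq> Z" unfolding Z_def using Ycomm by (auto simp: Y_def)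
  have YC: "y \<in> C" if "y \<in> Y" for y using that D(3) by (auto simp: Y_def)
  have AZ: "A \<subseteq> Z"
  proof
    fix a assume a: "a \<in> A"
    have "a \<otimes> y = y \<otimes> a" if "y \<in> Y" for y using C_commute[OF YC[OF that] a] by (rule sym)
    then show "a \<in> Z" using a D(2) unfolding Z_def by blast
  qed
  have "card Y * card Z \<le> card B"
  proof (rule commutator_character_count[OF D(1,3)])
    show "Y \<subseteq> carrier G" using Yc by blast
    show "commutator G b i \<in> A" if "b \<in> B" "i \<in> Y" for b i using that D(5) by (simp add: Y_def)
    show "commutator G z i = \<one>" if "z \<in> Z" "i \<in> Y" for z i
      using that ZB D(4) Yc by (subst commutator_eq_one_iff) (auto simp: Z_def)
    fix i j assume i: "i \<in> Y" and j: "j \<in> Y" and ij: "i \<noteq> j"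
    show "\<exists>b\<in>B. commutator G b i \<noteq> commutator G b j"
    proof (rule class2_separates[OF B])
      show "inv i \<otimes> j \<notin> A"
      proof
        assume "inv i \<otimes> j \<in> A"
        then have "inv i \<otimes> j = \<one>" using i j Ysub
          by (intro YA) (auto simp: subgroup.m_closed subgroup.m_inv_closed)
        then show False using inv_mult_one_imp_eq[OF Yc[OF i] Yc[OF j]] ij by simp
      qed
    qed (use i j in \<open>auto simp: Y_def\<close>)
  qed (use Zsub ZB in auto)
  moreover have "card A * card Y \<le> card Z"
  proof -
    have "inj_on (\<lambda>(a, y). a \<otimes> y) (A \<times> Y)"
    proof (rule inj_onI, clarify)
      fix a y a' y' assume a: "a \<in> A" "a' \<in> A" and y: "y \<in> Y" "y' \<in> Y" and eq: "a \<otimes> y = a' \<otimes> y'"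
      note c = A_carrier[OF a(1)] A_carrier[OF a(2)] Yc[OF y(1)] Yc[OF y(2)]
      have "y \<otimes> inv y' = inv a \<otimes> (a \<otimes> y) \<otimes> inv y'" using c by (simp add: inv_cancel_left)
      also have "\<dots> = inv a \<otimes> a'" unfolding eq using c by (simp add: m_assoc)
      finally have e: "y \<otimes> inv y' = inv a \<otimes> a'" .
      have "inv a \<otimes> a' \<in> Y" unfolding e[symmetric] using y Ysub by (simp add: subgroup.m_closed subgroup.m_inv_closed)
      moreover have "inv a \<otimes> a' \<in> A" using a by simp
      ultimately have "inv a \<otimes> a' = \<one>" by (rule YA)
      then have "a = a'" using inv_mult_one_imp_eq c by blast
      then show "a = a' \<and> y = y'" using eq c by simp
    qed
    moreover have "(\<lambda>(a, y). a \<otimes> y) ` (A \<times> Y) \<subseteq> Z"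
      using AZ YZ Zsub by (auto intro!: subgroup.m_closed)
    moreover have "finite Z" using ZB D(7) finite_subset by blast
    ultimately have "card (A \<times> Y) \<le> card Z" by (metis card_inj_on_le)
    then show ?thesis by (simp add: card_cartesian_product)
  qed
  ultimately have "card Y * (card A * card Y) \<le> card B" by (meson mult_le_mono2 order_trans)
  then show ?thesis by (simp add: Y_def power2_eq_square mult_ac)
qed

end

section \<open>The order of an irreducible soluble linear group\<close>

text \<open>The product formula for \<open>H K\<close>, which need not be a subgroup;
  \<open>L\<close> is any finite set that contains it.\<close>

lemma (in group) card_product_le:
  assumes "subgroup H G" "subgroup K G" "finite L" "\<And>h k. h \<in> H \<Longrightarrow> k \<in> K \<Longrightarrow> h \<otimes> k \<in> L" "finite H"
  shows "card H * card K \<le> card L * card (H \<inter> K)"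
proof -
  have Hc: "h \<in> carrier G" if "h \<in> H" for h using assms(1) that by (rule subgroup.mem_carrier)
  have Kc: "h \<in> carrier G" if "h \<in> K" for h using assms(2) that by (rule subgroup.mem_carrier)
  obtain T where T: "T \<subseteq> H" "\<And>t t'. t \<in> T \<Longrightarrow> t' \<in> T \<Longrightarrow> inv t \<otimes> t' \<in> H \<inter> K \<Longrightarrow> t = t'"
      "card T * card (H \<inter> K) = card H"
    using transversal[OF subgroups_Inter_pair[OF assms(1,2)] assms(1) Int_lower1 assms(5)] by metis
  have "inj_on (\<lambda>(t, k). t \<otimes> k) (T \<times> K)"
  proof (rule inj_onI, clarify)
    fix t k t' k' assume t: "t \<in> T" "t' \<in> T" and k: "k \<in> K" "k' \<in> K" and eq: "t \<otimes> k = t' \<otimes> k'"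
    have tH: "t \<in> H" "t' \<in> H" using t T(1) by auto
    note c = Hc[OF tH(1)] Hc[OF tH(2)] Kc[OF k(1)] Kc[OF k(2)]
    have "inv t \<otimes> t' = inv t \<otimes> (t' \<otimes> k') \<otimes> inv k'" using c by (simp add: m_assoc)
    also have "\<dots> = k \<otimes> inv k'" unfolding eq[symmetric] using c by (simp add: inv_cancel_left)
    finally have e: "inv t \<otimes> t' = k \<otimes> inv k'" .
    have "inv t \<otimes> t' \<in> H" using tH assms(1) by (simp add: subgroup.m_closed subgroup.m_inv_closed)
    moreover have "inv t \<otimes> t' \<in> K"
      unfolding e using k assms(2) by (simp add: subgroup.m_closed subgroup.m_inv_closed)
    ultimately have "t = t'" using T(2) t by blast
    then show "t = t' \<and> k = k'" using eq c by simp
  qed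
  moreover have "(\<lambda>(t, k). t \<otimes> k) ` (T \<times> K) \<subseteq> L" using T(1) assms(4) by auto
  ultimately have "card (T \<times> K) \<le> card L" using assms(3) by (metis card_inj_on_le)
  then have "card T * card K \<le> card L" by (simp add: card_cartesian_product)
  then have "card T * card K * card (H \<inter> K) \<le> card L * card (H \<inter> K)" by (rule mult_le_mono1)
  then show ?thesis using T(3) by (simp add: mult_ac)
qed

definition (in lin_act) irreducible :: bool where
  "irreducible \<longleftrightarrow> carrier V \<noteq> {\<zero>\<^bsub>V\<^esub>} \<and>
    (\<forall>W. W \<subseteq> carrier V \<and> \<zero>\<^bsub>V\<^esub> \<in> W \<and> (\<forall>u\<in>W. \<forall>v\<in>W. u \<ominus>\<^bsub>V\<^esub> v \<in> W) \<and>
      (\<forall>g\<in>carrier G. \<forall>w\<in>W. act g w \<in> W) \<longrightarrow> W = {\<zero>\<^bsub>V\<^esub>} \<or> W = carrier V)"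

lemma (in lin_act) irreducibleD:
  assumes irreducible "W \<subseteq> carrier V" "\<zero>\<^bsub>V\<^esub> \<in> W" "\<And>u v. u \<in> W \<Longrightarrow> v \<in> W \<Longrightarrow> u \<ominus>\<^bsub>V\<^esub> v \<in> W"
    "\<And>g w. g \<in> carrier G \<Longrightarrow> w \<in> W \<Longrightarrow> act g w \<in> W"
  shows "W = {\<zero>\<^bsub>V\<^esub>} \<or> W = carrier V"
  using assms(1) unfolding irreducible_def
  by (elim conjE allE[of _ W] impE) (use assms(2-) in simp_all)

text \<open>Sections of a group have a type different from that of the group; restricting the induction
  hypothesis to groups and modules over \<open>nat\<close> keeps the induction within fixed types.\<close>

definition irr_bound :: "nat \<Rightarrow> bool" where
  "irr_bound n \<longleftrightarrow> (\<forall>(V :: nat ring) (G :: (nat \<Rightarrow> nat) monoid) act.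
     lin_act G V act \<longrightarrow> lin_act.irreducible G V act \<longrightarrow> solvable G \<longrightarrow>
     (\<forall>g\<in>carrier G. (\<forall>v\<in>carrier V. act g v = v) \<longrightarrow> g = \<one>\<^bsub>G\<^esub>) \<longrightarrow> card (carrier V) = n \<longrightarrow>
     64 * card (carrier G) ^ 3 \<le> card (carrier V) ^ 8)"

text \<open>The vectors are renumbered by naturals and \<open>G\<close> is replaced by its image as
  a permutation group on them. Passing to the image loses the kernel, which returns cubed as a
  factor on the right.\<close>

lemma (in lin_act) irr_bound_transfer:
  assumes n: "irr_bound (card (carrier V))" and irr: irreducible and sol: "solvable G"
  shows "64 * card (carrier G) ^ 3 \<le> card (carrier V) ^ 8 * card (fixer (carrier V)) ^ 3"
proof -
  let ?n = "card (carrier V)"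
  obtain e where e: "bij_betw e (carrier V) {..<?n}"
    using ex_bij_betw_finite_nat[OF finite_set] by (auto simp: atLeast0LessThan)
  define d where "d = inv_into (carrier V) e"
  have d: "bij_betw d {..<?n} (carrier V)" unfolding d_def by (rule bij_betw_inv_into[OF e])
  have ec: "e v < ?n" if "v \<in> carrier V" for v using e that by (auto dest: bij_betwE)
  have dc: "d i \<in> carrier V" if "i < ?n" for i using d that by (auto dest: bij_betwE)
  have de: "d (e v) = v" if "v \<in> carrier V" for v
    using that e by (simp add: d_def bij_betw_inv_into_left)
  have ed: "e (d i) = i" if "i < ?n" for i
    using that e by (simp add: d_def bij_betw_inv_into_right)
  define V' :: "nat ring" where "V' = \<lparr>carrier = {..<?n}, monoid.mult = undefined, monoid.one = undefined,
    ring.zero = e \<zero>\<^bsub>V\<^esub>, ring.add = (\<lambda>i j. e (d i \<oplus>\<^bsub>V\<^esub> d j))\<rparr>"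
  have V's: "carrier V' = {..<?n}" "\<zero>\<^bsub>V'\<^esub> = e \<zero>\<^bsub>V\<^esub>" "\<And>i j. i \<oplus>\<^bsub>V'\<^esub> j = e (d i \<oplus>\<^bsub>V\<^esub> d j)"
    by (simp_all add: V'_def)
  have V': "abelian_group V'"
  proof (rule abelian_groupI)
    fix i assume i: "i \<in> carrier V'"
    then have "e (\<ominus>\<^bsub>V\<^esub> d i) \<in> carrier V' \<and> e (\<ominus>\<^bsub>V\<^esub> d i) \<oplus>\<^bsub>V'\<^esub> i = \<zero>\<^bsub>V'\<^esub>"
      by (simp add: V's dc ec de V.l_neg)
    then show "\<exists>j\<in>carrier V'. j \<oplus>\<^bsub>V'\<^esub> i = \<zero>\<^bsub>V'\<^esub>" by blast
  qed (simp_all add: V's dc ec de ed V.a_ac)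
  interpret V': abelian_group V' by (rule V')
  define \<phi> where "\<phi> g = (\<lambda>i\<in>{..<?n}. e (act g (d i)))" for g
  have \<phi>: "\<phi> g i = e (act g (d i))" if "i < ?n" for g i using that by (simp add: \<phi>_def)
  have \<phi>Bij: "\<phi> g \<in> Bij {..<?n}" if g: "g \<in> carrier G" for g
  proof -
    have "bij_betw (\<phi> g) {..<?n} {..<?n}"
      by (rule bij_betwI[where g = "\<phi> (inv g)"]) (use g in \<open>auto simp: \<phi> ec dc de ed\<close>)
    then show ?thesis by (simp add: Bij_def \<phi>_def)
  qed
  have \<phi>mult: "\<phi> (g \<otimes> h) = compose {..<?n} (\<phi> g) (\<phi> h)" if "g \<in> carrier G" "h \<in> carrier G" for g h
    using that by (auto simp: \<phi>_def compose_def fun_eq_iff ec dc de)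
  have "\<phi> \<in> hom G (BijGroup {..<?n})"
    unfolding hom_def BijGroup_def by (auto simp: \<phi>Bij \<phi>mult)
  then interpret \<phi>: group_hom G "BijGroup {..<?n}" \<phi>
    by (simp add: group_hom_def group_hom_axioms_def is_group group_BijGroup)
  define T where "T = (BijGroup {..<?n})\<lparr>carrier := \<phi> ` carrier G\<rparr>"
  have Tsub: "subgroup (\<phi> ` carrier G) (BijGroup {..<?n})" by (rule \<phi>.img_is_subgroup)
  have Tgr: "group T" unfolding T_def using Tsub by (rule subgroup.subgroup_is_group) (rule group_BijGroup)
  have Tsol: "solvable T"
  proof -
    interpret \<psi>: group_hom G T \<phi>
      using is_group Tgr by (auto simp: group_hom_def group_hom_axioms_def hom_def T_def \<phi>.hom_mult)
    show ?thesis by (rule \<psi>.surj_hom_imp_solvable[OF _ sol]) (simp add: T_def)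
  qed
  have Tone: "\<one>\<^bsub>T\<^esub> = (\<lambda>i\<in>{..<?n}. i)" by (simp add: T_def BijGroup_def)
  interpret T: lin_act T V' "\<lambda>f. f"
  proof (intro lin_act.intro set_act.intro set_act_axioms.intro lin_act_axioms.intro Tgr V')
    fix f i assume "f \<in> carrier T" "i \<in> carrier V'"
    then show "f i \<in> carrier V'" by (auto simp: T_def V's \<phi> ec dc)
  next
    fix f h i assume "f \<in> carrier T" "h \<in> carrier T" "i \<in> carrier V'"
    then show "(f \<otimes>\<^bsub>T\<^esub> h) i = f (h i)"
      using \<phi>Bij by (auto simp: T_def V's BijGroup_def compose_def)
  next
    fix f i j assume "f \<in> carrier T" "i \<in> carrier V'" "j \<in> carrier V'"
    then show "f (i \<oplus>\<^bsub>V'\<^esub> j) = f i \<oplus>\<^bsub>V'\<^esub> f j"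
      by (auto simp: T_def V's \<phi> ec dc de act_add)
  qed (auto simp: T_def V's BijGroup_def)
  have minus: "e u \<ominus>\<^bsub>V'\<^esub> e v = e (u \<ominus>\<^bsub>V\<^esub> v)" if uv: "u \<in> carrier V" "v \<in> carrier V" for u v
  proof -
    have "\<ominus>\<^bsub>V'\<^esub> e v = e (\<ominus>\<^bsub>V\<^esub> v)"
      by (rule V'.minus_equality) (use uv in \<open>simp_all add: V's ec de V.l_neg\<close>)
    then show ?thesis using uv by (simp add: a_minus_def V's de)
  qed
  have "T.irreducible" unfolding T.irreducible_def
  proof (intro conjI allI impI)
    have "e v \<noteq> e \<zero>\<^bsub>V\<^esub>" if "v \<in> carrier V" "v \<noteq> \<zero>\<^bsub>V\<^esub>" for v using that de by (metis V.zero_closed)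
    moreover obtain v where "v \<in> carrier V" "v \<noteq> \<zero>\<^bsub>V\<^esub>"
      using irr V.zero_closed unfolding irreducible_def by blast
    ultimately show "carrier V' \<noteq> {\<zero>\<^bsub>V'\<^esub>}" using ec by (auto simp: V's)
    fix W assume W: "W \<subseteq> carrier V' \<and> \<zero>\<^bsub>V'\<^esub> \<in> W \<and> (\<forall>u\<in>W. \<forall>v\<in>W. u \<ominus>\<^bsub>V'\<^esub> v \<in> W) \<and>
      (\<forall>g\<in>carrier T. \<forall>w\<in>W. g w \<in> W)"
    define U where "U = {u \<in> carrier V. e u \<in> W}"
    have "U = {\<zero>\<^bsub>V\<^esub>} \<or> U = carrier V"
    proof -
      have "U \<subseteq> carrier V" by (auto simp: U_def)
      moreover have "\<zero>\<^bsub>V\<^esub> \<in> U" using W by (simp add: U_def V's)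
      moreover have "u \<ominus>\<^bsub>V\<^esub> v \<in> U" if "u \<in> U" "v \<in> U" for u v
      proof -
        have "e u \<ominus>\<^bsub>V'\<^esub> e v \<in> W" using that W unfolding U_def by blast
        then show ?thesis using that minus[of u v] by (simp add: U_def)
      qed
      moreover have "act g u \<in> U" if "g \<in> carrier G" "u \<in> U" for g u
      proof -
        have "\<phi> g (e u) \<in> W" using W that by (auto simp: T_def U_def)
        then show ?thesis using that by (simp add: U_def \<phi> ec de)
      qed
      ultimately show ?thesis by (rule irreducibleD[OF irr])
    qed
    moreover have "W = e ` U"
    proof (intro equalityI subsetI)
      fix i assume i: "i \<in> W"
      then have "i < ?n" using W by (auto simp: V's)
      then show "i \<in> e ` U" using i ed dc by (intro image_eqI[of _ _ "d i"]) (auto simp: U_def)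
    qed (auto simp: U_def)
    ultimately show "W = {\<zero>\<^bsub>V'\<^esub>} \<or> W = carrier V'" using e by (auto simp: V's bij_betw_def)
  qed
  moreover have "\<forall>g\<in>carrier T. (\<forall>v\<in>carrier V'. g v = v) \<longrightarrow> g = \<one>\<^bsub>T\<^esub>"
    by (auto simp: T_def V's \<phi>_def fun_eq_iff BijGroup_def)
  moreover have "card (carrier V') = ?n" by (simp add: V's)
  ultimately have T: "64 * card (carrier T) ^ 3 \<le> card (carrier V') ^ 8"
    using n Tsol T.lin_act_axioms unfolding irr_bound_def by blast
  have "card (carrier G) \<le> card (\<phi> ` carrier G) * card (fixer (carrier V))"
  proof (rule card_le_fibres)
    show "finite (fixer (carrier V))" by (simp add: fixer_def)
    fix g h assume gh: "g \<in> carrier G" "h \<in> carrier G" "\<phi> g = \<phi> h"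
    have "act g v = act h v" if v: "v \<in> carrier V" for v
    proof -
      have "e (act g v) = e (act h v)" using fun_cong[OF gh(3), of "e v"] v by (simp add: \<phi> ec de)
      then have "d (e (act g v)) = d (e (act h v))" by simp
      then show ?thesis using v gh by (simp add: de)
    qed
    then show "inv g \<otimes> h \<in> fixer (carrier V)" using gh by (auto simp: fixer_def) (metis act_inv)
  qed auto
  then have "card (carrier G) ^ 3 \<le> card (carrier T) ^ 3 * card (fixer (carrier V)) ^ 3"
    unfolding power_mult_distrib[symmetric] by (intro power_mono) (simp_all add: T_def)
  then have "64 * card (carrier G) ^ 3 \<le> (64 * card (carrier T) ^ 3) * card (fixer (carrier V)) ^ 3"
    by simp
  also have "\<dots> \<le> card (carrier V) ^ 8 * card (fixer (carrier V)) ^ 3"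
    using T \<open>card (carrier V') = ?n\<close> by simp
  finally show ?thesis .
qed

section \<open>Chief factors as modules\<close>

context group
begin

text \<open>\<open>M/A\<close> is an irreducible \<open>G\<close>-module under conjugation, by
  minimality of \<open>M\<close>, and the kernel of that action consists of the elements
  centralising \<open>M\<close> modulo \<open>A\<close>. The bound for modules of order
  \<open>|M/A|\<close> is multiplied by \<open>card A ^ 8\<close> to avoid quotients.\<close>

lemma chief_factor_bound:
  assumes fin: "finite (carrier G)" and sol: "solvable G" and A: "A \<lhd> G" and M: "M \<lhd> G" and AM: "A \<subset> M"
    and comm: "\<And>x y. x \<in> M \<Longrightarrow> y \<in> M \<Longrightarrow> commutator G x y \<in> A"
    and minimal: "\<And>N. N \<lhd> G \<Longrightarrow> A \<subseteq> N \<Longrightarrow> N \<subseteq> M \<Longrightarrow> N = A \<or> N = M"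
    and bound: "irr_bound (card M div card A)"
  shows "64 * card (carrier G) ^ 3 * card A ^ 8
    \<le> card M ^ 8 * card {g \<in> carrier G. \<forall>m\<in>M. commutator G m g \<in> A} ^ 3"
proof -
  interpret A: normal A G by fact
  interpret M: normal M G by fact
  have Mc: "m \<in> carrier G" if "m \<in> M" for m using that M.subset by auto
  have Ac: "m \<in> carrier G" if "m \<in> A" for m using that A.subset by auto
  have finM: "finite M" "finite A" using M.subset A.subset fin finite_subset by blast+
  define V :: "'a set ring" where "V = \<lparr>carrier = (\<lambda>m. A #> m) ` M, monoid.mult = undefined,
    monoid.one = undefined, ring.zero = A, ring.add = (\<lambda>S Y. S <#> Y)\<rparr>"
  have Vc: "carrier V = (\<lambda>m. A #> m) ` M" and V0: "\<zero>\<^bsub>V\<^esub> = A" by (simp_all add: V_def)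
  have Vadd: "(A #> x) \<oplus>\<^bsub>V\<^esub> (A #> y) = A #> (x \<otimes> y)" if "x \<in> M" "y \<in> M" for x y
    using that Mc by (simp add: V_def A.rcos_sum)
  have coset_eq: "A #> x = A #> y \<longleftrightarrow> x \<otimes> inv y \<in> A" if "x \<in> carrier G" "y \<in> carrier G" for x y
  proof
    assume "A #> x = A #> y"
    then have "x \<in> A #> y" using rcos_self[OF that(1) A.is_subgroup] by simp
    then show "x \<otimes> inv y \<in> A" using that Ac by (auto simp: r_coset_def m_assoc)
  next
    assume "x \<otimes> inv y \<in> A"
    then have "(x \<otimes> inv y) \<otimes> y \<in> A #> y" by (auto simp: r_coset_def)
    then have "x \<in> A #> y" using that by (simp add: m_assoc)
    then show "A #> x = A #> y" using repr_independence[OF _ that(2) A.is_subgroup] by simp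
  qed
  have coset_A: "A #> x = A \<longleftrightarrow> x \<in> A" if "x \<in> carrier G" for x
    using coset_eq[of x \<one>] that A.subset by (simp add: coset_mult_one)
  have zeroM: "A = A #> \<one>" using A.subset by (simp add: coset_mult_one)
  have V: "abelian_group V"
  proof (rule abelian_groupI)
    fix S Y assume "S \<in> carrier V" "Y \<in> carrier V"
    then obtain x y where xy: "x \<in> M" "y \<in> M" "S = A #> x" "Y = A #> y" by (auto simp: Vc)
    show "S \<oplus>\<^bsub>V\<^esub> Y \<in> carrier V" using xy by (auto simp: Vadd Vc)
    have "x \<otimes> y \<otimes> inv (y \<otimes> x) \<in> A"
      using comm[OF xy(1,2)] Mc xy by (simp add: commutator_def inv_mult_group m_assoc)
    then have "A #> (x \<otimes> y) = A #> (y \<otimes> x)" using xy Mc by (subst coset_eq) auto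
    then show "S \<oplus>\<^bsub>V\<^esub> Y = Y \<oplus>\<^bsub>V\<^esub> S" using xy by (simp add: Vadd)
    fix Z assume "Z \<in> carrier V"
    then obtain z where z: "z \<in> M" "Z = A #> z" by (auto simp: Vc)
    show "S \<oplus>\<^bsub>V\<^esub> Y \<oplus>\<^bsub>V\<^esub> Z = S \<oplus>\<^bsub>V\<^esub> (Y \<oplus>\<^bsub>V\<^esub> Z)"
      using xy z Mc by (simp add: Vadd m_assoc)
  next
    show "\<zero>\<^bsub>V\<^esub> \<in> carrier V" using zeroM by (auto simp: V0 Vc)
    fix S assume "S \<in> carrier V"
    then obtain x where x: "x \<in> M" "S = A #> x" by (auto simp: Vc)
    have "\<zero>\<^bsub>V\<^esub> = A #> \<one>" using zeroM by (simp add: V0)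
    then show "\<zero>\<^bsub>V\<^esub> \<oplus>\<^bsub>V\<^esub> S = S" using x Mc by (simp add: Vadd)
    have "(A #> inv x) \<oplus>\<^bsub>V\<^esub> S = \<zero>\<^bsub>V\<^esub>" using x Mc zeroM by (simp add: Vadd V0)
    then show "\<exists>Y\<in>carrier V. Y \<oplus>\<^bsub>V\<^esub> S = \<zero>\<^bsub>V\<^esub>" using x by (auto simp: Vc)
  qed
  interpret V: abelian_group V by (rule V)
  define act where "act g S = (\<lambda>x. g \<otimes> x \<otimes> inv g) ` S" for g S
  have conjM: "g \<otimes> m \<otimes> inv g \<in> M" if "g \<in> carrier G" "m \<in> M" for g m
    using that by (rule M.inv_op_closed2)
  have act: "act g (A #> m) = A #> (g \<otimes> m \<otimes> inv g)" if g: "g \<in> carrier G" and m: "m \<in> carrier G" for g m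
  proof (intro equalityI subsetI)
    fix y assume "y \<in> act g (A #> m)"
    then obtain a where a: "a \<in> A" "y = g \<otimes> (a \<otimes> m) \<otimes> inv g" by (auto simp: act_def r_coset_def)
    have "y = (g \<otimes> a \<otimes> inv g) \<otimes> (g \<otimes> m \<otimes> inv g)"
      using a Ac[OF a(1)] g m by (simp add: m_assoc inv_cancel_left)
    then show "y \<in> A #> (g \<otimes> m \<otimes> inv g)" using A.inv_op_closed2[OF g a(1)] by (auto simp: r_coset_def)
  next
    fix y assume "y \<in> A #> (g \<otimes> m \<otimes> inv g)"
    then obtain a where a: "a \<in> A" "y = a \<otimes> (g \<otimes> m \<otimes> inv g)" by (auto simp: r_coset_def)
    have "y = g \<otimes> ((inv g \<otimes> a \<otimes> g) \<otimes> m) \<otimes> inv g"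
      using a Ac[OF a(1)] g m by (simp add: m_assoc inv_cancel_left')
    then show "y \<in> act g (A #> m)" using A.inv_op_closed1[OF g a(1)] unfolding act_def r_coset_def by blast
  qed
  interpret L: lin_act G V act
  proof (intro lin_act.intro set_act.intro set_act_axioms.intro lin_act_axioms.intro is_group V)
    fix g S assume g: "g \<in> carrier G" and "S \<in> carrier V"
    then obtain x where x: "x \<in> M" "S = A #> x" by (auto simp: Vc)
    show "act g S \<in> carrier V" using g x act Mc conjM by (auto simp: Vc)
    fix h assume h: "h \<in> carrier G"
    show "act (g \<otimes> h) S = act g (act h S)"
      using g h x Mc by (simp add: act m_assoc inv_mult_group)
  next
    fix S assume "S \<in> carrier V"
    then obtain x where x: "x \<in> M" "S = A #> x" by (auto simp: Vc)
    then show "act \<one> S = S" using Mc by (simp add: act)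
  next
    fix g S Y assume g: "g \<in> carrier G" and "S \<in> carrier V" "Y \<in> carrier V"
    then obtain x y where xy: "x \<in> M" "y \<in> M" "S = A #> x" "Y = A #> y" by (auto simp: Vc)
    have "g \<otimes> (x \<otimes> y) \<otimes> inv g = (g \<otimes> x \<otimes> inv g) \<otimes> (g \<otimes> y \<otimes> inv g)"
      using g xy Mc by (simp add: m_assoc inv_cancel_left)
    then show "act g (S \<oplus>\<^bsub>V\<^esub> Y) = act g S \<oplus>\<^bsub>V\<^esub> act g Y"
      using g xy Mc conjM by (simp add: Vadd act)
  qed (use fin finM in \<open>auto simp: Vc\<close>)
  have "card (carrier V) * card A = card M"
  proof -
    have "card (carrier V) = card (rcosets\<^bsub>G\<lparr>carrier := M\<rparr>\<^esub> A)"
      by (rule arg_cong[where f = card]) (auto simp: Vc RCOSETS_def r_coset_def)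
    moreover have "card (rcosets\<^bsub>G\<lparr>carrier := M\<rparr>\<^esub> A) * card A = Coset.order (G\<lparr>carrier := M\<rparr>)"
      using group.lagrange[OF subgroup_imp_group[OF M.is_subgroup] subgroup_incl[OF A.is_subgroup M.is_subgroup]] AM
      by (auto simp: mult.commute)
    ultimately show ?thesis by (simp add: Coset.order_def)
  qed
  moreover have A0: "card A \<noteq> 0"
  proof -
    have "A \<noteq> {}" using A.one_closed by blast
    then show ?thesis using finM by simp
  qed
  ultimately have cardV: "card (carrier V) = card M div card A" "card (carrier V) * card A = card M"
    by (auto simp flip: \<open>card (carrier V) * card A = card M\<close>)
  have "L.irreducible" unfolding L.irreducible_def
  proof (intro conjI allI impI)
    obtain m where m: "m \<in> M" "m \<notin> A" using AM by auto
    then have "A #> m \<in> carrier V" "A #> m \<noteq> A" using coset_A Mc by (auto simp: Vc)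
    then show "carrier V \<noteq> {\<zero>\<^bsub>V\<^esub>}" by (auto simp: V0)
    fix W assume W: "W \<subseteq> carrier V \<and> \<zero>\<^bsub>V\<^esub> \<in> W \<and> (\<forall>u\<in>W. \<forall>v\<in>W. u \<ominus>\<^bsub>V\<^esub> v \<in> W) \<and>
      (\<forall>g\<in>carrier G. \<forall>w\<in>W. act g w \<in> W)"
    \<comment> \<open>The preimage in \<open>M\<close> of a submodule is a normal subgroup of
      \<open>G\<close> between \<open>A\<close> and \<open>M\<close>, to which minimality
      applies.\<close>
    define N where "N = {m \<in> M. A #> m \<in> W}"
    have neg: "\<ominus>\<^bsub>V\<^esub> (A #> x) = A #> inv x" if "x \<in> M" for x
      by (rule V.minus_equality) (use that Mc zeroM in \<open>auto simp: Vadd V0 Vc\<close>)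
    have Wadd: "A #> (x \<otimes> y) \<in> W" if x: "x \<in> N" and y: "y \<in> N" for x y
    proof -
      have xy: "x \<in> M" "y \<in> M" "A #> x \<in> W" "A #> y \<in> W" using x y by (auto simp: N_def)
      have "\<zero>\<^bsub>V\<^esub> \<ominus>\<^bsub>V\<^esub> (A #> y) \<in> W" using W xy by blast
      moreover have yV: "A #> y \<in> carrier V" using xy by (auto simp: Vc)
      ultimately have "\<ominus>\<^bsub>V\<^esub> (A #> y) \<in> W" by (simp add: a_minus_def)
      then have "(A #> x) \<ominus>\<^bsub>V\<^esub> (\<ominus>\<^bsub>V\<^esub> (A #> y)) \<in> W" using W xy by blast
      then show ?thesis using yV xy by (simp add: a_minus_def V.minus_minus Vadd)
    qed
    have "N \<lhd> G"
    proof (rule normal_invI)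
      show "subgroup N G"
      proof (rule subgroupI)
        show "N \<subseteq> carrier G" using Mc by (auto simp: N_def)
        have "\<one> \<in> N" using W zeroM by (auto simp: N_def V0)
        then show "N \<noteq> {}" by blast
        fix x assume x: "x \<in> N"
        then have xx: "x \<in> M" "A #> x \<in> W" by (auto simp: N_def)
        have "\<zero>\<^bsub>V\<^esub> \<ominus>\<^bsub>V\<^esub> (A #> x) \<in> W" using W xx by blast
        moreover have "A #> inv x \<in> carrier V" using xx by (auto simp: Vc)
        ultimately show "inv x \<in> N" using xx neg by (simp add: a_minus_def N_def)
        fix y assume "y \<in> N"
        then show "x \<otimes> y \<in> N" using x Wadd by (simp add: N_def)
      qed
      fix g x assume g: "g \<in> carrier G" and x: "x \<in> N"
      then have "act g (A #> x) \<in> W" using W by (auto simp: N_def)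
      then show "g \<otimes> x \<otimes> inv g \<in> N" using g x Mc conjM by (simp add: N_def act)
    qed
    moreover have "A \<subseteq> N"
    proof
      fix a assume a: "a \<in> A"
      then have "A #> a = A" using coset_A Ac by blast
      then show "a \<in> N" using a AM W by (auto simp: N_def V0)
    qed
    moreover have "N \<subseteq> M" by (auto simp: N_def)
    ultimately have "N = A \<or> N = M" by (rule minimal)
    then show "W = {\<zero>\<^bsub>V\<^esub>} \<or> W = carrier V"
    proof
      assume NA: "N = A"
      have "S = A" if S: "S \<in> W" for S
      proof -
        obtain x where x: "x \<in> M" "S = A #> x" using S W by (auto simp: Vc)
        then have "x \<in> N" using S by (simp add: N_def)
        then show ?thesis using NA x coset_A Ac by simp
      qed
      then show ?thesis using W by (auto simp: V0)
    next
      assume "N = M"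
      then have "carrier V \<subseteq> W" by (auto simp: Vc N_def)
      then show ?thesis using W by blast
    qed
  qed
  then have *: "64 * card (carrier G) ^ 3 \<le> card (carrier V) ^ 8 * card (L.fixer (carrier V)) ^ 3"
    using L.irr_bound_transfer sol bound cardV(1) by simp
  have fx: "L.fixer (carrier V) = {g \<in> carrier G. \<forall>m\<in>M. commutator G m g \<in> A}"
  proof -
    have "act g (A #> m) = A #> m \<longleftrightarrow> commutator G m g \<in> A" if g: "g \<in> carrier G" and m: "m \<in> M" for g m
    proof -
      have "act g (A #> m) = A #> m \<longleftrightarrow> commutator G g m \<in> A"
        using g m Mc by (simp add: act coset_eq commutator_def)
      also have "\<dots> \<longleftrightarrow> inv (commutator G m g) \<in> A" using g m Mc by (simp add: inv_commutator)
      also have "\<dots> \<longleftrightarrow> commutator G m g \<in> A" 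
        using g m Mc A.m_inv_closed by (metis commutator_closed inv_inv)
      finally show ?thesis .
    qed
    then show ?thesis unfolding L.fixer_def Vc by auto
  qed
  have "64 * card (carrier G) ^ 3 * card A ^ 8
      \<le> (card (carrier V) ^ 8 * card (L.fixer (carrier V)) ^ 3) * card A ^ 8"
    using * by (rule mult_le_mono1)
  also have "\<dots> = (card (carrier V) * card A) ^ 8 * card (L.fixer (carrier V)) ^ 3"
    by (simp add: power_mult_distrib)
  finally show ?thesis unfolding cardV(2) fx .
qed

end

text \<open>Makes \<open>B/A\<close>, of order at most \<open>m^2\<close>, smaller than
  \<open>V\<close>, of order \<open>|span|^m\<close>, so that the induction on \<open>|V|\<close>
  may be invoked. Base 2 would fail for \<open>m\<close> = 2, 3, 4, whence the later proof that the
  field has at least 3 elements.\<close>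

lemma square_less_pow3: "(m::nat)\<^sup>2 < 3 ^ m"
proof (induct m)
  case (Suc m)
  have "2 * m + 1 \<le> 3 ^ m" by (induct m) auto
  moreover have "m < 3 ^ m" by (induct m) auto
  ultimately show ?case using Suc by (simp add: power2_eq_square)
qed simp

lemma (in group) centralizer_mod_set_mult:
  assumes "A \<lhd> G" "B \<subseteq> carrier G" "M \<subseteq> carrier G"
    "g \<in> {g \<in> carrier G. \<forall>n\<in>B. commutator G n g \<in> A} \<inter> {g \<in> carrier G. \<forall>n\<in>M. commutator G n g \<in> A}"
  shows "g \<in> {g \<in> carrier G. \<forall>n\<in>B <#> M. commutator G n g \<in> A}"
proof -
  interpret A: normal A G by fact
  have "commutator G n g \<in> A" if n: "n \<in> B <#> M" for n
  proof -
    obtain b m where bm: "b \<in> B" "m \<in> M" "n = b \<otimes> m" using n by (auto simp: set_mult_def)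
    then have c: "b \<in> carrier G" "m \<in> carrier G" "g \<in> carrier G"
      "commutator G b g \<in> A" "commutator G m g \<in> A" using assms by auto
    have "b \<otimes> commutator G m g \<otimes> inv b \<in> A" using c by (intro A.inv_op_closed2)
    then show ?thesis using c bm by (simp add: commutator_mult_left)
  qed
  then show ?thesis using assms(4) by simp
qed

text \<open>The setting of the primitive case inside the induction on \<open>|V|\<close>:
  \<open>A\<close> is maximal among the abelian normal subgroups, and the order bound is known for
  all smaller modules.\<close>

locale lin_max = lin_field G V act A
  for G (structure) and V :: "('v, 'w) ring_scheme" and act and A +
  assumes A_max: "\<And>N. N \<lhd> G \<Longrightarrow> A \<subseteq> N \<Longrightarrow> (\<And>x y. x \<in> N \<Longrightarrow> y \<in> N \<Longrightarrow> x \<otimes> y = y \<otimes> x) \<Longrightarrow> N = A"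
    and sol: "solvable G"
    and IH: "\<And>n. n < card (carrier V) \<Longrightarrow> irr_bound n"
begin

lemma normal_subset_carrier: "N \<lhd> G \<Longrightarrow> x \<in> N \<Longrightarrow> x \<in> carrier G"
  using normal_imp_subgroup subgroup.mem_carrier by fastforce

lemma normal_centralizer:
  assumes "B \<lhd> G" "N \<lhd> G" shows "{x \<in> B. \<forall>y\<in>N. x \<otimes> y = y \<otimes> x} \<lhd> G"
proof (rule normal_invI)
  have c: "\<And>x. x \<in> B \<Longrightarrow> x \<in> carrier G" "\<And>x. x \<in> N \<Longrightarrow> x \<in> carrier G"
    using assms normal_subset_carrier by blast+
  show "subgroup {x \<in> B. \<forall>y\<in>N. x \<otimes> y = y \<otimes> x} G"
    using assms c by (intro subgroup_centralizer) (auto simp: normal_imp_subgroup)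
  fix g x assume g: "g \<in> carrier G" and x: "x \<in> {x \<in> B. \<forall>y\<in>N. x \<otimes> y = y \<otimes> x}"
  have xc: "x \<in> carrier G" using x c by blast
  have "g \<otimes> x \<otimes> inv g \<otimes> y = y \<otimes> (g \<otimes> x \<otimes> inv g)" if y: "y \<in> N" for y
  proof -
    have z: "inv g \<otimes> y \<otimes> g \<in> N" by (rule normal.inv_op_closed1[OF assms(2) g y])
    have e: "x \<otimes> (inv g \<otimes> y \<otimes> g) = (inv g \<otimes> y \<otimes> g) \<otimes> x" using x z by blast
    have "g \<otimes> x \<otimes> inv g \<otimes> y = g \<otimes> (x \<otimes> (inv g \<otimes> y \<otimes> g)) \<otimes> inv g"
      using g xc c(2)[OF y] by (simp add: m_assoc inv_cancel_left inv_cancel_left')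
    also have "\<dots> = g \<otimes> ((inv g \<otimes> y \<otimes> g) \<otimes> x) \<otimes> inv g" by (simp only: e)
    also have "\<dots> = y \<otimes> (g \<otimes> x \<otimes> inv g)"
      using g xc c(2)[OF y] by (simp add: m_assoc inv_cancel_left inv_cancel_left')
    finally show ?thesis .
  qed
  moreover have "g \<otimes> x \<otimes> inv g \<in> B" using x by (intro normal.inv_op_closed2[OF assms(1) g]) blast
  ultimately show "g \<otimes> x \<otimes> inv g \<in> {x \<in> B. \<forall>y\<in>N. x \<otimes> y = y \<otimes> x}" by blast
qed

lemma C_normal: "C \<lhd> G"
  using normal_centralizer[OF normal_self A_normal] by (simp only: C_def)

text \<open>The centre of \<open>B\<close> is an abelian normal subgroup of \<open>G\<close>
  containing \<open>A\<close>, so maximality of \<open>A\<close> leaves no other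
  possibility.\<close>

lemma class2I:
  assumes B: "B \<lhd> G" "A \<subseteq> B" "B \<subseteq> C" and comm: "\<And>x y. x \<in> B \<Longrightarrow> y \<in> B \<Longrightarrow> commutator G x y \<in> A"
  shows "class2 B"
proof -
  have "{x \<in> B. \<forall>y\<in>B. x \<otimes> y = y \<otimes> x} = A"
  proof (rule A_max)
    show "{x \<in> B. \<forall>y\<in>B. x \<otimes> y = y \<otimes> x} \<lhd> G" using B(1) by (intro normal_centralizer)
    show "A \<subseteq> {x \<in> B. \<forall>y\<in>B. x \<otimes> y = y \<otimes> x}"
    proof
      fix a assume a: "a \<in> A"
      have "a \<otimes> y = y \<otimes> a" if "y \<in> B" for y
        using C_commute[OF subsetD[OF B(3) that] a] by (rule sym)
      then show "a \<in> {x \<in> B. \<forall>y\<in>B. x \<otimes> y = y \<otimes> x}" using a B by blast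
    qed
  qed blast
  then show ?thesis unfolding class2_def using B comm by blast
qed

text \<open>If \<open>A\<close> were trivial, \<open>B\<close> would be abelian, hence equal to its
  centre \<open>A\<close>. So \<open>A\<close> has at least two elements, and the field has more
  elements than \<open>A\<close>.\<close>

lemma class2_nontrivial_span:
  assumes "class2 B" "B \<noteq> A" shows "3 \<le> card span"
proof -
  note D = class2D[OF assms(1)]
  have "A \<noteq> {\<one>}"
  proof
    assume A1: "A = {\<one>}"
    have "B \<subseteq> A"
    proof
      fix x assume x: "x \<in> B"
      have "x \<otimes> y = y \<otimes> x" if y: "y \<in> B" for y
      proof -
        have "commutator G x y = \<one>" using D(5)[OF x y] A1 by simp
        then show ?thesis using D(4) x y by (simp add: commutator_eq_one_iff)
      qed
      then show "x \<in> A" by (rule D(6)[OF x])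
    qed
    then show False using D(2) assms(2) by blast
  qed
  then obtain a where a: "a \<in> A" "a \<noteq> \<one>" using A.one_closed by blast
  have "card {a, \<one>} \<le> card A" using a finite_subset[OF A.subset finite_carrier] by (intro card_mono) auto
  then show ?thesis using card_A_less_span a by simp
qed

text \<open>Solvability provides an abelian normal section above \<open>A\<close> inside
  \<open>Y\<close>; a normal subgroup of least order in it gives a chief factor \<open>M/A\<close>,
  whose order is small enough for the inductive bound.\<close>

lemma minimal_section:
  assumes Y: "Y \<lhd> G" "A \<subset> Y" "Y \<subseteq> C"
  obtains M where "class2 M" "A \<subset> M" "M \<subseteq> Y" "\<forall>N. N \<lhd> G \<longrightarrow> A \<subseteq> N \<longrightarrow> N \<subseteq> M \<longrightarrow> N = A \<or> N = M"
    "64 * card (carrier G) ^ 3 * card A ^ 8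
      \<le> card M ^ 8 * card {g \<in> carrier G. \<forall>m\<in>M. commutator G m g \<in> A} ^ 3"
proof -
  obtain M0 where M0: "M0 \<lhd> G" "A \<subset> M0" "M0 \<subseteq> Y" "\<And>x y. x \<in> M0 \<Longrightarrow> y \<in> M0 \<Longrightarrow> commutator G x y \<in> A"
    using solvable_normal_step[OF sol A_normal Y(1,2)] by metis
  define good where "good N \<longleftrightarrow> N \<lhd> G \<and> A \<subset> N \<and> N \<subseteq> M0" for N
  have "good M0" using M0 by (simp add: good_def)
  then obtain M where M: "good M" and mn: "\<And>N. good N \<Longrightarrow> card M \<le> card N"
    using ex_has_least_nat[of good M0 card] by blast
  have Mn: "M \<lhd> G" "A \<subset> M" "M \<subseteq> M0" using M by (simp_all add: good_def)
  have finM: "finite M" using normal_imp_subgroup[OF Mn(1)] subgroup.subset finite_carrier finite_subset by blast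
  have c2: "class2 M" 
  proof (rule class2I[OF Mn(1)])
    show "A \<subseteq> M" "M \<subseteq> C" using Mn M0 Y by auto
    show "commutator G x y \<in> A" if "x \<in> M" "y \<in> M" for x y using that Mn(3) by (intro M0(4)) auto
  qed
  have minimal: "N = A \<or> N = M" if N: "N \<lhd> G" "A \<subseteq> N" "N \<subseteq> M" for N
  proof (rule ccontr)
    assume "\<not> ?thesis"
    then have ne: "N \<noteq> A" "N \<noteq> M" by simp_all
    then have "N \<subset> M" using N(3) by blast
    moreover have "good N" unfolding good_def using N ne Mn(3) by blast
    ultimately show False using mn[of N] psubset_card_mono[OF finM, of N] by simp
  qed
  obtain Y' where Y': "Y' \<subseteq> carrier V" "card (carrier V) = card span ^ card Y'"
    "determining Y'"
    by (rule span_basis)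
  have "card M div card A < card (carrier V)"
  proof -
    have "card M \<le> (card Y')\<^sup>2 * card A" by (rule class2_card_le[OF c2 Y'])
    then have "card M div card A \<le> (card Y')\<^sup>2 * card A div card A" by (rule div_le_mono)
    also have "\<dots> \<le> (card Y')\<^sup>2" by simp
    also have "\<dots> < 3 ^ card Y'" by (rule square_less_pow3)
    also have "\<dots> \<le> card span ^ card Y'" using class2_nontrivial_span[OF c2] Mn by (intro power_mono) auto
    finally show ?thesis using Y'(2) by simp
  qed
  then have "irr_bound (card M div card A)" by (rule IH)
  then have "64 * card (carrier G) ^ 3 * card A ^ 8
      \<le> card M ^ 8 * card {g \<in> carrier G. \<forall>m\<in>M. commutator G m g \<in> A} ^ 3"
    using minimal class2D(5)[OF c2] by (intro chief_factor_bound[OF finite_carrier sol A_normal Mn(1,2)]) auto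
  moreover have "M \<subseteq> Y" using Mn M0 by blast
  ultimately show ?thesis using that[OF c2 Mn(2)] minimal by blast
qed

text \<open>\<open>B\<close> is a largest class-two subgroup for which the product form of the
  inductive bound holds. If something in \<open>C\<close> outside \<open>A\<close> centralised
  \<open>B\<close>, a chief factor \<open>M/A\<close> inside that centraliser could be multiplied
  on: \<open>B M\<close> is again of class two, and the bounds for \<open>B\<close> and
  \<open>M\<close> multiply to the bound for \<open>B M\<close>.\<close>

lemma socle:
  obtains B where "class2 B" "\<forall>g\<in>C. (\<forall>b\<in>B. g \<otimes> b = b \<otimes> g) \<longrightarrow> g \<in> A"
    "B = A \<or> 64 * card (carrier G) ^ 3 * card A ^ 8
      \<le> card B ^ 8 * card {g \<in> carrier G. \<forall>m\<in>B. commutator G m g \<in> A} ^ 3"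
proof -
  define Cm where "Cm N = {g \<in> carrier G. \<forall>m\<in>N. commutator G m g \<in> A}" for N
  define good where "good B \<longleftrightarrow> class2 B \<and> (B = A \<or> 64 * card (carrier G) ^ 3 * card A ^ 8
      \<le> card B ^ 8 * card (Cm B) ^ 3)" for B
  have "class2 A"
  proof (rule class2I[OF A_normal subset_refl A_le_C])
    fix x y assume xy: "x \<in> A" "y \<in> A"
    then have "commutator G x y = \<one>" using A_comm[OF xy] by (simp add: commutator_eq_one_iff)
    then show "commutator G x y \<in> A" by simp
  qed
  then have "good A" by (simp add: good_def)
  moreover have "card B < Suc (card (carrier G))" if "good B" for B
    using that class2D(4)[of B] by (auto simp: good_def less_Suc_eq_le intro!: card_mono)
  ultimately obtain B where B: "good B" and mx: "\<And>N. good N \<Longrightarrow> card N \<le> card B"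
    using ex_has_greatest_nat[of good A card] by blast
  have B2: "class2 B" using B by (simp add: good_def)
  note D = class2D[OF B2]
  have Bn: "B \<lhd> G" using B2 by (simp add: class2_def)
  have "g \<in> A" if g: "g \<in> C" "\<And>b. b \<in> B \<Longrightarrow> g \<otimes> b = b \<otimes> g" for g
  proof (rule ccontr)
    assume gA: "g \<notin> A"
    define Y where "Y = {x \<in> C. \<forall>y\<in>B. x \<otimes> y = y \<otimes> x}"
    have Yn: "Y \<lhd> G" unfolding Y_def by (rule normal_centralizer[OF C_normal Bn])
    have "A \<subseteq> Y"
    proof
      fix a assume a: "a \<in> A"
      have "a \<otimes> y = y \<otimes> a" if "y \<in> B" for y
        using C_commute[OF subsetD[OF D(3) that] a] by (rule sym)
      then show "a \<in> Y" using a A_le_C unfolding Y_def by blast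
    qed
    moreover have "g \<in> Y" using g unfolding Y_def by blast
    ultimately have AY: "A \<subset> Y" using gA by blast
    have YC: "Y \<subseteq> C" unfolding Y_def by blast
    obtain M where M: "class2 M" "A \<subset> M" "M \<subseteq> Y"
      and minimal: "\<forall>N. N \<lhd> G \<longrightarrow> A \<subseteq> N \<longrightarrow> N \<subseteq> M \<longrightarrow> N = A \<or> N = M"
      and Mb: "64 * card (carrier G) ^ 3 * card A ^ 8 \<le> card M ^ 8 * card (Cm M) ^ 3"
      unfolding Cm_def by (rule minimal_section[OF Yn AY YC])
    note DM = class2D[OF M(1)]
    have Mn: "M \<lhd> G" using M by (simp add: class2_def)
    have MB: "m \<otimes> b = b \<otimes> m" if "m \<in> M" "b \<in> B" for m b using that M(3) unfolding Y_def by blast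
    \<comment> \<open>By minimality the intersection is \<open>A\<close> or \<open>M\<close>. The
      latter would make \<open>M\<close>, which centralises \<open>B\<close>, part of the centre of
      \<open>B\<close>.\<close>
    have inter: "B \<inter> M = A"
    proof -
      have "B \<inter> M \<lhd> G" by (rule normal_subgroup_intersect[OF Bn Mn])
      then have "B \<inter> M = A \<or> B \<inter> M = M" using minimal D(2) M(2) by blast
      moreover have "B \<inter> M \<noteq> M"
      proof
        assume eq: "B \<inter> M = M"
        have "M \<subseteq> A"
        proof
          fix x assume x: "x \<in> M"
          then have "x \<in> B" using eq by blast
          then show "x \<in> A" using MB[OF x] by (rule D(6))
        qed
        then show False using M(2) by blast
      qed
      ultimately show ?thesis by blast
    qed
    define N where "N = B <#> M"
    have Nn: "N \<lhd> G" unfolding N_def by (rule normal_set_mult_normal[OF Bn Mn])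
    have BN: "B \<subseteq> N"
    proof
      fix b assume b: "b \<in> B"
      then have "b \<otimes> \<one> \<in> N" using DM(1) unfolding N_def set_mult_def by (blast dest: subgroup.one_closed)
      then show "b \<in> N" using D(4)[OF b] by simp
    qed
    have MN: "M \<subseteq> N"
    proof
      fix m assume m: "m \<in> M"
      then have "\<one> \<otimes> m \<in> N" using D(1) unfolding N_def set_mult_def by (blast dest: subgroup.one_closed)
      then show "m \<in> N" using DM(4)[OF m] by simp
    qed
    have NC: "N \<subseteq> C"
    proof
      fix n assume "n \<in> N"
      then obtain b m where "b \<in> B" "m \<in> M" "n = b \<otimes> m" by (auto simp: N_def set_mult_def)
      then show "n \<in> C" using D(3) DM(3) subgroup.m_closed[OF normal_imp_subgroup[OF C_normal]] by blast
    qed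
    have Bc: "B \<subseteq> carrier G" and Mc: "M \<subseteq> carrier G" using D(4) DM(4) by auto
    have CmB: "B \<subseteq> Cm B" "M \<subseteq> Cm B" "B \<subseteq> Cm M" "M \<subseteq> Cm M"
    proof -
      show "B \<subseteq> Cm B" using D(4,5) by (auto simp: Cm_def)
      show "M \<subseteq> Cm M" using DM(4,5) by (auto simp: Cm_def)
      have one: "commutator G m b = \<one>" "commutator G b m = \<one>" if "m \<in> M" "b \<in> B" for m b
        using MB[OF that] D(4)[OF that(2)] DM(4)[OF that(1)] by (simp_all add: commutator_eq_one_iff)
      show "M \<subseteq> Cm B" "B \<subseteq> Cm M" using one D(4) DM(4) by (auto simp: Cm_def)
    qed
    have CmS: "subgroup (Cm B) G" "subgroup (Cm M) G"
      unfolding Cm_def using Bc Mc by (simp_all add: subgroup_centralizer_mod A_normal)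
    have CmN: "Cm B \<inter> Cm M \<subseteq> Cm N"
      unfolding Cm_def N_def using centralizer_mod_set_mult[OF A_normal Bc Mc] by blast
    have NCm: "N \<subseteq> Cm N"
    proof
      fix n assume "n \<in> N"
      then obtain b m where bm: "b \<in> B" "m \<in> M" "n = b \<otimes> m" by (auto simp: N_def set_mult_def)
      then have "n \<in> Cm B" "n \<in> Cm M"
        using CmB CmS by (auto intro!: subgroup.m_closed)
      then show "n \<in> Cm N" using CmN by blast
    qed
    have N2: "class2 N"
      by (rule class2I[OF Nn _ NC]) (use BN D(2) NCm in \<open>auto simp: Cm_def\<close>)
    have finN: "finite N" using class2D(7)[OF N2] .
    have cBM: "card B * card M \<le> card N * card A"
      using card_product_le[OF D(1) DM(1) finN _ D(7)] unfolding inter N_def set_mult_def by blast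
    \<comment> \<open>Acting trivially on both \<open>B/A\<close> and \<open>M/A\<close> means
      acting trivially on their product, so \<open>G/Cm N\<close> embeds into the product of the
      quotients by \<open>Cm B\<close> and \<open>Cm M\<close>.\<close>
    have cCm: "card (Cm B) * card (Cm M) \<le> card (carrier G) * card (Cm N)"
    proof -
      have cc: "x \<in> carrier G" if "x \<in> Cm S" for x S using that by (simp add: Cm_def)
      have "finite (Cm S)" for S by (simp add: Cm_def)
      then have "card (Cm B) * card (Cm M) \<le> card (carrier G) * card (Cm B \<inter> Cm M)"
        by (intro card_product_le CmS) (auto dest: cc)
      also have "\<dots> \<le> card (carrier G) * card (Cm N)"
        by (intro mult_left_mono card_mono CmN) (simp_all add: Cm_def)
      finally show ?thesis .
    qed
    show False
    proof (cases "B = A")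
      case True
      have "good M" using M(1) Mb by (simp add: good_def)
      moreover have "card B < card M" using True M(2) DM(7) by (simp add: psubset_card_mono)
      ultimately show False using mx by fastforce
    next
      case False
      then have Bb: "64 * card (carrier G) ^ 3 * card A ^ 8 \<le> card B ^ 8 * card (Cm B) ^ 3"
        using B by (simp add: good_def)
      define g a where "g = card (carrier G)" and "a = card A"
      have g0: "g > 0" and a0: "a > 0"
      proof -
        have "A \<noteq> {}" "carrier G \<noteq> {}" using A.one_closed one_closed by blast+
        then show "g > 0" "a > 0"
          using finite_subset[OF A.subset finite_carrier] by (simp_all add: g_def a_def card_gt_0_iff)
      qed
      \<comment> \<open>Multiplying the two bounds yields a second factor 64, which is simply
        dropped; what survives has the same shape as before.\<close>
      have "(64 * g ^ 3 * a ^ 8) * (64 * g ^ 3 * a ^ 8) \<le> (card B ^ 8 * card (Cm B) ^ 3) * (card M ^ 8 * card (Cm M) ^ 3)"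
        unfolding g_def a_def by (rule mult_mono[OF Bb Mb]) auto
      also have "\<dots> = (card B * card M) ^ 8 * (card (Cm B) * card (Cm M)) ^ 3"
        by (simp add: power_mult_distrib mult_ac)
      also have "\<dots> \<le> (card N * a) ^ 8 * (g * card (Cm N)) ^ 3"
        unfolding g_def a_def by (rule mult_mono[OF power_mono[OF cBM] power_mono[OF cCm]]) simp_all
      also have "\<dots> = (card N ^ 8 * card (Cm N) ^ 3) * (g ^ 3 * a ^ 8)"
        by (simp add: power_mult_distrib mult_ac)
      finally have "(64 * (64 * g ^ 3 * a ^ 8)) * (g ^ 3 * a ^ 8) \<le> (card N ^ 8 * card (Cm N) ^ 3) * (g ^ 3 * a ^ 8)"
        by (simp add: mult_ac)
      then have "64 * (64 * g ^ 3 * a ^ 8) \<le> card N ^ 8 * card (Cm N) ^ 3"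
        using g0 a0 by simp
      then have "64 * g ^ 3 * a ^ 8 \<le> card N ^ 8 * card (Cm N) ^ 3" by linarith
      then have "good N" using N2 by (simp add: good_def g_def a_def)
      moreover have "B \<noteq> N" using MN inter M(2) by blast
      then have "card B < card N" using BN finN by (intro psubset_card_mono) auto
      ultimately show False using mx by fastforce
    qed
  qed
  then show ?thesis using that[OF B2] B by (simp add: good_def Cm_def)
qed

end

section \<open>Numerical estimates that close the induction\<close>

lemma pow22_step:
  fixes m :: nat assumes "4 \<le> m" shows "(m + 1) ^ 22 \<le> 6561 * m ^ 22"
proof -
  have "(4 * (m + 1)) ^ 22 \<le> (5 * m) ^ 22" using assms by (intro power_mono) auto
  then have "4 ^ 22 * (m + 1) ^ 22 \<le> 5 ^ 22 * m ^ 22" by (simp only: power_mult_distrib)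
  also have "\<dots> \<le> (4 ^ 22 * 6561) * m ^ 22" by (rule mult_le_mono1) simp
  finally have "4 ^ 22 * (m + 1) ^ 22 \<le> 4 ^ 22 * (6561 * m ^ 22)" by (simp only: mult.assoc)
  then show ?thesis by simp
qed

text \<open>The critical case of a field with 3 elements: 6561 is 3^8 and 8 is (3 - 1)^3. The
  starting values \<open>m\<close> = 2 and 3 hold only narrowly; from 4 on, an increment costs at
  most (5/4)^22 on the left, far below 6561.\<close>

lemma pow22_le_a:
  fixes m :: nat assumes "2 \<le> m" shows "8 * m ^ 22 \<le> 6561 ^ m"
proof (cases "4 \<le> m")
  case True
  then show ?thesis
  proof (induct m rule: dec_induct)
    case (step n)
    have "8 * Suc n ^ 22 \<le> 6561 * (8 * n ^ 22)" using pow22_step[OF step(1)] by simp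
    also have "\<dots> \<le> 6561 * 6561 ^ n" by (rule mult_le_mono2[OF step(3)])
    finally show ?case by simp
  qed simp
next
  case False
  then have "m = 2 \<or> m = 3" using assms by auto
  then show ?thesis by auto
qed

text \<open>For fields with at least 4 elements. The 6 powers missing from \<open>8 * m\<close> are
  spent on the factors \<open>k^3\<close> and \<open>(Q - 1)^3\<close>, each of which is bounded by
  \<open>Q^3\<close>.\<close>

lemma pow22_le_b:
  fixes m :: nat assumes "2 \<le> m" shows "m ^ 22 \<le> 8 * 4 ^ (8 * m - 6)"
proof (cases "4 \<le> m")
  case True
  then show ?thesis
  proof (induct m rule: dec_induct)
    case (step n)
    have e: "8 * Suc n - 6 = (8 * n - 6) + 8" using step(1) by simp
    have "Suc n ^ 22 \<le> 6561 * n ^ 22" using pow22_step[OF step(1)] by simp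
    also have "\<dots> \<le> 4 ^ 8 * (8 * 4 ^ (8 * n - 6))" using step(3) by (intro mult_mono) auto
    also have "\<dots> = 8 * 4 ^ (8 * Suc n - 6)" unfolding e power_add by simp
    finally show ?case .
  qed simp
next
  case False
  then have "m = 2 \<or> m = 3" using assms by auto
  then show ?thesis by auto
qed

lemma double_le_of_pow_le:
  fixes k Q :: nat assumes "2 ^ k \<le> Q" shows "2 * k \<le> Q"
proof -
  have "2 * k \<le> 2 ^ k"
  proof (induct k)
    case (Suc k)
    then show ?case by (cases k) auto
  qed simp
  then show ?thesis using assms by linarith
qed

text \<open>The final inequality when \<open>B\<close> is larger than \<open>A\<close>. From
  \<open>2^k \<le> Q\<close> comes \<open>2 k \<le> Q\<close>; for \<open>Q = 3\<close> this forces
  \<open>k \<le> 1\<close>, and that small case needs its own estimate.\<close>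

lemma primitive_numeric_a:
  fixes m k Q :: nat
  assumes m: "2 \<le> m" and Q: "3 \<le> Q" and k: "2 ^ k \<le> Q"
  shows "k ^ 3 * (m ^ 22 * (Q - 1) ^ 3) \<le> Q ^ (8 * m)"
proof (cases "Q = 3")
  case True
  have "k \<le> 1" using double_le_of_pow_le[OF k] True by linarith
  then have "k ^ 3 * (m ^ 22 * (Q - 1) ^ 3) \<le> 1 ^ 3 * (m ^ 22 * (Q - 1) ^ 3)"
    by (intro mult_le_mono1 power_mono) auto
  also have "\<dots> = 8 * m ^ 22" using True by simp
  also have "\<dots> \<le> 6561 ^ m" by (rule pow22_le_a[OF m])
  also have "\<dots> = Q ^ (8 * m)" using True by (simp add: power_mult)
  finally show ?thesis .
next
  case False
  then have Q4: "4 \<le> Q" using Q by simp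
  have "8 * (k ^ 3 * (m ^ 22 * (Q - 1) ^ 3)) = (2 * k) ^ 3 * (Q - 1) ^ 3 * m ^ 22"
    by (simp add: power_mult_distrib)
  also have "\<dots> \<le> Q ^ 3 * Q ^ 3 * (8 * 4 ^ (8 * m - 6))"
    using double_le_of_pow_le[OF k] pow22_le_b[OF m] by (intro mult_mono power_mono) auto
  also have "\<dots> \<le> Q ^ 3 * Q ^ 3 * (8 * Q ^ (8 * m - 6))"
    using Q4 by (intro mult_mono power_mono) auto
  also have "\<dots> = 8 * (Q ^ 6 * Q ^ (8 * m - 6))" by (simp add: power_add[symmetric])
  also have "\<dots> = 8 * Q ^ (8 * m)" using m by (simp add: power_add[symmetric])
  finally show ?thesis by simp
qed

text \<open>The final inequality when \<open>B = A\<close>, where \<open>G\<close> is at most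
  \<open>k\<close> times \<open>A\<close>. Here the factor 64 has to be earned from the numbers, as
  no inductive bound supplies it.\<close>

lemma primitive_numeric_b:
  fixes k Q :: nat
  assumes Q: "2 \<le> Q" and k: "2 ^ k \<le> Q"
  shows "64 * (k ^ 3 * (Q - 1) ^ 3) \<le> Q ^ 8"
proof (cases "Q < 4")
  case True
  have "k \<le> 1" using double_le_of_pow_le[OF k] True by linarith
  then have "64 * (k ^ 3 * (Q - 1) ^ 3) \<le> 64 * (1 ^ 3 * (Q - 1) ^ 3)"
    by (intro mult_le_mono mult_le_mono1 power_mono) auto
  also have "\<dots> \<le> Q ^ 8"
  proof -
    have "Q = 2 \<or> Q = 3" using Q True by auto
    then show ?thesis by auto
  qed
  finally show ?thesis .
next
  case False
  then have Q4: "4 \<le> Q" by simp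
  have "64 * (k ^ 3 * (Q - 1) ^ 3) = 8 * ((2 * k) ^ 3 * (Q - 1) ^ 3)"
    by (simp add: power_mult_distrib)
  also have "\<dots> \<le> Q ^ 2 * (Q ^ 3 * Q ^ 3)"
  proof (intro mult_mono power_mono double_le_of_pow_le[OF k])
    have "(4::nat) ^ 2 \<le> Q ^ 2" using Q4 by (intro power_mono) auto
    then show "8 \<le> Q ^ 2" by simp
  qed auto
  also have "\<dots> = Q ^ 8" by (simp add: power_add[symmetric])
  finally show ?thesis .
qed

section \<open>Orders and vector stabilisers when \<open>span\<close> is a field\<close>

context lin_max
begin

text \<open>Two conclusions from the same data: the order bound that continues the induction, and
  the stabiliser bound needed for basic groups. \<open>k\<close> bounds the index of
  \<open>C\<close>, and \<open>m\<close> is the dimension of \<open>V\<close> over the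
  field.\<close>

lemma field_case_bound:
  obtains m k where "card (carrier V) = card span ^ m" "1 \<le> m" "2 ^ k \<le> card span"
    "64 * card (carrier G) ^ 3 \<le> card (carrier V) ^ 8"
    "\<forall>v\<in>carrier V. v \<noteq> \<zero>\<^bsub>V\<^esub> \<longrightarrow> card (fixer {v}) ^ 3 \<le> k ^ 3 * m ^ 19"
proof -
  obtain Y where Y: "Y \<subseteq> carrier V" "card (carrier V) = card span ^ card Y" "determining Y"
    by (rule span_basis)
  define m where "m = card Y"
  obtain k where k: "\<forall>H. subgroup H G \<longrightarrow> card H \<le> k * card (H \<inter> C)" and kQ: "2 ^ k \<le> card span"
    by (rule card_index_C)
  have kH: "card H \<le> k * card (H \<inter> C)" if "subgroup H G" for H
    using that k by blast
  obtain B where B: "class2 B" and self': "\<forall>g\<in>C. (\<forall>b\<in>B. g \<otimes> b = b \<otimes> g) \<longrightarrow> g \<in> A"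
    and Bb: "B = A \<or> 64 * card (carrier G) ^ 3 * card A ^ 8
      \<le> card B ^ 8 * card {g \<in> carrier G. \<forall>m\<in>B. commutator G m g \<in> A} ^ 3"
    by (rule socle)
  have self: "g \<in> A" if "g \<in> C" "\<And>b. b \<in> B \<Longrightarrow> g \<otimes> b = b \<otimes> g" for g
    using self' that by blast
  note D = class2D[OF B]
  define Q a where "Q = card span" and "a = card A"
  have finA: "finite A" using A.subset finite_carrier finite_subset by blast
  have "A \<noteq> {}" using A.one_closed by blast
  then have a0: "a > 0" using finA by (simp add: a_def card_gt_0_iff)
  have aQ: "a \<le> Q - 1" "2 \<le> Q" using card_A_less_span a0 by (auto simp: a_def Q_def)
  have CS: "subgroup C G" by (rule normal_imp_subgroup[OF C_normal])
  have Cc: "C \<subseteq> carrier G" by (rule subgroup.subset[OF CS])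
  have finC: "finite C" using Cc finite_carrier finite_subset by blast
  have m1: "1 \<le> m"
  proof (rule ccontr)
    assume "\<not> 1 \<le> m"
    then have "card (carrier V) = 1" using Y by (simp add: m_def)
    then show False using V_gt_1 by simp
  qed
  have GC: "card (carrier G) \<le> k * card C"
    using kH[OF subgroup_self] Cc by (simp add: Int_absorb1)
  have Bm: "card B \<le> m\<^sup>2 * a" unfolding m_def a_def by (rule class2_card_le[OF B Y])
  show ?thesis
  proof (cases "B = A")
    case True
    \<comment> \<open>The self-centralising property of \<open>B = A\<close> applied inside
      \<open>C\<close>; vector stabilisers then meet \<open>C\<close> trivially, since
      \<open>A\<close> is semiregular.\<close>
    have CA: "C = A"
    proof
      show "C \<subseteq> A" using self C_commute True by blast
    qed (rule A_le_C)
    have "64 * card (carrier G) ^ 3 \<le> 64 * (k * a) ^ 3"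
      using GC CA by (intro mult_left_mono power_mono) (auto simp: a_def)
    also have "\<dots> = 64 * (k ^ 3 * a ^ 3)" by (simp add: power_mult_distrib)
    also have "\<dots> \<le> 64 * (k ^ 3 * (Q - 1) ^ 3)" using aQ by (intro mult_left_mono power_mono) auto
    also have "\<dots> \<le> Q ^ 8" using aQ(2) kQ by (intro primitive_numeric_b) (auto simp: Q_def)
    also have "\<dots> \<le> Q ^ (m * 8)" using aQ(2) m1 by (intro power_increasing) auto
    also have "\<dots> = card (carrier V) ^ 8" using Y(2) by (simp add: power_mult m_def Q_def)
    finally have bG: "64 * card (carrier G) ^ 3 \<le> card (carrier V) ^ 8" .
    have "card (fixer {v}) ^ 3 \<le> k ^ 3 * m ^ 19" if v: "v \<in> carrier V" "v \<noteq> \<zero>\<^bsub>V\<^esub>" for v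
    proof -
      have "fixer {v} \<inter> C \<subseteq> {\<one>}"
        using A_semiregular[OF _ v] unfolding CA by (auto simp: fixer_def)
      then have "card (fixer {v} \<inter> C) \<le> 1" using card_mono[of "{\<one>}"] by fastforce
      then have "k * card (fixer {v} \<inter> C) \<le> k * 1" by (rule mult_le_mono2)
      moreover have "card (fixer {v}) \<le> k * card (fixer {v} \<inter> C)"
        using v by (intro kH subgroup_fixer) simp
      ultimately have "card (fixer {v}) \<le> k * 1" by (rule order_trans[rotated])
      then have "card (fixer {v}) \<le> k" by simp
      then have "card (fixer {v}) ^ 3 \<le> k ^ 3" by (rule power_mono) simp
      also have "\<dots> \<le> k ^ 3 * m ^ 19" using m1 by simp
      finally show ?thesis .
    qed
    then show ?thesis using that[of m k] Y(2) m1 kQ bG by (simp add: m_def)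
  next
    case False
    define Cm where "Cm = {g \<in> carrier G. \<forall>m\<in>B. commutator G m g \<in> A}"
    define b g where "b = card B" and "g = card (carrier G)"
    have b0: "b > 0" "g > 0"
      using D(7) subgroup.one_closed[OF D(1)] one_closed by (auto simp: b_def g_def card_gt_0_iff simp del: one_closed)
    have ab: "a < b" unfolding a_def b_def using D(2,7) False by (intro psubset_card_mono) auto
    \<comment> \<open>In dimension 1 the bound \<open>b \<le> m^2 a\<close> would force
      \<open>B = A\<close>.\<close>
    have m2: "2 \<le> m"
    proof (rule ccontr)
      assume "\<not> 2 \<le> m"
      then have "m = 1" using m1 by simp
      then show False using Bm ab by (simp add: b_def)
    qed
    have "Cm \<subseteq> carrier G" by (auto simp: Cm_def)
    have CmS: "subgroup Cm G" unfolding Cm_def using D(4) by (intro subgroup_centralizer_mod A_normal) auto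
    have "C \<inter> Cm = {g \<in> C. \<forall>b\<in>B. commutator G b g \<in> A}" using Cc by (auto simp: Cm_def)
    then have CCm: "card (C \<inter> Cm) \<le> b" using class2_centralizer_card[OF B self] by (simp add: b_def)
    \<comment> \<open>The inductive bound controls \<open>G/Cm\<close>. The product formula passes
      it to the quotient of \<open>C\<close> by its part in \<open>Cm\<close>, whose order is at
      most \<open>b\<close>.\<close>
    have "card C * card Cm \<le> g * card (C \<inter> Cm)" unfolding g_def
      using Cc \<open>Cm \<subseteq> carrier G\<close> finC by (intro card_product_le CS CmS) auto
    also have "\<dots> \<le> g * b" by (rule mult_le_mono2[OF CCm])
    finally have ccm: "card C * card Cm \<le> g * b" .
    have "64 * g ^ 3 * a ^ 8 \<le> b ^ 8 * card Cm ^ 3" using Bb False by (simp add: g_def a_def b_def Cm_def)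
    then have "(64 * g ^ 3 * a ^ 8) * card C ^ 3 \<le> (b ^ 8 * card Cm ^ 3) * card C ^ 3" by (rule mult_le_mono1)
    also have "\<dots> = b ^ 8 * (card C * card Cm) ^ 3" by (simp add: power_mult_distrib mult_ac)
    also have "\<dots> \<le> b ^ 8 * (g * b) ^ 3" using ccm by (intro mult_left_mono power_mono) auto
    also have "\<dots> = b ^ 11 * g ^ 3" by (simp add: power_mult_distrib power_add[symmetric] mult_ac)
    finally have "(64 * card C ^ 3 * a ^ 8) * g ^ 3 \<le> b ^ 11 * g ^ 3" by (simp add: mult_ac)
    then have Cb: "64 * card C ^ 3 * a ^ 8 \<le> b ^ 11" using b0 by simp
    have bm: "b \<le> m\<^sup>2 * a" using Bm by (simp add: b_def)
    \<comment> \<open>The exponent 11 is 8 from the module bound plus 3 from the cubed factor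
      \<open>b\<close>; substituting \<open>b \<le> m^2 a\<close> turns it into \<open>m^22\<close>
      and leaves \<open>a^3\<close>.\<close>
    have "64 * card C ^ 3 * a ^ 8 \<le> (m\<^sup>2 * a) ^ 11" by (rule order_trans[OF Cb power_mono[OF bm]]) simp
    also have "\<dots> = (m ^ 22 * a ^ 3) * a ^ 8" by (simp add: power_mult_distrib power_mult[symmetric] power_add[symmetric] mult_ac)
    finally have CA: "64 * card C ^ 3 \<le> m ^ 22 * a ^ 3" using a0 by simp
    have "64 * g ^ 3 \<le> 64 * (k * card C) ^ 3"
      using GC by (intro mult_left_mono power_mono) (auto simp: g_def)
    also have "\<dots> = k ^ 3 * (64 * card C ^ 3)" by (simp add: power_mult_distrib)
    also have "\<dots> \<le> k ^ 3 * (m ^ 22 * a ^ 3)" by (rule mult_le_mono2[OF CA])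
    also have "\<dots> \<le> k ^ 3 * (m ^ 22 * (Q - 1) ^ 3)" using aQ by (intro mult_left_mono power_mono) auto
    also have "\<dots> \<le> Q ^ (8 * m)"
      using class2_nontrivial_span[OF B False] kQ by (intro primitive_numeric_a m2) (auto simp: Q_def)
    also have "\<dots> = card (carrier V) ^ 8" using Y(2) by (simp add: power_mult[symmetric] m_def Q_def mult.commute)
    finally have bG: "64 * card (carrier G) ^ 3 \<le> card (carrier V) ^ 8" by (simp add: g_def)
    have "card (fixer {v}) ^ 3 \<le> k ^ 3 * m ^ 19" if v: "v \<in> carrier V" "v \<noteq> \<zero>\<^bsub>V\<^esub>" for v
    proof -
      define s c where "s = card (B \<inter> fixer {v})" and "c = card (fixer {v} \<inter> C)"
      have FS: "subgroup (fixer {v}) G" using v by (intro subgroup_fixer) simp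
      have "s\<^sup>2 * a \<le> b" unfolding s_def a_def b_def by (rule class2_stabilizer_card[OF B v])
      also have "b \<le> m\<^sup>2 * a" by (rule bm)
      finally have "s\<^sup>2 \<le> m\<^sup>2" using a0 by simp
      then have sm: "s \<le> m" by (rule power2_le_imp_le) simp
      \<comment> \<open>\<open>B\<close> together with the stabiliser in \<open>C\<close> still lies
        in \<open>C\<close>, and they share at most \<open>m\<close> elements. So the stabiliser is
        smaller than \<open>C\<close> by about the factor \<open>b\<close>, which lowers the power
        of \<open>m\<close> from 22 to 16 + 3 = 19.\<close>
      have "c * b \<le> card C * card (fixer {v} \<inter> C \<inter> B)" unfolding c_def b_def
        using CS D(3) finC by (intro card_product_le subgroups_Inter_pair FS D(1)) (auto intro: subgroup.m_closed)
      also have "fixer {v} \<inter> C \<inter> B = B \<inter> fixer {v}" using D(3) by blast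
      finally have "c * b \<le> card C * s" by (simp add: s_def)
      then have "(c * b) ^ 3 \<le> (card C * s) ^ 3" by (rule power_mono) simp
      then have "64 * a ^ 8 * (c * b) ^ 3 \<le> 64 * a ^ 8 * (card C * s) ^ 3" by (rule mult_le_mono2)
      also have "\<dots> = (64 * card C ^ 3 * a ^ 8) * s ^ 3" by (simp add: power_mult_distrib mult_ac)
      also have "\<dots> \<le> b ^ 11 * s ^ 3" by (rule mult_le_mono1[OF Cb])
      also have "\<dots> = (b ^ 8 * s ^ 3) * b ^ 3"
        using power_add[of b 8 3] by (simp add: mult_ac)
      also have "64 * a ^ 8 * (c * b) ^ 3 = (64 * a ^ 8 * c ^ 3) * b ^ 3"
        by (simp only: power_mult_distrib mult.assoc)
      finally have "(64 * a ^ 8 * c ^ 3) * b ^ 3 \<le> (b ^ 8 * s ^ 3) * b ^ 3" .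
      then have "64 * a ^ 8 * c ^ 3 \<le> b ^ 8 * s ^ 3" using b0 by simp
      also have "\<dots> \<le> (m\<^sup>2 * a) ^ 8 * m ^ 3" using bm sm by (intro mult_mono power_mono) auto
      also have "\<dots> = m ^ 19 * a ^ 8" by (simp add: power_mult_distrib power_mult[symmetric] power_add[symmetric] mult_ac)
      finally have "64 * c ^ 3 \<le> m ^ 19" using a0 by (simp add: mult_ac)
      then have c3: "c ^ 3 \<le> m ^ 19" by linarith
      have "card (fixer {v}) \<le> k * c" unfolding c_def by (rule kH[OF FS])
      then have "card (fixer {v}) ^ 3 \<le> (k * c) ^ 3" by (rule power_mono) simp
      also have "\<dots> = k ^ 3 * c ^ 3" by (simp add: power_mult_distrib)
      also have "\<dots> \<le> k ^ 3 * m ^ 19" by (rule mult_le_mono2[OF c3])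
      finally show ?thesis .
    qed
    then show ?thesis using that[of m k] Y(2) m1 kQ bG by (simp add: m_def)
  qed
qed

end

section \<open>Systems of imprimitivity\<close>

context lin_act
begin

definition vsub :: "'v set \<Rightarrow> bool" where
  "vsub U \<longleftrightarrow> U \<subseteq> carrier V \<and> \<zero>\<^bsub>V\<^esub> \<in> U \<and> (\<forall>u\<in>U. \<forall>v\<in>U. u \<ominus>\<^bsub>V\<^esub> v \<in> U)"

lemma vsubD:
  assumes "vsub U"
  shows "u \<in> U \<Longrightarrow> u \<in> carrier V" "\<zero>\<^bsub>V\<^esub> \<in> U" "u \<in> U \<Longrightarrow> v \<in> U \<Longrightarrow> u \<ominus>\<^bsub>V\<^esub> v \<in> U"
    "u \<in> U \<Longrightarrow> \<ominus>\<^bsub>V\<^esub> u \<in> U" "u \<in> U \<Longrightarrow> v \<in> U \<Longrightarrow> u \<oplus>\<^bsub>V\<^esub> v \<in> U"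
proof -
  show c: "\<And>u. u \<in> U \<Longrightarrow> u \<in> carrier V" and z: "\<zero>\<^bsub>V\<^esub> \<in> U"
    and m: "\<And>u v. u \<in> U \<Longrightarrow> v \<in> U \<Longrightarrow> u \<ominus>\<^bsub>V\<^esub> v \<in> U"
    using assms by (auto simp: vsub_def)
  show n: "\<And>u. u \<in> U \<Longrightarrow> \<ominus>\<^bsub>V\<^esub> u \<in> U" using m[OF z] c by (simp add: a_minus_def)
  show "u \<in> U \<Longrightarrow> v \<in> U \<Longrightarrow> u \<oplus>\<^bsub>V\<^esub> v \<in> U"
    using m[of u "\<ominus>\<^bsub>V\<^esub> v"] n c by (simp add: a_minus_def V.minus_minus)
qed

lemma act_image_vsub:
  assumes "vsub U" "g \<in> carrier G" shows "vsub (act g ` U)"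
  unfolding vsub_def
proof (intro conjI ballI)
  show "act g ` U \<subseteq> carrier V" using vsubD(1)[OF assms(1)] assms(2) by auto
  have "act g \<zero>\<^bsub>V\<^esub> = \<zero>\<^bsub>V\<^esub>" using V.endo_zero[OF act_endo[OF assms(2)]] .
  then show "\<zero>\<^bsub>V\<^esub> \<in> act g ` U" using vsubD(2)[OF assms(1)] by (metis image_eqI)
  fix u v assume "u \<in> act g ` U" "v \<in> act g ` U"
  then obtain x y where xy: "x \<in> U" "y \<in> U" "u = act g x" "v = act g y" by auto
  then have "u \<ominus>\<^bsub>V\<^esub> v = act g (x \<ominus>\<^bsub>V\<^esub> y)"
    using V.endo_diff[OF act_endo[OF assms(2)]] vsubD(1)[OF assms(1)] by simp
  then show "u \<ominus>\<^bsub>V\<^esub> v \<in> act g ` U" using xy vsubD(3)[OF assms(1)] by simp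
qed

lemma act_image_image:
  "g \<in> carrier G \<Longrightarrow> h \<in> carrier G \<Longrightarrow> U \<subseteq> carrier V \<Longrightarrow> act g ` act h ` U = act (g \<otimes> h) ` U"
  by (auto simp: image_image subset_iff intro!: image_cong)

lemma act_one_image: "U \<subseteq> carrier V \<Longrightarrow> act \<one> ` U = U"
  by (auto simp: subset_iff image_iff)

text \<open>The summands index themselves. Transitivity of \<open>G\<close> on them is included
  because it transfers irreducibility from \<open>V\<close> to the stabiliser of one
  summand.\<close>

definition imprimitivity_system :: "'v set set \<Rightarrow> bool" where
  "imprimitivity_system S \<longleftrightarrow> finite S \<and> (\<forall>U\<in>S. vsub U \<and> U \<noteq> {\<zero>\<^bsub>V\<^esub>}) \<and>
     (\<forall>g\<in>carrier G. \<forall>U\<in>S. act g ` U \<in> S) \<and>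
     (\<forall>U\<in>S. \<forall>U'\<in>S. \<exists>g\<in>carrier G. act g ` U = U') \<and>
     bij_betw (\<lambda>u. \<Oplus>\<^bsub>V\<^esub>U\<in>S. u U) (\<Pi>\<^sub>E U\<in>S. U) (carrier V)"

text \<open>The sum of the subgroups \<open>f U\<close> is non-zero and \<open>G\<close>-invariant,
  hence everything by irreducibility. The family \<open>f\<close> is left general for two uses: the
  homogeneous components themselves, and the translates of a subgroup of one summand.\<close>

lemma invariant_family_sum_spans:
  assumes irr: irreducible and fin: "finite S" and inv: "\<And>g U. g \<in> carrier G \<Longrightarrow> U \<in> S \<Longrightarrow> act g ` U \<in> S"
    and sub: "\<And>U. U \<in> S \<Longrightarrow> U \<subseteq> carrier V" and f: "\<And>U. U \<in> S \<Longrightarrow> vsub (f U)"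
    and finv: "\<And>g U w. g \<in> carrier G \<Longrightarrow> U \<in> S \<Longrightarrow> w \<in> f U \<Longrightarrow> act g w \<in> f (act g ` U)"
    and nz: "U0 \<in> S" "x0 \<in> f U0" "x0 \<noteq> \<zero>\<^bsub>V\<^esub>" and v: "v \<in> carrier V"
  shows "\<exists>u \<in> (\<Pi>\<^sub>E U\<in>S. f U). v = (\<Oplus>\<^bsub>V\<^esub>U\<in>S. u U)"
proof -
  define W where "W = (\<lambda>u. \<Oplus>\<^bsub>V\<^esub>U\<in>S. u U) ` (\<Pi>\<^sub>E U\<in>S. f U)"
  have c: "u U \<in> carrier V" if "u \<in> (\<Pi>\<^sub>E U\<in>S. f U)" "U \<in> S" for u U
    using PiE_mem[OF that] vsubD(1)[OF f[OF that(2)]] by blast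
  have inW: "(\<Oplus>\<^bsub>V\<^esub>U\<in>S. u U) \<in> W" if "\<And>U. U \<in> S \<Longrightarrow> u U \<in> f U" for u
  proof -
    have eq: "finsum V u S = finsum V (restrict u S) S"
      using that vsubD(1)[OF f] by (intro V.finsum_cong') auto
    show ?thesis unfolding W_def 
      by (rule image_eqI[where x = "restrict u S"]) (use eq that in \<open>simp_all only: restrict_PiE_iff, simp\<close>)
  qed
  have "W = {\<zero>\<^bsub>V\<^esub>} \<or> W = carrier V"
  proof (rule irreducibleD[OF irr])
    show "W \<subseteq> carrier V" using c by (auto simp: W_def intro!: V.finsum_closed)
    have "(\<Oplus>\<^bsub>V\<^esub>U\<in>S. \<zero>\<^bsub>V\<^esub>) \<in> W" using vsubD(2)[OF f] by (rule inW)
    then show "\<zero>\<^bsub>V\<^esub> \<in> W" by simp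
  next
    fix x y assume "x \<in> W" "y \<in> W"
    then obtain u w where u: "u \<in> (\<Pi>\<^sub>E U\<in>S. f U)" "x = (\<Oplus>\<^bsub>V\<^esub>U\<in>S. u U)"
      and w: "w \<in> (\<Pi>\<^sub>E U\<in>S. f U)" "y = (\<Oplus>\<^bsub>V\<^esub>U\<in>S. w U)" by (auto simp: W_def)
    have "x \<ominus>\<^bsub>V\<^esub> y = (\<Oplus>\<^bsub>V\<^esub>U\<in>S. u U \<ominus>\<^bsub>V\<^esub> w U)"
      unfolding u(2) w(2) using c[OF u(1)] c[OF w(1)] by (intro V.finsum_diff[symmetric]) auto
    moreover have "\<dots> \<in> W" 
      by (rule inW) (rule vsubD(3)[OF f PiE_mem[OF u(1)] PiE_mem[OF w(1)]])
    ultimately show "x \<ominus>\<^bsub>V\<^esub> y \<in> W" by simp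
  next
    fix g x assume g: "g \<in> carrier G" and "x \<in> W"
    then obtain u where u: "u \<in> (\<Pi>\<^sub>E U\<in>S. f U)" "x = (\<Oplus>\<^bsub>V\<^esub>U\<in>S. u U)" by (auto simp: W_def)
    \<comment> \<open>Applying \<open>g\<close> moves the term at \<open>U\<close> to the summand
      \<open>g U\<close>; reindexing by the inverse permutation \<open>h\<close> brings the sum back
      to the same index set.\<close>
    define h where "h U = act (inv g) ` U" for U
    have hS: "h U \<in> S" "act g ` h U = U" "h (act g ` U) = U" if "U \<in> S" for U
      using that g inv sub[OF that] by (simp_all add: h_def act_image_image act_one_image)
    have injg: "inj_on (\<lambda>U. act g ` U) S" using hS(3) by (rule inj_on_inverseI)
    have imS: "(\<lambda>U. act g ` U) ` S = S"
    proof (intro equalityI subsetI)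
      fix U assume "U \<in> S"
      then show "U \<in> (\<lambda>U. act g ` U) ` S" using hS by (metis image_eqI)
    qed (use inv g in auto)
    have "act g x = (\<Oplus>\<^bsub>V\<^esub>U\<in>S. act g (u U))"
      unfolding u(2) using g c[OF u(1)] by (intro V.endo_finsum) auto
    also have "\<dots> = (\<Oplus>\<^bsub>V\<^esub>U\<in>S. act g (u (h (act g ` U))))"
      using hS(3) c[OF u(1)] g by (intro V.finsum_cong') auto
    also have "\<dots> = (\<Oplus>\<^bsub>V\<^esub>U\<in>(\<lambda>U. act g ` U) ` S. act g (u (h U)))"
      using hS c[OF u(1)] g imS by (intro V.finsum_reindex[symmetric] injg) auto
    also have "\<dots> = (\<Oplus>\<^bsub>V\<^esub>U\<in>S. act g (u (h U)))" unfolding imS ..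
    also have "\<dots> \<in> W"
    proof (rule inW)
      fix U assume U: "U \<in> S"
      have "act g (u (h U)) \<in> f (act g ` h U)" 
        by (rule finv[OF g hS(1)[OF U] PiE_mem[OF u(1) hS(1)[OF U]]])
      then show "act g (u (h U)) \<in> f U" using hS[OF U] by simp
    qed
    finally show "act g x \<in> W" .
  qed
  moreover have "x0 \<in> W"
  proof -
    have x0c: "x0 \<in> carrier V" using vsubD(1)[OF f[OF nz(1)]] nz(2) by blast
    have "(\<Oplus>\<^bsub>V\<^esub>U\<in>S. if U0 = U then x0 else \<zero>\<^bsub>V\<^esub>) \<in> W"
      using nz vsubD(2)[OF f] by (intro inW) auto
    then show ?thesis using V.finsum_singleton[OF nz(1) fin, of "\<lambda>_. x0"] x0c by simp
  qed
  ultimately have "W = carrier V" using nz(3) by blast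
  then show ?thesis using v by (auto simp: W_def)
qed

end

section \<open>Homogeneous components of the restriction to \<open>A\<close>\<close>

context lin_abel
begin

definition smod :: "'v set \<Rightarrow> bool" where
  "smod W \<longleftrightarrow> vsub W \<and> (\<forall>r\<in>span. \<forall>w\<in>W. r w \<in> W) \<and> W \<noteq> {\<zero>\<^bsub>V\<^esub>}"

text \<open>The homogeneous component of a simple submodule \<open>W\<close> of the restriction to \<open>A\<close>.\<close>

definition component :: "'v set \<Rightarrow> 'v set" where
  "component W = {v \<in> carrier V. \<forall>r\<in>span. (\<forall>w\<in>W. r w = \<zero>\<^bsub>V\<^esub>) \<longrightarrow> r v = \<zero>\<^bsub>V\<^esub>}"

lemma componentD: "v \<in> component W \<Longrightarrow> r \<in> span \<Longrightarrow> (\<And>w. w \<in> W \<Longrightarrow> r w = \<zero>\<^bsub>V\<^esub>) \<Longrightarrow> r v = \<zero>\<^bsub>V\<^esub>"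
  unfolding component_def by blast

lemma component_vsub: "vsub (component W)"
  by (auto simp: vsub_def component_def V.endo_diff V.diff_eq_zero_iff)

lemma component_span: "v \<in> component W \<Longrightarrow> r \<in> span \<Longrightarrow> r v \<in> component W"
  by (auto simp: component_def span_commute[of _ r])

lemma conj_span:
  assumes "g \<in> carrier G" "r \<in> span"
  obtains r' where "r' \<in> span" "\<forall>v\<in>carrier V. r (act g v) = act g (r' v)"
proof
  show "(\<lambda>v\<in>carrier V. act (inv g) (r (act (inv (inv g)) v))) \<in> span"
    using assms by (intro span_conj) auto
qed (use assms in auto)

lemma act_component:
  assumes g: "g \<in> carrier G" and W: "W \<subseteq> carrier V"
  shows "act g ` component W = component (act g ` W)"
proof -
  have sub: "act g ` component W \<subseteq> component (act g ` W)" if g: "g \<in> carrier G" and W: "W \<subseteq> carrier V" for g W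
  proof clarify
    fix v assume v: "v \<in> component W"
    then have vc: "v \<in> carrier V" by (simp add: component_def)
    have "r (act g v) = \<zero>\<^bsub>V\<^esub>" if r: "r \<in> span" "\<forall>w\<in>act g ` W. r w = \<zero>\<^bsub>V\<^esub>" for r
    proof -
      obtain r' where r': "r' \<in> span" "\<forall>v\<in>carrier V. r (act g v) = act g (r' v)"
        by (rule conj_span[OF g r(1)])
      have "r' w = \<zero>\<^bsub>V\<^esub>" if "w \<in> W" for w
      proof -
        have wc: "w \<in> carrier V" using that W by auto
        have "act g (r' w) = r (act g w)" using r'(2) wc by simp
        also have "\<dots> = act g \<zero>\<^bsub>V\<^esub>" using r(2) that V.endo_zero[OF act_endo[OF g]] by simp
        finally have "act g (r' w) = act g \<zero>\<^bsub>V\<^esub>" .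
        then show ?thesis using act_inj[OF g] r'(1) wc by simp
      qed
      then have "r' v = \<zero>\<^bsub>V\<^esub>" using componentD[OF v r'(1)] by blast
      then show ?thesis using r'(2) vc V.endo_zero[OF act_endo[OF g]] by simp
    qed
    then show "act g v \<in> component (act g ` W)" using vc g by (simp add: component_def)
  qed
  have "component (act g ` W) = act g ` act (inv g) ` component (act g ` W)"
    using g by (subst act_image_image) (auto simp: act_one_image component_def)
  also have "act (inv g) ` component (act g ` W) \<subseteq> component (act (inv g) ` act g ` W)"
    using g W by (intro sub) auto
  also have "act (inv g) ` act g ` W = W" using g W by (simp add: act_image_image act_one_image)
  finally have "component (act g ` W) \<subseteq> act g ` component W" by auto
  then show ?thesis using sub[OF g W] by blast
qed

text \<open>Clifford's theorem in the abelian case. The homogeneous components are permuted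
  transitively and have direct sum \<open>V\<close>. With a single component the ring acts on
  \<open>V\<close> as faithfully as on a simple submodule, where non-zero elements are invertible,
  so it is a field.\<close>

lemma field_or_imprimitive:
  assumes irr: irreducible
  shows "span_field \<or> (\<exists>S. imprimitivity_system S \<and> 2 \<le> card S)"
proof -
  have Vs: "smod (carrier V)" using V_nontrivial by (simp add: smod_def vsub_def)
  \<comment> \<open>A non-zero submodule of least order is simple, and so are its translates, which
    have the same order.\<close>
  then obtain W0 where W0: "smod W0" and mn: "\<And>W. smod W \<Longrightarrow> card W0 \<le> card W"
    using ex_has_least_nat[of smod "carrier V" card] by blast
  define simple where "simple W \<longleftrightarrow> smod W \<and> card W = card W0" for W
  have sc: "W \<subseteq> carrier V" if "simple W" for W using that by (auto simp: simple_def smod_def vsub_def)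
  have finW: "finite W" if "simple W" for W using sc[OF that] finite_set finite_subset by blast
  \<comment> \<open>Schur's lemma: the kernel of \<open>r\<close> on \<open>W\<close> is a proper
    submodule, hence zero. Finiteness of the ring of restrictions to \<open>W\<close> then produces
    the inverse inside that ring.\<close>
  have inverse: "\<exists>s\<in>span. \<forall>w\<in>W. s (r w) = w"
    if W: "simple W" and r: "r \<in> span" and nz: "w0 \<in> W" "r w0 \<noteq> \<zero>\<^bsub>V\<^esub>" for W r w0
  proof -
    have Wv: "vsub W" and Wr: "\<And>r w. r \<in> span \<Longrightarrow> w \<in> W \<Longrightarrow> r w \<in> W"
      using W by (auto simp: simple_def smod_def)
    note c = vsubD(1)[OF Wv]
    define K where "K = {w \<in> W. r w = \<zero>\<^bsub>V\<^esub>}"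
    have "K = {\<zero>\<^bsub>V\<^esub>}"
    proof (rule ccontr)
      assume "K \<noteq> {\<zero>\<^bsub>V\<^esub>}"
      moreover have "vsub K" unfolding vsub_def K_def
        using c vsubD[OF Wv] r by (auto simp: V.endo_diff V.diff_eq_zero_iff)
      moreover have "\<forall>s\<in>span. \<forall>w\<in>K. s w \<in> K"
        using Wr c r by (auto simp: K_def span_commute[of r])
      ultimately have "card W0 \<le> card K" by (intro mn) (simp add: smod_def)
      moreover have "K \<subset> W" using nz by (auto simp: K_def)
      then have "card K < card W" by (rule psubset_card_mono[OF finW[OF W]])
      ultimately show False using W by (simp add: simple_def)
    qed
    then have ker: "w = \<zero>\<^bsub>V\<^esub>" if "w \<in> W" "r w = \<zero>\<^bsub>V\<^esub>" for w using that by (auto simp: K_def)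
    have rinj: "inj_on r W"
    proof (rule inj_onI)
      fix u v assume uv: "u \<in> W" "v \<in> W" "r u = r v"
      then have "r (u \<ominus>\<^bsub>V\<^esub> v) = \<zero>\<^bsub>V\<^esub>" using r c by (simp add: V.endo_diff V.diff_eq_zero_iff)
      then have "u \<ominus>\<^bsub>V\<^esub> v = \<zero>\<^bsub>V\<^esub>" using ker vsubD(3)[OF Wv] uv by blast
      then show "u = v" using uv c by (simp add: V.diff_eq_zero_iff)
    qed
    have rsurj: "r ` W = W" by (rule endo_inj_surj[OF finW[OF W] image_subsetI rinj]) (rule Wr[OF r])
    define F where "F = (\<lambda>s. restrict s W) ` span"
    define \<Phi> where "\<Phi> f = (\<lambda>w\<in>W. f (r w))" for f :: "'v \<Rightarrow> 'v"
    have "inj_on \<Phi> F"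
    proof (rule inj_onI)
      fix f f' assume f: "f \<in> F" "f' \<in> F" and eq: "\<Phi> f = \<Phi> f'"
      have "f w = f' w" if "w \<in> W" for w
      proof -
        have "w \<in> r ` W" using that rsurj by simp
        then obtain x where x: "x \<in> W" "w = r x" by (elim imageE)
        then show ?thesis using fun_cong[OF eq, of x] by (simp add: \<Phi>_def)
      qed
      then show "f = f'" using f by (intro extensionalityI[where A = W]) (auto simp: F_def)
    qed
    moreover have "\<Phi> ` F \<subseteq> F"
    proof clarify
      fix f assume "f \<in> F"
      then obtain s where s: "s \<in> span" "f = restrict s W" by (auto simp: F_def)
      have "\<Phi> f = restrict (\<lambda>v\<in>carrier V. s (r v)) W"
        using s r Wr c by (auto simp: \<Phi>_def intro!: restrict_ext)
      then show "\<Phi> f \<in> F" unfolding F_def using span_comp[OF s(1) r] by blast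
    qed
    moreover have "finite F" using finite_span by (simp add: F_def)
    ultimately have FF: "\<Phi> ` F = F" by (intro endo_inj_surj)
    have "restrict (\<lambda>v\<in>carrier V. v) W \<in> F" unfolding F_def using span_id by blast
    then have "restrict (\<lambda>v\<in>carrier V. v) W \<in> \<Phi> ` F" using FF by simp
    then obtain s where s: "s \<in> span" and eq: "restrict (\<lambda>v\<in>carrier V. v) W = \<Phi> (restrict s W)"
      by (auto simp: F_def)
    have "s (r w) = w" if "w \<in> W" for w
      using fun_cong[OF eq, of w] that c Wr[OF r that] by (simp add: \<Phi>_def)
    then show ?thesis using s by blast
  qed
  \<comment> \<open>With \<open>s\<close> inverse to \<open>r\<close> on \<open>W\<close>, the
    element \<open>s r - 1\<close> annihilates \<open>W\<close>, hence its whole component;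
    \<open>r\<close> is therefore injective there as well.\<close>
  have comp_inj: "v = \<zero>\<^bsub>V\<^esub>"
    if W: "simple W" and r: "r \<in> span" and nz: "w0 \<in> W" "r w0 \<noteq> \<zero>\<^bsub>V\<^esub>"
      and v: "v \<in> component W" "r v = \<zero>\<^bsub>V\<^esub>" for W r w0 v
  proof -
    obtain s where s: "s \<in> span" "\<forall>w\<in>W. s (r w) = w" using inverse[OF W r nz] by blast
    have vc: "v \<in> carrier V" using v by (simp add: component_def)
    define t where "t = (\<lambda>v\<in>carrier V. (\<lambda>v\<in>carrier V. s (r v)) v \<ominus>\<^bsub>V\<^esub> (\<lambda>v\<in>carrier V. v) v)"
    have t: "t \<in> span" unfolding t_def by (rule diff[OF span_comp[OF s(1) r] span_id])
    have "t w = \<zero>\<^bsub>V\<^esub>" if "w \<in> W" for w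
      using that s sc[OF W] r by (auto simp: t_def V.diff_eq_zero_iff subset_iff)
    then have "t v = \<zero>\<^bsub>V\<^esub>" using componentD[OF v(1) t] by blast
    then have "s (r v) = v" using vc r s by (simp add: t_def V.diff_eq_zero_iff)
    then show ?thesis using v(2) s(1) by simp
  qed
  \<comment> \<open>Annihilators of simple modules are maximal ideals, so distinct ones are
    incomparable. An element that kills \<open>W2\<close> but not \<open>W1\<close> kills the second
    component and is injective on the first.\<close>
  have comp_sep: "\<exists>r\<in>span. (\<forall>v\<in>component W2. r v = \<zero>\<^bsub>V\<^esub>) \<and> (\<forall>v\<in>component W1. r v = \<zero>\<^bsub>V\<^esub> \<longrightarrow> v = \<zero>\<^bsub>V\<^esub>)"
    if W: "simple W1" "simple W2" and ne: "component W1 \<noteq> component W2" for W1 W2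
  proof -
    have "\<exists>r\<in>span. (\<forall>w\<in>W2. r w = \<zero>\<^bsub>V\<^esub>) \<and> \<not> (\<forall>w\<in>W1. r w = \<zero>\<^bsub>V\<^esub>)"
    proof (rule ccontr)
      assume "\<not> ?thesis"
      then have a21: "\<forall>w\<in>W1. r w = \<zero>\<^bsub>V\<^esub>" if "r \<in> span" "\<forall>w\<in>W2. r w = \<zero>\<^bsub>V\<^esub>" for r using that by blast
      have "\<exists>r\<in>span. (\<forall>w\<in>W1. r w = \<zero>\<^bsub>V\<^esub>) \<and> \<not> (\<forall>w\<in>W2. r w = \<zero>\<^bsub>V\<^esub>)"
      proof (rule ccontr)
        assume "\<not> ?thesis"
        then have "(\<forall>w\<in>W1. r w = \<zero>\<^bsub>V\<^esub>) \<longleftrightarrow> (\<forall>w\<in>W2. r w = \<zero>\<^bsub>V\<^esub>)" if "r \<in> span" for r using that a21 by blast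
        then have "component W1 = component W2" unfolding component_def by auto
        then show False using ne by simp
      qed
      then obtain r w2 where r: "r \<in> span" "\<forall>w\<in>W1. r w = \<zero>\<^bsub>V\<^esub>" "w2 \<in> W2" "r w2 \<noteq> \<zero>\<^bsub>V\<^esub>" by blast
      obtain s where s: "s \<in> span" "\<forall>w\<in>W2. s (r w) = w" using inverse[OF W(2) r(1,3,4)] by blast
      define t where "t = (\<lambda>v\<in>carrier V. (\<lambda>v\<in>carrier V. s (r v)) v \<ominus>\<^bsub>V\<^esub> (\<lambda>v\<in>carrier V. v) v)"
      have t: "t \<in> span" unfolding t_def by (rule diff[OF span_comp[OF s(1) r(1)] span_id])
      have "t w = \<zero>\<^bsub>V\<^esub>" if "w \<in> W2" for w
        using that s sc[OF W(2)] by (auto simp: t_def V.diff_eq_zero_iff subset_iff)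
      then have t1: "t w = \<zero>\<^bsub>V\<^esub>" if "w \<in> W1" for w using a21[OF t] that by blast
      have "w = \<zero>\<^bsub>V\<^esub>" if w: "w \<in> W1" for w
      proof -
        have wc: "w \<in> carrier V" using w sc[OF W(1)] by blast
        have "s (r w) = w" using t1[OF w] wc s r by (simp add: t_def V.diff_eq_zero_iff)
        then show ?thesis using r(2) w s(1) by simp
      qed
      moreover have "W1 \<noteq> {\<zero>\<^bsub>V\<^esub>}" "\<zero>\<^bsub>V\<^esub> \<in> W1" using W(1) by (auto simp: simple_def smod_def vsub_def)
      ultimately show False by blast
    qed
    then obtain r w1 where r: "r \<in> span" "\<forall>w\<in>W2. r w = \<zero>\<^bsub>V\<^esub>" "w1 \<in> W1" "r w1 \<noteq> \<zero>\<^bsub>V\<^esub>" by blast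
    have "r v = \<zero>\<^bsub>V\<^esub>" if "v \<in> component W2" for v using componentD[OF that r(1)] r(2) by blast
    then show ?thesis using r(1) comp_inj[OF W(1) r(1,3,4)] by blast
  qed
  have simple_act: "simple (act g ` W0)" if g: "g \<in> carrier G" for g
  proof -
    have W0v: "vsub W0" "\<And>r w. r \<in> span \<Longrightarrow> w \<in> W0 \<Longrightarrow> r w \<in> W0" "W0 \<noteq> {\<zero>\<^bsub>V\<^esub>}"
      using W0 by (auto simp: smod_def)
    note c = vsubD(1)[OF W0v(1)]
    have inj: "inj_on (act g) W0" using act_inj[OF g] c by (intro inj_onI) blast
    have cd: "card (act g ` W0) = card W0" by (rule card_image[OF inj])
    have "r w \<in> act g ` W0" if r: "r \<in> span" and w: "w \<in> act g ` W0" for r w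
    proof -
      obtain r' where r': "r' \<in> span" "\<forall>v\<in>carrier V. r (act g v) = act g (r' v)"
        by (rule conj_span[OF g r])
      obtain x where "x \<in> W0" "w = act g x" using w by auto
      then show ?thesis using r' W0v(2) c by auto
    qed
    moreover have "act g ` W0 \<noteq> {\<zero>\<^bsub>V\<^esub>}"
    proof
      assume "act g ` W0 = {\<zero>\<^bsub>V\<^esub>}"
      then have "card W0 = 1" using cd by simp
      then obtain x where "W0 = {x}" by (meson card_1_singletonE)
      then show False using W0v(3) vsubD(2)[OF W0v(1)] by auto
    qed
    ultimately show ?thesis using act_image_vsub[OF W0v(1) g] cd by (simp add: simple_def smod_def)
  qed
  have W0c: "W0 \<subseteq> carrier V" using W0 by (auto simp: smod_def vsub_def)
  define S where "S = (\<lambda>g. component (act g ` W0)) ` carrier G"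
  have finS: "finite S" by (simp add: S_def)
  have Ssub: "vsub U" if "U \<in> S" for U using that component_vsub by (auto simp: S_def)
  have WU: "W \<subseteq> component W" if "W \<subseteq> carrier V" for W using that by (auto simp: component_def)
  have Snz: "U \<noteq> {\<zero>\<^bsub>V\<^esub>}" if U: "U \<in> S" for U
  proof -
    obtain g where g: "g \<in> carrier G" "U = component (act g ` W0)" using U by (auto simp: S_def)
    have "smod (act g ` W0)" using simple_act[OF g(1)] by (simp add: simple_def)
    then obtain w where w: "w \<in> act g ` W0" "w \<noteq> \<zero>\<^bsub>V\<^esub>" unfolding smod_def vsub_def by blast
    have "act g ` W0 \<subseteq> U" using WU[OF sc[OF simple_act[OF g(1)]]] g(2) by simp
    then show ?thesis using w by blast
  qed
  have Sinv: "act h ` U \<in> S" if h: "h \<in> carrier G" and U: "U \<in> S" for h U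
  proof -
    obtain g where g: "g \<in> carrier G" "U = component (act g ` W0)" using U by (auto simp: S_def)
    have "act h ` U = component (act (h \<otimes> g) ` W0)"
      using g h W0c by (simp add: act_component sc[OF simple_act] act_image_image)
    then show ?thesis using g h by (auto simp: S_def)
  qed
  have Strans: "\<exists>h\<in>carrier G. act h ` U = U'" if U: "U \<in> S" "U' \<in> S" for U U'
  proof -
    obtain g g' where g: "g \<in> carrier G" "U = component (act g ` W0)"
      and g': "g' \<in> carrier G" "U' = component (act g' ` W0)" using U by (auto simp: S_def)
    have "act (g' \<otimes> inv g) ` U = component (act (g' \<otimes> inv g \<otimes> g) ` W0)"
      using g g' W0c by (simp add: act_component sc[OF simple_act] act_image_image)
    also have "\<dots> = U'" using g g' by (simp add: m_assoc)
    finally show ?thesis using g g' by blast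
  qed
  \<comment> \<open>Independence by induction: to see that the part in \<open>U\<close> vanishes,
    apply a ring element that kills \<open>U0\<close> and is injective on \<open>U\<close>. The
    relation loses a term and the remaining parts stay in their components.\<close>
  have indep: "\<forall>u. (\<forall>U\<in>F. u U \<in> U) \<longrightarrow> (\<Oplus>\<^bsub>V\<^esub>U\<in>F. u U) = \<zero>\<^bsub>V\<^esub> \<longrightarrow> (\<forall>U\<in>F. u U = \<zero>\<^bsub>V\<^esub>)"
    if "finite F" "F \<subseteq> S" for F
    using that
  proof (induct F rule: finite_induct)
    case (insert U0 F)
    show ?case
    proof (intro allI impI)
      fix u assume u: "\<forall>U\<in>insert U0 F. u U \<in> U" and sum: "(\<Oplus>\<^bsub>V\<^esub>U\<in>insert U0 F. u U) = \<zero>\<^bsub>V\<^esub>"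
      have uc: "u U \<in> carrier V" if "U \<in> insert U0 F" for U
        by (rule vsubD(1)[OF Ssub[OF subsetD[OF insert(4) that]]]) (use u that in blast)
      have sum': "u U0 \<oplus>\<^bsub>V\<^esub> (\<Oplus>\<^bsub>V\<^esub>U\<in>F. u U) = \<zero>\<^bsub>V\<^esub>"
        using sum insert(1,2) uc by (simp add: V.finsum_insert Pi_iff)
      have F0: "u U = \<zero>\<^bsub>V\<^esub>" if U: "U \<in> F" for U
      proof -
        obtain g g0 where g: "g \<in> carrier G" "U = component (act g ` W0)"
          and g0: "g0 \<in> carrier G" "U0 = component (act g0 ` W0)"
          using U insert(4) by (auto simp: S_def)
        have "U \<noteq> U0" using U insert(2) by blast
        then obtain r where r: "r \<in> span" "\<forall>v\<in>U0. r v = \<zero>\<^bsub>V\<^esub>" "\<forall>v\<in>U. r v = \<zero>\<^bsub>V\<^esub> \<longrightarrow> v = \<zero>\<^bsub>V\<^esub>"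
          using comp_sep[OF simple_act[OF g(1)] simple_act[OF g0(1)]] g g0 by auto
        have Fc: "(\<Oplus>\<^bsub>V\<^esub>U\<in>F. u U) \<in> carrier V" using uc by (intro V.finsum_closed) auto
        have "r (u U0 \<oplus>\<^bsub>V\<^esub> (\<Oplus>\<^bsub>V\<^esub>U\<in>F. u U)) = \<zero>\<^bsub>V\<^esub>" unfolding sum' using r(1) by simp
        then have "r (\<Oplus>\<^bsub>V\<^esub>U\<in>F. u U) = \<zero>\<^bsub>V\<^esub>" using r u uc Fc by (simp add: V.endo_add)
        then have "(\<Oplus>\<^bsub>V\<^esub>U\<in>F. r (u U)) = \<zero>\<^bsub>V\<^esub>" using V.endo_finsum[of r u F] r(1) uc by auto
        moreover have "r (u U) \<in> U" if "U \<in> F" for U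
        proof -
          have "u U \<in> U" "U \<in> S" using u that insert(4) by auto
          then show ?thesis using component_span r(1) by (auto simp: S_def)
        qed
        moreover have "F \<subseteq> S" using insert(4) by simp
        from insert(3)[OF this, THEN spec, of "\<lambda>U. r (u U)"]
        have "(\<forall>U\<in>F. r (u U) \<in> U) \<longrightarrow> (\<Oplus>\<^bsub>V\<^esub>U\<in>F. r (u U)) = \<zero>\<^bsub>V\<^esub> \<longrightarrow> (\<forall>U\<in>F. r (u U) = \<zero>\<^bsub>V\<^esub>)" .
        ultimately have "r (u U) = \<zero>\<^bsub>V\<^esub>" using U by blast
        then show ?thesis using r(3) u U by blast
      qed
      then have "(\<Oplus>\<^bsub>V\<^esub>U\<in>F. u U) = (\<Oplus>\<^bsub>V\<^esub>U\<in>F. \<zero>\<^bsub>V\<^esub>)" by (intro V.finsum_cong') auto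
      then have "u U0 = \<zero>\<^bsub>V\<^esub>" using sum' uc by simp
      then show "\<forall>U\<in>insert U0 F. u U = \<zero>\<^bsub>V\<^esub>" using F0 by blast
    qed
  qed simp
  have U0: "component W0 \<in> S" unfolding S_def using act_one_image[OF W0c] by (metis image_eqI one_closed)
  have Scar: "\<And>U. U \<in> S \<Longrightarrow> U \<subseteq> carrier V" using Ssub by (simp add: vsub_def)
  obtain x0 where x0: "x0 \<in> component W0" "x0 \<noteq> \<zero>\<^bsub>V\<^esub>"
    using Snz[OF U0] vsubD(2)[OF Ssub[OF U0]] by blast
  have spans: "\<exists>u \<in> (\<Pi>\<^sub>E U\<in>S. U). v = (\<Oplus>\<^bsub>V\<^esub>U\<in>S. u U)" if "v \<in> carrier V" for v
    by (rule invariant_family_sum_spans[OF irr finS Sinv Scar Ssub imageI U0 x0 that])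
  have PiEc: "u U \<in> carrier V" if "u \<in> (\<Pi>\<^sub>E U\<in>S. U)" "U \<in> S" for u U
    using PiE_mem[OF that] Scar[OF that(2)] by blast
  have "bij_betw (\<lambda>u. \<Oplus>\<^bsub>V\<^esub>U\<in>S. u U) (\<Pi>\<^sub>E U\<in>S. U) (carrier V)"
  proof (rule bij_betw_imageI)
    show "inj_on (\<lambda>u. \<Oplus>\<^bsub>V\<^esub>U\<in>S. u U) (\<Pi>\<^sub>E U\<in>S. U)"
    proof (rule inj_onI)
      fix u w assume u: "u \<in> (\<Pi>\<^sub>E U\<in>S. U)" and w: "w \<in> (\<Pi>\<^sub>E U\<in>S. U)"
        and eq: "(\<Oplus>\<^bsub>V\<^esub>U\<in>S. u U) = (\<Oplus>\<^bsub>V\<^esub>U\<in>S. w U)"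
      have "(\<Oplus>\<^bsub>V\<^esub>U\<in>S. u U \<ominus>\<^bsub>V\<^esub> w U) = (\<Oplus>\<^bsub>V\<^esub>U\<in>S. u U) \<ominus>\<^bsub>V\<^esub> (\<Oplus>\<^bsub>V\<^esub>U\<in>S. w U)"
        using PiEc[OF u] PiEc[OF w] by (intro V.finsum_diff) auto
      also have "\<dots> = \<zero>\<^bsub>V\<^esub>" unfolding eq
        using PiEc[OF w] by (subst V.diff_eq_zero_iff) (auto intro!: V.finsum_closed)
      finally have z: "(\<Oplus>\<^bsub>V\<^esub>U\<in>S. u U \<ominus>\<^bsub>V\<^esub> w U) = \<zero>\<^bsub>V\<^esub>" .
      have m: "\<forall>U\<in>S. u U \<ominus>\<^bsub>V\<^esub> w U \<in> U" using PiE_mem[OF u] PiE_mem[OF w] vsubD(3)[OF Ssub] by blast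
      have d0: "\<forall>U\<in>S. u U \<ominus>\<^bsub>V\<^esub> w U = \<zero>\<^bsub>V\<^esub>"
        using indep[OF finS subset_refl, rule_format, of "\<lambda>U. u U \<ominus>\<^bsub>V\<^esub> w U"] m z by blast
      have "u U = w U" if "U \<in> S" for U
        using bspec[OF d0 that] PiEc[OF u that] PiEc[OF w that] by (simp add: V.diff_eq_zero_iff)
      then show "u = w" by (rule PiE_ext[OF u w])
    qed
    show "(\<lambda>u. \<Oplus>\<^bsub>V\<^esub>U\<in>S. u U) ` (\<Pi>\<^sub>E U\<in>S. U) = carrier V"
    proof (intro equalityI subsetI)
      fix v assume "v \<in> (\<lambda>u. \<Oplus>\<^bsub>V\<^esub>U\<in>S. u U) ` (\<Pi>\<^sub>E U\<in>S. U)"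
      then show "v \<in> carrier V" using PiEc by (auto intro!: V.finsum_closed)
    next
      fix v assume "v \<in> carrier V"
      then show "v \<in> (\<lambda>u. \<Oplus>\<^bsub>V\<^esub>U\<in>S. u U) ` (\<Pi>\<^sub>E U\<in>S. U)" using spans by (metis image_eqI)
    qed
  qed
  then have sys: "imprimitivity_system S"
    unfolding imprimitivity_system_def using finS Ssub Snz Sinv Strans by blast
  show ?thesis
  proof (cases "2 \<le> card S")
    case True then show ?thesis using sys by blast
  next
    case False
    moreover have "card S \<noteq> 0" using U0 finS by auto
    ultimately have "card S = 1" by linarith
    then have S1: "S = {component W0}" using U0 by (metis card_1_singletonE singletonD)
    \<comment> \<open>With one component the direct sum has one term, so \<open>V\<close> is
      homogeneous, and an element killing some non-zero vector kills \<open>W0\<close> and then all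
      of \<open>V\<close>.\<close>
    have all: "v \<in> component W0" if v: "v \<in> carrier V" for v
    proof -
      obtain u where u: "u \<in> (\<Pi>\<^sub>E U\<in>S. U)" "v = (\<Oplus>\<^bsub>V\<^esub>U\<in>S. u U)" using spans[OF v] by blast
      have uU: "u (component W0) \<in> component W0" using PiE_mem[OF u(1) U0] .
      then have "v = u (component W0)" using u(2) PiEc[OF u(1) U0] unfolding S1
        by (simp add: V.finsum_insert)
      then show ?thesis using uU by simp
    qed
    have "simple W0" using W0 by (simp add: simple_def)
    have span_field unfolding span_field_def
    proof (intro ballI impI)
      fix r x assume r: "r \<in> span" and "\<exists>v\<in>carrier V. v \<noteq> \<zero>\<^bsub>V\<^esub> \<and> r v = \<zero>\<^bsub>V\<^esub>" and x: "x \<in> carrier V"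
      then obtain v where v: "v \<in> carrier V" "v \<noteq> \<zero>\<^bsub>V\<^esub>" "r v = \<zero>\<^bsub>V\<^esub>" by blast
      have "r w = \<zero>\<^bsub>V\<^esub>" if "w \<in> W0" for w
        using comp_inj[OF \<open>simple W0\<close> r that _ all[OF v(1)] v(3)] v(2) by blast
      then show "r x = \<zero>\<^bsub>V\<^esub>" using componentD[OF all[OF x] r] by blast
    qed
    then show ?thesis by blast
  qed
qed

end

section \<open>The imprimitive case of the order bound\<close>

context lin_act
begin

lemma vsub_abelian_group:
  assumes U: "vsub U"
  shows "abelian_group (V\<lparr>carrier := U\<rparr>)"
    "\<And>u v. u \<in> U \<Longrightarrow> v \<in> U \<Longrightarrow> u \<ominus>\<^bsub>V\<lparr>carrier := U\<rparr>\<^esub> v = u \<ominus>\<^bsub>V\<^esub> v"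
proof -
  note D = vsubD[OF U]
  show ag: "abelian_group (V\<lparr>carrier := U\<rparr>)"
  proof (rule abelian_groupI)
    fix u assume "u \<in> carrier (V\<lparr>carrier := U\<rparr>)"
    then have "\<ominus>\<^bsub>V\<^esub> u \<in> U \<and> \<ominus>\<^bsub>V\<^esub> u \<oplus>\<^bsub>V\<^esub> u = \<zero>\<^bsub>V\<^esub>" using D by (simp add: V.l_neg)
    then show "\<exists>v\<in>carrier (V\<lparr>carrier := U\<rparr>). v \<oplus>\<^bsub>V\<lparr>carrier := U\<rparr>\<^esub> u = \<zero>\<^bsub>V\<lparr>carrier := U\<rparr>\<^esub>"
      by auto
  qed (use D in \<open>auto simp: V.a_ac\<close>)
  interpret U: abelian_group "V\<lparr>carrier := U\<rparr>" by (rule ag)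
  fix u v assume uv: "u \<in> U" "v \<in> U"
  have "\<ominus>\<^bsub>V\<lparr>carrier := U\<rparr>\<^esub> v = \<ominus>\<^bsub>V\<^esub> v"
    by (rule U.minus_equality) (use uv D in \<open>auto simp: V.l_neg\<close>)
  then show "u \<ominus>\<^bsub>V\<lparr>carrier := U\<rparr>\<^esub> v = u \<ominus>\<^bsub>V\<^esub> v" by (simp add: a_minus_def)
qed

lemma imprimitivityD:
  assumes "imprimitivity_system S"
  shows "finite S" "U \<in> S \<Longrightarrow> vsub U" "U \<in> S \<Longrightarrow> U \<noteq> {\<zero>\<^bsub>V\<^esub>}"
    "g \<in> carrier G \<Longrightarrow> U \<in> S \<Longrightarrow> act g ` U \<in> S"
    "U \<in> S \<Longrightarrow> U' \<in> S \<Longrightarrow> \<exists>g\<in>carrier G. act g ` U = U'"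
    "bij_betw (\<lambda>u. \<Oplus>\<^bsub>V\<^esub>U\<in>S. u U) (\<Pi>\<^sub>E U\<in>S. U) (carrier V)"
  using assms unfolding imprimitivity_system_def by blast+

text \<open>A subgroup \<open>W\<close> of \<open>U\<close> invariant under the stabiliser of
  \<open>U\<close> has well-defined translates in the other summands. Their sum is
  \<open>G\<close>-invariant, hence all of \<open>V\<close>, and comparing components in
  \<open>U\<close> gives \<open>W = U\<close>.\<close>

lemma component_stabilizer_irreducible:
  assumes irr: irreducible and S: "imprimitivity_system S" and U: "U \<in> S"
  defines "H \<equiv> {g \<in> carrier G. act g ` U = U}"
  shows "subgroup H G" "lin_act (G\<lparr>carrier := H\<rparr>) (V\<lparr>carrier := U\<rparr>) act"
    "lin_act.irreducible (G\<lparr>carrier := H\<rparr>) (V\<lparr>carrier := U\<rparr>) act"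
proof -
  note D = imprimitivityD[OF S]
  have Uv: "vsub U" by (rule D(2)[OF U])
  have Uc: "U \<subseteq> carrier V" using Uv by (simp add: vsub_def)
  show Hs: "subgroup H G"
  proof (rule subgroupI)
    show "H \<subseteq> carrier G" by (auto simp: H_def)
    have "\<one> \<in> H" using act_one_image[OF Uc] by (simp add: H_def)
    then show "H \<noteq> {}" by blast
    fix a assume a: "a \<in> H"
    then have "act (inv a) ` U = act (inv a) ` act a ` U" by (simp add: H_def)
    also have "\<dots> = U"
    proof -
      have "a \<in> carrier G" using a by (simp add: H_def)
      then show ?thesis using Uc by (simp add: act_image_image act_one_image)
    qed
    finally show "inv a \<in> H" using a by (simp add: H_def)
    fix b assume b: "b \<in> H"
    have "act (a \<otimes> b) ` U = act a ` act b ` U"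
      by (rule act_image_image[symmetric, OF _ _ Uc]) (use a b in \<open>simp_all add: H_def\<close>)
    then show "a \<otimes> b \<in> H" using a b by (simp add: H_def)
  qed
  have HU: "act g u \<in> U" if "g \<in> H" "u \<in> U" for g u using that by (auto simp: H_def)
  have Hc: "g \<in> carrier G" if "g \<in> H" for g using that by (simp add: H_def)
  have Ucc: "u \<in> carrier V" if "u \<in> U" for u using that Uc by blast
  interpret L: lin_act "G\<lparr>carrier := H\<rparr>" "V\<lparr>carrier := U\<rparr>" act
    unfolding lin_act_def set_act_def set_act_axioms_def lin_act_axioms_def
    using subgroup_imp_group[OF Hs] vsub_abelian_group(1)[OF Uv] HU Hc Ucc act_add
      finite_subset[OF Uc finite_set] finite_subset[OF subgroup.subset[OF Hs] finite_carrier] by simp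
  show "lin_act (G\<lparr>carrier := H\<rparr>) (V\<lparr>carrier := U\<rparr>) act" by (rule L.lin_act_axioms)
  show "L.irreducible" unfolding L.irreducible_def
  proof (intro conjI allI impI)
    show "carrier (V\<lparr>carrier := U\<rparr>) \<noteq> {\<zero>\<^bsub>V\<lparr>carrier := U\<rparr>\<^esub>}" using D(3)[OF U] by simp
    fix W assume "W \<subseteq> carrier (V\<lparr>carrier := U\<rparr>) \<and> \<zero>\<^bsub>V\<lparr>carrier := U\<rparr>\<^esub> \<in> W \<and>
      (\<forall>u\<in>W. \<forall>v\<in>W. u \<ominus>\<^bsub>V\<lparr>carrier := U\<rparr>\<^esub> v \<in> W) \<and>
      (\<forall>g\<in>carrier (G\<lparr>carrier := H\<rparr>). \<forall>w\<in>W. act g w \<in> W)"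
    then have W: "W \<subseteq> U" "\<zero>\<^bsub>V\<^esub> \<in> W" "\<And>g w. g \<in> H \<Longrightarrow> w \<in> W \<Longrightarrow> act g w \<in> W"
      and Wm': "\<And>u v. u \<in> W \<Longrightarrow> v \<in> W \<Longrightarrow> u \<ominus>\<^bsub>V\<lparr>carrier := U\<rparr>\<^esub> v \<in> W" by auto
    have Wm: "u \<ominus>\<^bsub>V\<^esub> v \<in> W" if "u \<in> W" "v \<in> W" for u v
      using Wm'[OF that]
      by (simp only: vsub_abelian_group(2)[OF Uv subsetD[OF W(1) that(1)] subsetD[OF W(1) that(2)]])
    have Wc: "w \<in> carrier V" if "w \<in> W" for w using that W(1) Uc by blast
    have "W = U" if ne: "W \<noteq> {\<zero>\<^bsub>V\<^esub>}"
    proof -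
      obtain x0 where x0: "x0 \<in> W" "x0 \<noteq> \<zero>\<^bsub>V\<^esub>" using ne W(2) by blast
      \<comment> \<open>The translate of \<open>W\<close> in \<open>U'\<close>. Two elements
        carrying \<open>U\<close> to \<open>U'\<close> differ by one that stabilises
        \<open>U\<close>, so it does not depend on the choice of the element.\<close>
      define f where "f U' = {act g w | g w. g \<in> carrier G \<and> act g ` U = U' \<and> w \<in> W}" for U'
      have fsub: "f U' \<subseteq> U'" for U' using W(1) by (auto simp: f_def)
      have fU: "f U = W"
      proof (intro equalityI subsetI)
        fix x assume "x \<in> f U"
        then show "x \<in> W" using W(3) by (auto simp: f_def H_def)
      next
        fix x assume x: "x \<in> W"
        have "x = act \<one> x" using Wc[OF x] by simp
        then show "x \<in> f U" using x act_one_image[OF Uc] unfolding f_def by blast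
      qed
      have fv: "vsub (f U')" if U': "U' \<in> S" for U'
        unfolding vsub_def
      proof (intro conjI ballI)
        show "f U' \<subseteq> carrier V" using fsub D(2)[OF U'] by (auto simp: vsub_def)
        obtain g where g: "g \<in> carrier G" "act g ` U = U'" using D(5)[OF U U'] by blast
        have "\<zero>\<^bsub>V\<^esub> = act g \<zero>\<^bsub>V\<^esub>" using V.endo_zero[OF act_endo[OF g(1)]] by simp
        then show "\<zero>\<^bsub>V\<^esub> \<in> f U'" using g W(2) unfolding f_def by blast
        fix x y assume "x \<in> f U'" "y \<in> f U'"
        then obtain g h u w where gh: "g \<in> carrier G" "h \<in> carrier G" "act g ` U = U'" "act h ` U = U'"
          and uw: "u \<in> W" "w \<in> W" "x = act g u" "y = act h w" by (auto simp: f_def)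
        have "act (inv g \<otimes> h) ` U = act (inv g) ` act h ` U"
          by (rule act_image_image[symmetric, OF _ _ Uc]) (use gh in simp_all)
        also have "\<dots> = act (inv g) ` act g ` U" by (simp only: gh)
        also have "\<dots> = U" using gh(1) Uc by (simp add: act_image_image act_one_image)
        finally have "inv g \<otimes> h \<in> H" using gh by (simp add: H_def)
        then have w': "act (inv g \<otimes> h) w \<in> W" using uw W(3) by blast
        have "act g (act (inv g \<otimes> h) w) = y" using gh uw Wc by simp
        then have "x \<ominus>\<^bsub>V\<^esub> y = act g (u \<ominus>\<^bsub>V\<^esub> act (inv g \<otimes> h) w)"
          using V.endo_diff[OF act_endo[OF gh(1)]] Wc[OF uw(1)] Wc[OF w'] uw(3) by simp
        then show "x \<ominus>\<^bsub>V\<^esub> y \<in> f U'" using Wm[OF uw(1) w'] gh unfolding f_def by blast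
      qed
      have finv: "act g x \<in> f (act g ` U')" if g: "g \<in> carrier G" and U': "U' \<in> S" and x: "x \<in> f U'" for g U' x
      proof -
        obtain h w where hw: "h \<in> carrier G" "act h ` U = U'" "w \<in> W" "x = act h w" using x by (auto simp: f_def)
        have "act (g \<otimes> h) ` U = act g ` U'" using act_image_image[OF g hw(1) Uc] hw(2) by simp
        moreover have "act g x = act (g \<otimes> h) w" using g hw Wc by simp
        ultimately show ?thesis using g hw unfolding f_def by blast
      qed
      have Sc: "U' \<subseteq> carrier V" if "U' \<in> S" for U' using D(2)[OF that] by (simp add: vsub_def)
      have x0f: "x0 \<in> f U" using x0 fU by simp
      show "W = U"
      proof
        show "U \<subseteq> W"
        proof
          fix y assume y: "y \<in> U"
          have "\<exists>u \<in> (\<Pi>\<^sub>E U\<in>S. f U). y = (\<Oplus>\<^bsub>V\<^esub>U\<in>S. u U)"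
            by (rule invariant_family_sum_spans[OF irr D(1) D(4) Sc fv finv U x0f x0(2)]) (use y Ucc in auto)
          then obtain u where u: "u \<in> (\<Pi>\<^sub>E U\<in>S. f U)" "y = (\<Oplus>\<^bsub>V\<^esub>U\<in>S. u U)" by blast
          \<comment> \<open>The trivial decomposition of \<open>y\<close>, with \<open>y\<close>
            itself at \<open>U\<close> and zero elsewhere. Uniqueness identifies it with
            \<open>u\<close>, whose part at \<open>U\<close> lies in \<open>W\<close>.\<close>
          define w where "w = (\<lambda>U'\<in>S. if U = U' then y else \<zero>\<^bsub>V\<^esub>)"
          have wS: "w \<in> (\<Pi>\<^sub>E U\<in>S. U)" using y vsubD(2)[OF D(2)] by (auto simp: w_def)
          have uS: "u \<in> (\<Pi>\<^sub>E U\<in>S. U)" using u(1) fsub by (auto simp: PiE_def Pi_def)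
          have wy: "(\<Oplus>\<^bsub>V\<^esub>U\<in>S. w U) = y"
          proof -
            have "(\<Oplus>\<^bsub>V\<^esub>U'\<in>S. w U') = (\<Oplus>\<^bsub>V\<^esub>U'\<in>S. if U = U' then y else \<zero>\<^bsub>V\<^esub>)"
              using y Ucc by (intro V.finsum_cong') (auto simp: w_def)
            then show ?thesis using V.finsum_singleton[OF U D(1), of "\<lambda>_. y"] y Ucc by simp
          qed
          have "u = w"
            by (rule inj_onD[OF bij_betw_imp_inj_on[OF D(6)] _ uS wS]) (simp only: u(2)[symmetric] wy)
          then have "u U = y" using U by (simp add: w_def)
          then show "y \<in> W" using PiE_mem[OF u(1) U] fU by simp
        qed
      qed (rule W(1))
    qed
    then show "W = {\<zero>\<^bsub>V\<lparr>carrier := U\<rparr>\<^esub>} \<or> W = carrier (V\<lparr>carrier := U\<rparr>)" by auto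
  qed
qed

text \<open>For \<open>k\<close> summands the permutation action costs \<open>4^(k-1)\<close>, that
  is \<open>64^(k-1)\<close> after cubing. Each summand contributes a factor 64 on the left through
  its own inductive bound, \<open>64^k\<close> in all, so exactly one factor 64 is left over for the
  conclusion.\<close>

lemma imprimitive_bound:
  assumes irr: irreducible and S: "imprimitivity_system S" and S2: "2 \<le> card S" and sol: "solvable G"
    and faithful: "\<And>g. g \<in> carrier G \<Longrightarrow> (\<And>v. v \<in> carrier V \<Longrightarrow> act g v = v) \<Longrightarrow> g = \<one>"
    and IH: "\<And>n. n < card (carrier V) \<Longrightarrow> irr_bound n"
  shows "64 * card (carrier G) ^ 3 \<le> card (carrier V) ^ 8"
proof -
  note D = imprimitivityD[OF S]
  have Sc: "U \<subseteq> carrier V" if "U \<in> S" for U using D(2)[OF that] by (simp add: vsub_def)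
  have finU: "finite U" if "U \<in> S" for U using Sc[OF that] finite_set finite_subset by blast
  have cardV: "card (carrier V) = (\<Prod>U\<in>S. card U)"
    using bij_betw_same_card[OF D(6)] D(1) by (simp add: card_PiE)
  have U2: "2 \<le> card U" if U: "U \<in> S" for U
  proof -
    obtain x where x: "x \<in> U" "x \<noteq> \<zero>\<^bsub>V\<^esub>" using D(3)[OF U] vsubD(2)[OF D(2)[OF U]] by blast
    have "card {x, \<zero>\<^bsub>V\<^esub>} \<le> card U" using x vsubD(2)[OF D(2)[OF U]] finU[OF U] by (intro card_mono) auto
    then show ?thesis using x by simp
  qed
  \<comment> \<open>There is a second summand, with at least two elements, so \<open>V\<close> is at
    least twice as large as \<open>U\<close>.\<close>
  have small: "card U < card (carrier V)" if U: "U \<in> S" for U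
  proof -
    have "S - {U} \<noteq> {}" 
    proof
      assume "S - {U} = {}"
      then have "card S \<le> card {U}" by (intro card_mono) auto
      then show False using S2 by simp
    qed
    then obtain U' where U': "U' \<in> S" "U' \<noteq> U" by blast
    have "card (carrier V) = card U * (\<Prod>U\<in>S - {U}. card U)"
      using cardV D(1) U by (simp add: prod.remove)
    also have "(\<Prod>U\<in>S - {U}. card U) = card U' * (\<Prod>U\<in>S - {U} - {U'}. card U)"
      using D(1) U' by (intro prod.remove) auto
    finally have "card (carrier V) = card U * (card U' * (\<Prod>U\<in>S - {U} - {U'}. card U))" .
    moreover have "1 \<le> (\<Prod>U\<in>S - {U} - {U'}. card U)" using U2 by (intro prod_ge_1) force
    then have "2 * 1 \<le> card U' * (\<Prod>U\<in>S - {U} - {U'}. card U)" using U2[OF U'(1)] by (intro mult_mono) auto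
    then have "card U * 2 \<le> card U * (card U' * (\<Prod>U\<in>S - {U} - {U'}. card U))" by (intro mult_le_mono2) simp
    ultimately show ?thesis using U2[OF U] by simp
  qed
  interpret P: set_act G S "\<lambda>g U. act g ` U"
    unfolding set_act_def set_act_axioms_def
    using is_group D(1,4) act_image_image[OF _ _ Sc] act_one_image[OF Sc] by simp
  define L where "L = {g \<in> carrier G. \<forall>U\<in>S. act g ` U = U}"
  have Sne: "S \<noteq> {}" using S2 by auto
  have GL: "card (carrier G) \<le> 4 ^ (card S - 1) * card L"
    unfolding L_def by (rule soluble_perm_card_le[OF P.set_act_axioms sol Sne])
  have Ls: "subgroup L G" using P.subgroup_fixer[of S] by (simp add: P.fixer_def L_def)
  \<comment> \<open>The summands are treated one at a time. The module bound for the full stabiliser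
    \<open>H\<close> of \<open>U\<close> is passed to the part of \<open>L\<close> already fixing
    the earlier summands, by the product formula for that part and the kernel on
    \<open>U\<close>.\<close>
  have chain: "64 ^ card F * card L ^ 3 \<le> (\<Prod>U\<in>F. card U) ^ 8 * card (L \<inter> fixer (\<Union>F)) ^ 3"
    if "finite F" "F \<subseteq> S" for F
    using that
  proof (induct F rule: finite_induct)
    case empty
    have "L \<inter> carrier G = L" by (auto simp: L_def)
    then show ?case by simp
  next
    case (insert U F)
    have U: "U \<in> S" and FS: "F \<subseteq> S" using insert by auto
    define H where "H = {g \<in> carrier G. act g ` U = U}"
    note C = component_stabilizer_irreducible[OF irr S U, folded H_def]
    interpret C: lin_act "G\<lparr>carrier := H\<rparr>" "V\<lparr>carrier := U\<rparr>" act by (rule C(2))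
    define K where "K = {g \<in> H. \<forall>u\<in>U. act g u = u}"
    have KC: "K = C.fixer (carrier (V\<lparr>carrier := U\<rparr>))" by (simp add: K_def C.fixer_def)
    have "64 * card H ^ 3 \<le> card U ^ 8 * card K ^ 3"
      using C.irr_bound_transfer[OF _ C(3) solvable_subgroup_group[OF sol C(1)]] IH[OF small[OF U]] KC by simp
    moreover define L' where "L' = L \<inter> fixer (\<Union>F)"
    have L's: "subgroup L' G" unfolding L'_def
      using Ls Sc FS by (intro subgroups_Inter_pair subgroup_fixer) auto
    have Ks: "subgroup K G"
    proof -
      have "K = H \<inter> fixer U" by (auto simp: K_def H_def fixer_def)
      then show ?thesis using subgroups_Inter_pair[OF C(1) subgroup_fixer[OF Sc[OF U]]] by simp
    qed
    have L'H: "L' \<subseteq> H" using U by (auto simp: L'_def L_def H_def)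
    have KH: "K \<subseteq> H" by (auto simp: K_def)
    have finH: "finite H" by (simp add: H_def)
    have "card L' * card K \<le> card H * card (L' \<inter> K)"
      using L'H KH C(1) finH finite_subset[OF L'H]
      by (intro card_product_le L's Ks) (auto intro!: subgroup.m_closed[OF C(1)])
    moreover have "L' \<inter> K = L \<inter> fixer (\<Union>(insert U F))"
      using U by (auto simp: L'_def K_def H_def L_def fixer_def)
    ultimately have a: "64 * card H ^ 3 \<le> card U ^ 8 * card K ^ 3"
      and b: "card L' * card K \<le> card H * card (L \<inter> fixer (\<Union>(insert U F)))" by simp_all
    define x where "x = card (L \<inter> fixer (\<Union>(insert U F)))"
    have K0: "card K > 0" using subgroup.one_closed[OF Ks] finite_subset[OF KH finH] card_gt_0_iff by blast
    have "64 * (card L' * card K) ^ 3 \<le> 64 * (card H * x) ^ 3"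
      using b by (intro mult_le_mono2 power_mono) (auto simp: x_def)
    also have "\<dots> = (64 * card H ^ 3) * x ^ 3" by (simp add: power_mult_distrib)
    also have "\<dots> \<le> (card U ^ 8 * card K ^ 3) * x ^ 3" by (rule mult_le_mono1[OF a])
    finally have "(64 * card L' ^ 3) * card K ^ 3 \<le> (card U ^ 8 * x ^ 3) * card K ^ 3"
      by (simp add: power_mult_distrib mult_ac)
    then have l: "64 * card L' ^ 3 \<le> card U ^ 8 * x ^ 3" using K0 by simp
    have "64 ^ card (insert U F) * card L ^ 3 = 64 * (64 ^ card F * card L ^ 3)"
      using insert by simp
    also have "\<dots> \<le> 64 * ((\<Prod>U\<in>F. card U) ^ 8 * card L' ^ 3)"
      using insert(3)[OF FS] unfolding L'_def by (rule mult_le_mono2)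
    also have "\<dots> = (\<Prod>U\<in>F. card U) ^ 8 * (64 * card L' ^ 3)" by simp
    also have "\<dots> \<le> (\<Prod>U\<in>F. card U) ^ 8 * (card U ^ 8 * x ^ 3)" by (rule mult_le_mono2[OF l])
    also have "\<dots> = (\<Prod>U\<in>insert U F. card U) ^ 8 * x ^ 3"
      using insert(1,2) by (simp add: power_mult_distrib mult_ac)
    finally show ?case by (simp add: x_def)
  qed
  have "L \<inter> fixer (\<Union>S) \<subseteq> {\<one>}"
  proof
    fix g assume g: "g \<in> L \<inter> fixer (\<Union>S)"
    then have gc: "g \<in> carrier G" by (simp add: L_def)
    have "g = \<one>"
    proof (rule faithful[OF gc])
      fix v assume "v \<in> carrier V"
      then have "v \<in> (\<lambda>u. \<Oplus>\<^bsub>V\<^esub>U\<in>S. u U) ` (\<Pi>\<^sub>E U\<in>S. U)" using bij_betw_imp_surj_on[OF D(6)] by simp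
      then obtain u where u: "u \<in> (\<Pi>\<^sub>E U\<in>S. U)" "v = (\<Oplus>\<^bsub>V\<^esub>U\<in>S. u U)" by blast
      have uc: "u U \<in> carrier V" if "U \<in> S" for U using PiE_mem[OF u(1) that] Sc[OF that] by blast
      have "act g v = (\<Oplus>\<^bsub>V\<^esub>U\<in>S. act g (u U))"
        unfolding u(2) using gc uc by (intro V.endo_finsum) auto
      also have "\<dots> = (\<Oplus>\<^bsub>V\<^esub>U\<in>S. u U)"
        using g PiE_mem[OF u(1)] uc by (intro V.finsum_cong') (auto simp: fixer_def)
      finally show "act g v = v" by (simp add: u(2))
    qed
    then show "g \<in> {\<one>}" by simp
  qed
  then have "card (L \<inter> fixer (\<Union>S)) \<le> 1" using card_mono[of "{\<one>}"] by fastforce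
  then have one: "card (L \<inter> fixer (\<Union>S)) ^ 3 \<le> 1 ^ 3" by (rule power_mono) simp
  have "64 * card (carrier G) ^ 3 \<le> 64 * (4 ^ (card S - 1) * card L) ^ 3"
    using GL by (intro mult_le_mono2 power_mono) auto
  also have "\<dots> = 64 * 64 ^ (card S - 1) * card L ^ 3"
  proof -
    have "((4::nat) ^ (card S - 1)) ^ 3 = (4 ^ 3) ^ (card S - 1)" by (simp only: power_mult[symmetric] mult.commute)
    then show ?thesis by (simp add: power_mult_distrib)
  qed
  also have "64 * 64 ^ (card S - 1) = (64::nat) ^ card S"
    using S2 by (metis One_nat_def Suc_1 Suc_diff_1 Suc_le_lessD less_trans power_Suc zero_less_Suc)
  also have "64 ^ card S * card L ^ 3 \<le> card (carrier V) ^ 8 * card (L \<inter> fixer (\<Union>S)) ^ 3"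
    using chain[OF D(1)] cardV by simp
  also have "\<dots> \<le> card (carrier V) ^ 8 * 1 ^ 3" by (rule mult_le_mono2[OF one])
  finally show ?thesis by simp
qed

lemma maximal_abelian_normal:
  obtains A where "A \<lhd> G" "\<forall>a\<in>A. \<forall>b\<in>A. a \<otimes> b = b \<otimes> a"
    "\<forall>N. N \<lhd> G \<longrightarrow> A \<subseteq> N \<longrightarrow> (\<forall>x\<in>N. \<forall>y\<in>N. x \<otimes> y = y \<otimes> x) \<longrightarrow> N = A"
proof -
  define good where "good A \<longleftrightarrow> A \<lhd> G \<and> (\<forall>a\<in>A. \<forall>b\<in>A. a \<otimes> b = b \<otimes> a)" for A
  have fin: "A \<subseteq> carrier G" if "good A" for A
    using that normal_imp_subgroup subgroup.subset unfolding good_def by blast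
  have "good {\<one>}" unfolding good_def using one_is_normal by auto
  moreover have "card A < Suc (card (carrier G))" if "good A" for A
    using card_mono[OF finite_carrier fin[OF that]] by simp
  ultimately obtain A where A: "good A" and mx: "\<And>N. good N \<Longrightarrow> card N \<le> card A"
    using ex_has_greatest_nat[of good "{\<one>}" card] by blast
  have "N = A" if "N \<lhd> G" "A \<subseteq> N" "\<forall>x\<in>N. \<forall>y\<in>N. x \<otimes> y = y \<otimes> x" for N
  proof -
    have gN: "good N" using that by (simp add: good_def)
    have "finite N" using fin[OF gN] finite_subset[OF _ finite_carrier] by blast
    then show ?thesis using card_seteq[of N A] mx[OF gN] that(2) by simp
  qed
  then show ?thesis using that[of A] A unfolding good_def by blast
qed

lemma irreducible_step:
  assumes irr: irreducible and sol: "solvable G"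
    and faithful: "\<And>g. g \<in> carrier G \<Longrightarrow> (\<And>v. v \<in> carrier V \<Longrightarrow> act g v = v) \<Longrightarrow> g = \<one>"
    and IH: "\<And>n. n < card (carrier V) \<Longrightarrow> irr_bound n"
  shows "64 * card (carrier G) ^ 3 \<le> card (carrier V) ^ 8"
proof -
  obtain A where A: "A \<lhd> G" "\<forall>a\<in>A. \<forall>b\<in>A. a \<otimes> b = b \<otimes> a"
    "\<forall>N. N \<lhd> G \<longrightarrow> A \<subseteq> N \<longrightarrow> (\<forall>x\<in>N. \<forall>y\<in>N. x \<otimes> y = y \<otimes> x) \<longrightarrow> N = A"
    by (rule maximal_abelian_normal)
  have la: "lin_abel G V act A"
    using faithful irr A lin_act_axioms unfolding lin_abel_def lin_abel_axioms_def irreducible_def by blast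
  interpret lin_abel G V act A by (rule la)
  consider span_field | S where "imprimitivity_system S" "2 \<le> card S"
    using field_or_imprimitive[OF irr] by blast
  then show ?thesis
  proof cases
    case 1
    interpret lin_max G V act A
      using A(3) 1 sol IH by unfold_locales blast+
    show ?thesis by (rule field_case_bound)
  next
    case 2
    then show ?thesis using imprimitive_bound[OF irr _ _ sol faithful IH] by blast
  qed
qed

end

theorem irr_bound: "irr_bound n"
proof (induct n rule: less_induct)
  case (less n)
  show ?case unfolding irr_bound_def
  proof (intro allI impI)
    fix V :: "nat ring" and G :: "(nat \<Rightarrow> nat) monoid" and act
    assume "lin_act G V act" and irr: "lin_act.irreducible G V act" and sol: "solvable G"
      and f: "\<forall>g\<in>carrier G. (\<forall>v\<in>carrier V. act g v = v) \<longrightarrow> g = \<one>\<^bsub>G\<^esub>" and n: "card (carrier V) = n"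
    interpret lin_act G V act by fact
    show "64 * card (carrier G) ^ 3 \<le> card (carrier V) ^ 8"
      using irreducible_step[OF irr sol] f less n by blast
  qed
qed

section \<open>The upper bounds\<close>

lemma (in set_act) irred_seq_pow_le_card:
  assumes irr: "irred_seq xs" and i: "i \<le> length xs"
  shows "2 ^ (length xs - i) \<le> card (fixer (set (take i xs)))"
  using i
proof (induct i rule: inc_induct)
  case base
  have "subgroup (fixer (set xs)) G" using irr by (intro subgroup_fixer) (simp add: irred_seq_def)
  then have "\<one> \<in> fixer (set xs)" by (rule subgroup.one_closed)
  moreover have "finite (fixer (set xs))" by (simp add: fixer_def)
  ultimately have "card (fixer (set xs)) \<noteq> 0" by auto
  then show ?case by simp
next
  case (step n)
  have sub: "subgroup (fixer (set (take j xs))) G" for j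
    using irr by (intro subgroup_fixer) (auto simp: irred_seq_def dest: in_set_takeD)
  have "2 * card (fixer (set (take (Suc n) xs))) \<le> card (fixer (set (take n xs)))"
    using irr step(2) sub by (intro card_subgroup_double) (auto simp: irred_seq_def fixer_def)
  moreover have "length xs - n = Suc (length xs - Suc n)" using step by simp
  ultimately show ?case using step(3) by simp
qed

lemma perm_group_Bij: "perm_group \<Delta> G \<Longrightarrow> g \<in> G \<Longrightarrow> g \<in> Bij \<Delta>"
  using subgroup.mem_carrier[of G "BijGroup \<Delta>" g] by (simp add: perm_group_def BijGroup_def)

lemma perm_group_set_act:
  assumes "perm_group \<Delta> G"
  shows "set_act ((BijGroup \<Delta>)\<lparr>carrier := G\<rparr>) \<Delta> (\<lambda>g. g)"
proof -
  have sub: "subgroup G (BijGroup \<Delta>)" and fin: "finite \<Delta>" using assms by (auto simp: perm_group_def)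
  have GB: "g \<in> Bij \<Delta>" if "g \<in> G" for g
    using subgroup.mem_carrier[OF sub that] by (simp add: BijGroup_def)
  have "G \<subseteq> \<Delta> \<rightarrow>\<^sub>E \<Delta>"
    using GB Bij_imp_funcset Bij_imp_extensional by (force simp: PiE_def)
  then have "finite G" using fin finite_subset by (metis finite_PiE)
  then show ?thesis
    unfolding set_act_def set_act_axioms_def
    using group.subgroup_imp_group[OF group_BijGroup sub] fin GB Bij_imp_funcset
    by (auto simp: BijGroup_def compose_def)
qed

lemma irredundant_iff_irred_seq:
  assumes "perm_group \<Delta> G"
  shows "irredundant \<Delta> G = set_act.irred_seq ((BijGroup \<Delta>)\<lparr>carrier := G\<rparr>) \<Delta> (\<lambda>g. g)"
    "pointwise_stab G xs = set_act.fixer ((BijGroup \<Delta>)\<lparr>carrier := G\<rparr>) (\<lambda>g. g) (set xs)"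
proof -
  interpret set_act "(BijGroup \<Delta>)\<lparr>carrier := G\<rparr>" \<Delta> "\<lambda>g. g" by (rule perm_group_set_act[OF assms])
  have *: "pointwise_stab G xs = fixer (set xs)" for xs by (simp add: pointwise_stab_def fixer_def)
  show "pointwise_stab G xs = fixer (set xs)" by (rule *)
  show "irredundant \<Delta> G = irred_seq"
    by (rule ext) (simp add: irredundant_def irred_seq_def *)
qed

lemma max_irredundant_base_attained:
  assumes "perm_group \<Delta> G"
  obtains \<delta> where "irredundant \<Delta> G \<delta>" "is_base \<Delta> G \<delta>" "length \<delta> = max_irredundant_base \<Delta> G"
proof -
  have "finite \<Delta>" using assms by (simp add: perm_group_def)
  then have "max_irredundant_base \<Delta> G \<in> {length \<delta> | \<delta>. irredundant \<Delta> G \<delta> \<and> is_base \<Delta> G \<delta>}"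
    unfolding max_irredundant_base_def
    using irredundant_base_exists[OF assms] by (intro Max_in irredundant_bases_finite) auto
  then show ?thesis using that by auto
qed

text \<open>A longest irredundant sequence is a base, since any point moved by its stabiliser could
  be appended. For lower bounds it is therefore enough to exhibit an irredundant sequence.\<close>

lemma length_le_max_irredundant_base:
  assumes pg: "perm_group \<Delta> G" and irr: "irredundant \<Delta> G \<delta>"
  shows "length \<delta> \<le> max_irredundant_base \<Delta> G"
proof -
  interpret set_act "(BijGroup \<Delta>)\<lparr>carrier := G\<rparr>" \<Delta> "\<lambda>g. g" by (rule perm_group_set_act[OF pg])
  have fin: "finite \<Delta>" by simp
  obtain xs where xs: "irredundant \<Delta> G xs" and mx: "\<And>ys. irredundant \<Delta> G ys \<Longrightarrow> length ys \<le> length xs"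
    using ex_has_greatest_nat[of "irredundant \<Delta> G" \<delta> length "Suc (card \<Delta>)"]
      irredundant_length_le[OF fin] irr by (metis le_imp_less_Suc)
  have irs: "irred_seq xs" using xs by (simp add: irredundant_iff_irred_seq[OF pg])
  have fxE: "fixer (set xs) \<subseteq> {\<one>\<^bsub>BijGroup \<Delta>\<^esub>}"
  proof
    fix g assume g: "g \<in> fixer (set xs)"
    have "g x = x" if x: "x \<in> \<Delta>" for x
    proof (rule ccontr)
      assume "g x \<noteq> x"
      then have "fixer (insert x (set xs)) \<noteq> fixer (set xs)" using g by (auto simp: fixer_def)
      then have "irred_seq (xs @ [x])" by (rule irred_seq_append[OF irs x])
      then show False using mx[of "xs @ [x]"] by (simp add: irredundant_iff_irred_seq[OF pg])
    qed
    moreover have "g \<in> G" using g by (simp add: fixer_def)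
    then have "g \<in> extensional \<Delta>" using perm_group_Bij[OF pg] by (simp add: Bij_def)
    ultimately have "g = (\<lambda>x\<in>\<Delta>. x)" by (intro extensionalityI[where A = \<Delta>]) auto
    then show "g \<in> {\<one>\<^bsub>BijGroup \<Delta>\<^esub>}" by (simp add: BijGroup_def)
  qed
  have sD: "set xs \<subseteq> \<Delta>" using irs by (simp add: irred_seq_def)
  then have "\<one>\<^bsub>BijGroup \<Delta>\<^esub> \<in> fixer (set xs)"
    using subgroup.one_closed[OF subgroup_fixer[OF sD]] by simp
  then have "is_base \<Delta> G xs"
    unfolding is_base_def irredundant_iff_irred_seq(2)[OF pg] using fxE sD by blast
  then have "length xs \<le> max_irredundant_base \<Delta> G"
    unfolding max_irredundant_base_def
    using xs by (intro Max_ge irredundant_bases_finite fin) auto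
  then show ?thesis using mx[OF irr] by simp
qed

lemma primitive_perm_group_iff:
  assumes "perm_group \<Delta> G"
  shows "primitive_perm_group \<Delta> G \<longleftrightarrow> set_act.primitive ((BijGroup \<Delta>)\<lparr>carrier := G\<rparr>) \<Delta> (\<lambda>g. g)"
proof -
  interpret set_act "(BijGroup \<Delta>)\<lparr>carrier := G\<rparr>" \<Delta> "\<lambda>g. g" by (rule perm_group_set_act[OF assms])
  have sub: "subgroup G (BijGroup \<Delta>)" using assms by (simp add: perm_group_def)
  have "group_hom ((BijGroup \<Delta>)\<lparr>carrier := G\<rparr>) (BijGroup \<Delta>) (\<lambda>g. g)"
    using is_group group_BijGroup subgroup.mem_carrier[OF sub]
    by (auto simp: group_hom_def group_hom_axioms_def hom_def)
  then have "transitive_action ((BijGroup \<Delta>)\<lparr>carrier := G\<rparr>) \<Delta> (\<lambda>g. g) \<longleftrightarrow>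
      (\<forall>x\<in>\<Delta>. \<forall>y\<in>\<Delta>. \<exists>g\<in>G. g x = y)"
    by (auto simp: transitive_action_def transitive_action_axioms_def group_action_def)
  then show ?thesis using assms by (simp add: primitive_perm_group_def primitive_def)
qed

lemma primitive_soluble_bound:
  assumes "primitive_soluble \<Delta> G"
  shows "real (max_irredundant_base \<Delta> G) \<le> log 2 (real (card \<Delta>)) + 1"
proof -
  have pp: "primitive_perm_group \<Delta> G" and sol: "solvable ((BijGroup \<Delta>)\<lparr>carrier := G\<rparr>)"
    using assms by (simp_all add: primitive_soluble_def)
  then have pg: "perm_group \<Delta> G" by (simp add: primitive_perm_group_def)
  interpret set_act "(BijGroup \<Delta>)\<lparr>carrier := G\<rparr>" \<Delta> "\<lambda>g. g" by (rule perm_group_set_act[OF pg])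
  have "card \<Delta> \<noteq> 0" using pg by (simp add: perm_group_def)
  then have c1: "1 \<le> card \<Delta>" by linarith
  obtain \<delta> where \<delta>: "irredundant \<Delta> G \<delta>" "length \<delta> = max_irredundant_base \<Delta> G"
    using max_irredundant_base_attained[OF pg] by blast
  show ?thesis
  proof (cases "\<delta> = []")
    case True
    then show ?thesis using \<delta> c1 by simp
  next
    case False
    have "2 ^ (length \<delta> - 1) \<le> card \<Delta>"
      using primitive_irred_seq_length[OF _ sol _ False] pp \<delta>(1)
      by (simp add: primitive_perm_group_iff[OF pg] irredundant_iff_irred_seq[OF pg])
    then have "(2::real) ^ (length \<delta> - 1) \<le> real (card \<Delta>)"
      by (metis of_nat_le_iff of_nat_numeral of_nat_power)
    then have "log 2 (2 ^ (length \<delta> - 1)) \<le> log 2 (real (card \<Delta>))" using c1 by (intro log_mono) auto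
    then have "real (length \<delta> - 1) \<le> log 2 (real (card \<Delta>))" by simp
    then show ?thesis using \<delta>(2) False by (simp add: of_nat_diff Suc_le_eq)
  qed
qed

section \<open>Renaming the points of a permutation group\<close>

definition transport_map :: "('a \<Rightarrow> 'b) \<Rightarrow> 'a set \<Rightarrow> ('a \<Rightarrow> 'a) \<Rightarrow> 'b \<Rightarrow> 'b" where
  "transport_map \<phi> \<Delta> g = (\<lambda>y\<in>\<phi> ` \<Delta>. \<phi> (g (inv_into \<Delta> \<phi> y)))"

lemma transport_eq: "transport \<phi> \<Delta> G = transport_map \<phi> \<Delta> ` G"
  by (simp add: transport_def transport_map_def)

lemma transport_map_apply:
  "inj_on \<phi> \<Delta> \<Longrightarrow> x \<in> \<Delta> \<Longrightarrow> transport_map \<phi> \<Delta> g (\<phi> x) = \<phi> (g x)"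
  by (simp add: transport_map_def)

lemma transport_hom:
  assumes pg: "perm_group \<Delta> G" and inj: "inj_on \<phi> \<Delta>"
  shows "group_hom ((BijGroup \<Delta>)\<lparr>carrier := G\<rparr>) (BijGroup (\<phi> ` \<Delta>)) (transport_map \<phi> \<Delta>)"
    "inj_on (transport_map \<phi> \<Delta>) G"
proof -
  interpret set_act "(BijGroup \<Delta>)\<lparr>carrier := G\<rparr>" \<Delta> "\<lambda>g. g" by (rule perm_group_set_act[OF pg])
  have sub: "subgroup G (BijGroup \<Delta>)" using pg by (simp add: perm_group_def)
  have GB: "g \<in> Bij \<Delta>" if "g \<in> G" for g
    using subgroup.mem_carrier[OF sub that] by (simp add: BijGroup_def)
  have Gc: "g x \<in> \<Delta>" if "g \<in> G" "x \<in> \<Delta>" for g x using act_closed that by simp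
  note t = transport_map_apply[OF inj]
  have TB: "transport_map \<phi> \<Delta> g \<in> Bij (\<phi> ` \<Delta>)" if g: "g \<in> G" for g
  proof -
    have "bij_betw g \<Delta> \<Delta>" using GB[OF g] by (simp add: Bij_def)
    moreover have "bij_betw \<phi> \<Delta> (\<phi> ` \<Delta>)" using inj by (simp add: bij_betw_def)
    moreover have "bij_betw (inv_into \<Delta> \<phi>) (\<phi> ` \<Delta>) \<Delta>" using calculation(2) by (rule bij_betw_inv_into)
    ultimately have "bij_betw (\<phi> \<circ> g \<circ> inv_into \<Delta> \<phi>) (\<phi> ` \<Delta>) (\<phi> ` \<Delta>)"
      by (metis bij_betw_trans)
    then have "bij_betw (transport_map \<phi> \<Delta> g) (\<phi> ` \<Delta>) (\<phi> ` \<Delta>)"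
      by (rule bij_betw_cong[THEN iffD1, rotated]) (simp add: transport_map_def)
    then show ?thesis by (simp add: Bij_def transport_map_def)
  qed
  have "transport_map \<phi> \<Delta> (g \<otimes>\<^bsub>BijGroup \<Delta>\<^esub> h)
      = transport_map \<phi> \<Delta> g \<otimes>\<^bsub>BijGroup (\<phi> ` \<Delta>)\<^esub> transport_map \<phi> \<Delta> h" if "g \<in> G" "h \<in> G" for g h
  proof (rule extensionalityI[where A = "\<phi> ` \<Delta>"])
    fix y assume "y \<in> \<phi> ` \<Delta>"
    then obtain x where x: "x \<in> \<Delta>" "y = \<phi> x" by auto
    then show "transport_map \<phi> \<Delta> (g \<otimes>\<^bsub>BijGroup \<Delta>\<^esub> h) y
      = (transport_map \<phi> \<Delta> g \<otimes>\<^bsub>BijGroup (\<phi> ` \<Delta>)\<^esub> transport_map \<phi> \<Delta> h) y"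
      using that GB TB Gc by (simp add: BijGroup_def compose_eq t)
  qed (use that TB in \<open>auto simp: transport_map_def BijGroup_def\<close>)
  then show "group_hom ((BijGroup \<Delta>)\<lparr>carrier := G\<rparr>) (BijGroup (\<phi> ` \<Delta>)) (transport_map \<phi> \<Delta>)"
    using TB is_group group_BijGroup
    by (simp add: group_hom_def group_hom_axioms_def hom_def) (auto simp: BijGroup_def)
  show "inj_on (transport_map \<phi> \<Delta>) G"
  proof (rule inj_onI)
    fix g h assume g: "g \<in> G" and h: "h \<in> G" and eq: "transport_map \<phi> \<Delta> g = transport_map \<phi> \<Delta> h"
    show "g = h"
    proof (rule extensionalityI[where A = \<Delta>])
      fix x assume x: "x \<in> \<Delta>"
      then have "\<phi> (g x) = \<phi> (h x)" using t[OF x, of g] t[OF x, of h] eq by simp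
      then show "g x = h x" using inj_onD[OF inj] Gc g h x by blast
    qed (use GB g h in \<open>auto simp: Bij_def\<close>)
  qed
qed

lemma transport_solvable:
  assumes pg: "perm_group \<Delta> G" and inj: "inj_on \<phi> \<Delta>" and sol: "solvable ((BijGroup \<Delta>)\<lparr>carrier := G\<rparr>)"
  shows "subgroup (transport \<phi> \<Delta> G) (BijGroup (\<phi> ` \<Delta>))"
    "solvable ((BijGroup (\<phi> ` \<Delta>))\<lparr>carrier := transport \<phi> \<Delta> G\<rparr>)"
proof -
  interpret t: group_hom "(BijGroup \<Delta>)\<lparr>carrier := G\<rparr>" "BijGroup (\<phi> ` \<Delta>)" "transport_map \<phi> \<Delta>"
    by (rule transport_hom(1)[OF pg inj])
  show sub: "subgroup (transport \<phi> \<Delta> G) (BijGroup (\<phi> ` \<Delta>))"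
    using t.img_is_subgroup by (simp add: transport_eq)
  interpret s: group_hom "(BijGroup \<Delta>)\<lparr>carrier := G\<rparr>"
    "(BijGroup (\<phi> ` \<Delta>))\<lparr>carrier := transport \<phi> \<Delta> G\<rparr>" "transport_map \<phi> \<Delta>"
    using group.subgroup_imp_group[OF group_BijGroup sub] t.G.is_group t.hom_mult
    by (auto simp: group_hom_def group_hom_axioms_def hom_def transport_eq)
  show "solvable ((BijGroup (\<phi> ` \<Delta>))\<lparr>carrier := transport \<phi> \<Delta> G\<rparr>)"
    by (rule s.surj_hom_imp_solvable[OF _ sol]) (simp add: transport_eq)
qed

section \<open>Linear groups over the prime field as actions on a finite abelian group\<close>

lemma card_vec_space: "card (carrier (vec_space p d)) = p ^ d"
  by (simp add: vec_space_def card_PiE residue_ring_def)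

lemma finite_vec_space: "finite (carrier (vec_space p d))"
  by (auto simp: vec_space_def residue_ring_def intro!: finite_PiE)

lemma vec_space_abelian_group:
  "Factorial_Ring.prime p \<Longrightarrow> abelian_group (vec_space p d)"
  using vec_space_module by (auto simp: module_def)

lemma vec_space_one_smult:
  assumes "Factorial_Ring.prime p" "x \<in> carrier (vec_space p d)"
  shows "1 \<odot>\<^bsub>vec_space p d\<^esub> x = x" "0 \<odot>\<^bsub>vec_space p d\<^esub> x = \<zero>\<^bsub>vec_space p d\<^esub>"
proof -
  interpret M: Module.module "residue_ring (int p)" "vec_space p d" by (rule vec_space_module[OF assms(1)])
  have "1 = \<one>\<^bsub>residue_ring (int p)\<^esub>" "0 = \<zero>\<^bsub>residue_ring (int p)\<^esub>" by (simp_all add: residue_ring_def)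
  then show "1 \<odot>\<^bsub>vec_space p d\<^esub> x = x" "0 \<odot>\<^bsub>vec_space p d\<^esub> x = \<zero>\<^bsub>vec_space p d\<^esub>"
    using assms(2) M.smult_one M.smult_l_null by metis+
qed

text \<open>Over a prime field every scalar is a sum of ones, so additive subgroups are subspaces.\<close>

lemma additive_subgroup_subspace:
  assumes p: "Factorial_Ring.prime p" and W: "W \<subseteq> carrier (vec_space p d)" "\<zero>\<^bsub>vec_space p d\<^esub> \<in> W"
    and diff: "\<And>u v. u \<in> W \<Longrightarrow> v \<in> W \<Longrightarrow> u \<ominus>\<^bsub>vec_space p d\<^esub> v \<in> W"
  shows "subspace_of p d W"
proof -
  interpret M: Module.module "residue_ring (int p)" "vec_space p d" by (rule vec_space_module[OF p])
  interpret R: residues "int p" "residue_ring (int p)"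
    by unfold_locales (use p prime_gt_1_nat in auto)
  have neg: "\<ominus>\<^bsub>vec_space p d\<^esub> u \<in> W" if "u \<in> W" for u
    using diff[OF W(2) that] that W(1) by (simp add: a_minus_def subset_iff)
  have add: "u \<oplus>\<^bsub>vec_space p d\<^esub> v \<in> W" if "u \<in> W" "v \<in> W" for u v
    using diff[OF that(1) neg[OF that(2)]] that W(1) by (simp add: a_minus_def M.minus_minus subset_iff)
  have sm: "int n \<odot>\<^bsub>vec_space p d\<^esub> x \<in> W" if "x \<in> W" "n < p" for n x
    using that(2)
  proof (induct n)
    case 0
    then show ?case using vec_space_one_smult(2)[OF p, of x d] W that by (simp add: subset_iff)
  next
    case (Suc n)
    have xc: "x \<in> carrier (vec_space p d)" using that W by auto
    have "int (Suc n) = int n \<oplus>\<^bsub>residue_ring (int p)\<^esub> 1"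
      using Suc(2) by (simp add: residue_ring_def)
    moreover have "int n \<in> carrier (residue_ring (int p))" "1 \<in> carrier (residue_ring (int p))"
      using Suc(2) prime_gt_1_nat[OF p] by (auto simp: residue_ring_def)
    ultimately have "int (Suc n) \<odot>\<^bsub>vec_space p d\<^esub> x = int n \<odot>\<^bsub>vec_space p d\<^esub> x \<oplus>\<^bsub>vec_space p d\<^esub> x"
      using M.smult_l_distr[of "int n" 1 x] xc vec_space_one_smult(1)[OF p xc] by simp
    then show ?case using Suc add that(1) by simp
  qed
  show ?thesis
  proof (rule M.submoduleI[OF W(1,2) neg add])
    fix a x assume a: "a \<in> carrier (residue_ring (int p))" and x: "x \<in> W"
    have "a = int (nat a)" "nat a < p" using a by (auto simp: residue_ring_def)
    then show "a \<odot>\<^bsub>vec_space p d\<^esub> x \<in> W" using sm[OF x, of "nat a"] by simp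
  qed
qed

lemma GL_D:
  assumes "h \<in> GL p d"
  shows "h \<in> Bij (carrier (vec_space p d))" "\<And>x. x \<in> carrier (vec_space p d) \<Longrightarrow> h x \<in> carrier (vec_space p d)"
    "\<And>x y. x \<in> carrier (vec_space p d) \<Longrightarrow> y \<in> carrier (vec_space p d) \<Longrightarrow>
      h (x \<oplus>\<^bsub>vec_space p d\<^esub> y) = h x \<oplus>\<^bsub>vec_space p d\<^esub> h y"
  using assms Bij_imp_funcset[of h] by (auto simp: GL_def)

lemma linear_group_lin_act:
  assumes p: "Factorial_Ring.prime p" and H: "subgroup H (BijGroup (carrier (vec_space p d)))" "H \<subseteq> GL p d"
  shows "lin_act ((BijGroup (carrier (vec_space p d)))\<lparr>carrier := H\<rparr>) (vec_space p d) (\<lambda>g. g)"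
proof -
  have "carrier (vec_space p d) \<noteq> {}"
    using abelian_groupE(2)[OF vec_space_abelian_group[OF p, of d]] by blast
  then have "perm_group (carrier (vec_space p d)) H"
    using H finite_vec_space by (simp add: perm_group_def)
  then show ?thesis
    unfolding lin_act_def lin_act_axioms_def
    using perm_group_set_act vec_space_abelian_group[OF p] H(2) GL_D(3) by auto
qed

text \<open>Primitivity excludes systems of imprimitivity, so the field case applies and gives
  \<open>c^3 \<le> k^3 m^19\<close>. From \<open>2^k \<le> |span|\<close> and
  \<open>|V| = |span|^m\<close> follows \<open>k m \<le> log |V|\<close>, and a cube root gives the
  exponent 19/3.\<close>

lemma primitive_linear_stabilizer_bound:
  assumes p: "Factorial_Ring.prime p" and d: "1 \<le> d" and H: "primitive_linear p d H"
    and sol: "solvable ((BijGroup (carrier (vec_space p d)))\<lparr>carrier := H\<rparr>)"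
    and w: "w \<in> carrier (vec_space p d)" "w \<noteq> \<zero>\<^bsub>vec_space p d\<^esub>"
  shows "real (card {h \<in> H. h w = w}) \<le> log 2 (real (p ^ d)) powr (19 / 3)"
proof -
  let ?V = "vec_space p d"
  let ?G = "(BijGroup (carrier ?V))\<lparr>carrier := H\<rparr>"
  have irrl: "irreducible_linear p d H" and prim: "\<not> imprimitive_linear p d H"
    using H by (simp_all add: primitive_linear_def)
  have Hs: "subgroup H (BijGroup (carrier ?V))" "H \<subseteq> GL p d" using irrl by (simp_all add: irreducible_linear_def)
  interpret L: lin_act ?G ?V "\<lambda>g. g" by (rule linear_group_lin_act[OF p Hs])
  have irr: L.irreducible unfolding L.irreducible_def
  proof (intro conjI allI impI)
    show "carrier ?V \<noteq> {\<zero>\<^bsub>?V\<^esub>}" using w by auto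
    fix W assume "W \<subseteq> carrier ?V \<and> \<zero>\<^bsub>?V\<^esub> \<in> W \<and> (\<forall>u\<in>W. \<forall>v\<in>W. u \<ominus>\<^bsub>?V\<^esub> v \<in> W) \<and>
      (\<forall>g\<in>carrier ?G. \<forall>w\<in>W. g w \<in> W)"
    then have "subspace_of p d W" "\<forall>h\<in>H. h ` W \<subseteq> W"
      by (auto intro!: additive_subgroup_subspace[OF p])
    then show "W = {\<zero>\<^bsub>?V\<^esub>} \<or> W = carrier ?V" using irrl by (simp add: irreducible_linear_def)
  qed
  \<comment> \<open>Enumerating the set of summands turns a system of imprimitivity into a
    decomposition indexed by numbers, as in the definition of imprimitivity.\<close>
  have no_system: "\<not> (L.imprimitivity_system S \<and> 2 \<le> card S)" for S
  proof
    assume S: "L.imprimitivity_system S \<and> 2 \<le> card S"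
    note D = L.imprimitivityD[OF conjunct1[OF S]]
    define k where "k = card S"
    obtain e where e: "bij_betw e {..<k} S"
      using ex_bij_betw_nat_finite[OF D(1)] by (auto simp: k_def atLeast0LessThan)
    have eS: "e i \<in> S" if "i < k" for i using e that by (auto dest: bij_betwE)
    have Sc: "U \<subseteq> carrier ?V" if "U \<in> S" for U using D(2)[OF that] by (simp add: L.vsub_def)
    define i' where "i' = inv_into {..<k} e"
    have i': "i' U < k" "e (i' U) = U" if "U \<in> S" for U
    proof -
      have "i' U \<in> {..<k}" unfolding i'_def by (rule inv_into_into) (use e that in \<open>simp add: bij_betw_def\<close>)
      then show "i' U < k" by simp
      show "e (i' U) = U" unfolding i'_def using e that by (simp add: bij_betw_inv_into_right)
    qed
    have i'e: "i' (e i) = i" if "i < k" for i unfolding i'_def using e that by (simp add: bij_betw_inv_into_left)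
    have "direct_sum_decomposition p d k e" unfolding direct_sum_decomposition_def
    proof (intro conjI allI impI)
      fix i assume i: "i < k"
      show "subspace_of p d (e i)"
        using D(2)[OF eS[OF i]] by (intro additive_subgroup_subspace[OF p]) (auto simp: L.vsub_def)
      show "e i \<noteq> {\<zero>\<^bsub>?V\<^esub>}" by (rule D(3)[OF eS[OF i]])
    next
      define \<Psi> where "\<Psi> w = (\<lambda>U\<in>S. w (i' U))" for w :: "nat \<Rightarrow> nat \<Rightarrow> int"
      have b1: "bij_betw \<Psi> (\<Pi>\<^sub>E i\<in>{..<k}. e i) (\<Pi>\<^sub>E U\<in>S. U)"
      proof (rule bij_betwI[where g = "\<lambda>u. \<lambda>i\<in>{..<k}. u (e i)"])
        show "\<Psi> \<in> (\<Pi>\<^sub>E i\<in>{..<k}. e i) \<rightarrow> (\<Pi>\<^sub>E U\<in>S. U)"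
        proof
          fix w assume w: "w \<in> (\<Pi>\<^sub>E i\<in>{..<k}. e i)"
          have "w (i' U) \<in> U" if "U \<in> S" for U using PiE_mem[OF w, of "i' U"] i'[OF that] by simp
          then show "\<Psi> w \<in> (\<Pi>\<^sub>E U\<in>S. U)" by (simp add: \<Psi>_def)
        qed
        show "(\<lambda>u. \<lambda>i\<in>{..<k}. u (e i)) \<in> (\<Pi>\<^sub>E U\<in>S. U) \<rightarrow> (\<Pi>\<^sub>E i\<in>{..<k}. e i)"
          using eS by (auto dest: PiE_mem)
        show "(\<lambda>i\<in>{..<k}. \<Psi> w (e i)) = w" if "w \<in> (\<Pi>\<^sub>E i\<in>{..<k}. e i)" for w
          by (rule extensionalityI[where A = "{..<k}"]) (use that eS i'e in \<open>auto simp: \<Psi>_def PiE_def\<close>)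
        show "\<Psi> (\<lambda>i\<in>{..<k}. u (e i)) = u" if "u \<in> (\<Pi>\<^sub>E U\<in>S. U)" for u
          by (rule extensionalityI[where A = S]) (use that i' in \<open>auto simp: \<Psi>_def PiE_def\<close>)
      qed
      have "bij_betw ((\<lambda>u. \<Oplus>\<^bsub>?V\<^esub>U\<in>S. u U) \<circ> \<Psi>) (\<Pi>\<^sub>E i\<in>{..<k}. e i) (carrier ?V)"
        by (rule bij_betw_trans[OF b1 D(6)])
      then show "bij_betw (\<lambda>w. \<Oplus>\<^bsub>?V\<^esub>i\<in>{..<k}. w i) (\<Pi>\<^sub>E i\<in>{..<k}. e i) (carrier ?V)"
      proof (rule bij_betw_cong[THEN iffD1, rotated])
        fix w assume w: "w \<in> (\<Pi>\<^sub>E i\<in>{..<k}. e i)"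
        have wc: "w i \<in> carrier ?V" if "i < k" for i using PiE_mem[OF w, of i] Sc[OF eS[OF that]] that by auto
        have im: "e ` {..<k} = S" using e by (simp add: bij_betw_def)
        have "(\<Oplus>\<^bsub>?V\<^esub>U\<in>e ` {..<k}. \<Psi> w U) = (\<Oplus>\<^bsub>?V\<^esub>i\<in>{..<k}. \<Psi> w (e i))"
          using e wc i' im by (intro L.V.finsum_reindex) (auto simp: bij_betw_def \<Psi>_def)
        also have "\<dots> = (\<Oplus>\<^bsub>?V\<^esub>i\<in>{..<k}. w i)"
          using wc eS i'e by (intro L.V.finsum_cong') (auto simp: \<Psi>_def)
        finally show "((\<lambda>u. \<Oplus>\<^bsub>?V\<^esub>U\<in>S. u U) \<circ> \<Psi>) w = (\<Oplus>\<^bsub>?V\<^esub>i\<in>{..<k}. w i)" by (simp add: im)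
      qed
    qed
    moreover have "\<forall>h\<in>H. \<forall>i<k. \<exists>j<k. h ` e i = e j"
    proof (intro ballI allI impI)
      fix h i assume "h \<in> H" "i < k"
      then have "h ` e i \<in> S" using D(4)[of h "e i"] eS by simp
      then show "\<exists>j<k. h ` e i = e j" using i' by metis
    qed
    ultimately have "imprimitive_linear p d H"
      unfolding imprimitive_linear_def using irrl S k_def by blast
    then show False using prim by simp
  qed
  obtain A where A: "A \<lhd> ?G" "\<forall>a\<in>A. \<forall>b\<in>A. a \<otimes>\<^bsub>?G\<^esub> b = b \<otimes>\<^bsub>?G\<^esub> a"
    "\<forall>N. N \<lhd> ?G \<longrightarrow> A \<subseteq> N \<longrightarrow> (\<forall>x\<in>N. \<forall>y\<in>N. x \<otimes>\<^bsub>?G\<^esub> y = y \<otimes>\<^bsub>?G\<^esub> x) \<longrightarrow> N = A"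
    by (rule L.maximal_abelian_normal)
  have faithful: "g = \<one>\<^bsub>?G\<^esub>" if g: "g \<in> carrier ?G" and fx: "\<And>v. v \<in> carrier ?V \<Longrightarrow> g v = v" for g
  proof -
    have "g \<in> extensional (carrier ?V)" using g GL_D(1)[of g p d] Hs(2) by (auto simp: Bij_def)
    then have "g = (\<lambda>v\<in>carrier ?V. v)" using fx by (intro extensionalityI[where A = "carrier ?V"]) auto
    then show ?thesis by (simp add: BijGroup_def)
  qed
  have la: "lin_abel ?G ?V (\<lambda>g. g) A"
    using faithful irr A(1,2) L.lin_act_axioms
    unfolding lin_abel_def lin_abel_axioms_def L.irreducible_def by blast
  interpret A: lin_abel ?G ?V "\<lambda>g. g" A by (rule la)
  have "A.span_field" using A.field_or_imprimitive[OF irr] no_system by blast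
  then interpret M: lin_max ?G ?V "\<lambda>g. g" A
    using A(3) sol irr_bound by unfold_locales blast+
  obtain m k where mk: "card (carrier ?V) = card A.span ^ m" "1 \<le> m" "2 ^ k \<le> card A.span"
    and b: "\<forall>v\<in>carrier ?V. v \<noteq> \<zero>\<^bsub>?V\<^esub> \<longrightarrow> card (L.fixer {v}) ^ 3 \<le> k ^ 3 * m ^ 19"
    by (rule M.field_case_bound)
  define c where "c = card {h \<in> H. h w = w}"
  have "L.fixer {w} = {h \<in> H. h w = w}" by (auto simp: L.fixer_def)
  then have c: "c ^ 3 \<le> k ^ 3 * m ^ 19" using bspec[OF b w(1)] w(2) by (simp add: c_def)
  have "\<one>\<^bsub>?G\<^esub> \<in> L.fixer {w}" using w by (intro subgroup.one_closed L.subgroup_fixer) simp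
  moreover have "finite (L.fixer {w})"
    by (rule finite_subset[OF _ L.finite_carrier]) (auto simp: L.fixer_def)
  ultimately have "card (L.fixer {w}) \<noteq> 0" by auto
  then have c0: "c > 0" using \<open>L.fixer {w} = {h \<in> H. h w = w}\<close> by (simp add: c_def)
  have k1: "1 \<le> k"
  proof (rule ccontr)
    assume "\<not> 1 \<le> k"
    then have "k = 0" by simp
    then have "c ^ 3 \<le> 0" using c by simp
    then show False using c0 by simp
  qed
  \<comment> \<open>Raising the exponent of \<open>k\<close> to 19, which needs
    \<open>k \<ge> 1\<close>, makes the right side a power of \<open>k m\<close> alone.\<close>
  have "c ^ 3 \<le> k ^ 19 * m ^ 19"
  proof -
    have "k ^ 3 \<le> k ^ 19" using k1 by (intro power_increasing) auto
    then show ?thesis using c by (meson mult_le_mono1 order_trans)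
  qed
  then have "c ^ 3 \<le> (k * m) ^ 19" by (simp add: power_mult_distrib)
  then have "real (c ^ 3) \<le> real ((k * m) ^ 19)" by (simp only: of_nat_le_iff)
  moreover have "real (k * m) \<le> log 2 (real (p ^ d))"
  proof -
    have "2 ^ (k * m) \<le> p ^ d"
      using power_mono[OF mk(3), of m] mk(1) by (simp add: power_mult card_vec_space)
    then have "(2::real) ^ (k * m) \<le> real (p ^ d)" by (metis of_nat_le_iff of_nat_numeral of_nat_power)
    then have "log 2 (2 ^ (k * m)) \<le> log 2 (real (p ^ d))" using prime_gt_0_nat[OF p] by (intro log_mono) auto
    then show ?thesis by simp
  qed
  then have "real (k * m) ^ 19 \<le> log 2 (real (p ^ d)) ^ 19" by (intro power_mono) auto
  ultimately have "real c ^ 3 \<le> log 2 (real (p ^ d)) ^ 19" by simp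
  have lpos: "0 < log 2 (real (p ^ d))"
  proof -
    have "1 * 1 \<le> k * m" using k1 mk(2) by (rule mult_le_mono)
    then have "real (1 * 1) \<le> real (k * m)" by (simp only: of_nat_le_iff)
    then have "1 \<le> real (k * m)" by simp
    then show ?thesis using \<open>real (k * m) \<le> log 2 (real (p ^ d))\<close> by linarith
  qed
  have root: "(x ^ n) powr (1 / 3) = x powr (real n * (1 / 3))" if "x > 0" for x :: real and n
    by (simp only: powr_realpow[OF that, symmetric] powr_powr)
  have "real c = (real c ^ 3) powr (1 / 3)"
    using root[of "real c" 3] c0 by simp
  also have "\<dots> \<le> (log 2 (real (p ^ d)) ^ 19) powr (1 / 3)"
    using \<open>real c ^ 3 \<le> log 2 (real (p ^ d)) ^ 19\<close> by (intro powr_mono2) auto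
  also have "\<dots> = log 2 (real (p ^ d)) powr (19 / 3)"
    unfolding root[OF lpos] by simp
  finally show ?thesis by (simp add: c_def)
qed

text \<open>An affine map fixing \<open>a\<close> and \<open>b\<close> has a linear part fixing the
  difference \<open>w = b - a\<close>, and its translation part is determined by the linear part and
  \<open>a\<close>. So taking linear parts is injective on the stabiliser of two points.\<close>

lemma two_point_stabilizer_le:
  assumes pg: "perm_group \<Delta> G" and aff: "affine_identification \<Delta> G p d \<phi>"
    and x: "x \<in> \<Delta>" and y: "y \<in> \<Delta>" and xy: "x \<noteq> y"
  obtains w where "w \<in> carrier (vec_space p d)" "w \<noteq> \<zero>\<^bsub>vec_space p d\<^esub>"
    "card {g \<in> G. g x = x \<and> g y = y}
      \<le> card {h \<in> pointwise_stab (transport \<phi> \<Delta> G) [\<zero>\<^bsub>vec_space p d\<^esub>]. h w = w}"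
proof -
  let ?V = "vec_space p d"
  have p: "Factorial_Ring.prime p" and bij: "bij_betw \<phi> \<Delta> (carrier ?V)"
    and AG: "transport \<phi> \<Delta> G \<subseteq> AGL p d" and TG: "translation_maps p d \<subseteq> transport \<phi> \<Delta> G"
    and irr: "irreducible_linear p d (pointwise_stab (transport \<phi> \<Delta> G) [\<zero>\<^bsub>?V\<^esub>])"
    using aff by (simp_all add: affine_identification_def)
  have inj: "inj_on \<phi> \<Delta>" and im: "\<phi> ` \<Delta> = carrier ?V" using bij by (simp_all add: bij_betw_def)
  interpret V: abelian_group ?V by (rule vec_space_abelian_group[OF p])
  interpret S: set_act "(BijGroup \<Delta>)\<lparr>carrier := G\<rparr>" \<Delta> "\<lambda>g. g" by (rule perm_group_set_act[OF pg])
  interpret t: group_hom "(BijGroup \<Delta>)\<lparr>carrier := G\<rparr>" "BijGroup (\<phi> ` \<Delta>)" "transport_map \<phi> \<Delta>"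
    by (rule transport_hom(1)[OF pg inj])
  let ?t = "transport_map \<phi> \<Delta>"
  note tap = transport_map_apply[OF inj]
  define a b w where "a = \<phi> x" and "b = \<phi> y" and "w = b \<ominus>\<^bsub>?V\<^esub> a"
  have ab: "a \<in> carrier ?V" "b \<in> carrier ?V" using x y im by (auto simp: a_def b_def)
  have wc: "w \<in> carrier ?V" using ab by (simp add: w_def)
  have w0: "w \<noteq> \<zero>\<^bsub>?V\<^esub>"
    using ab inj_onD[OF inj, of y x] x y xy by (auto simp: w_def V.diff_eq_zero_iff a_def b_def)
  define H where "H = pointwise_stab (transport \<phi> \<Delta> G) [\<zero>\<^bsub>?V\<^esub>]"
  define F where "F = {g \<in> G. g x = x \<and> g y = y}"
  have ex: "\<exists>h. h \<in> H \<and> h w = w \<and> (\<forall>z\<in>carrier ?V. ?t g z = h z \<oplus>\<^bsub>?V\<^esub> (a \<ominus>\<^bsub>?V\<^esub> h a))" if g: "g \<in> F" for g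
  proof -
    have gG: "g \<in> G" using g by (simp add: F_def)
    have tab: "?t g a = a" "?t g b = b" using tap x y g by (simp_all add: a_def b_def F_def)
    have "?t g \<in> AGL p d" using gG AG by (auto simp: transport_eq)
    then obtain h v where h: "h \<in> GL p d" and v: "v \<in> carrier ?V"
      and tg: "?t g = (\<lambda>z\<in>carrier ?V. h z \<oplus>\<^bsub>?V\<^esub> v)" by (auto simp: AGL_def)
    note hD = GL_D[OF h]
    have hendo: "V.endo h" using hD by (simp add: V.endo_def)
    have e: "a = h a \<oplus>\<^bsub>?V\<^esub> v" "b = h b \<oplus>\<^bsub>?V\<^esub> v" using tab ab by (simp_all add: tg)
    have va: "v = a \<ominus>\<^bsub>?V\<^esub> h a"
    proof -
      have "h a \<oplus>\<^bsub>?V\<^esub> v = \<zero>\<^bsub>?V\<^esub> \<oplus>\<^bsub>?V\<^esub> a" using e(1) ab by simp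
      then have "v \<ominus>\<^bsub>?V\<^esub> a = \<zero>\<^bsub>?V\<^esub> \<ominus>\<^bsub>?V\<^esub> h a" using ab v hD(2) by (intro V.diff_eq_diffI) auto
      then have m: "v \<ominus>\<^bsub>?V\<^esub> a = \<ominus>\<^bsub>?V\<^esub> h a" using ab hD(2) by (simp add: a_minus_def)
      have "v = (v \<ominus>\<^bsub>?V\<^esub> a) \<oplus>\<^bsub>?V\<^esub> a" using ab v by (simp add: a_minus_def V.a_assoc V.l_neg)
      also have "\<dots> = a \<ominus>\<^bsub>?V\<^esub> h a" unfolding m using ab hD(2) by (simp add: a_minus_def V.a_comm)
      finally show ?thesis .
    qed
    have hw: "h w = w"
    proof -
      have "b \<ominus>\<^bsub>?V\<^esub> a = (h b \<oplus>\<^bsub>?V\<^esub> v) \<ominus>\<^bsub>?V\<^esub> (h a \<oplus>\<^bsub>?V\<^esub> v)" using e by simp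
      also have "\<dots> = (h b \<ominus>\<^bsub>?V\<^esub> h a) \<oplus>\<^bsub>?V\<^esub> (v \<ominus>\<^bsub>?V\<^esub> v)" using ab v hD(2) by (intro V.diff_add_diff) auto
      also have "v \<ominus>\<^bsub>?V\<^esub> v = \<zero>\<^bsub>?V\<^esub>" using v by (simp add: V.diff_eq_zero_iff)
      finally show ?thesis using V.endo_diff[OF hendo ab(2,1)] ab hD(2) by (simp add: w_def)
    qed
    \<comment> \<open>The group contains all translations; composing with the one by
      \<open>-v\<close> shows that the linear part itself belongs to the point stabiliser
      \<open>H\<close>.\<close>
    have "(\<lambda>z\<in>carrier ?V. z \<oplus>\<^bsub>?V\<^esub> (\<ominus>\<^bsub>?V\<^esub> v)) \<in> transport \<phi> \<Delta> G"
      by (rule subsetD[OF TG]) (use V.a_inv_closed[OF v] in \<open>unfold translation_maps_def, blast\<close>)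
    then obtain g0 where g0: "g0 \<in> G" "?t g0 = (\<lambda>z\<in>carrier ?V. z \<oplus>\<^bsub>?V\<^esub> (\<ominus>\<^bsub>?V\<^esub> v))"
      by (auto simp: transport_eq)
    have prod: "g0 \<otimes>\<^bsub>BijGroup \<Delta>\<^esub> g \<in> G" using S.m_closed[of g0 g] g0(1) gG by simp
    have "?t (g0 \<otimes>\<^bsub>BijGroup \<Delta>\<^esub> g) = h"
    proof (rule extensionalityI[where A = "carrier ?V"])
      show "?t (g0 \<otimes>\<^bsub>BijGroup \<Delta>\<^esub> g) \<in> extensional (carrier ?V)" by (simp add: transport_map_def im)
      show "h \<in> extensional (carrier ?V)" using hD(1) by (simp add: Bij_def)
      fix z assume z: "z \<in> carrier ?V"
      then obtain u where u: "u \<in> \<Delta>" "z = \<phi> u" using im by auto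
      have gu: "g u \<in> \<Delta>" using S.act_closed[of g u] gG u by simp
      have "?t (g0 \<otimes>\<^bsub>BijGroup \<Delta>\<^esub> g) z = \<phi> (g0 (g u))"
        using S.act_mult[of g0 g u] g0(1) gG u by (simp add: tap)
      also have "\<dots> = ?t g0 (?t g z)" using u gu by (simp add: tap)
      also have "\<dots> = h z"
        using z v hD(2) by (simp add: g0(2) tg V.a_assoc V.r_neg)
      finally show "?t (g0 \<otimes>\<^bsub>BijGroup \<Delta>\<^esub> g) z = h z" .
    qed
    then have "h \<in> transport \<phi> \<Delta> G" using prod by (auto simp: transport_eq)
    then have "h \<in> H" using V.endo_zero[OF hendo] by (simp add: H_def pointwise_stab_def)
    moreover have "\<forall>z\<in>carrier ?V. ?t g z = h z \<oplus>\<^bsub>?V\<^esub> (a \<ominus>\<^bsub>?V\<^esub> h a)" by (simp add: tg va[symmetric])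
    ultimately show ?thesis using hw by blast
  qed
  then obtain \<eta> where \<eta>: "\<And>g. g \<in> F \<Longrightarrow> \<eta> g \<in> H \<and> \<eta> g w = w \<and>
      (\<forall>z\<in>carrier ?V. ?t g z = \<eta> g z \<oplus>\<^bsub>?V\<^esub> (a \<ominus>\<^bsub>?V\<^esub> \<eta> g a))" by metis
  have "inj_on \<eta> F"
  proof (rule inj_onI)
    fix g g' assume g: "g \<in> F" "g' \<in> F" and eq: "\<eta> g = \<eta> g'"
    have "?t g = ?t g'"
      by (rule extensionalityI[where A = "carrier ?V"]) (use \<eta>[OF g(1)] \<eta>[OF g(2)] eq in \<open>auto simp: transport_map_def im\<close>)
    then show "g = g'" using inj_onD[OF transport_hom(2)[OF pg inj]] g by (auto simp: F_def)
  qed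
  moreover have "\<eta> ` F \<subseteq> {h \<in> H. h w = w}" using \<eta> by auto
  moreover have "finite {h \<in> H. h w = w}"
  proof -
    have "finite (transport \<phi> \<Delta> G)" using S.finite_carrier by (simp add: transport_eq)
    then show ?thesis by (simp add: H_def pointwise_stab_def)
  qed
  ultimately have "card F \<le> card {h \<in> H. h w = w}" by (rule card_inj_on_le)
  then show ?thesis using that[OF wc w0] by (simp add: F_def H_def)
qed

text \<open>The first two points of the base account for the summand 2. Every further point halves
  the stabiliser, so their number is at most the logarithm of the order of a two-point
  stabiliser.\<close>

lemma basic_bound:
  assumes ps: "primitive_soluble \<Delta> G" and bas: "basic \<Delta> G"
  shows "real (max_irredundant_base \<Delta> G) \<le> 6.49 * log 2 (log 2 (real (card \<Delta>))) + 2"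
proof -
  have sol: "solvable ((BijGroup \<Delta>)\<lparr>carrier := G\<rparr>)" and pg: "perm_group \<Delta> G"
    using ps by (simp_all add: primitive_soluble_def primitive_perm_group_def)
  obtain p d \<phi> where aff: "affine_identification \<Delta> G p d \<phi>"
    and prim: "primitive_linear p d (pointwise_stab (transport \<phi> \<Delta> G) [\<zero>\<^bsub>vec_space p d\<^esub>])"
    using bas by (auto simp: basic_def)
  let ?V = "vec_space p d"
  define H where "H = pointwise_stab (transport \<phi> \<Delta> G) [\<zero>\<^bsub>?V\<^esub>]"
  have p: "Factorial_Ring.prime p" and d: "1 \<le> d" and bij: "bij_betw \<phi> \<Delta> (carrier ?V)"
    using aff by (simp_all add: affine_identification_def)
  have inj: "inj_on \<phi> \<Delta>" and im: "\<phi> ` \<Delta> = carrier ?V" using bij by (simp_all add: bij_betw_def)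
  have cD: "card \<Delta> = p ^ d" using bij_betw_same_card[OF bij] by (simp add: card_vec_space)
  have n2: "2 \<le> card \<Delta>"
  proof -
    have "p ^ 1 \<le> p ^ d" using d prime_gt_0_nat[OF p] by (intro power_increasing) auto
    then show ?thesis using prime_ge_2_nat[OF p] cD by simp
  qed
  define l where "l = log 2 (real (card \<Delta>))"
  \<comment> \<open>The degree is at least 2, so the double logarithm is non-negative; bases with
    fewer than two points then satisfy the bound trivially.\<close>
  have l1: "1 \<le> l"
  proof -
    have "log 2 2 \<le> l" unfolding l_def using n2 by (intro log_mono) auto
    then show ?thesis by simp
  qed
  then have ll: "0 \<le> log 2 l" by simp
  interpret S: set_act "(BijGroup \<Delta>)\<lparr>carrier := G\<rparr>" \<Delta> "\<lambda>g. g" by (rule perm_group_set_act[OF pg])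
  obtain \<delta> where \<delta>: "irredundant \<Delta> G \<delta>" "length \<delta> = max_irredundant_base \<Delta> G"
    using max_irredundant_base_attained[OF pg] by blast
  show ?thesis
  proof (cases "length \<delta> < 2")
    case True
    then show ?thesis using \<delta>(2) ll by (simp add: l_def)
  next
    case False
    have irs: "S.irred_seq \<delta>" using \<delta>(1) by (simp add: irredundant_iff_irred_seq[OF pg])
    then have sub: "set \<delta> \<subseteq> \<Delta>" by (simp add: S.irred_seq_def)
    define x y where "x = \<delta> ! 0" and "y = \<delta> ! 1"
    have "\<delta> ! 0 \<in> set \<delta>" "\<delta> ! 1 \<in> set \<delta>" by (rule nth_mem, use False in linarith)+
    then have xy: "x \<in> \<Delta>" "y \<in> \<Delta>" using sub by (auto simp: x_def y_def)
    have t2: "take 2 \<delta> = [x, y]" "take 1 \<delta> = [x]"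
      using False by (cases \<delta>; cases "tl \<delta>"; auto simp: x_def y_def)+
    have "S.fixer (set (take (Suc 1) \<delta>)) \<subset> S.fixer (set (take 1 \<delta>))"
    proof -
      have "1 < length \<delta>" using False by simp
      then show ?thesis by (rule irs[unfolded S.irred_seq_def, THEN conjunct2, rule_format])
    qed
    then have ne: "x \<noteq> y" using t2 by (auto simp: numeral_2_eq_2)
    obtain w where w: "w \<in> carrier ?V" "w \<noteq> \<zero>\<^bsub>?V\<^esub>"
      and cw: "card {g \<in> G. g x = x \<and> g y = y} \<le> card {h \<in> H. h w = w}"
      unfolding H_def by (rule two_point_stabilizer_le[OF pg aff xy ne])
    have Hsol: "solvable ((BijGroup (carrier ?V))\<lparr>carrier := H\<rparr>)"
    proof -
      note T = transport_solvable[OF pg inj sol, unfolded im]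
      interpret T: group "(BijGroup (carrier ?V))\<lparr>carrier := transport \<phi> \<Delta> G\<rparr>"
        using T(1) group_BijGroup by (rule group.subgroup_imp_group[rotated])
      have "subgroup H (BijGroup (carrier ?V))"
        using prim by (simp add: H_def primitive_linear_def irreducible_linear_def)
      moreover have "H \<subseteq> transport \<phi> \<Delta> G" by (auto simp: H_def pointwise_stab_def)
      ultimately have "subgroup H ((BijGroup (carrier ?V))\<lparr>carrier := transport \<phi> \<Delta> G\<rparr>)"
        using T(1) group_BijGroup by (intro group.subgroup_incl)
      from T.solvable_subgroup_group[OF T(2) this] show ?thesis by simp
    qed
    have "2 ^ (length \<delta> - 2) \<le> card (S.fixer (set (take 2 \<delta>)))"
      using False by (intro S.irred_seq_pow_le_card[OF irs]) simp
    also have "S.fixer (set (take 2 \<delta>)) = {g \<in> G. g x = x \<and> g y = y}"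
      by (auto simp: t2 S.fixer_def)
    finally have "2 ^ (length \<delta> - 2) \<le> card {h \<in> H. h w = w}" using cw by linarith
    then have "real (2 ^ (length \<delta> - 2)) \<le> real (card {h \<in> H. h w = w})" by (simp only: of_nat_le_iff)
    also have "\<dots> \<le> log 2 (real (p ^ d)) powr (19 / 3)"
      by (rule primitive_linear_stabilizer_bound[OF p d prim[folded H_def] Hsol w])
    finally have "2 ^ (length \<delta> - 2) \<le> l powr (19 / 3)" by (simp add: l_def cD)
    then have "log 2 (2 ^ (length \<delta> - 2)) \<le> log 2 (l powr (19 / 3))" by (intro log_mono) auto
    then have "real (length \<delta> - 2) \<le> 19 / 3 * log 2 l" using l1 by (simp add: log_powr)
    also have "\<dots> \<le> 6.49 * log 2 l" using ll by (intro mult_right_mono) auto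
    finally show ?thesis using False \<delta>(2) by (simp add: l_def of_nat_diff)
  qed
qed

section \<open>The examples\<close>

lemma BijGroup_mult_apply:
  "f \<in> Bij \<Delta> \<Longrightarrow> g \<in> Bij \<Delta> \<Longrightarrow> x \<in> \<Delta> \<Longrightarrow> (f \<otimes>\<^bsub>BijGroup \<Delta>\<^esub> g) x = f (g x)"
  by (simp add: BijGroup_def compose_def)

lemma finite_Bij: "finite \<Delta> \<Longrightarrow> finite (Bij \<Delta>)"
proof (rule finite_subset)
  show "Bij \<Delta> \<subseteq> \<Delta> \<rightarrow>\<^sub>E \<Delta>" by (auto simp: Bij_def PiE_def bij_betw_def)
  show "finite \<Delta> \<Longrightarrow> finite (\<Delta> \<rightarrow>\<^sub>E \<Delta>)" by (simp add: finite_PiE)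
qed

text \<open>In a finite group closure under products suffices: right multiplication by
  \<open>f\<close> permutes \<open>S\<close>, so it reaches the identity, and the preimage is the
  inverse of \<open>f\<close>.\<close>

lemma subgroup_BijGroupI:
  assumes fin: "finite \<Delta>" and S: "S \<subseteq> Bij \<Delta>" and one: "(\<lambda>x\<in>\<Delta>. x) \<in> S"
    and closed: "\<And>f g. f \<in> S \<Longrightarrow> g \<in> S \<Longrightarrow> compose \<Delta> f g \<in> S"
  shows "subgroup S (BijGroup \<Delta>)"
proof -
  interpret B: group "BijGroup \<Delta>" by (rule group_BijGroup)
  have Sc: "f \<in> carrier (BijGroup \<Delta>)" if "f \<in> S" for f using that S by (auto simp: BijGroup_def)
  have mult: "f \<otimes>\<^bsub>BijGroup \<Delta>\<^esub> g \<in> S" if "f \<in> S" "g \<in> S" for f g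
    using that closed[OF that] S by (simp add: BijGroup_def subset_iff)
  show ?thesis
  proof (rule B.subgroupI)
    show "S \<subseteq> carrier (BijGroup \<Delta>)" using Sc by blast
    show "S \<noteq> {}" using one by blast
    fix f assume f: "f \<in> S"
    have "inj_on (\<lambda>g. g \<otimes>\<^bsub>BijGroup \<Delta>\<^esub> f) S" 
    proof (rule inj_onI)
      fix g h assume "g \<in> S" "h \<in> S" "g \<otimes>\<^bsub>BijGroup \<Delta>\<^esub> f = h \<otimes>\<^bsub>BijGroup \<Delta>\<^esub> f"
      then show "g = h" using B.right_cancel[of f g h] Sc f by simp
    qed
    moreover have "(\<lambda>g. g \<otimes>\<^bsub>BijGroup \<Delta>\<^esub> f) ` S \<subseteq> S" using mult f by blast
    moreover have "finite S" using S finite_Bij[OF fin] finite_subset by blast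
    ultimately have "(\<lambda>g. g \<otimes>\<^bsub>BijGroup \<Delta>\<^esub> f) ` S = S" by (intro endo_inj_surj)
    moreover have "\<one>\<^bsub>BijGroup \<Delta>\<^esub> \<in> S" using one by (simp add: BijGroup_def)
    ultimately have "\<one>\<^bsub>BijGroup \<Delta>\<^esub> \<in> (\<lambda>g. g \<otimes>\<^bsub>BijGroup \<Delta>\<^esub> f) ` S" by simp
    then obtain g where g: "g \<in> S" "\<one>\<^bsub>BijGroup \<Delta>\<^esub> = g \<otimes>\<^bsub>BijGroup \<Delta>\<^esub> f" by (elim imageE)
    have "inv\<^bsub>BijGroup \<Delta>\<^esub> f = g" by (rule B.inv_equality[OF g(2)[symmetric] Sc[OF f] Sc[OF g(1)]])
    then show "inv\<^bsub>BijGroup \<Delta>\<^esub> f \<in> S" using g(1) by simp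
  qed (rule mult)
qed

lemma (in group) derived_subset:
  assumes H: "H \<subseteq> carrier G" and K: "subgroup K G"
    and c: "\<And>g h. g \<in> H \<Longrightarrow> h \<in> H \<Longrightarrow> \<exists>k\<in>K. g \<otimes> h = k \<otimes> (h \<otimes> g)"
  shows "derived G H \<subseteq> K"
  unfolding derived_def
proof (rule generate_subgroup_incl[OF _ K], clarify)
  fix g h assume gh: "g \<in> H" "h \<in> H"
  then have car: "g \<in> carrier G" "h \<in> carrier G" using H by auto
  obtain k where k: "k \<in> K" "g \<otimes> h = k \<otimes> (h \<otimes> g)" using c[OF gh] by blast
  have kc: "k \<in> carrier G" by (rule subgroup.mem_carrier[OF K k(1)])
  have "g \<otimes> h \<otimes> inv g \<otimes> inv h = k \<otimes> (h \<otimes> g) \<otimes> inv g \<otimes> inv h" using k by simp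
  also have "\<dots> = k" using car kc by (simp add: m_assoc)
  finally show "g \<otimes> h \<otimes> inv g \<otimes> inv h \<in> K" using k by simp
qed

text \<open>Both families of examples have derived length at most 3: translations, then a group of
  diagonal or scalar maps, then a cyclic group on top. The commutator condition is written as
  \<open>g h = k h g\<close> to avoid computing inverses of explicit maps.\<close>

lemma solvable_BijGroupI:
  assumes S0: "subgroup S0 (BijGroup \<Delta>)" and S1: "subgroup S1 (BijGroup \<Delta>)" and S2: "subgroup S2 (BijGroup \<Delta>)"
    and c0: "\<And>g h. g \<in> S0 \<Longrightarrow> h \<in> S0 \<Longrightarrow> \<exists>k\<in>S1. \<forall>x\<in>\<Delta>. g (h x) = k (h (g x))"
    and c1: "\<And>g h. g \<in> S1 \<Longrightarrow> h \<in> S1 \<Longrightarrow> \<exists>k\<in>S2. \<forall>x\<in>\<Delta>. g (h x) = k (h (g x))"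
    and c2: "\<And>g h x. g \<in> S2 \<Longrightarrow> h \<in> S2 \<Longrightarrow> x \<in> \<Delta> \<Longrightarrow> g (h x) = h (g x)"
  shows "solvable ((BijGroup \<Delta>)\<lparr>carrier := S0\<rparr>)"
proof -
  interpret B: group "BijGroup \<Delta>" by (rule group_BijGroup)
  have SB: "g \<in> Bij \<Delta>" if "g \<in> S" "subgroup S (BijGroup \<Delta>)" for g S
    using subgroup.mem_carrier[OF that(2,1)] by (simp add: BijGroup_def)
  have eqI: "g \<otimes>\<^bsub>BijGroup \<Delta>\<^esub> h = k \<otimes>\<^bsub>BijGroup \<Delta>\<^esub> (h \<otimes>\<^bsub>BijGroup \<Delta>\<^esub> g)"
    if B: "g \<in> Bij \<Delta>" "h \<in> Bij \<Delta>" "k \<in> Bij \<Delta>" and e: "\<forall>x\<in>\<Delta>. g (h x) = k (h (g x))" for g h k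
  proof -
    have hg: "h \<otimes>\<^bsub>BijGroup \<Delta>\<^esub> g \<in> Bij \<Delta>" using B.m_closed[of h g] B by (simp add: BijGroup_def)
    have m: "u \<otimes>\<^bsub>BijGroup \<Delta>\<^esub> v \<in> extensional \<Delta>" if "u \<in> Bij \<Delta>" "v \<in> Bij \<Delta>" for u v
      using that by (simp add: BijGroup_def)
    show ?thesis
    proof (rule extensionalityI[OF m[OF B(1,2)] m[OF B(3) hg]])
      fix x assume x: "x \<in> \<Delta>"
      show "(g \<otimes>\<^bsub>BijGroup \<Delta>\<^esub> h) x = (k \<otimes>\<^bsub>BijGroup \<Delta>\<^esub> (h \<otimes>\<^bsub>BijGroup \<Delta>\<^esub> g)) x"
        using e x by (simp only: BijGroup_mult_apply[OF B(1,2) x] BijGroup_mult_apply[OF B(3) hg x]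
            BijGroup_mult_apply[OF B(2,1) x])
    qed
  qed
  have step: "derived (BijGroup \<Delta>) S \<subseteq> S'"
    if S: "subgroup S (BijGroup \<Delta>)" "subgroup S' (BijGroup \<Delta>)"
      and c: "\<And>g h. g \<in> S \<Longrightarrow> h \<in> S \<Longrightarrow> \<exists>k\<in>S'. \<forall>x\<in>\<Delta>. g (h x) = k (h (g x))" for S S'
  proof (rule B.derived_subset[OF subgroup.subset[OF S(1)] S(2)])
    fix g h assume gh: "g \<in> S" "h \<in> S"
    obtain k where k: "k \<in> S'" "\<forall>x\<in>\<Delta>. g (h x) = k (h (g x))" using c[OF gh] by blast
    then show "\<exists>k\<in>S'. g \<otimes>\<^bsub>BijGroup \<Delta>\<^esub> h = k \<otimes>\<^bsub>BijGroup \<Delta>\<^esub> (h \<otimes>\<^bsub>BijGroup \<Delta>\<^esub> g)"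
      using eqI[OF SB[OF gh(1) S(1)] SB[OF gh(2) S(1)] SB[OF k(1) S(2)] k(2)] by blast
  qed
  have S3: "subgroup {\<one>\<^bsub>BijGroup \<Delta>\<^esub>} (BijGroup \<Delta>)" by (rule B.triv_subgroup)
  have d2: "derived (BijGroup \<Delta>) S2 \<subseteq> {\<one>\<^bsub>BijGroup \<Delta>\<^esub>}"
  proof (rule step[OF S2 S3])
    fix g h assume gh: "g \<in> S2" "h \<in> S2"
    have "\<one>\<^bsub>BijGroup \<Delta>\<^esub> (h (g x)) = h (g x)" if "x \<in> \<Delta>" for x
      using SB[OF gh(1) S2] SB[OF gh(2) S2] that Bij_imp_funcset[of g \<Delta>] Bij_imp_funcset[of h \<Delta>]
      by (simp add: BijGroup_def Pi_iff)
    then show "\<exists>k\<in>{\<one>\<^bsub>BijGroup \<Delta>\<^esub>}. \<forall>x\<in>\<Delta>. g (h x) = k (h (g x))"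
      using c2[OF gh] by simp
  qed
  have d0: "derived (BijGroup \<Delta>) S0 \<subseteq> S1" by (rule step[OF S0 S1 c0])
  have d1: "derived (BijGroup \<Delta>) S1 \<subseteq> S2" by (rule step[OF S1 S2 c1])
  have "(derived (BijGroup \<Delta>) ^^ 3) S0 \<subseteq> {\<one>\<^bsub>BijGroup \<Delta>\<^esub>}"
  proof -
    have "derived (BijGroup \<Delta>) (derived (BijGroup \<Delta>) (derived (BijGroup \<Delta>) S0))
      \<subseteq> derived (BijGroup \<Delta>) (derived (BijGroup \<Delta>) S1)" by (intro B.mono_derived d0)
    also have "\<dots> \<subseteq> derived (BijGroup \<Delta>) S2" by (intro B.mono_derived d1)
    also have "\<dots> \<subseteq> {\<one>\<^bsub>BijGroup \<Delta>\<^esub>}" by (rule d2)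
    finally show ?thesis by (simp add: numeral_3_eq_3)
  qed
  moreover have "\<one>\<^bsub>BijGroup \<Delta>\<^esub> \<in> (derived (BijGroup \<Delta>) ^^ 3) S0"
    by (rule subgroup.one_closed[OF B.exp_of_derived_is_subgroup[OF S0]])
  ultimately have "(derived (BijGroup \<Delta>) ^^ 3) S0 = {\<one>\<^bsub>BijGroup \<Delta>\<^esub>}" by blast
  then have seq: "solvable_seq (BijGroup \<Delta>) S0" by (rule B.trivial_derived_seq_imp_solvable[OF S0])
  interpret i: group_hom "(BijGroup \<Delta>)\<lparr>carrier := S0\<rparr>" "BijGroup \<Delta>" id
    using B.subgroup_imp_group[OF S0] subgroup.mem_carrier[OF S0]
    by (auto simp: group_hom_def group_hom_axioms_def hom_def B.is_group)
  have "solvable_seq ((BijGroup \<Delta>)\<lparr>carrier := S0\<rparr>) S0"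
    using i.G.subgroup_self seq by (intro i.solvable_img_imp_solvable) auto
  then show ?thesis by (simp add: solvable_def)
qed

text \<open>For a transitive action it is enough to look at blocks through one point
  \<open>z\<close>, since all cells of an invariant partition are translates of the cell of
  \<open>z\<close>.\<close>

lemma (in set_act) primitiveI:
  assumes z: "z \<in> E" and trans: "\<And>x. x \<in> E \<Longrightarrow> \<exists>g\<in>carrier G. act g z = x"
    and block: "\<And>B b. z \<in> B \<Longrightarrow> B \<subseteq> E \<Longrightarrow> b \<in> B \<Longrightarrow> b \<noteq> z \<Longrightarrow>
      (\<And>g x. g \<in> carrier G \<Longrightarrow> x \<in> B \<Longrightarrow> act g x \<in> B \<Longrightarrow> act g ` B = B) \<Longrightarrow> B = E"
  shows primitive
  unfolding primitive_def
proof (intro conjI ballI allI impI)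
  fix x y assume x: "x \<in> E" and y: "y \<in> E"
  obtain g h where g: "g \<in> carrier G" "act g z = x" and h: "h \<in> carrier G" "act h z = y"
    using trans x y by blast
  have "act (inv g) x = z" using g z act_inv[of g z] by simp
  then have "act (h \<otimes> inv g) x = y" using g h x by simp
  then show "\<exists>g\<in>carrier G. act g x = y" using g h by blast
next
  fix P assume P: "partition_on E P \<and> (\<forall>g\<in>carrier G. \<forall>B\<in>P. act g ` B \<in> P)"
  have UP: "\<Union>P = E" and disj: "\<And>B C. B \<in> P \<Longrightarrow> C \<in> P \<Longrightarrow> B \<noteq> C \<Longrightarrow> B \<inter> C = {}" and neP: "{} \<notin> P"
    using P by (auto simp: partition_on_def disjoint_def)
  have inv: "act g ` B \<in> P" if "g \<in> carrier G" "B \<in> P" for g B using P that by simp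
  have "z \<in> \<Union>P" using z UP by simp
  then obtain B where B: "B \<in> P" "z \<in> B" by blast
  have BE: "B \<subseteq> E" using B UP by blast
  have Bblock: "act g ` B = B" if g: "g \<in> carrier G" and x: "x \<in> B" "act g x \<in> B" for g x
  proof (rule ccontr)
    assume "act g ` B \<noteq> B"
    then have "act g ` B \<inter> B = {}" using disj inv[OF g B(1)] B(1) by simp
    then show False using x by blast
  qed
  show "P = {E} \<or> P = (\<lambda>x. {x}) ` E"
  proof (cases "B = {z}")
    case False
    then obtain b where b: "b \<in> B" "b \<noteq> z" using B by blast
    have "B = E" by (rule block[OF B(2) BE b Bblock])
    moreover have "C = B" if C: "C \<in> P" for C
    proof (rule ccontr)
      assume "C \<noteq> B"
      then have "C \<inter> B = {}" using disj C B by simp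
      moreover have "C \<subseteq> E" using C UP by blast
      ultimately have "C = {}" using \<open>B = E\<close> by blast
      then show False using C neP by simp
    qed
    ultimately show ?thesis using B by blast
  next
    case True
    have sing: "{x} \<in> P" if x: "x \<in> E" for x
    proof -
      obtain g where g: "g \<in> carrier G" "act g z = x" using trans[OF x] by blast
      then show ?thesis using inv[OF g(1) B(1)] True by simp
    qed
    have "C \<in> (\<lambda>x. {x}) ` E" if C: "C \<in> P" for C
    proof -
      have "C \<noteq> {}" using C neP by auto
      then obtain x where x: "x \<in> C" by blast
      then have "x \<in> E" using C UP by blast
      then have "C = {x}" using disj[OF C sing] x by blast
      then show ?thesis using \<open>x \<in> E\<close> by blast
    qed
    then show ?thesis using sing by blast
  qed
qed

lemma transport_primitive_soluble:
  assumes ps: "primitive_soluble \<Delta> G" and inj: "inj_on \<phi> \<Delta>"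
  shows "primitive_soluble (\<phi> ` \<Delta>) (transport \<phi> \<Delta> G)"
    "irredundant \<Delta> G \<delta> \<Longrightarrow> irredundant (\<phi> ` \<Delta>) (transport \<phi> \<Delta> G) (map \<phi> \<delta>)"
proof -
  have pp: "primitive_perm_group \<Delta> G" and sol: "solvable ((BijGroup \<Delta>)\<lparr>carrier := G\<rparr>)"
    using ps by (simp_all add: primitive_soluble_def)
  then have pg: "perm_group \<Delta> G" by (simp add: primitive_perm_group_def)
  interpret S: set_act "(BijGroup \<Delta>)\<lparr>carrier := G\<rparr>" \<Delta> "\<lambda>g. g" by (rule perm_group_set_act[OF pg])
  note T = transport_solvable[OF pg inj sol]
  have pgT: "perm_group (\<phi> ` \<Delta>) (transport \<phi> \<Delta> G)" using T(1) pg by (simp add: perm_group_def)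
  interpret T: set_act "(BijGroup (\<phi> ` \<Delta>))\<lparr>carrier := transport \<phi> \<Delta> G\<rparr>" "\<phi> ` \<Delta>" "\<lambda>g. g"
    by (rule perm_group_set_act[OF pgT])
  note tap = transport_map_apply[OF inj]
  have prim: S.primitive using pp by (simp add: primitive_perm_group_iff[OF pg])
  have gE: "g x \<in> \<Delta>" if "g \<in> G" "x \<in> \<Delta>" for g x using S.act_closed[of g x] that by simp
  have tr: "\<forall>x\<in>\<Delta>. \<forall>y\<in>\<Delta>. \<exists>g\<in>G. g x = y" using prim by (simp add: S.primitive_def)
  obtain z where z: "z \<in> \<Delta>" using pg by (auto simp: perm_group_def)
  have "T.primitive"
  proof (rule T.primitiveI[of "\<phi> z"])
    show "\<phi> z \<in> \<phi> ` \<Delta>" using z by simp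
    fix y assume "y \<in> \<phi> ` \<Delta>"
    then obtain x where x: "x \<in> \<Delta>" "y = \<phi> x" by auto
    obtain g where "g \<in> G" "g z = x" using tr z x by blast
    then have "transport_map \<phi> \<Delta> g \<in> transport \<phi> \<Delta> G" "transport_map \<phi> \<Delta> g (\<phi> z) = y"
      using tap[OF z] x by (auto simp: transport_eq)
    then show "\<exists>g\<in>carrier ((BijGroup (\<phi> ` \<Delta>))\<lparr>carrier := transport \<phi> \<Delta> G\<rparr>). g (\<phi> z) = y" by auto
  next
    fix B b assume B: "\<phi> z \<in> B" "B \<subseteq> \<phi> ` \<Delta>" "b \<in> B" "b \<noteq> \<phi> z"
      and bl: "\<And>g x. g \<in> carrier ((BijGroup (\<phi> ` \<Delta>))\<lparr>carrier := transport \<phi> \<Delta> G\<rparr>) \<Longrightarrow> x \<in> B \<Longrightarrow> g x \<in> B \<Longrightarrow> g ` B = B"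
    \<comment> \<open>The preimage of the block \<open>B\<close>. Its translates form an invariant
      partition of the original set, to which primitivity there applies.\<close>
    define C where "C = {x \<in> \<Delta>. \<phi> x \<in> B}"
    have CB: "\<phi> ` C = B" using B(2) by (auto simp: C_def)
    have Cbl: "g ` C = C" if g: "g \<in> G" and x: "x \<in> C" "g x \<in> C" for g x
    proof -
      have "transport_map \<phi> \<Delta> g ` B = B"
        using x g tap[of x g] by (intro bl[of _ "\<phi> x"]) (auto simp: C_def transport_eq)
      moreover have "transport_map \<phi> \<Delta> g ` B = \<phi> ` g ` C"
      proof -
        have "transport_map \<phi> \<Delta> g ` \<phi> ` C = (\<lambda>x. \<phi> (g x)) ` C"
          unfolding image_image by (rule image_cong) (auto simp: C_def tap)
        then show ?thesis using CB by (simp add: image_image)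
      qed
      ultimately have "\<phi> ` g ` C = \<phi> ` C" using CB by simp
      moreover have "g ` C \<subseteq> \<Delta>" "C \<subseteq> \<Delta>" using gE g by (auto simp: C_def)
      ultimately show ?thesis using inj_on_image_eq_iff[OF inj] by blast
    qed
    define P where "P = (\<lambda>g. g ` C) ` G"
    have Cd: "C \<subseteq> \<Delta>" by (auto simp: C_def)
    have "partition_on \<Delta> P"
    proof (rule partition_onI)
      show "\<Union>P = \<Delta>"
      proof (intro equalityI subsetI)
        fix x assume x: "x \<in> \<Delta>"
        obtain g where "g \<in> G" "g z = x" using tr z x by blast
        then show "x \<in> \<Union>P" using z B by (auto simp: P_def C_def)
      qed (use gE in \<open>auto simp: P_def C_def\<close>)
      show "{} \<notin> P" using z B by (auto simp: P_def C_def)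
      fix X1 X2 assume "X1 \<in> P" "X2 \<in> P" and ne: "X1 \<noteq> X2"
      then obtain g h where g: "g \<in> G" "X1 = g ` C" and h: "h \<in> G" "X2 = h ` C" by (auto simp: P_def)
      show "disjnt X1 X2"
      proof (rule ccontr)
        assume "\<not> disjnt X1 X2"
        then obtain c c' where c: "c \<in> C" "c' \<in> C" "g c = h c'" using g h by (auto simp: disjnt_def)
        let ?k = "inv\<^bsub>(BijGroup \<Delta>)\<lparr>carrier := G\<rparr>\<^esub> h \<otimes>\<^bsub>BijGroup \<Delta>\<^esub> g"
        have kG: "?k \<in> G" using S.m_closed[of "inv\<^bsub>(BijGroup \<Delta>)\<lparr>carrier := G\<rparr>\<^esub> h" g] S.inv_closed[of h] g h by simp
        have hk: "h (?k x) = g x" if "x \<in> \<Delta>" for x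
          using S.act_mult[of "inv\<^bsub>(BijGroup \<Delta>)\<lparr>carrier := G\<rparr>\<^esub> h" g x] S.act_inv'[of h "g x"] S.inv_closed[of h]
            g h gE that by simp
        have "?k c = c'" using S.act_inj[of h "?k c" c'] hk[of c] c h gE[OF kG] Cd by auto
        then have "?k ` C = C" using Cbl[OF kG c(1)] c by simp
        then have "h ` C = h ` ?k ` C" by simp
        also have "\<dots> = g ` C" unfolding image_image by (rule image_cong) (use hk Cd in auto)
        finally show False using ne g h by simp
      qed
    qed
    moreover have "\<forall>g\<in>G. \<forall>B\<in>P. g ` B \<in> P"
    proof (intro ballI)
      fix g B assume g: "g \<in> G" and "B \<in> P"
      then obtain h where h: "h \<in> G" "B = h ` C" by (auto simp: P_def)
      have "g ` B = (g \<otimes>\<^bsub>BijGroup \<Delta>\<^esub> h) ` C"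
        unfolding h(2) image_image
      proof (rule image_cong[OF refl])
        fix x assume "x \<in> C" then show "g (h x) = (g \<otimes>\<^bsub>BijGroup \<Delta>\<^esub> h) x"
          using S.act_mult[of g h x] g h Cd by auto
      qed
      moreover have "g \<otimes>\<^bsub>BijGroup \<Delta>\<^esub> h \<in> G" using S.m_closed[of g h] g h by simp
      ultimately show "g ` B \<in> P" by (auto simp: P_def)
    qed
    ultimately have "P = {\<Delta>} \<or> P = (\<lambda>x. {x}) ` \<Delta>" using prim by (simp add: S.primitive_def)
    moreover have CP: "C \<in> P"
    proof -
      have "\<one>\<^bsub>BijGroup \<Delta>\<^esub> ` C = (\<lambda>x. x) ` C" by (rule image_cong) (use S.act_one Cd in auto)
      moreover have "\<one>\<^bsub>BijGroup \<Delta>\<^esub> \<in> G" using S.one_closed by simp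
      ultimately show ?thesis
        unfolding P_def by (intro image_eqI[of _ _ "\<one>\<^bsub>BijGroup \<Delta>\<^esub>"]) simp_all
    qed
    moreover have "P \<noteq> (\<lambda>x. {x}) ` \<Delta>"
    proof
      assume "P = (\<lambda>x. {x}) ` \<Delta>"
      then obtain x where "C = {x}" using CP by auto
      then show False using CB B by auto
    qed
    ultimately have "C = \<Delta>" by blast
    then show "B = \<phi> ` \<Delta>" using CB by simp
  qed
  then show "primitive_soluble (\<phi> ` \<Delta>) (transport \<phi> \<Delta> G)"
    using T(2) by (simp add: primitive_soluble_def primitive_perm_group_iff[OF pgT])
  assume irr: "irredundant \<Delta> G \<delta>"
  have sub: "set \<delta> \<subseteq> \<Delta>" using irr by (simp add: irredundant_def)
  have ps: "pointwise_stab (transport \<phi> \<Delta> G) (map \<phi> xs) = transport_map \<phi> \<Delta> ` pointwise_stab G xs"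
    if "set xs \<subseteq> \<Delta>" for xs
  proof -
    have "transport_map \<phi> \<Delta> g (\<phi> x) = \<phi> x \<longleftrightarrow> g x = x" if "g \<in> G" "x \<in> \<Delta>" for g x
      using tap[OF that(2)] inj_on_eq_iff[OF inj gE[OF that] that(2)] by simp
    then show ?thesis using that by (fastforce simp: pointwise_stab_def transport_eq)
  qed
  have injt: "inj_on (transport_map \<phi> \<Delta>) G" by (rule transport_hom(2)[OF pg inj])
  show "irredundant (\<phi> ` \<Delta>) (transport \<phi> \<Delta> G) (map \<phi> \<delta>)"
    unfolding irredundant_def
  proof (intro conjI allI impI)
    show "set (map \<phi> \<delta>) \<subseteq> \<phi> ` \<Delta>" using sub by auto
    fix i assume "i < length (map \<phi> \<delta>)"
    then have ss: "pointwise_stab G (take (Suc i) \<delta>) \<subset> pointwise_stab G (take i \<delta>)"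
      using irr by (simp add: irredundant_def)
    have "pointwise_stab G (take i \<delta>) \<subseteq> G" by (auto simp: pointwise_stab_def)
    then have "transport_map \<phi> \<Delta> ` pointwise_stab G (take (Suc i) \<delta>)
        \<subset> transport_map \<phi> \<Delta> ` pointwise_stab G (take i \<delta>)"
      using ss inj_on_subset[OF injt] by (intro image_strict_mono) auto
    moreover have "set (take j \<delta>) \<subseteq> \<Delta>" for j using sub by (auto dest: in_set_takeD)
    ultimately show "pointwise_stab (transport \<phi> \<Delta> G) (take (Suc i) (map \<phi> \<delta>))
        \<subset> pointwise_stab (transport \<phi> \<Delta> G) (take i (map \<phi> \<delta>))"
      by (simp only: take_map ps)
  qed
qed

lemma irredundantI:
  assumes sub: "set \<delta> \<subseteq> \<Delta>"
    and ex: "\<And>i. i < length \<delta> \<Longrightarrow> \<exists>g\<in>G. (\<forall>x\<in>set (take i \<delta>). g x = x) \<and> g (\<delta> ! i) \<noteq> \<delta> ! i"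
  shows "irredundant \<Delta> G \<delta>"
  unfolding irredundant_def
proof (intro conjI allI impI sub)
  fix i assume i: "i < length \<delta>"
  have "set (take (Suc i) \<delta>) = insert (\<delta> ! i) (set (take i \<delta>))"
    using i by (simp add: take_Suc_conv_app_nth)
  then have eq: "pointwise_stab G (take (Suc i) \<delta>) = {g \<in> pointwise_stab G (take i \<delta>). g (\<delta> ! i) = \<delta> ! i}"
    by (auto simp: pointwise_stab_def)
  obtain g where "g \<in> pointwise_stab G (take i \<delta>)" "g (\<delta> ! i) \<noteq> \<delta> ! i"
    using ex[OF i] by (auto simp: pointwise_stab_def)
  then show "pointwise_stab G (take (Suc i) \<delta>) \<subset> pointwise_stab G (take i \<delta>)"
    unfolding eq by blast
qed

text \<open>The affine group \<open>F\<^sub>3\<^sup>d : ({\<plusminus>1} wr C\<^sub>d)\<close>, as maps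
  \<open>v \<mapsto> (\<epsilon>\<^sub>i v\<^sub>i\<^sub>+\<^sub>s + b\<^sub>i)\<^sub>i\<close> with indices modulo \<open>d\<close>.\<close>

definition cube :: "nat \<Rightarrow> (nat \<Rightarrow> 3) set" where
  "cube d = {..<d} \<rightarrow>\<^sub>E UNIV"

definition cube_map :: "nat \<Rightarrow> (nat \<Rightarrow> 3) \<Rightarrow> nat \<Rightarrow> (nat \<Rightarrow> 3) \<Rightarrow> (nat \<Rightarrow> 3) \<Rightarrow> nat \<Rightarrow> 3" where
  "cube_map d \<epsilon> s b = (\<lambda>v\<in>cube d. \<lambda>i\<in>{..<d}. \<epsilon> i * v ((i + s) mod d) + b i)"

text \<open>Over the field with 3 elements the condition means that every value is 1 or -1. It is
  imposed at all indices, so that cyclic shifts of \<open>\<epsilon>\<close> need no range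
  conditions.\<close>

definition signs :: "(nat \<Rightarrow> 3) set" where
  "signs = {\<epsilon>. \<forall>i. \<epsilon> i * \<epsilon> i = 1}"

definition cube_group :: "nat \<Rightarrow> ((nat \<Rightarrow> 3) \<Rightarrow> nat \<Rightarrow> 3) set" where
  "cube_group d = {cube_map d \<epsilon> s b | \<epsilon> s b. \<epsilon> \<in> signs}"

definition cube_diag :: "nat \<Rightarrow> ((nat \<Rightarrow> 3) \<Rightarrow> nat \<Rightarrow> 3) set" where
  "cube_diag d = {cube_map d \<epsilon> 0 b | \<epsilon> b. \<epsilon> \<in> signs}"

definition cube_trans :: "nat \<Rightarrow> ((nat \<Rightarrow> 3) \<Rightarrow> nat \<Rightarrow> 3) set" where
  "cube_trans d = {cube_map d (\<lambda>_. 1) 0 b | b. True}"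

lemma finite_cube: "finite (cube d)"
  by (auto simp: cube_def intro!: finite_PiE)

lemma card_cube: "card (cube d) = 3 ^ d"
  by (simp add: cube_def card_PiE)

lemma three_eq_zero: "x + x + x = (0 :: 3)"
proof -
  have "x + x + x = 3 * x" by simp
  also have "(3 :: 3) = 0" by simp
  finally show ?thesis by simp
qed

lemma cube_map_in_cube [simp]: "v \<in> cube d \<Longrightarrow> cube_map d \<epsilon> s b v \<in> cube d"
  by (simp add: cube_map_def cube_def)

lemma cube_map_apply: "v \<in> cube d \<Longrightarrow> i < d \<Longrightarrow> cube_map d \<epsilon> s b v i = \<epsilon> i * v ((i + s) mod d) + b i"
  by (simp add: cube_map_def)

lemma cube_eqI: "u \<in> cube d \<Longrightarrow> v \<in> cube d \<Longrightarrow> (\<And>i. i < d \<Longrightarrow> u i = v i) \<Longrightarrow> u = v"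
  unfolding cube_def by (rule PiE_ext) auto

lemma cube_map_compose:
  assumes "v \<in> cube d"
  shows "cube_map d \<epsilon> s b (cube_map d \<epsilon>' s' b' v) =
    cube_map d (\<lambda>i. \<epsilon> i * \<epsilon>' ((i + s) mod d)) (s + s') (\<lambda>i. \<epsilon> i * b' ((i + s) mod d) + b i) v"
proof (rule cube_eqI[of _ d])
  fix i assume i: "i < d"
  then have m: "(i + s) mod d < d" by simp
  have "((i + s) mod d + s') mod d = (i + (s + s')) mod d" by (simp add: mod_add_left_eq add.assoc)
  then show "cube_map d \<epsilon> s b (cube_map d \<epsilon>' s' b' v) i =
    cube_map d (\<lambda>i. \<epsilon> i * \<epsilon>' ((i + s) mod d)) (s + s') (\<lambda>i. \<epsilon> i * b' ((i + s) mod d) + b i) v i"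
    using assms i m by (simp add: cube_map_apply algebra_simps)
qed (use assms in simp_all)

lemma signs_mult: "\<epsilon> \<in> signs \<Longrightarrow> \<epsilon>' \<in> signs \<Longrightarrow> (\<lambda>i. \<epsilon> i * \<epsilon>' (f i)) \<in> signs"
proof -
  assume a: "\<epsilon> \<in> signs" "\<epsilon>' \<in> signs"
  show ?thesis unfolding signs_def mem_Collect_eq
  proof
    fix i
    have "(\<epsilon> i * \<epsilon>' (f i)) * (\<epsilon> i * \<epsilon>' (f i)) = (\<epsilon> i * \<epsilon> i) * (\<epsilon>' (f i) * \<epsilon>' (f i))"
      by (simp only: mult_ac)
    also have "\<dots> = 1" using a by (simp add: signs_def)
    finally show "(\<epsilon> i * \<epsilon>' (f i)) * (\<epsilon> i * \<epsilon>' (f i)) = 1" .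
  qed
qed

lemma one_signs: "(\<lambda>_. 1) \<in> signs"
  by (simp add: signs_def)

lemma cube_map_id: "cube_map d (\<lambda>_. 1) 0 (\<lambda>_. 0) = (\<lambda>v\<in>cube d. v)"
proof (rule extensionalityI[where A = "cube d"])
  fix v assume v: "v \<in> cube d"
  have "cube_map d (\<lambda>_. 1) 0 (\<lambda>_. 0) v = v"
    by (rule cube_eqI[of _ d]) (use v in \<open>simp_all add: cube_map_apply\<close>)
  then show "cube_map d (\<lambda>_. 1) 0 (\<lambda>_. 0) v = (\<lambda>v\<in>cube d. v) v" using v by simp
qed (simp_all add: cube_map_def)

lemma cube_map_Bij:
  assumes \<epsilon>: "\<epsilon> \<in> signs" shows "cube_map d \<epsilon> s b \<in> Bij (cube d)"
proof -
  have "inj_on (cube_map d \<epsilon> s b) (cube d)"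
  proof (rule inj_onI)
    fix u v assume u: "u \<in> cube d" and v: "v \<in> cube d" and eq: "cube_map d \<epsilon> s b u = cube_map d \<epsilon> s b v"
    show "u = v"
    proof (rule cube_eqI[OF u v])
      fix j assume j: "j < d"
      \<comment> \<open>The coordinate whose value under the map is read off from coordinate
        \<open>j\<close>.\<close>
      define i where "i = (j + (d - s mod d)) mod d"
      have i: "i < d" using j by (simp add: i_def)
      have "(i + s) mod d = (j + (d - s mod d) + s mod d) mod d"
        by (simp add: i_def mod_simps)
      also have "j + (d - s mod d) + s mod d = j + d"
        using mod_less_divisor[of d s] j by linarith
      finally have ij: "(i + s) mod d = j" using j by simp
      have "\<epsilon> i * u j + b i = \<epsilon> i * v j + b i"
        using fun_cong[OF eq, of i] u v i ij by (simp add: cube_map_apply)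
      then have "\<epsilon> i * (\<epsilon> i * u j) = \<epsilon> i * (\<epsilon> i * v j)" by simp
      then show "u j = v j" using \<epsilon> by (simp add: signs_def mult.assoc[symmetric])
    qed
  qed
  moreover have "cube_map d \<epsilon> s b ` cube d \<subseteq> cube d" by auto
  ultimately have "cube_map d \<epsilon> s b ` cube d = cube d" by (intro endo_inj_surj finite_cube)
  then show ?thesis using \<open>inj_on (cube_map d \<epsilon> s b) (cube d)\<close>
    by (simp add: Bij_def bij_betw_def cube_map_def)
qed

lemma compose_cube_map:
  "compose (cube d) (cube_map d \<epsilon> s b) (cube_map d \<epsilon>' s' b') =
    cube_map d (\<lambda>i. \<epsilon> i * \<epsilon>' ((i + s) mod d)) (s + s') (\<lambda>i. \<epsilon> i * b' ((i + s) mod d) + b i)"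
proof (rule extensionalityI[where A = "cube d"])
  fix v assume "v \<in> cube d"
  then show "compose (cube d) (cube_map d \<epsilon> s b) (cube_map d \<epsilon>' s' b') v =
    cube_map d (\<lambda>i. \<epsilon> i * \<epsilon>' ((i + s) mod d)) (s + s') (\<lambda>i. \<epsilon> i * b' ((i + s) mod d) + b i) v"
    by (simp add: compose_eq cube_map_compose)
qed (simp_all add: compose_def cube_map_def)

lemma cube_groupI: "\<epsilon> \<in> signs \<Longrightarrow> cube_map d \<epsilon> s b \<in> cube_group d"
  unfolding cube_group_def by blast

lemma cube_diagI: "\<epsilon> \<in> signs \<Longrightarrow> cube_map d \<epsilon> 0 b \<in> cube_diag d"
  unfolding cube_diag_def by blast

lemma cube_group_subgroups:
  "subgroup (cube_group d) (BijGroup (cube d))"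
  "subgroup (cube_diag d) (BijGroup (cube d))"
  "subgroup (cube_trans d) (BijGroup (cube d))"
proof -
  show "subgroup (cube_group d) (BijGroup (cube d))"
  proof (rule subgroup_BijGroupI[OF finite_cube])
    show "cube_group d \<subseteq> Bij (cube d)" using cube_map_Bij by (auto simp: cube_group_def)
    show "(\<lambda>x\<in>cube d. x) \<in> cube_group d"
      unfolding cube_map_id[symmetric] cube_group_def using one_signs by blast
    show "compose (cube d) f g \<in> cube_group d" if fg: "f \<in> cube_group d" "g \<in> cube_group d" for f g
    proof -
      obtain \<epsilon> s b \<epsilon>' s' b' where "\<epsilon> \<in> signs" "\<epsilon>' \<in> signs" "f = cube_map d \<epsilon> s b" "g = cube_map d \<epsilon>' s' b'"
        using fg by (auto simp: cube_group_def)
      then show ?thesis by (simp only: compose_cube_map) (intro cube_groupI signs_mult)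
    qed
  qed
  show "subgroup (cube_diag d) (BijGroup (cube d))"
  proof (rule subgroup_BijGroupI[OF finite_cube])
    show "cube_diag d \<subseteq> Bij (cube d)" using cube_map_Bij by (auto simp: cube_diag_def)
    show "(\<lambda>x\<in>cube d. x) \<in> cube_diag d"
      unfolding cube_map_id[symmetric] cube_diag_def using one_signs by blast
    show "compose (cube d) f g \<in> cube_diag d" if fg: "f \<in> cube_diag d" "g \<in> cube_diag d" for f g
    proof -
      obtain \<epsilon> b \<epsilon>' b' where "\<epsilon> \<in> signs" "\<epsilon>' \<in> signs" "f = cube_map d \<epsilon> 0 b" "g = cube_map d \<epsilon>' 0 b'"
        using fg by (auto simp: cube_diag_def)
      then show ?thesis by (simp only: compose_cube_map add_0_right) (intro cube_diagI signs_mult)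
    qed
  qed
  show "subgroup (cube_trans d) (BijGroup (cube d))"
  proof (rule subgroup_BijGroupI[OF finite_cube])
    show "cube_trans d \<subseteq> Bij (cube d)" using cube_map_Bij one_signs by (auto simp: cube_trans_def)
    show "(\<lambda>x\<in>cube d. x) \<in> cube_trans d"
      unfolding cube_map_id[symmetric] cube_trans_def by blast
    show "compose (cube d) f g \<in> cube_trans d" if "f \<in> cube_trans d" "g \<in> cube_trans d" for f g
      using that unfolding cube_trans_def by (auto simp: compose_cube_map)
  qed
qed

lemma cube_group_solvable: "solvable ((BijGroup (cube d))\<lparr>carrier := cube_group d\<rparr>)"
proof (rule solvable_BijGroupI[OF cube_group_subgroups])
  fix g h assume "g \<in> cube_group d" "h \<in> cube_group d"
  then obtain \<epsilon> s b \<epsilon>' s' b' where e: "\<epsilon> \<in> signs" "\<epsilon>' \<in> signs"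
    and gh: "g = cube_map d \<epsilon> s b" "h = cube_map d \<epsilon>' s' b'" by (auto simp: cube_group_def)
  define \<alpha> \<beta> where "\<alpha> = (\<lambda>i. \<epsilon> i * \<epsilon>' ((i + s) mod d))" and "\<beta> = (\<lambda>i. \<epsilon>' i * \<epsilon> ((i + s') mod d))"
  define a b2 where "a = (\<lambda>i. \<epsilon> i * b' ((i + s) mod d) + b i)" and "b2 = (\<lambda>i. \<epsilon>' i * b ((i + s') mod d) + b' i)"
  have ab: "\<alpha> \<in> signs" "\<beta> \<in> signs" using e signs_mult by (auto simp: \<alpha>_def \<beta>_def)
  \<comment> \<open>The quotient of the maps \<open>g h\<close> and \<open>h g\<close>. They have
    the same shift \<open>s + s'\<close>, and each sign is its own inverse, so the linear part of
    the quotient is the product of the two sign vectors.\<close>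
  define \<kappa> where "\<kappa> = cube_map d (\<lambda>i. \<alpha> i * \<beta> i) 0 (\<lambda>i. a i - \<alpha> i * \<beta> i * b2 i)"
  have "\<kappa> \<in> cube_diag d" unfolding \<kappa>_def cube_diag_def using signs_mult[OF ab, of "\<lambda>i. i"] by blast
  moreover have "g (h v) = \<kappa> (h (g v))" if v: "v \<in> cube d" for v
  proof (rule cube_eqI[of _ d])
    fix i assume i: "i < d"
    have bb: "\<beta> i * \<beta> i = 1" using ab by (simp add: signs_def)
    have "g (h v) i = \<alpha> i * v ((i + (s + s')) mod d) + a i"
      using v i by (simp add: gh cube_map_compose cube_map_apply \<alpha>_def a_def)
    moreover have hg: "h (g v) i = \<beta> i * v ((i + (s + s')) mod d) + b2 i"
      using v i by (simp add: gh cube_map_compose cube_map_apply \<beta>_def b2_def add.commute)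
    moreover have "h (g v) \<in> cube d" using v by (simp add: gh)
    then have "\<kappa> (h (g v)) i = \<alpha> i * \<beta> i * h (g v) i + (a i - \<alpha> i * \<beta> i * b2 i)"
      using i by (simp add: \<kappa>_def cube_map_apply)
    then have "\<kappa> (h (g v)) i = \<alpha> i * (\<beta> i * \<beta> i) * v ((i + (s + s')) mod d) + a i"
      unfolding hg by (simp add: algebra_simps)
    ultimately show "g (h v) i = \<kappa> (h (g v)) i" by (simp add: bb)
  qed (use v in \<open>simp_all add: gh \<kappa>_def\<close>)
  ultimately show "\<exists>k\<in>cube_diag d. \<forall>x\<in>cube d. g (h x) = k (h (g x))" by blast
next
  fix g h assume "g \<in> cube_diag d" "h \<in> cube_diag d"
  then obtain \<epsilon> b \<epsilon>' b' where gh: "g = cube_map d \<epsilon> 0 b" "h = cube_map d \<epsilon>' 0 b'"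
    by (auto simp: cube_diag_def)
  define \<kappa> where "\<kappa> = cube_map d (\<lambda>_. 1) 0 (\<lambda>i. \<epsilon> i * b' i + b i - (\<epsilon>' i * b i + b' i))"
  have "\<kappa> \<in> cube_trans d" unfolding \<kappa>_def cube_trans_def by blast
  moreover have "g (h v) = \<kappa> (h (g v))" if v: "v \<in> cube d" for v
    by (rule cube_eqI[of _ d]) (use v in \<open>simp_all add: gh \<kappa>_def cube_map_apply algebra_simps\<close>)
  ultimately show "\<exists>k\<in>cube_trans d. \<forall>x\<in>cube d. g (h x) = k (h (g x))" by blast
next
  fix g h v assume "g \<in> cube_trans d" "h \<in> cube_trans d" and v: "v \<in> cube d"
  then obtain b b' where gh: "g = cube_map d (\<lambda>_. 1) 0 b" "h = cube_map d (\<lambda>_. 1) 0 b'"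
    by (auto simp: cube_trans_def)
  show "g (h v) = h (g v)"
    by (rule cube_eqI[of _ d]) (use v in \<open>simp_all add: gh cube_map_apply algebra_simps\<close>)
qed

definition cube_unit :: "nat \<Rightarrow> nat \<Rightarrow> 3 \<Rightarrow> nat \<Rightarrow> 3" where
  "cube_unit d j c = (\<lambda>i\<in>{..<d}. if i = j then c else 0)"

text \<open>A block through the origin is closed under addition, by translations, and under the
  linear part of the group. From any non-zero vector in it one extracts a multiple of a basis vector
  by sign changes; cyclic shifts and sums then produce everything.\<close>

lemma cube_primitive_soluble:
  assumes d: "1 \<le> d" shows "primitive_soluble (cube d) (cube_group d)"
proof -
  define o' where "o' = (\<lambda>i\<in>{..<d}. 0 :: 3)"
  have o': "o' \<in> cube d" by (simp add: o'_def cube_def)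
  have uc: "cube_unit d j c \<in> cube d" for j c by (simp add: cube_unit_def cube_def)
  have pg: "perm_group (cube d) (cube_group d)"
    using cube_group_subgroups(1) finite_cube o' by (auto simp: perm_group_def)
  interpret S: set_act "(BijGroup (cube d))\<lparr>carrier := cube_group d\<rparr>" "cube d" "\<lambda>g. g"
    by (rule perm_group_set_act[OF pg])
  have S.primitive
  proof (rule S.primitiveI[OF o'])
    fix x assume x: "x \<in> cube d"
    have "cube_map d (\<lambda>_. 1) 0 x o' = x"
      by (rule cube_eqI[of _ d]) (use x o' in \<open>simp_all add: cube_map_apply o'_def\<close>)
    moreover have "cube_map d (\<lambda>_. 1) 0 x \<in> cube_group d" unfolding cube_group_def using one_signs by blast
    ultimately show "\<exists>g\<in>carrier ((BijGroup (cube d))\<lparr>carrier := cube_group d\<rparr>). g o' = x" by auto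
  next
    fix B b assume oB: "o' \<in> B" and BE: "B \<subseteq> cube d" and b: "b \<in> B" "b \<noteq> o'"
      and bl0: "\<And>g x. g \<in> carrier ((BijGroup (cube d))\<lparr>carrier := cube_group d\<rparr>) \<Longrightarrow> x \<in> B \<Longrightarrow> g x \<in> B \<Longrightarrow> g ` B = B"
    have bl: "cube_map d \<epsilon> s c ` B = B" if "\<epsilon> \<in> signs" "x \<in> B" "cube_map d \<epsilon> s c x \<in> B" for \<epsilon> s c x
      by (rule bl0[where g = "cube_map d \<epsilon> s c" and x = x]) (use that cube_groupI in auto)
    have Bc: "v \<in> cube d" if "v \<in> B" for v using that BE by blast
    have add: "cube_map d (\<lambda>_. 1) 0 v u \<in> B" if v: "v \<in> B" and u: "u \<in> B" for u v
    proof -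
      have "cube_map d (\<lambda>_. 1) 0 v o' = v"
        by (rule cube_eqI[of _ d]) (use Bc[OF v] o' in \<open>simp_all add: cube_map_apply o'_def\<close>)
      then have "cube_map d (\<lambda>_. 1) 0 v ` B = B" using bl[OF one_signs oB] v by simp
      then show ?thesis using u by blast
    qed
    have lin: "cube_map d \<epsilon> s (\<lambda>_. 0) u \<in> B" if e: "\<epsilon> \<in> signs" and u: "u \<in> B" for \<epsilon> s u
    proof -
      have "cube_map d \<epsilon> s (\<lambda>_. 0) o' = o'"
        by (rule cube_eqI[of _ d]) (use o' in \<open>simp_all add: cube_map_apply o'_def\<close>)
      then have "cube_map d \<epsilon> s (\<lambda>_. 0) ` B = B" using bl[OF e oB, of s "\<lambda>_. 0"] oB by simp
      then show ?thesis using u by blast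
    qed
    obtain j where j: "j < d" "b j \<noteq> 0"
    proof (rule ccontr)
      assume "\<not> thesis"
      then have "b i = o' i" if "i < d" for i using that \<open>\<And>j. j < d \<Longrightarrow> b j \<noteq> 0 \<Longrightarrow> thesis\<close> by (auto simp: o'_def)
      then have "b = o'" using cube_eqI[OF Bc[OF b(1)] o'] by blast
      then show False using b by simp
    qed
    define c where "c = b j"
    have c0: "c \<noteq> 0" using j by (simp add: c_def)
    \<comment> \<open>Flipping all signs except the one at \<open>j\<close> and adding to
      \<open>b\<close> cancels the other coordinates and leaves \<open>2 c = -c\<close> at
      \<open>j\<close>; a final negation restores \<open>c\<close>.\<close>
    have unit: "cube_unit d j c \<in> B"
    proof -
      define \<epsilon> :: "nat \<Rightarrow> 3" where "\<epsilon> i = (if i = j then 1 else -1)" for i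
      have "\<epsilon> \<in> signs" by (simp add: signs_def \<epsilon>_def)
      then have w: "cube_map d \<epsilon> 0 (\<lambda>_. 0) b \<in> B" using b by (intro lin)
      have "cube_map d (\<lambda>_. 1) 0 b (cube_map d \<epsilon> 0 (\<lambda>_. 0) b) \<in> B" by (rule add[OF b(1) w])
      then have "cube_map d (\<lambda>_. -1) 0 (\<lambda>_. 0) (cube_map d (\<lambda>_. 1) 0 b (cube_map d \<epsilon> 0 (\<lambda>_. 0) b)) \<in> B"
        by (intro lin) (simp_all add: signs_def)
      also have "cube_map d (\<lambda>_. -1) 0 (\<lambda>_. 0) (cube_map d (\<lambda>_. 1) 0 b (cube_map d \<epsilon> 0 (\<lambda>_. 0) b)) = cube_unit d j c"
      proof (rule cube_eqI[of _ d])
        fix i assume i: "i < d"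
        have "- c + - c = c" using three_eq_zero[of c] by (metis add.commute add_eq_0_iff minus_add_distrib)
        then show "cube_map d (\<lambda>_. -1) 0 (\<lambda>_. 0) (cube_map d (\<lambda>_. 1) 0 b (cube_map d \<epsilon> 0 (\<lambda>_. 0) b)) i = cube_unit d j c i"
          using i Bc[OF b(1)] by (simp add: cube_map_apply cube_unit_def \<epsilon>_def c_def)
      qed (use Bc[OF b(1)] uc in simp_all)
      finally show ?thesis .
    qed
    have shift: "cube_unit d k c \<in> B" if k: "k < d" for k
    proof -
      \<comment> \<open>The shift is chosen so that coordinate \<open>k\<close> of the result is
        coordinate \<open>j\<close> of the argument modulo \<open>d\<close>; natural numbers require
        \<open>d - k\<close> in place of \<open>-k\<close>.\<close>
      have "cube_map d (\<lambda>_. 1) (j + (d - k)) (\<lambda>_. 0) (cube_unit d j c) \<in> B" by (rule lin[OF one_signs unit])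
      also have "cube_map d (\<lambda>_. 1) (j + (d - k)) (\<lambda>_. 0) (cube_unit d j c) = cube_unit d k c"
      proof (rule cube_eqI[of _ d])
        fix i assume i: "i < d"
        have "(i + (j + (d - k))) mod d = j \<longleftrightarrow> i = k"
        proof
          assume "i = k"
          then have "i + (j + (d - k)) = j + d" using k by simp
          then show "(i + (j + (d - k))) mod d = j" using j(1) by (simp only: mod_add_self2 mod_less)
        next
          assume m: "(i + (j + (d - k))) mod d = j"
          show "i = k"
          proof (cases "i + (j + (d - k)) < d")
            case True
            then have "i + (j + (d - k)) = j" using m by simp
            then show ?thesis using k by simp
          next
            case False
            show ?thesis
            proof (cases "i + (j + (d - k)) < 2 * d")
              case True
              then have "i + (j + (d - k)) - d < d" using False by linarith
              then have "i + (j + (d - k)) - d = j"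
                using m False le_mod_geq[of d "i + (j + (d - k))"] by simp
              then show ?thesis using k False by linarith
            next
              case F2: False
              have "i + (j + (d - k)) - 2 * d < d" using i j by linarith
              then have "i + (j + (d - k)) - 2 * d = j"
                using m F2 le_mod_geq[of d "i + (j + (d - k))"] le_mod_geq[of d "i + (j + (d - k)) - d"] by simp
              then show ?thesis using i k F2 by linarith
            qed
          qed
        qed
        then show "cube_map d (\<lambda>_. 1) (j + (d - k)) (\<lambda>_. 0) (cube_unit d j c) i = cube_unit d k c i"
          using i uc by (simp add: cube_map_apply cube_unit_def)
      qed (use uc in simp_all)
      finally show ?thesis .
    qed
    have units: "cube_unit d k x \<in> B" if k: "k < d" for k x
    proof -
      \<comment> \<open>A non-zero \<open>c\<close> generates the additive group of the field, which
        has prime order 3.\<close>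
      have "\<exists>n::nat. x = of_nat n * c"
      proof -
        have all: "y \<in> {0, 1, 2}" for y :: 3
        proof (cases y)
          case (of_int z)
          then have "z = 0 \<or> z = 1 \<or> z = 2" by auto
          then show ?thesis using of_int by auto
        qed
        have "x \<in> {0,1,2}" "c \<in> {1,2}" using all[of x] all[of c] c0 by auto
        moreover have "(2 * 2 :: 3) = 1" by simp
        ultimately have "x = of_nat 0 * c \<or> x = of_nat 1 * c \<or> x = of_nat 2 * c" by auto
        then show ?thesis by (elim disjE) (rule exI, assumption)+
      qed
      then obtain n :: nat where n: "x = of_nat n * c" by blast
      have "cube_unit d k (of_nat n * c) \<in> B" for n :: nat
      proof (induct n)
        case 0
        have "cube_unit d k 0 = o'" by (rule cube_eqI[OF uc o']) (simp add: cube_unit_def o'_def)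
        then show ?case using oB by simp
      next
        case (Suc n)
        have "cube_map d (\<lambda>_. 1) 0 (cube_unit d k c) (cube_unit d k (of_nat n * c)) \<in> B"
          by (rule add[OF shift[OF k] Suc])
        also have "cube_map d (\<lambda>_. 1) 0 (cube_unit d k c) (cube_unit d k (of_nat n * c)) = cube_unit d k (of_nat (Suc n) * c)"
          by (rule cube_eqI[of _ d]) (use uc in \<open>simp_all add: cube_map_apply cube_unit_def algebra_simps\<close>)
        finally show ?case .
      qed
      then show ?thesis using n by simp
    qed
    have pre: "(\<lambda>i\<in>{..<d}. if i < m then v i else 0) \<in> B" if v: "v \<in> cube d" and m: "m \<le> d" for v m
      using m
    proof (induct m)
      case 0
      show ?case using oB unfolding o'_def by (simp only: not_less_zero if_False)
    next
      case (Suc m)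
      have c1: "(\<lambda>i\<in>{..<d}. if i < m then v i else 0) \<in> cube d" by (simp add: cube_def)
      have "cube_map d (\<lambda>_. 1) 0 (cube_unit d m (v m)) (\<lambda>i\<in>{..<d}. if i < m then v i else 0) \<in> B"
        by (rule add[OF units Suc(1)]) (use Suc(2) in linarith)+
      also have "cube_map d (\<lambda>_. 1) 0 (cube_unit d m (v m)) (\<lambda>i\<in>{..<d}. if i < m then v i else 0)
          = (\<lambda>i\<in>{..<d}. if i < Suc m then v i else 0)"
      proof (rule cube_eqI[OF cube_map_in_cube[OF c1]])
        show "(\<lambda>i\<in>{..<d}. if i < Suc m then v i else 0) \<in> cube d" by (simp add: cube_def)
        fix i assume "i < d"
        then show "cube_map d (\<lambda>_. 1) 0 (cube_unit d m (v m)) (\<lambda>i\<in>{..<d}. if i < m then v i else 0) i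
            = (\<lambda>i\<in>{..<d}. if i < Suc m then v i else 0) i"
          by (simp add: cube_map_apply[OF c1] cube_unit_def less_Suc_eq)
      qed
      finally show ?case .
    qed
    have "v \<in> B" if v: "v \<in> cube d" for v
    proof -
      have "(\<lambda>i\<in>{..<d}. if i < d then v i else 0) = v"
      proof (rule cube_eqI[OF _ v])
        show "(\<lambda>i\<in>{..<d}. if i < d then v i else 0) \<in> cube d" by (simp add: cube_def)
      qed simp
      then show ?thesis using pre[OF v le_refl] by (simp only:)
    qed
    then show "B = cube d" using BE by blast
  qed
  then show ?thesis
    using cube_group_solvable by (simp add: primitive_soluble_def primitive_perm_group_iff[OF pg])
qed

text \<open>A translation moves the origin. After that, changing the sign at coordinate
  \<open>j\<close> fixes the origin and the earlier basis vectors but moves the one at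
  \<open>j\<close>, because -1 differs from 1 in characteristic 3. The length \<open>d + 1\<close>
  is \<open>log n / log 3 + 1\<close>.\<close>

lemma cube_irredundant:
  assumes d: "1 \<le> d"
  shows "irredundant (cube d) (cube_group d) ((\<lambda>i\<in>{..<d}. 0) # map (\<lambda>j. cube_unit d j 1) [0..<d])"
    (is "irredundant _ _ (?o # map ?e _)")
proof (rule irredundantI)
  have oc: "?o \<in> cube d" and uc: "?e j \<in> cube d" for j by (simp_all add: cube_unit_def cube_def)
  show "set (?o # map ?e [0..<d]) \<subseteq> cube d" using oc uc by auto
  fix i assume i: "i < length (?o # map ?e [0..<d])"
  show "\<exists>g\<in>cube_group d. (\<forall>x\<in>set (take i (?o # map ?e [0..<d])). g x = x) \<and>
      g ((?o # map ?e [0..<d]) ! i) \<noteq> (?o # map ?e [0..<d]) ! i"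
  proof (cases i)
    case 0
    let ?g = "cube_map d (\<lambda>_. 1) 0 (\<lambda>_. 1)"
    have "?g ?o 0 \<noteq> ?o 0" using oc d by (simp add: cube_map_apply)
    then have "?g ?o \<noteq> ?o" by auto
    then show ?thesis using 0 by (intro bexI[OF _ cube_groupI[OF one_signs]]) simp
  next
    case (Suc j)
    then have j: "j < d" using i by simp
    define \<epsilon> :: "nat \<Rightarrow> 3" where "\<epsilon> i = (if i = j then -1 else 1)" for i
    let ?g = "cube_map d \<epsilon> 0 (\<lambda>_. 0)"
    have \<epsilon>: "\<epsilon> \<in> signs" by (simp add: signs_def \<epsilon>_def)
    have o: "?g ?o = ?o" by (rule cube_eqI[of _ d]) (use oc in \<open>simp_all add: cube_map_apply\<close>)
    have e: "?g (?e l) = ?e l" if "l < j" for l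
      by (rule cube_eqI[of _ d]) (use uc that in \<open>auto simp: cube_map_apply cube_unit_def \<epsilon>_def\<close>)
    have "?g (?e j) j \<noteq> ?e j j" using uc j by (simp add: cube_map_apply cube_unit_def \<epsilon>_def)
    then have ne: "?g (?e j) \<noteq> ?e j" by auto
    have "set (take i (?o # map ?e [0..<d])) = insert ?o (?e ` {0..<j})"
      using Suc j by (simp add: take_map)
    then have "\<forall>x\<in>set (take i (?o # map ?e [0..<d])). ?g x = x" using o e by auto
    moreover have "(?o # map ?e [0..<d]) ! i = ?e j" using Suc j by simp
    ultimately show ?thesis using ne cube_groupI[OF \<epsilon>] by auto
  qed
qed

text \<open>The integer inequality behind it is 3^63 \<le> 2^100; the constant 0.63 is just below
  the reciprocal of the binary logarithm of 3.\<close>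

lemma log_3_bound: "0.63 * log 2 3 \<le> 1"
proof -
  have a: "log 2 ((3::real) ^ 63) = real 63 * log 2 3" by (rule log_nat_power) simp
  have b: "log 2 ((2::real) ^ 100) = real 100 * log 2 2" by (rule log_nat_power) simp
  have "log 2 ((3::real) ^ 63) \<le> log 2 (2 ^ 100)" by (rule log_mono) simp_all
  then have "real 63 * log 2 3 \<le> real 100 * log 2 2" by (simp only: a b)
  then show ?thesis by simp
qed

lemma infinite_lower_bound:
  "infinite {n :: nat. \<exists>(\<Delta> :: nat set) G. primitive_soluble \<Delta> G \<and> card \<Delta> = n \<and>
     real (max_irredundant_base \<Delta> G) \<ge> 0.63 * log 2 (real n) + 1}" (is "infinite ?A")
proof -
  have "3 ^ Suc d \<in> ?A" for d
  proof -
    let ?d = "Suc d"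
    have ps: "primitive_soluble (cube ?d) (cube_group ?d)" by (rule cube_primitive_soluble) simp
    obtain \<phi> :: "(nat \<Rightarrow> 3) \<Rightarrow> nat" where \<phi>: "inj_on \<phi> (cube ?d)"
      using finite_imp_inj_to_nat_seg[OF finite_cube] by blast
    let ?\<Delta> = "\<phi> ` cube ?d" and ?G = "transport \<phi> (cube ?d) (cube_group ?d)"
    note T = transport_primitive_soluble[OF ps \<phi>]
    have pg: "perm_group ?\<Delta> ?G" using T(1) by (simp add: primitive_soluble_def primitive_perm_group_def)
    have "?d + 1 \<le> max_irredundant_base ?\<Delta> ?G"
      using length_le_max_irredundant_base[OF pg T(2)[OF cube_irredundant[of ?d]]] by simp
    then have "real (?d + 1) \<le> real (max_irredundant_base ?\<Delta> ?G)" by (simp only: of_nat_le_iff)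
    moreover have "0.63 * log 2 (real (3 ^ ?d)) \<le> real ?d"
    proof -
      have "0.63 * log 2 (real (3 ^ ?d)) = real ?d * (0.63 * log 2 3)"
        by (subst of_nat_power, subst log_nat_power) simp_all
      also have "\<dots> \<le> real ?d * 1" by (rule mult_left_mono[OF log_3_bound]) simp
      finally show ?thesis by simp
    qed
    ultimately have "0.63 * log 2 (real (3 ^ ?d)) + 1 \<le> real (max_irredundant_base ?\<Delta> ?G)" by simp
    moreover have "card ?\<Delta> = 3 ^ ?d" using \<phi> by (simp only: card_image card_cube)
    ultimately show ?thesis using T(1) by blast
  qed
  then have "range (\<lambda>d. 3 ^ Suc d) \<subseteq> ?A" by blast
  moreover have "inj (\<lambda>d. (3::nat) ^ Suc d)" by (rule injI) simp
  then have "infinite (range (\<lambda>d. (3::nat) ^ Suc d))" by (rule range_inj_infinite)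
  ultimately show ?thesis by (rule infinite_super)
qed

section \<open>The algebraic closure of the field with 2 elements and its finite subfields\<close>

type_synonym K = "bit alg_closure"

lemma K_two: "(2 :: K) = 0"
proof -
  have "(2 :: K) = to_ac (1 :: bit) + to_ac 1" by (simp only: to_ac_1 one_add_one)
  also have "\<dots> = to_ac (1 + 1)" by (rule to_ac_add[symmetric])
  also have "(1 + 1 :: bit) = 0" by simp
  finally show ?thesis by (simp only: to_ac_0)
qed

lemma K_double [simp]: "x + x = (0 :: K)"
proof -
  have "x + x = 2 * x" by simp
  then show ?thesis by (simp add: K_two)
qed

lemma K_add_cancel: "x + (x + y) = (y :: K)"
  by (simp add: add.assoc[symmetric])

lemma K_minus [simp]: "- x = (x :: K)"
  by (metis K_double add_eq_0_iff)

lemma K_add_eq_zero: "x + y = (0 :: K) \<longleftrightarrow> x = y"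
  by (metis K_minus add_eq_0_iff)

lemma K_frobenius_add: "(x + y :: K) ^ (2 ^ j) = x ^ (2 ^ j) + y ^ (2 ^ j)"
proof (induct j)
  case (Suc j)
  have sq: "(a + b) ^ 2 = a ^ 2 + b ^ 2" for a b :: K
    by (simp add: power2_sum K_two)
  have "(x + y) ^ (2 ^ Suc j) = ((x + y) ^ (2 ^ j)) ^ 2" by (simp add: power_mult[symmetric] mult.commute)
  also have "\<dots> = (x ^ (2 ^ j)) ^ 2 + (y ^ (2 ^ j)) ^ 2" by (simp only: Suc sq)
  finally show ?case by (simp add: power_mult[symmetric] mult.commute)
qed simp

text \<open>In characteristic 2 the Artin-Schreier map satisfies \<open>T\<^sup>n x = x\<^sup>q + x\<close> with \<open>q = 2\<^sup>n\<close>
  whenever \<open>n\<close> is a power of 2. So the field with \<open>q\<close> elements is the kernel of \<open>T\<^sup>n\<close>, and its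
  cardinality follows from that of the kernel of \<open>T\<close>.\<close>

definition T :: "K \<Rightarrow> K" where "T x = x ^ 2 + x"

lemma T_add: "T (x + y) = T x + T y"
proof -
  have "(x + y) ^ 2 = x ^ 2 + y ^ 2" using K_frobenius_add[of x y 1] by (simp only: power_one_right)
  then show ?thesis by (simp only: T_def ac_simps)
qed

lemma T_surj: "\<exists>x. T x = y"
proof -
  have "degree [:y, 1, 1 :: K:] > 0" by simp
  from alg_closed_imp_poly_has_root[OF this] obtain x where "y + x * (1 + x) = 0" by auto
  then have "x ^ 2 + x = y" by (simp add: power2_eq_square algebra_simps K_add_eq_zero)
      (metis K_add_eq_zero add.assoc add.commute)
  then show ?thesis by (auto simp: T_def)
qed

lemma T_eq_zero: "T x = 0 \<longleftrightarrow> x = 0 \<or> x = 1"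
proof -
  have "T x = x * (x + 1)" by (simp add: T_def power2_eq_square algebra_simps)
  then show ?thesis by (auto simp: K_add_eq_zero)
qed

definition ker :: "nat \<Rightarrow> K set" where "ker n = {x. (T ^^ n) x = 0}"

lemma T_pow_add: "(T ^^ n) (x + y) = (T ^^ n) x + (T ^^ n) y"
  by (induct n) (simp_all add: T_add)

lemma ker_add: "x \<in> ker n \<Longrightarrow> y \<in> ker n \<Longrightarrow> x + y \<in> ker n"
  by (simp add: ker_def T_pow_add)

lemma T_pow_zero [simp]: "(T ^^ n) 0 = 0"
  by (induct n) (simp_all add: T_def)

lemma ker_zero: "0 \<in> ker n"
  by (simp add: ker_def)

lemma ker_mono: "m \<le> n \<Longrightarrow> ker m \<subseteq> ker n"
proof (rule subsetI)
  fix x assume "m \<le> n" "x \<in> ker m"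
  then show "x \<in> ker n" using funpow_add[of "n - m" m T] by (simp add: ker_def)
qed

text \<open>\<open>T\<close> is additive and onto with kernel {0, 1}, so every element of
  \<open>ker n\<close> has exactly two preimages under \<open>T\<close>, namely \<open>r y\<close>
  and \<open>r y + 1\<close>.\<close>

lemma card_ker: "card (ker n) = 2 ^ n \<and> finite (ker n)"
proof (induct n)
  case 0
  have "ker 0 = {0}" by (auto simp: ker_def)
  then show ?case by simp
next
  case (Suc n)
  define r where "r y = (SOME x. T x = y)" for y
  have r: "T (r y) = y" for y unfolding r_def by (rule someI_ex[OF T_surj])
  have "bij_betw (\<lambda>(y, e). r y + e) (ker n \<times> {0, 1}) (ker (Suc n))"
  proof (rule bij_betw_imageI)
    have T01: "T (r y + e) = y" if "e \<in> {0, 1}" for y e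
      using that r T_eq_zero[of e] by (simp add: T_add)
    show "inj_on (\<lambda>(y, e). r y + e) (ker n \<times> {0, 1})"
    proof (rule inj_onI, clarify)
      fix y e y' e' assume e: "e \<in> {0, 1 :: K}" "e' \<in> {0, 1 :: K}" and eq: "r y + e = r y' + e'"
      have "y = y'" using T01[OF e(1), of y] T01[OF e(2), of y'] eq by simp
      then show "y = y' \<and> e = e'" using eq by simp
    qed
    show "(\<lambda>(y, e). r y + e) ` (ker n \<times> {0, 1}) = ker (Suc n)"
    proof (intro equalityI subsetI)
      fix x assume "x \<in> (\<lambda>(y, e). r y + e) ` (ker n \<times> {0, 1})"
      then obtain y e where "y \<in> ker n" "e \<in> {0, 1}" "x = r y + e" by auto
      then show "x \<in> ker (Suc n)" using T01[of e y] by (simp only: ker_def mem_Collect_eq funpow_Suc_right o_apply)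
    next
      fix x assume x: "x \<in> ker (Suc n)"
      define e where "e = x + r (T x)"
      have "T e = 0" by (simp add: e_def T_add r)
      then have "e \<in> {0, 1}" by (simp add: T_eq_zero)
      moreover have "T x \<in> ker n" using x by (simp only: ker_def mem_Collect_eq funpow_Suc_right o_apply)
      moreover have "x = r (T x) + e" by (simp add: e_def add.left_commute)
      ultimately show "x \<in> (\<lambda>(y, e). r y + e) ` (ker n \<times> {0, 1})" by (intro image_eqI[of _ _ "(T x, e)"]) auto
    qed
  qed
  then have "card (ker n \<times> {0, 1 :: K}) = card (ker (Suc n))" "finite (ker n \<times> {0, 1 :: K}) = finite (ker (Suc n))"
    by (rule bij_betw_same_card, rule bij_betw_finite)
  then show ?case using Suc by (simp add: card_cartesian_product)
qed

text \<open>If the iterate of order \<open>2^k\<close> equals \<open>\<phi> + 1\<close>, where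
  \<open>\<phi>\<close> is the power map with exponent \<open>2^(2^k)\<close>, then the next one is
  its square, and in characteristic 2 the square of \<open>\<phi> + 1\<close> is
  \<open>\<phi>^2 + 1\<close>.\<close>

lemma ker_pow2: "ker (2 ^ k) = {x. x ^ (2 ^ 2 ^ k) = x}"
proof -
  have "(T ^^ (2 ^ k)) x = x ^ (2 ^ 2 ^ k) + x" for x
  proof (induct k arbitrary: x)
    case (Suc k)
    let ?q = "2 ^ 2 ^ k :: nat"
    have "(T ^^ (2 ^ Suc k)) x = (T ^^ (2 ^ k)) ((T ^^ (2 ^ k)) x)"
      by (simp only: power_Suc mult_2 funpow_add o_apply)
    also have "\<dots> = (x ^ ?q + x) ^ ?q + (x ^ ?q + x)" by (simp only: Suc)
    also have "\<dots> = (x ^ ?q) ^ ?q + x ^ ?q + (x ^ ?q + x)" by (simp only: K_frobenius_add)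
    also have "\<dots> = (x ^ ?q) ^ ?q + x" by (simp only: add.assoc K_add_cancel)
    also have "(x ^ ?q) ^ ?q = x ^ (2 ^ 2 ^ Suc k)"
    proof -
      have "?q * ?q = 2 ^ 2 ^ Suc k" by (simp only: power_Suc mult_2 power_add)
      then show ?thesis by (simp only: power_mult[symmetric])
    qed
    finally show ?case .
  qed (simp add: T_def)
  then show ?thesis by (auto simp: ker_def K_add_eq_zero)
qed

text \<open>The exponent \<open>j\<close> of the Frobenius map is kept as a natural number instead
  of a residue, so that composing two maps simply adds the exponents.\<close>

definition semiaffine :: "K set \<Rightarrow> K \<Rightarrow> nat \<Rightarrow> K \<Rightarrow> K \<Rightarrow> K" where
  "semiaffine F a j b = (\<lambda>x\<in>F. a * x ^ (2 ^ j) + b)"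

locale two_power_field =
  fixes k :: nat and F :: "K set"
  assumes k1: "1 \<le> k" and F_eq: "F = ker (2 ^ k)"
begin

lemma F_iff: "x \<in> F \<longleftrightarrow> x ^ (2 ^ 2 ^ k) = x"
  by (simp add: F_eq ker_pow2)

lemma card_F: "card F = 2 ^ 2 ^ k" and finite_F: "finite F"
  using card_ker[of "2 ^ k"] by (simp_all add: F_eq)

lemma F_add: "x \<in> F \<Longrightarrow> y \<in> F \<Longrightarrow> x + y \<in> F"
  unfolding F_eq by (rule ker_add)

lemma F_mult: "x \<in> F \<Longrightarrow> y \<in> F \<Longrightarrow> x * y \<in> F"
  by (simp add: F_iff power_mult_distrib)

lemma F_divide: "x \<in> F \<Longrightarrow> y \<in> F \<Longrightarrow> x / y \<in> F"
  by (simp add: F_iff power_divide)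

lemma F_power: "x \<in> F \<Longrightarrow> x ^ n \<in> F"
  by (induct n) (simp_all add: F_iff power_mult_distrib)

lemma F_01 [simp]: "0 \<in> F" "1 \<in> F"
  by (simp_all add: F_iff)

lemma semiaffine_in: "a \<in> F \<Longrightarrow> b \<in> F \<Longrightarrow> x \<in> F \<Longrightarrow> semiaffine F a j b x \<in> F"
  by (simp add: semiaffine_def F_add F_mult F_power)

lemma semiaffine_compose:
  assumes "a \<in> F" "b \<in> F" "a' \<in> F" "b' \<in> F" "x \<in> F"
  shows "semiaffine F a j b (semiaffine F a' j' b' x) = semiaffine F (a * a' ^ 2 ^ j) (j + j') (a * b' ^ 2 ^ j + b) x"
proof -
  have "(x ^ 2 ^ j') ^ 2 ^ j = x ^ 2 ^ (j + j')"
    by (simp add: power_mult[symmetric] power_add mult.commute)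
  then show ?thesis
    using assms semiaffine_in[OF assms(3,4,5), of j']
    by (simp add: semiaffine_def K_frobenius_add power_mult_distrib algebra_simps)
qed

text \<open>The semiaffine, affine and translation groups of the line over \<open>F\<close>; they
  form the series with abelian factors used for solubility.\<close>

definition G0 where "G0 = {semiaffine F a j b | a j b. a \<in> F \<and> a \<noteq> 0 \<and> b \<in> F}"
definition G1 where "G1 = {semiaffine F a 0 b | a b. a \<in> F \<and> a \<noteq> 0 \<and> b \<in> F}"
definition G2 where "G2 = {semiaffine F 1 0 b | b. b \<in> F}"

lemma G0I: "a \<in> F \<Longrightarrow> a \<noteq> 0 \<Longrightarrow> b \<in> F \<Longrightarrow> semiaffine F a j b \<in> G0"
  unfolding G0_def by blast

lemma G1I: "a \<in> F \<Longrightarrow> a \<noteq> 0 \<Longrightarrow> b \<in> F \<Longrightarrow> semiaffine F a 0 b \<in> G1"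
  unfolding G1_def by blast

lemma G2I: "b \<in> F \<Longrightarrow> semiaffine F 1 0 b \<in> G2"
  unfolding G2_def by blast

lemma semiaffine_Bij:
  assumes "a \<in> F" "a \<noteq> 0" "b \<in> F" shows "semiaffine F a j b \<in> Bij F"
proof -
  have inj: "inj_on (semiaffine F a j b) F"
  proof (rule inj_onI)
    fix x y assume xy: "x \<in> F" "y \<in> F" "semiaffine F a j b x = semiaffine F a j b y"
    then have "x ^ 2 ^ j = y ^ 2 ^ j" using assms(2) by (simp add: semiaffine_def)
    then have "(x + y) ^ 2 ^ j = 0" by (simp add: K_frobenius_add)
    then show "x = y" by (simp add: K_add_eq_zero)
  qed
  have "semiaffine F a j b ` F = F"
    by (rule endo_inj_surj[OF finite_F image_subsetI inj]) (rule semiaffine_in[OF assms(1,3)])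
  then show ?thesis using inj by (simp add: Bij_def bij_betw_def semiaffine_def)
qed

lemma compose_semiaffine:
  assumes "a \<in> F" "b \<in> F" "a' \<in> F" "b' \<in> F"
  shows "compose F (semiaffine F a j b) (semiaffine F a' j' b') =
    semiaffine F (a * a' ^ 2 ^ j) (j + j') (a * b' ^ 2 ^ j + b)"
  by (rule extensionalityI[where A = F])
    (use assms in \<open>simp_all add: compose_eq semiaffine_compose, simp_all add: semiaffine_def compose_def\<close>)

lemma semiaffine_id: "semiaffine F 1 0 0 = (\<lambda>x\<in>F. x)"
  by (simp add: semiaffine_def cong: restrict_cong)

lemma subgroups: "subgroup G0 (BijGroup F)" "subgroup G1 (BijGroup F)" "subgroup G2 (BijGroup F)"
proof -
  show "subgroup G0 (BijGroup F)"
  proof (rule subgroup_BijGroupI[OF finite_F])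
    show "G0 \<subseteq> Bij F" using semiaffine_Bij by (auto simp: G0_def)
    show "(\<lambda>x\<in>F. x) \<in> G0" unfolding semiaffine_id[symmetric] by (rule G0I) simp_all
    fix f g assume "f \<in> G0" "g \<in> G0"
    then obtain a j b a' j' b' where h: "a \<in> F" "a \<noteq> 0" "b \<in> F" "a' \<in> F" "a' \<noteq> 0" "b' \<in> F"
      "f = semiaffine F a j b" "g = semiaffine F a' j' b'" by (auto simp: G0_def)
    show "compose F f g \<in> G0"
      unfolding h(7,8) compose_semiaffine[OF h(1,3,4,6)] by (rule G0I) (use h in \<open>simp_all add: F_add F_mult F_power\<close>)
  qed
  show "subgroup G1 (BijGroup F)"
  proof (rule subgroup_BijGroupI[OF finite_F])
    show "G1 \<subseteq> Bij F" using semiaffine_Bij by (auto simp: G1_def)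
    show "(\<lambda>x\<in>F. x) \<in> G1" unfolding semiaffine_id[symmetric] by (rule G1I) simp_all
    fix f g assume "f \<in> G1" "g \<in> G1"
    then obtain a b a' b' where h: "a \<in> F" "a \<noteq> 0" "b \<in> F" "a' \<in> F" "a' \<noteq> 0" "b' \<in> F"
      "f = semiaffine F a 0 b" "g = semiaffine F a' 0 b'" by (auto simp: G1_def)
    show "compose F f g \<in> G1"
      unfolding h(7,8) compose_semiaffine[OF h(1,3,4,6)] add_0_right
      by (rule G1I) (use h in \<open>simp_all add: F_add F_mult F_power\<close>)
  qed
  show "subgroup G2 (BijGroup F)"
  proof (rule subgroup_BijGroupI[OF finite_F])
    show "G2 \<subseteq> Bij F" using semiaffine_Bij by (auto simp: G2_def)
    show "(\<lambda>x\<in>F. x) \<in> G2" unfolding semiaffine_id[symmetric] by (rule G2I) simp_all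
    fix f g assume "f \<in> G2" "g \<in> G2"
    then obtain b b' where h: "b \<in> F" "b' \<in> F" "f = semiaffine F 1 0 b" "g = semiaffine F 1 0 b'"
      by (auto simp: G2_def)
    show "compose F f g \<in> G2"
      unfolding h(3,4) compose_semiaffine[OF F_01(2) h(1) F_01(2) h(2)] power_one mult_1_right add_0_right
      by (rule G2I) (use h in \<open>simp_all add: F_add F_power\<close>)
  qed
qed

lemma G0_solvable: "solvable ((BijGroup F)\<lparr>carrier := G0\<rparr>)"
proof (rule solvable_BijGroupI[OF subgroups])
  \<comment> \<open>Two semiaffine maps with the same Frobenius exponent differ by an affine map.
    The translation part is written with a plus sign, as the two copies of \<open>r * B'\<close>
    cancel in characteristic 2.\<close>
  have gen1: "semiaffine F A j B x = semiaffine F (A / A') 0 (B + A / A' * B') (semiaffine F A' j B' x)"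
    if AB: "A \<in> F" "A' \<in> F" "A' \<noteq> 0" "B \<in> F" "B' \<in> F" "x \<in> F" for A A' j B B' x
  proof -
    define r where "r = A / A'"
    have A: "A = r * A'" using AB(3) by (simp add: r_def)
    have "semiaffine F r 0 (B + r * B') (semiaffine F A' j B' x) = r * (A' * x ^ 2 ^ j + B') + (B + r * B')"
      using semiaffine_in[OF AB(2,5,6), of j] AB(6) by (simp add: semiaffine_def)
    also have "\<dots> = r * A' * x ^ 2 ^ j + (B + (r * B' + r * B'))"
      by (simp only: distrib_left mult.assoc add.assoc add.left_commute add.commute)
    also have "\<dots> = semiaffine F A j B x" using AB(6) by (simp add: A semiaffine_def)
    finally show ?thesis unfolding r_def by (rule sym)
  qed
  fix g h assume "g \<in> G0" "h \<in> G0"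
  then obtain a j b a' j' b' where h: "a \<in> F" "a \<noteq> 0" "b \<in> F" "a' \<in> F" "a' \<noteq> 0" "b' \<in> F"
    "g = semiaffine F a j b" "h = semiaffine F a' j' b'" by (auto simp: G0_def)
  define A B A' B' where "A = a * a' ^ 2 ^ j" and "B = a * b' ^ 2 ^ j + b"
    and "A' = a' * a ^ 2 ^ j'" and "B' = a' * b ^ 2 ^ j' + b'"
  have c: "A \<in> F" "A' \<in> F" "A' \<noteq> 0" "A \<noteq> 0" "B \<in> F" "B' \<in> F"
    using h by (simp_all add: A_def B_def A'_def B'_def F_add F_mult F_power)
  have "semiaffine F (A / A') 0 (B + A / A' * B') \<in> G1"
    using c by (intro G1I) (simp_all add: F_add F_mult F_divide)
  moreover have "g (h x) = semiaffine F (A / A') 0 (B + A / A' * B') (h (g x))" if x: "x \<in> F" for x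
    using gen1[OF c(1,2,3,5,6) x, of "j + j'"]
    by (simp add: h(7,8) semiaffine_compose[OF h(1,3,4,6) x] semiaffine_compose[OF h(4,6,1,3) x]
        A_def B_def A'_def B'_def add.commute)
  ultimately show "\<exists>k\<in>G1. \<forall>x\<in>F. g (h x) = k (h (g x))" by blast
next
  fix g h assume "g \<in> G1" "h \<in> G1"
  then obtain a b a' b' where h: "a \<in> F" "b \<in> F" "a' \<in> F" "b' \<in> F"
    "g = semiaffine F a 0 b" "h = semiaffine F a' 0 b'" by (auto simp: G1_def)
  define c where "c = a * b' + b + (a' * b + b')"
  have "c \<in> F" using h by (simp add: c_def F_add F_mult)
  moreover have "g (h x) = semiaffine F 1 0 c (h (g x))" if x: "x \<in> F" for x
  proof -
    have "h (g x) \<in> F" "g x \<in> F" "h x \<in> F" using x h by (simp_all add: semiaffine_in)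
    moreover have "h (g x) = a' * (a * x + b) + b'" "g (h x) = a * (a' * x + b') + b"
      using x h calculation by (simp_all add: semiaffine_def)
    ultimately have "semiaffine F 1 0 c (h (g x)) = a' * (a * x + b) + b' + c" by (simp add: semiaffine_def)
    also have "\<dots> = a * a' * x + a * b' + b + ((a' * b + b') + (a' * b + b'))"
      by (simp only: c_def distrib_left) (simp only: ac_simps)
    also have "\<dots> = g (h x)" using \<open>g (h x) = _\<close> by (simp add: algebra_simps)
    finally show ?thesis by simp
  qed
  ultimately show "\<exists>k\<in>G2. \<forall>x\<in>F. g (h x) = k (h (g x))" using G2I by blast
next
  fix g h x assume "g \<in> G2" "h \<in> G2" and x: "x \<in> F"
  then obtain b b' where h: "b \<in> F" "b' \<in> F" "g = semiaffine F 1 0 b" "h = semiaffine F 1 0 b'"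
    by (auto simp: G2_def)
  then show "g (h x) = h (g x)" using x by (simp add: semiaffine_def F_add add_ac)
qed

lemma primitive_soluble_G0: "primitive_soluble F G0"
proof -
  have "F \<noteq> {}" using F_01(1) by blast
  then have pg: "perm_group F G0" using subgroups(1) finite_F by (simp add: perm_group_def)
  interpret S: set_act "(BijGroup F)\<lparr>carrier := G0\<rparr>" F "\<lambda>g. g" by (rule perm_group_set_act[OF pg])
  have S.primitive
  proof (rule S.primitiveI[of 0])
    fix x assume x: "x \<in> F"
    have "semiaffine F 1 0 x \<in> G0" by (rule G0I) (use x in simp_all)
    moreover have "semiaffine F 1 0 x 0 = x" by (simp add: semiaffine_def)
    ultimately show "\<exists>g\<in>carrier ((BijGroup F)\<lparr>carrier := G0\<rparr>). g 0 = x" by auto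
  next
    fix B b assume B: "0 \<in> B" "B \<subseteq> F" "b \<in> B" "b \<noteq> 0"
      and bl: "\<And>g x. g \<in> carrier ((BijGroup F)\<lparr>carrier := G0\<rparr>) \<Longrightarrow> x \<in> B \<Longrightarrow> g x \<in> B \<Longrightarrow> g ` B = B"
    have "y \<in> B" if y: "y \<in> F" "y \<noteq> 0" for y
    proof -
      \<comment> \<open>Scalar multiplication fixes 0, so it preserves the block, and it can carry
        \<open>b\<close> to any prescribed non-zero element; the group is doubly transitive.\<close>
      let ?g = "semiaffine F (y / b) 0 0"
      have bF: "b \<in> F" using B by auto
      have "?g \<in> G0" using y bF B by (intro G0I) (simp_all add: F_divide)
      then have "?g ` B = B" using bl[of ?g 0] B(1) by (simp add: semiaffine_def)
      moreover have "?g b = y" using bF B by (simp add: semiaffine_def)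
      ultimately show ?thesis using B(3) by (metis image_eqI)
    qed
    then show "B = F" using B by blast
  qed simp
  then show ?thesis
    using G0_solvable by (simp add: primitive_soluble_def primitive_perm_group_iff[OF pg])
qed

text \<open>The tower of subfields of orders 2, 4, 16, 256, ... inside \<open>F\<close> has
  \<open>k\<close> quadratic steps, and \<open>w i\<close> is chosen new at step \<open>i\<close>.
  The power maps that fix a subfield pointwise move the next \<open>w\<close>, and with the points 0
  and 1 the length becomes \<open>k + 2\<close>.\<close>

lemma irredundant_G0:
  obtains \<delta> where "irredundant F G0 \<delta>" "length \<delta> = k + 2"
proof -
  have "\<exists>x. x \<in> ker (2 ^ Suc i) \<and> x \<notin> ker (2 ^ i)" for i
  proof (rule ccontr)
    assume "\<not> ?thesis"
    then have "ker (2 ^ Suc i) \<subseteq> ker (2 ^ i)" by blast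
    then have "card (ker (2 ^ Suc i)) \<le> card (ker (2 ^ i))" using card_ker by (intro card_mono) blast+
    then have "(2::nat) ^ 2 ^ Suc i \<le> 2 ^ 2 ^ i" by (simp only: card_ker[THEN conjunct1])
    then show False by simp
  qed
  then obtain w where w: "\<And>i. w i \<in> ker (2 ^ Suc i) \<and> w i \<notin> ker (2 ^ i)" by metis
  define \<delta> where "\<delta> = 0 # 1 # map w [0..<k]"
  have kerF: "ker (2 ^ i) \<subseteq> F" if "i \<le> k" for i
    unfolding F_eq using that by (intro ker_mono power_increasing) auto
  have "irredundant F G0 \<delta>"
  proof (rule irredundantI)
    have "w n \<in> F" if "n < k" for n using w[of n] kerF[of "Suc n"] that by (meson Suc_leI subsetD)
    then show "set \<delta> \<subseteq> F" by (auto simp: \<delta>_def)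
    fix i assume i: "i < length \<delta>"
    show "\<exists>g\<in>G0. (\<forall>x\<in>set (take i \<delta>). g x = x) \<and> g (\<delta> ! i) \<noteq> \<delta> ! i"
    proof (cases i)
      case 0
      have "semiaffine F 1 0 1 0 \<noteq> 0" by (simp add: semiaffine_def)
      then show ?thesis using 0 G0I[of 1 1 0] by (auto simp: \<delta>_def)
    next
      case (Suc j)
      show ?thesis
      proof (cases j)
        case 0
        \<comment> \<open>A multiplier is needed that fixes 0 but moves 1; \<open>w 0\<close>, lying
          outside the subfield {0, 1}, is such a scalar. At least one step of the tower is required
          to have it in \<open>F\<close>.\<close>
        have w0: "w 0 \<in> F" "w 0 \<noteq> 0" "w 0 \<noteq> 1"
        proof -
          show "w 0 \<in> F" using w[of 0] kerF[of 1] k1 by auto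
          have "0 \<in> ker (2 ^ 0)" "1 \<in> ker (2 ^ 0)" unfolding ker_pow2 by simp_all
          then show "w 0 \<noteq> 0" "w 0 \<noteq> 1" using w[of 0] by auto
        qed
        have "semiaffine F (w 0) 0 0 0 = 0" "semiaffine F (w 0) 0 0 1 \<noteq> 1"
          using w0 by (simp_all add: semiaffine_def)
        then show ?thesis using G0I[OF w0(1,2) F_01(1), of 0] Suc 0 by (auto simp: \<delta>_def)
      next
        case (Suc l)
        have l: "l < k" "i = Suc (Suc l)" using i Suc \<open>i = Suc j\<close> by (simp_all add: \<delta>_def)
        \<comment> \<open>The fixed points of this power map are exactly the subfield
          \<open>ker (2 ^ l)\<close>, which contains 0, 1 and the earlier \<open>w n\<close> but not
          \<open>w l\<close>.\<close>
        let ?g = "semiaffine F 1 (2 ^ l) 0"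
        have wF: "w n \<in> F" if "n \<le> l" for n using w[of n] kerF[of "Suc n"] that l by auto
        have "?g (w n) = w n" if "n < l" for n
        proof -
          have "w n \<in> ker (2 ^ l)" using w[of n] ker_mono[of "2 ^ Suc n" "2 ^ l"] that
            by (meson Suc_leI one_le_numeral power_increasing subsetD)
          then show ?thesis using wF[of n] that by (simp add: ker_pow2 semiaffine_def)
        qed
        moreover have "?g (w l) \<noteq> w l" using w[of l] wF[of l] by (simp add: ker_pow2 semiaffine_def)
        moreover have "?g 0 = 0" "?g 1 = 1" by (simp_all add: semiaffine_def)
        moreover have "set (take i \<delta>) = insert 0 (insert 1 (w ` {0..<l}))"
          using l by (simp add: \<delta>_def take_map)
        moreover have "\<delta> ! i = w l" using l by (simp add: \<delta>_def)
        ultimately show ?thesis using G0I[of 1 0 "2 ^ l"] by (intro bexI[of _ ?g]) auto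
      qed
    qed
  qed
  then show ?thesis using that[of \<delta>] by (simp add: \<delta>_def)
qed

end

text \<open>The final example lives on natural numbers, whereas \<open>basic\<close> asks for an
  identification with coordinate vectors; undoing the renaming recovers the concrete group on
  vectors.\<close>

lemma transport_inv_into:
  assumes inj: "inj_on \<phi> \<Delta>" and G: "\<And>g. g \<in> G \<Longrightarrow> g \<in> Bij \<Delta>"
  shows "transport (inv_into \<Delta> \<phi>) (\<phi> ` \<Delta>) (transport \<phi> \<Delta> G) = G"
proof -
  have im: "inv_into \<Delta> \<phi> ` \<phi> ` \<Delta> = \<Delta>" by (rule inv_into_image_cancel[OF inj subset_refl])
  have inj': "inj_on (inv_into \<Delta> \<phi>) (\<phi> ` \<Delta>)" by (rule inj_on_inv_into[OF subset_refl])
  have key: "transport_map (inv_into \<Delta> \<phi>) (\<phi> ` \<Delta>) (transport_map \<phi> \<Delta> g) = g" if g: "g \<in> G" for g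
  proof (rule extensionalityI[where A = \<Delta>])
    show "transport_map (inv_into \<Delta> \<phi>) (\<phi> ` \<Delta>) (transport_map \<phi> \<Delta> g) \<in> extensional \<Delta>"
      unfolding transport_map_def im by (rule restrict_extensional)
    show "g \<in> extensional \<Delta>" by (rule Bij_imp_extensional[OF G[OF g]])
    fix x assume x: "x \<in> \<Delta>"
    then have gx: "g x \<in> \<Delta>" using Bij_imp_funcset[OF G[OF g]] by blast
    have "transport_map (inv_into \<Delta> \<phi>) (\<phi> ` \<Delta>) (transport_map \<phi> \<Delta> g) (inv_into \<Delta> \<phi> (\<phi> x))
        = inv_into \<Delta> \<phi> (transport_map \<phi> \<Delta> g (\<phi> x))"
      by (rule transport_map_apply[OF inj']) (rule imageI[OF x])
    then show "transport_map (inv_into \<Delta> \<phi>) (\<phi> ` \<Delta>) (transport_map \<phi> \<Delta> g) x = g x"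
      using x gx by (simp add: inv_into_f_f[OF inj] transport_map_apply[OF inj])
  qed
  then show ?thesis unfolding transport_eq image_image by (simp cong: image_cong_simp)
qed

section \<open>Coordinates over the prime field for the semiaffine group\<close>

context two_power_field begin

abbreviation V where "V \<equiv> vec_space 2 (2 ^ k)"

lemma V_group: "abelian_group V"
  by (rule vec_space_abelian_group[OF two_is_prime_nat])

lemma V_mem: "v \<in> carrier V \<longleftrightarrow> v \<in> {..<2 ^ k} \<rightarrow>\<^sub>E {0, 1}"
proof -
  have "{0..1} = {0, 1 :: int}" by auto
  then show ?thesis by (simp add: vec_space_def residue_ring_def)
qed

lemma V_coord: "v \<in> carrier V \<Longrightarrow> i < 2 ^ k \<Longrightarrow> v i = 0 \<or> v i = 1"
  unfolding V_mem by blast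

lemma V_add: "i < 2 ^ k \<Longrightarrow> (v \<oplus>\<^bsub>V\<^esub> u) i = (v i + u i) mod 2"
  by (simp add: vec_space_def residue_ring_def)

lemma V_add_closed: "v \<in> carrier V \<Longrightarrow> u \<in> carrier V \<Longrightarrow> v \<oplus>\<^bsub>V\<^esub> u \<in> carrier V"
  using abelian_monoid.a_closed[of V] V_group by (simp add: abelian_group_def)

lemma V_zero: "\<zero>\<^bsub>V\<^esub> \<in> carrier V"
  using abelian_monoid.zero_closed[of V] V_group by (simp add: abelian_group_def)

text \<open>A basis of \<open>F\<close> over the field with 2 elements adapted to the flag
  \<open>ker 0 \<subset> ker 1 \<subset> ...\<close>, whose members double in order. It is obtained
  from cardinalities alone.\<close>

definition w :: "nat \<Rightarrow> K" where "w i = (SOME x. x \<in> ker (Suc i) \<and> x \<notin> ker i)"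

lemma w: "w i \<in> ker (Suc i)" "w i \<notin> ker i"
proof -
  have "\<exists>x. x \<in> ker (Suc i) \<and> x \<notin> ker i"
  proof (rule ccontr)
    assume "\<not> ?thesis"
    then have "ker (Suc i) \<subseteq> ker i" by blast
    then have "card (ker (Suc i)) \<le> card (ker i)" using card_ker by (intro card_mono) blast+
    then have "(2::nat) ^ Suc i \<le> 2 ^ i" by (simp only: card_ker[THEN conjunct1])
    then show False by simp
  qed
  from someI_ex[OF this] show "w i \<in> ker (Suc i)" "w i \<notin> ker i" unfolding w_def by blast+
qed

definition \<theta> :: "(nat \<Rightarrow> int) \<Rightarrow> K" where "\<theta> v = (\<Sum>i<2 ^ k. if v i = 0 then 0 else w i)"

lemma partial_sum_ker: "(\<Sum>i<n. if v i = (0 :: int) then 0 else w i) \<in> ker n"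
proof (induct n)
  case (Suc n)
  have "(\<Sum>i<n. if v i = 0 then 0 else w i) \<in> ker (Suc n)" using Suc ker_mono[of n "Suc n"] by auto
  moreover have "(if v n = 0 then 0 else w n) \<in> ker (Suc n)" by (simp add: w ker_zero)
  ultimately show ?case unfolding sum.lessThan_Suc by (rule ker_add)
qed (simp add: ker_zero)

text \<open>Triangularity with respect to the flag: if the last coordinate were non-zero, the
  earlier terms, which lie in \<open>ker n\<close>, would sum to \<open>w n\<close>, which does
  not.\<close>

lemma partial_sum_eq_zero:
  "(\<Sum>i<n. if v i = (0 :: int) then 0 else w i) = 0 \<Longrightarrow> \<forall>i<n. v i = 0"
proof (induct n)
  case (Suc n)
  show ?case
  proof (cases "v n = 0")
    case True
    then show ?thesis using Suc by (simp add: less_Suc_eq)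
  next
    case False
    then have "(\<Sum>i<n. if v i = 0 then 0 else w i) = w n" using Suc(2) by (simp add: K_add_eq_zero)
    then show ?thesis using partial_sum_ker[of v n] w(2)[of n] by simp
  qed
qed simp

lemma \<theta>_in: "\<theta> v \<in> F"
  unfolding \<theta>_def F_eq by (rule partial_sum_ker)

lemma \<theta>_add: "v \<in> carrier V \<Longrightarrow> u \<in> carrier V \<Longrightarrow> \<theta> (v \<oplus>\<^bsub>V\<^esub> u) = \<theta> v + \<theta> u"
  unfolding \<theta>_def sum.distrib[symmetric]
proof (rule sum.cong[OF refl])
  fix i assume vu: "v \<in> carrier V" "u \<in> carrier V" and "i \<in> {..<(2::nat) ^ k}"
  then have i: "i < 2 ^ k" by simp
  show "(if (v \<oplus>\<^bsub>V\<^esub> u) i = 0 then 0 else w i) = (if v i = 0 then 0 else w i) + (if u i = 0 then 0 else w i)"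
    unfolding V_add[OF i] using V_coord[OF vu(1) i] V_coord[OF vu(2) i] by auto
qed

lemma \<theta>_zero: "\<theta> \<zero>\<^bsub>V\<^esub> = 0"
  using \<theta>_add[OF V_zero V_zero] V_group V_zero
  by (simp add: abelian_group_def abelian_monoid.l_zero)

lemma \<theta>_inj: "inj_on \<theta> (carrier V)"
proof (rule inj_onI)
  fix v u assume vu: "v \<in> carrier V" "u \<in> carrier V" "\<theta> v = \<theta> u"
  then have "\<theta> (v \<oplus>\<^bsub>V\<^esub> u) = 0" by (simp add: \<theta>_add)
  then have z: "\<forall>i<2 ^ k. (v \<oplus>\<^bsub>V\<^esub> u) i = 0" unfolding \<theta>_def by (rule partial_sum_eq_zero)
  have "v i = u i" if i: "i < 2 ^ k" for i
  proof -
    have "(v i + u i) mod 2 = 0" using z i V_add[OF i, of v u] by simp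
    then show ?thesis using V_coord[OF vu(1) i] V_coord[OF vu(2) i] by auto
  qed
  then show "v = u" using vu(1,2) unfolding V_mem by (intro PiE_ext) auto
qed

lemma \<theta>_image: "\<theta> ` carrier V = F"
proof (rule card_subset_eq[OF finite_F])
  show "\<theta> ` carrier V \<subseteq> F" using \<theta>_in by blast
  show "card (\<theta> ` carrier V) = card F" by (simp add: card_image[OF \<theta>_inj] card_vec_space card_F)
qed

definition \<psi> :: "K \<Rightarrow> nat \<Rightarrow> int" where "\<psi> = inv_into (carrier V) \<theta>"

lemma \<psi>_\<theta>: "v \<in> carrier V \<Longrightarrow> \<psi> (\<theta> v) = v"
  unfolding \<psi>_def by (rule inv_into_f_f[OF \<theta>_inj])

lemma \<theta>_\<psi>: "x \<in> F \<Longrightarrow> \<theta> (\<psi> x) = x"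
  unfolding \<psi>_def by (rule f_inv_into_f[where f = \<theta> and A = "carrier V"]) (simp add: \<theta>_image)

lemma \<psi>_in: "x \<in> F \<Longrightarrow> \<psi> x \<in> carrier V"
  unfolding \<psi>_def by (rule inv_into_into) (simp add: \<theta>_image)

lemma \<psi>_image: "\<psi> ` F = carrier V"
  unfolding \<theta>_image[symmetric] \<psi>_def by (rule inv_into_image_cancel[OF \<theta>_inj subset_refl])

lemma \<psi>_inj: "inj_on \<psi> F"
  by (rule inj_on_inverseI[of _ \<theta>]) (rule \<theta>_\<psi>)

lemma \<psi>_add: "x \<in> F \<Longrightarrow> y \<in> F \<Longrightarrow> \<psi> (x + y) = \<psi> x \<oplus>\<^bsub>V\<^esub> \<psi> y"
  using \<psi>_\<theta>[OF V_add_closed[OF \<psi>_in \<psi>_in], of x y] by (simp add: \<theta>_add \<psi>_in \<theta>_\<psi>)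

lemma \<psi>_zero: "\<psi> 0 = \<zero>\<^bsub>V\<^esub>"
  using \<psi>_\<theta>[OF V_zero] by (simp add: \<theta>_zero)

lemma \<theta>_eq_zero: "v \<in> carrier V \<Longrightarrow> \<theta> v = 0 \<longleftrightarrow> v = \<zero>\<^bsub>V\<^esub>"
  using inj_on_eq_iff[OF \<theta>_inj _ V_zero] by (simp add: \<theta>_zero)

definition act :: "K \<Rightarrow> nat \<Rightarrow> K \<Rightarrow> (nat \<Rightarrow> int) \<Rightarrow> nat \<Rightarrow> int" where
  "act a j b = transport_map \<psi> F (semiaffine F a j b)"

lemma act_apply:
  assumes "v \<in> carrier V" shows "act a j b v = \<psi> (a * \<theta> v ^ 2 ^ j + b)"
  using transport_map_apply[OF \<psi>_inj \<theta>_in[of v], of "semiaffine F a j b"] assms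
  by (simp add: act_def \<psi>_\<theta> semiaffine_def \<theta>_in)

abbreviation G\<^sub>V where "G\<^sub>V \<equiv> transport \<psi> F G0"

lemma G\<^sub>V_eq: "G\<^sub>V = {act a j b | a j b. a \<in> F \<and> a \<noteq> 0 \<and> b \<in> F}"
  unfolding transport_eq G0_def act_def by blast

lemma G\<^sub>V_I: "a \<in> F \<Longrightarrow> a \<noteq> 0 \<Longrightarrow> b \<in> F \<Longrightarrow> act a j b \<in> G\<^sub>V"
  unfolding G\<^sub>V_eq by blast

lemma G\<^sub>V_primitive_soluble: "primitive_soluble (carrier V) G\<^sub>V"
  using transport_primitive_soluble(1)[OF primitive_soluble_G0 \<psi>_inj] by (simp only: \<psi>_image)

lemma G\<^sub>V_subgroup: "subgroup G\<^sub>V (BijGroup (carrier V))"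
  using G\<^sub>V_primitive_soluble by (simp add: primitive_soluble_def primitive_perm_group_def perm_group_def)

lemma G\<^sub>V_Bij: "g \<in> G\<^sub>V \<Longrightarrow> g \<in> Bij (carrier V)"
  using subgroup.mem_carrier[OF G\<^sub>V_subgroup] by (simp add: BijGroup_def)

lemma act_linear:
  assumes a: "a \<in> F" "a \<noteq> 0" shows "act a j 0 \<in> GL 2 (2 ^ k)"
  unfolding GL_def
proof (intro CollectI conjI ballI)
  show "act a j 0 \<in> Bij (carrier V)" by (rule G\<^sub>V_Bij[OF G\<^sub>V_I[OF a F_01(1)]])
  fix x y assume x: "x \<in> carrier V" and y: "y \<in> carrier V"
  show "act a j 0 (x \<oplus>\<^bsub>V\<^esub> y) = act a j 0 x \<oplus>\<^bsub>V\<^esub> act a j 0 y"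
    using x y a by (simp add: act_apply V_add_closed \<theta>_add K_frobenius_add distrib_left \<psi>_add F_mult F_power \<theta>_in)
next
  fix c x assume c: "c \<in> carrier (residue_ring (int 2))" and x: "x \<in> carrier V"
  have "c = 0 \<or> c = 1" using c by (auto simp: residue_ring_def)
  moreover have "act a j 0 x \<in> carrier V" using x a by (simp add: act_apply \<psi>_in F_mult F_power \<theta>_in)
  moreover have "act a j 0 \<zero>\<^bsub>V\<^esub> = \<zero>\<^bsub>V\<^esub>" by (simp add: act_apply V_zero \<theta>_zero \<psi>_zero zero_power)
  ultimately show "act a j 0 (c \<odot>\<^bsub>V\<^esub> x) = c \<odot>\<^bsub>V\<^esub> act a j 0 x"
    using vec_space_one_smult[OF two_is_prime_nat] x by auto
qed

lemma act_translation:
  assumes "a \<in> F" "a \<noteq> 0" "b \<in> F"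
  shows "act a j b = (\<lambda>x\<in>carrier V. act a j 0 x \<oplus>\<^bsub>V\<^esub> \<psi> b)"
proof (rule extensionalityI[where A = "carrier V"])
  show "act a j b \<in> extensional (carrier V)" by (rule Bij_imp_extensional[OF G\<^sub>V_Bij[OF G\<^sub>V_I[OF assms]]])
  fix x assume "x \<in> carrier V"
  then show "act a j b x = (\<lambda>x\<in>carrier V. act a j 0 x \<oplus>\<^bsub>V\<^esub> \<psi> b) x"
    using assms by (simp add: act_apply \<psi>_add F_mult F_power \<theta>_in)
qed simp

lemma G\<^sub>V_AGL: "G\<^sub>V \<subseteq> AGL 2 (2 ^ k)"
proof (rule subsetI)
  fix g assume "g \<in> G\<^sub>V"
  then obtain a j b where h: "a \<in> F" "a \<noteq> 0" "b \<in> F" "g = act a j b" unfolding G\<^sub>V_eq by blast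
  have "g = (\<lambda>x\<in>carrier V. act a j 0 x \<oplus>\<^bsub>V\<^esub> \<psi> b)" unfolding h(4) by (rule act_translation[OF h(1-3)])
  then show "g \<in> AGL 2 (2 ^ k)" unfolding AGL_def using act_linear[OF h(1,2), of j] \<psi>_in[OF h(3)] by blast
qed

lemma G\<^sub>V_translations: "translation_maps 2 (2 ^ k) \<subseteq> G\<^sub>V"
proof (rule subsetI)
  fix g assume "g \<in> translation_maps 2 (2 ^ k)"
  then obtain v where v: "v \<in> carrier V" "g = (\<lambda>x\<in>carrier V. x \<oplus>\<^bsub>V\<^esub> v)" unfolding translation_maps_def by blast
  have "act 1 0 (\<theta> v) = g"
    unfolding act_translation[OF F_01(2) one_neq_zero \<theta>_in] v(2)
    by (rule restrict_ext) (simp add: act_apply \<psi>_\<theta> v)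
  then show "g \<in> G\<^sub>V" using G\<^sub>V_I[OF F_01(2) one_neq_zero \<theta>_in[of v], of 0] by simp
qed

abbreviation H\<^sub>V where "H\<^sub>V \<equiv> pointwise_stab G\<^sub>V [\<zero>\<^bsub>V\<^esub>]"

lemma H\<^sub>V_I: "a \<in> F \<Longrightarrow> a \<noteq> 0 \<Longrightarrow> act a j 0 \<in> H\<^sub>V"
  using G\<^sub>V_I[OF _ _ F_01(1)] by (simp add: pointwise_stab_def act_apply V_zero \<theta>_zero \<psi>_zero zero_power)

lemma H\<^sub>V_GL: "H\<^sub>V \<subseteq> GL 2 (2 ^ k)"
proof (rule subsetI)
  fix g assume g: "g \<in> H\<^sub>V"
  then have "g \<in> G\<^sub>V" "g \<zero>\<^bsub>V\<^esub> = \<zero>\<^bsub>V\<^esub>" by (simp_all add: pointwise_stab_def)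
  then obtain a j b where h: "a \<in> F" "a \<noteq> 0" "b \<in> F" "g = act a j b" unfolding G\<^sub>V_eq by blast
  have "\<psi> b = \<zero>\<^bsub>V\<^esub>" using \<open>g \<zero>\<^bsub>V\<^esub> = _\<close> by (simp add: h(4) act_apply V_zero \<theta>_zero zero_power)
  then have "b = 0" using \<theta>_\<psi>[OF h(3)] by (simp add: \<theta>_zero)
  then show "g \<in> GL 2 (2 ^ k)" using act_linear[OF h(1,2)] h(4) by simp
qed

text \<open>Multiplications by non-zero field elements alone, the Singer cycle, carry any non-zero
  vector to any other. Irreducibility and linear primitivity both rest on this.\<close>

lemma H\<^sub>V_transitive:
  assumes "v \<in> carrier V" "v \<noteq> \<zero>\<^bsub>V\<^esub>" "u \<in> carrier V" "u \<noteq> \<zero>\<^bsub>V\<^esub>"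
  obtains h where "h \<in> H\<^sub>V" "h v = u"
proof
  show "act (\<theta> u / \<theta> v) 0 0 \<in> H\<^sub>V" using assms by (intro H\<^sub>V_I) (simp_all add: F_divide \<theta>_in \<theta>_eq_zero)
  show "act (\<theta> u / \<theta> v) 0 0 v = u" using assms by (simp add: act_apply \<theta>_eq_zero \<psi>_\<theta>)
qed

lemma subspace_zero: "subspace_of 2 (2 ^ k) W \<Longrightarrow> \<zero>\<^bsub>V\<^esub> \<in> W" "subspace_of 2 (2 ^ k) W \<Longrightarrow> W \<subseteq> carrier V"
  using subgroup.one_closed[of W "add_monoid V"] subgroup.subset[of W "add_monoid V"]
  by (simp_all add: submodule_def)

lemma H\<^sub>V_irreducible: "irreducible_linear 2 (2 ^ k) H\<^sub>V"
  unfolding irreducible_linear_def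
proof (intro conjI allI impI H\<^sub>V_GL)
  show "subgroup H\<^sub>V (BijGroup (carrier V))"
  proof (rule subgroup_BijGroupI[OF finite_vec_space])
    show "H\<^sub>V \<subseteq> Bij (carrier V)" using G\<^sub>V_Bij by (auto simp: pointwise_stab_def)
    show "(\<lambda>x\<in>carrier V. x) \<in> H\<^sub>V"
      using subgroup.one_closed[OF G\<^sub>V_subgroup] V_zero by (simp add: pointwise_stab_def BijGroup_def)
    fix f g assume "f \<in> H\<^sub>V" "g \<in> H\<^sub>V"
    then have fg: "f \<in> G\<^sub>V" "g \<in> G\<^sub>V" "f \<zero>\<^bsub>V\<^esub> = \<zero>\<^bsub>V\<^esub>" "g \<zero>\<^bsub>V\<^esub> = \<zero>\<^bsub>V\<^esub>"
      by (simp_all add: pointwise_stab_def)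
    have "compose (carrier V) f g \<in> G\<^sub>V"
      using subgroup.m_closed[OF G\<^sub>V_subgroup fg(1,2)] G\<^sub>V_Bij[OF fg(1)] G\<^sub>V_Bij[OF fg(2)]
      by (simp add: BijGroup_def)
    then show "compose (carrier V) f g \<in> H\<^sub>V" using fg V_zero by (simp add: pointwise_stab_def compose_eq)
  qed
  fix W assume W: "subspace_of 2 (2 ^ k) W \<and> (\<forall>h\<in>H\<^sub>V. h ` W \<subseteq> W)"
  note Wz = subspace_zero[OF W[THEN conjunct1]]
  show "W = {\<zero>\<^bsub>V\<^esub>} \<or> W = carrier V"
  proof (cases "W = {\<zero>\<^bsub>V\<^esub>}")
    case False
    then obtain v where v: "v \<in> W" "v \<noteq> \<zero>\<^bsub>V\<^esub>" using Wz(1) by blast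
    have "u \<in> W" if u: "u \<in> carrier V" for u
    proof (cases "u = \<zero>\<^bsub>V\<^esub>")
      case False
      obtain h where "h \<in> H\<^sub>V" "h v = u" using H\<^sub>V_transitive[OF _ v(2) u False] v(1) Wz(2) by blast
      then show ?thesis using W v(1) by blast
    qed (use Wz(1) in simp)
    then show ?thesis using Wz(2) by blast
  qed simp
qed

text \<open>A vector of one summand \<open>W j\<close> has a decomposition concentrated at
  \<open>j\<close>, whereas this sum has non-zero parts at both 0 and 1; uniqueness of the
  decomposition excludes both at once.\<close>

lemma sum_not_in_summand:
  assumes dec: "direct_sum_decomposition 2 (2 ^ k) n W" and n: "2 \<le> n" and j: "j < n"
    and x: "x \<in> W 0" "x \<noteq> \<zero>\<^bsub>V\<^esub>" and y: "y \<in> W 1" "y \<noteq> \<zero>\<^bsub>V\<^esub>"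
  shows "x \<oplus>\<^bsub>V\<^esub> y \<notin> W j"
proof
  assume s: "x \<oplus>\<^bsub>V\<^esub> y \<in> W j"
  interpret V: abelian_group V by (rule V_group)
  have sub: "subspace_of 2 (2 ^ k) (W i)" if "i < n" for i
    using dec that unfolding direct_sum_decomposition_def by blast
  note z = subspace_zero(1)[OF sub] and c = subspace_zero(2)[OF sub]
  have xV: "x \<in> carrier V" and yV: "y \<in> carrier V" using c[of 0] c[of 1] x y n by auto
  \<comment> \<open>The two competing decompositions of the same vector: \<open>e\<close> puts it
    entirely into the summand \<open>j\<close>, and \<open>f\<close> splits it between the summands
    0 and 1.\<close>
  define e where "e i = (if j = i then x \<oplus>\<^bsub>V\<^esub> y else \<zero>\<^bsub>V\<^esub>)" for i
  define f where "f i = (if 0 = i then x else \<zero>\<^bsub>V\<^esub>) \<oplus>\<^bsub>V\<^esub> (if 1 = i then y else \<zero>\<^bsub>V\<^esub>)" for i :: nat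
  have ec: "e \<in> {..<n} \<rightarrow> carrier V" and fc: "f \<in> {..<n} \<rightarrow> carrier V"
    using xV yV by (auto simp: e_def f_def)
  have eW: "(\<lambda>i\<in>{..<n}. e i) \<in> (\<Pi>\<^sub>E i\<in>{..<n}. W i)" using s z by (auto simp: e_def)
  have fW: "(\<lambda>i\<in>{..<n}. f i) \<in> (\<Pi>\<^sub>E i\<in>{..<n}. W i)" using x y z xV yV by (auto simp: f_def)
  have "(\<Oplus>\<^bsub>V\<^esub>i\<in>{..<n}. (\<lambda>i\<in>{..<n}. e i) i) = (\<Oplus>\<^bsub>V\<^esub>i\<in>{..<n}. e i)"
    by (rule V.finsum_cong'[OF refl ec]) simp
  also have "\<dots> = x \<oplus>\<^bsub>V\<^esub> y"
    unfolding e_def using V.finsum_singleton[of j "{..<n}" "\<lambda>_. x \<oplus>\<^bsub>V\<^esub> y"] j xV yV by simp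
  also have "\<dots> = (\<Oplus>\<^bsub>V\<^esub>i\<in>{..<n}. if 0 = i then x else \<zero>\<^bsub>V\<^esub>) \<oplus>\<^bsub>V\<^esub> (\<Oplus>\<^bsub>V\<^esub>i\<in>{..<n}. if 1 = i then y else \<zero>\<^bsub>V\<^esub>)"
    using V.finsum_singleton[of 0 "{..<n}" "\<lambda>_. x"] V.finsum_singleton[of 1 "{..<n}" "\<lambda>_. y"] n xV yV by simp
  also have "\<dots> = (\<Oplus>\<^bsub>V\<^esub>i\<in>{..<n}. f i)"
    unfolding f_def by (rule V.finsum_addf[symmetric]) (use xV yV in auto)
  also have "\<dots> = (\<Oplus>\<^bsub>V\<^esub>i\<in>{..<n}. (\<lambda>i\<in>{..<n}. f i) i)"
    by (rule V.finsum_cong'[OF refl, symmetric]) (use fc in auto)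
  finally have eq: "(\<Oplus>\<^bsub>V\<^esub>i\<in>{..<n}. (\<lambda>i\<in>{..<n}. e i) i) = (\<Oplus>\<^bsub>V\<^esub>i\<in>{..<n}. (\<lambda>i\<in>{..<n}. f i) i)" .
  have inj: "inj_on (\<lambda>w. \<Oplus>\<^bsub>V\<^esub>i\<in>{..<n}. w i) (\<Pi>\<^sub>E i\<in>{..<n}. W i)"
    using dec unfolding direct_sum_decomposition_def by (blast dest: bij_betw_imp_inj_on)
  have ef: "(\<lambda>i\<in>{..<n}. e i) = (\<lambda>i\<in>{..<n}. f i)" by (rule inj_onD[OF inj eq eW fW])
  have "e 0 = f 0" "e 1 = f 1" using fun_cong[OF ef, of 0] fun_cong[OF ef, of 1] n by simp_all
  then show False using x(2) y(2) xV yV by (auto simp: e_def f_def split: if_splits)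
qed

text \<open>By transitivity some element maps \<open>x\<close> from the first summand to
  \<open>x + y\<close>, with \<open>y\<close> non-zero in the second. The image of the first summand
  would then be a summand containing a vector that lies in none.\<close>

lemma H\<^sub>V_primitive: "primitive_linear 2 (2 ^ k) H\<^sub>V"
  unfolding primitive_linear_def imprimitive_linear_def
proof (intro conjI H\<^sub>V_irreducible notI)
  assume "irreducible_linear 2 (2 ^ k) H\<^sub>V \<and>
     (\<exists>n\<ge>2. \<exists>W. direct_sum_decomposition 2 (2 ^ k) n W \<and> (\<forall>h\<in>H\<^sub>V. \<forall>i<n. \<exists>j<n. h ` W i = W j))"
  then obtain n W where n: "2 \<le> n" and dec: "direct_sum_decomposition 2 (2 ^ k) n W"
    and perm: "\<forall>h\<in>H\<^sub>V. \<forall>i<n. \<exists>j<n. h ` W i = W j" by blast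
  have sub: "subspace_of 2 (2 ^ k) (W i)" "W i \<noteq> {\<zero>\<^bsub>V\<^esub>}" if "i < n" for i
    using dec that unfolding direct_sum_decomposition_def by blast+
  have nz: "\<exists>x. x \<in> W i \<and> x \<noteq> \<zero>\<^bsub>V\<^esub>" if "i < n" for i
    using sub(2)[OF that] subspace_zero(1)[OF sub(1)[OF that]] by blast
  have n01: "0 < n" "1 < n" using n by auto
  obtain x y where x: "x \<in> W 0" "x \<noteq> \<zero>\<^bsub>V\<^esub>" and y: "y \<in> W 1" "y \<noteq> \<zero>\<^bsub>V\<^esub>"
    using nz[OF n01(1)] nz[OF n01(2)] by blast
  have xV: "x \<in> carrier V" and yV: "y \<in> carrier V"
    using subspace_zero(2)[OF sub(1)] n01 x(1) y(1) by blast+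
  note not_in = sum_not_in_summand[OF dec n _ x y]
  have "x \<oplus>\<^bsub>V\<^esub> y \<noteq> \<zero>\<^bsub>V\<^esub>" using not_in[OF n01(1)] subspace_zero(1)[OF sub(1)[OF n01(1)]] by metis
  then obtain h where h: "h \<in> H\<^sub>V" "h x = x \<oplus>\<^bsub>V\<^esub> y"
    using H\<^sub>V_transitive[OF xV x(2) V_add_closed[OF xV yV]] by blast
  obtain j where "j < n" "h ` W 0 = W j" using perm h(1) n01(1) by blast
  then show False using not_in[of j] imageI[OF x(1), of h] h(2) by simp
qed

lemma basic_example:
  "\<exists>(\<Delta> :: nat set) G. primitive_soluble \<Delta> G \<and> basic \<Delta> G \<and> card \<Delta> = 2 ^ 2 ^ k \<and>
    k + 2 \<le> max_irredundant_base \<Delta> G"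
proof -
  obtain \<iota> :: "(nat \<Rightarrow> int) \<Rightarrow> nat" where \<iota>: "inj_on \<iota> (carrier V)"
    using finite_imp_inj_to_nat_seg[OF finite_vec_space] by blast
  let ?\<Delta> = "\<iota> ` carrier V" and ?G = "transport \<iota> (carrier V) G\<^sub>V" and ?\<phi> = "inv_into (carrier V) \<iota>"
  note T = transport_primitive_soluble[OF G\<^sub>V_primitive_soluble \<iota>]
  have pg: "perm_group ?\<Delta> ?G" using T(1) by (simp add: primitive_soluble_def primitive_perm_group_def)
  obtain \<delta> where \<delta>: "irredundant F G0 \<delta>" "length \<delta> = k + 2" by (rule irredundant_G0)
  have "irredundant (carrier V) G\<^sub>V (map \<psi> \<delta>)"
    using transport_primitive_soluble(2)[OF primitive_soluble_G0 \<psi>_inj \<delta>(1)] by (simp only: \<psi>_image)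
  from length_le_max_irredundant_base[OF pg T(2)[OF this]]
  have len: "k + 2 \<le> max_irredundant_base ?\<Delta> ?G" by (simp only: length_map \<delta>(2))
  have back_eq: "transport ?\<phi> ?\<Delta> ?G = G\<^sub>V"
    by (rule transport_inv_into[OF \<iota>]) (rule G\<^sub>V_Bij)
  have "bij_betw ?\<phi> ?\<Delta> (carrier V)" by (rule bij_betw_inv_into) (rule inj_on_imp_bij_betw[OF \<iota>])
  then have "affine_identification ?\<Delta> ?G 2 (2 ^ k) ?\<phi>"
    unfolding affine_identification_def back_eq
    using two_is_prime_nat G\<^sub>V_AGL G\<^sub>V_translations H\<^sub>V_irreducible by simp
  then have "basic ?\<Delta> ?G" unfolding basic_def using H\<^sub>V_primitive back_eq by metis
  moreover have "card ?\<Delta> = 2 ^ 2 ^ k" by (simp add: card_image[OF \<iota>] card_vec_space)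
  ultimately show ?thesis using T(1) len by blast
qed

end

lemma infinite_basic_lower_bound:
  "infinite {n :: nat. \<exists>(\<Delta> :: nat set) G. primitive_soluble \<Delta> G \<and> basic \<Delta> G \<and> card \<Delta> = n \<and>
     real (max_irredundant_base \<Delta> G) \<ge> log 2 (log 2 (real n)) + 2}" (is "infinite ?A")
proof -
  have "2 ^ 2 ^ Suc i \<in> ?A" for i
  proof -
    \<comment> \<open>The successor meets the requirement of at least one quadratic step, and the
      degree 2^(2^k) makes the double logarithm equal to \<open>k\<close> exactly.\<close>
    interpret two_power_field "Suc i" "ker (2 ^ Suc i)" by unfold_locales simp_all
    obtain \<Delta> :: "nat set" and G where G: "primitive_soluble \<Delta> G" "basic \<Delta> G" "card \<Delta> = 2 ^ 2 ^ Suc i"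
      and len: "Suc i + 2 \<le> max_irredundant_base \<Delta> G" using basic_example by blast
    have "log 2 (real (2 ^ m)) = real m" for m :: nat
      by (subst of_nat_power, subst log_nat_power) simp_all
    then have "log 2 (log 2 (real (2 ^ 2 ^ Suc i))) = real (Suc i)" by (simp only:)
    then have "log 2 (log 2 (real (2 ^ 2 ^ Suc i))) + 2 \<le> real (max_irredundant_base \<Delta> G)"
      using len by linarith
    then show ?thesis using G by blast
  qed
  then have "range (\<lambda>i. 2 ^ 2 ^ Suc i) \<subseteq> ?A" by blast
  moreover have "inj (\<lambda>i. (2::nat) ^ 2 ^ Suc i)" by (rule injI) simp
  then have "infinite (range (\<lambda>i. (2::nat) ^ 2 ^ Suc i))" by (rule range_inj_infinite)
  ultimately show ?thesis by (rule infinite_super)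
qed

theorem corollary1p2:
  shows "(\<forall>(\<Delta> :: 'a set) G. primitive_soluble \<Delta> G \<longrightarrow>
            real (max_irredundant_base \<Delta> G) \<le> log 2 (real (card \<Delta>)) + 1)
       \<and> infinite {n :: nat. \<exists>(\<Delta> :: nat set) G. primitive_soluble \<Delta> G \<and> card \<Delta> = n \<and>
            real (max_irredundant_base \<Delta> G) \<ge> 0.63 * log 2 (real n) + 1}
       \<and> (\<forall>(\<Delta> :: 'a set) G. primitive_soluble \<Delta> G \<and> basic \<Delta> G \<longrightarrow>
            real (max_irredundant_base \<Delta> G) \<le> 6.49 * log 2 (log 2 (real (card \<Delta>))) + 2)
       \<and> infinite {n :: nat. \<exists>(\<Delta> :: nat set) G. primitive_soluble \<Delta> G \<and> basic \<Delta> G \<and> card \<Delta> = n \<and>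
            real (max_irredundant_base \<Delta> G) \<ge> log 2 (log 2 (real n)) + 2}"
proof (intro conjI allI impI infinite_lower_bound infinite_basic_lower_bound)
  show "real (max_irredundant_base \<Delta> G) \<le> log 2 (real (card \<Delta>)) + 1"
    if "primitive_soluble \<Delta> G" for \<Delta> :: "'a set" and G
    using that by (rule primitive_soluble_bound)
  show "real (max_irredundant_base \<Delta> G) \<le> 6.49 * log 2 (log 2 (real (card \<Delta>))) + 2"
    if "primitive_soluble \<Delta> G \<and> basic \<Delta> G" for \<Delta> :: "'a set" and G
    using that basic_bound by blast
qed

end
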